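(* There exists a nonnegative constant $C$ such that for every subdivision $\pi=\{0=t_0<t_1<\cdots<t_n=T\}$ of $[0,T]$ with mesh $|\pi|=\max_{1\le i\le n}(t_i-t_{i-1})$, one has $$\sum_{1\leq i\leq n}\mathbb E\int_{t_{i-1}}^{t_i}\left(|Z_t-Z_{t_{i-1}}|^2+|Z_t-Z_{t_i}|^2\right)dt\leq C|\pi|.$$
   Context: Probabilistic setting. $T>0$ is fixed; $(W_t)_{0\le t\le T}$ and $(B_t)_{0\le t\le T}$ are independent standard Brownian motions on a probability space $(\Omega,\mathcal F,\mathbb P)$ with values in $\mathbb R^d$ and $\mathbb R$ respectively. $\mathcal N$ is the class of $\mathbb P$-null sets, $\mathcal F^W_{0,t}=\sigma(W_r-W_0;0\le r\le t)$, $\mathcal F^B_{t,T}=\sigma(B_r-B_t;t\le r\le T)$, and $\mathcal F_t=\mathcal F^W_{0,t}\vee\mathcal F^B_{t,T}\vee\mathcal N$ (not a filtration). $M^2([0,T],\mathbb R)$ is the set of real jointly measurable processes $(\varphi_t)_{t\in[0,T]}$ with $\varphi_t$ $\mathcal F_t$-measurable for almost every $t$ and $\mathbb E\int_0^T|\varphi_t|^2dt<\infty$. $\mathcal C^k_b$ denotes functions of class $\mathcal C^k$ bounded together with their partial derivatives up to order $k$. Forward process. For $x\in\mathbb R^d$, $X_t=x+\int_0^t b(X_r)dr+\int_0^t\sigma(X_r)dW_r$, where $b:\mathbb R^d\to\mathbb R^d$ and $\sigma:\mathbb R^d\to\mathbb R^{d\times d}$ are of class $\mathcal C^3_b$. Coefficients.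 $f,g:\Omega\times[0,T]\times\mathbb R^d\times\mathbb R\times\mathbb R^{1\times d}\to\mathbb R$ are jointly measurable, $f(\cdot,x,y,z),g(\cdot,x,y,z)\in M^2([0,T],\mathbb R)$ for all $(x,y,z)$, and: (i) there are constants $L_f,L_g\ge0$ and $\alpha\in[0,1)$ such that for every $\omega$ and all $t,t',x,x',y,y',z,z'$, $|f(t,x,y,z)-f(t',x',y',z')|^2\le L_f(|t-t'|+|x-x'|^2+|y-y'|^2+|z-z'|^2)$ and $|g(t,x,y,z)-g(t',x',y',z')|^2\le L_g(|t-t'|+|x-x'|^2+|y-y'|^2)+\alpha|z-z'|^2$; (ii) for all $s\in[0,T]$, $f(s,\cdot)$ and $g(s,\cdot)$ are of class $\mathcal C^3$ with bounded partial derivatives up to order 3, uniformly in time; (iii) $\sup_{r\in[0,T]}|f(r,0,0,0)|+\sup_{r\in[0,T]}|g(r,0,0,0)|<\infty$; (iv) for every $\omega$, $\sup_{t,x,y,z}|\partial_z g(t,x,y,z)|<1$. Backward equation. Let $\phi:\mathbb R^d\to\mathbb R$ be of class $\mathcal C^2_b$. $(Y,Z)$, with values in $\mathbb R\times\mathbb R^{1\times d}$, is the unique solution ($Y_t$, $Z_t$ being $\mathcal F_t$-measurable, $\mathbb E(\sup_{s}|Y_s|^2)+\mathbb E\int_0^T|Z_s|^2ds<\infty$) of $$Y_s=\phi(X_T)+\int_s^Tf(r,X_r,Y_r,Z_r)dr+\int_s^Tg(r,X_r,Y_r,Z_r)d\overleftarrow{B}_r-\int_s^TZ_rdW_r,$$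 where $dW$ is the forward Itô integral and $d\overleftarrow B$ the backward Itô integral. Pointwise values $Z_t$ are those of the version $Z_t=\nabla Y_t(\nabla X_t)^{-1}\sigma(X_t)$, where $\nabla X_t=(\partial X^i_t/\partial x_j)_{i,j}$ and $\nabla Y_t\in\mathbb R^{1\times d}$ is the (continuous in $t$) gradient of $Y_t$ with respect to the initial condition $x$; with $\Theta_r=(X_r,Y_r,Z_r)$, its $j$-th component $\partial_jY$, together with an $\mathbb R^{1\times d}$-valued process $\partial_jZ$, solves the linear equation $\partial_jY_t=\phi'(X_T)\partial_jX_T+\int_t^T(\partial_xf(r,\Theta_r)\cdot\partial_jX_r+\partial_yf(r,\Theta_r)\partial_jY_r+\partial_zf(r,\Theta_r)\cdot\partial_jZ_r)dr+\int_t^T(\partial_xg(r,\Theta_r)\cdot\partial_jX_r+\partial_yg(r,\Theta_r)\partial_jY_r+\partial_zg(r,\Theta_r)\cdot\partial_jZ_r)d\overleftarrow{B}_r-\int_t^T\partial_jZ_rdW_r$. *)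

theory Defs
  imports "HOL-Probability.Probability"
begin

section \<open>Functions of class \<open>C\<^sup>k\<close>\<close>

text \<open>\<open>partials [e\<^sub>1, \<dots>, e\<^sub>m] f\<close> is the iterated partial derivative of \<open>f\<close> in the
  directions \<open>e\<^sub>1, \<dots>, e\<^sub>m\<close>; it is only meaningful where \<open>class_C\<close> below guarantees
  differentiability.\<close>

primrec partials ::
  "'a list \<Rightarrow> ('a::euclidean_space \<Rightarrow> 'b::real_normed_vector) \<Rightarrow> 'a \<Rightarrow> 'b" where
  "partials [] f = f"
| "partials (e # es) f = (\<lambda>x. frechet_derivative (partials es f) (at x) e)"

definition class_C :: "nat \<Rightarrow> ('a::euclidean_space \<Rightarrow> 'b::real_normed_vector) \<Rightarrow> bool" where
  "class_C k f \<longleftrightarrow>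
     (\<forall>es. set es \<subseteq> Basis \<and> length es < k \<longrightarrow> (\<forall>x. partials es f differentiable (at x))) \<and>
     (\<forall>es. set es \<subseteq> Basis \<and> length es \<le> k \<longrightarrow> continuous_on UNIV (partials es f))"

text \<open>The function itself (\<open>es = []\<close>) is required to be bounded too.\<close>

definition class_Cb :: "nat \<Rightarrow> ('a::euclidean_space \<Rightarrow> 'b::real_normed_vector) \<Rightarrow> bool" where
  "class_Cb k f \<longleftrightarrow> class_C k f \<and>
     (\<forall>es. set es \<subseteq> Basis \<and> length es \<le> k \<longrightarrow> bounded (range (partials es f)))"

definition grad :: "('a::euclidean_space \<Rightarrow> real) \<Rightarrow> 'a \<Rightarrow> 'a" where
  "grad h x = (\<Sum>e\<in>Basis. frechet_derivative h (at x) e *\<^sub>R e)"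

text \<open>\<open>\<partial>\<^sub>x h \<cdot> u + \<partial>\<^sub>y h v + \<partial>\<^sub>z h \<cdot> w\<close>, evaluated at \<open>(x, y, z)\<close>. Throughout, the row vectors of
  \<open>\<real>\<^sup>1\<^sup>\<times>\<^sup>d\<close> are represented by \<open>real^'d\<close>.\<close>

definition linearized ::
  "(real^'d \<Rightarrow> real \<Rightarrow> real^'d \<Rightarrow> real) \<Rightarrow> real^'d \<Rightarrow> real \<Rightarrow> real^'d
     \<Rightarrow> real^'d \<Rightarrow> real \<Rightarrow> real^'d \<Rightarrow> real" where
  "linearized h x y z u v w =
     grad (\<lambda>x'. h x' y z) x \<bullet> u + deriv (\<lambda>y'. h x y' z) y * v + grad (\<lambda>z'. h x y z') z \<bullet> w"


section \<open>Brownian motions and the associated \<open>\<sigma>\<close>-algebras\<close>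

definition std_brownian_motion ::
  "'w measure \<Rightarrow> real \<Rightarrow> (real \<Rightarrow> 'w \<Rightarrow> 'e::euclidean_space) \<Rightarrow> bool" where
  "std_brownian_motion M T V \<longleftrightarrow>
     (\<forall>t\<in>{0..T}. V t \<in> borel_measurable M) \<and>
     (AE \<omega> in M. V 0 \<omega> = 0) \<and>
     (AE \<omega> in M. continuous_on {0..T} (\<lambda>t. V t \<omega>)) \<and>
     (\<forall>n (\<tau> :: nat \<Rightarrow> real). 0 \<le> \<tau> 0 \<and> (\<forall>k<n. \<tau> k \<le> \<tau> (Suc k)) \<and> \<tau> n \<le> T \<longrightarrow>
        prob_space.indep_vars M (\<lambda>_. borel) (\<lambda>k \<omega>. V (\<tau> (Suc k)) \<omega> - V (\<tau> k) \<omega>) {..<n}) \<and>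
     (\<forall>s t. 0 \<le> s \<and> s < t \<and> t \<le> T \<longrightarrow>
        prob_space.indep_vars M (\<lambda>_. borel) (\<lambda>e \<omega>. (V t \<omega> - V s \<omega>) \<bullet> e) Basis \<and>
        (\<forall>e\<in>Basis. distributed M lborel (\<lambda>\<omega>. (V t \<omega> - V s \<omega>) \<bullet> e)
                     (\<lambda>y. ennreal (normal_density 0 (sqrt (t - s)) y))))"

definition generated_events ::
  "'w measure \<Rightarrow> real set \<Rightarrow> (real \<Rightarrow> 'w \<Rightarrow> 'e::euclidean_space) \<Rightarrow> 'w set set" where
  "generated_events M I V = sigma_sets (space M) {V r -` A \<inter> space M | r A. r \<in> I \<and> A \<in> sets borel}"

definition independent_processes ::
  "'w measure \<Rightarrow> real \<Rightarrow> (real \<Rightarrow> 'w \<Rightarrow> 'e::euclidean_space) \<Rightarrow> (real \<Rightarrow> 'w \<Rightarrow> 'f::euclidean_space) \<Rightarrow> bool"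
  where
  "independent_processes M T V V' \<longleftrightarrow>
     prob_space.indep_set M (generated_events M {0..T} V) (generated_events M {0..T} V')"

text \<open>\<open>info M W B T u v\<close> is the measurable space of \<open>\<F>\<^sup>W\<^sub>0\<^sub>,\<^sub>u \<or> \<F>\<^sup>B\<^sub>v\<^sub>,\<^sub>T \<or> \<N>\<close>. Hence
  \<open>\<F>\<^sub>t\<close> is given by \<open>info M W B T t t\<close>, and \<open>\<F>\<^sup>W\<^sub>0\<^sub>,\<^sub>t \<or> \<N>\<close> by \<open>info M W B T t T\<close>, since
  \<open>\<F>\<^sup>B\<^sub>T\<^sub>,\<^sub>T\<close> is trivial.\<close>

definition info ::
  "'w measure \<Rightarrow> (real \<Rightarrow> 'w \<Rightarrow> 'e::euclidean_space) \<Rightarrow> (real \<Rightarrow> 'w \<Rightarrow> real) \<Rightarrow> real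
     \<Rightarrow> real \<Rightarrow> real \<Rightarrow> 'w measure" where
  "info M W B T u v = sigma (space M)
     (generated_events M {0..u} (\<lambda>r \<omega>. W r \<omega> - W 0 \<omega>) \<union>
      generated_events M {v..T} (\<lambda>r \<omega>. B r \<omega> - B v \<omega>) \<union> null_sets M)"

definition process :: "'w measure \<Rightarrow> real \<Rightarrow> (real \<Rightarrow> 'w \<Rightarrow> 'b::topological_space) \<Rightarrow> bool" where
  "process M T \<Phi> \<longleftrightarrow>
     (\<lambda>(t, \<omega>). \<Phi> t \<omega>) \<in> borel_measurable (restrict_space borel {0..T} \<Otimes>\<^sub>M M)"

definition M2 ::
  "'w measure \<Rightarrow> (real \<Rightarrow> 'w \<Rightarrow> 'e::euclidean_space) \<Rightarrow> (real \<Rightarrow> 'w \<Rightarrow> real) \<Rightarrow> real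
     \<Rightarrow> (real \<Rightarrow> 'w \<Rightarrow> real) \<Rightarrow> bool" where
  "M2 M W B T \<phi> \<longleftrightarrow> process M T \<phi> \<and>
     (AE t in lborel. t \<in> {0..T} \<longrightarrow> \<phi> t \<in> borel_measurable (info M W B T t t)) \<and>
     (\<integral>\<^sup>+\<omega>. (\<integral>\<^sup>+t\<in>{0..T}. ennreal (\<bar>\<phi> t \<omega>\<bar>\<^sup>2) \<partial>lborel) \<partial>M) < \<infinity>"


section \<open>Forward and backward Ito integrals\<close>

text \<open>Elementary integrands \<open>\<Sum>\<^sub>k \<xi>\<^sub>k 1\<^bsub>(\<tau>\<^sub>k, \<tau>\<^sub>k\<^sub>+\<^sub>1]\<^esub>\<close> on \<open>[s, t]\<close>. The coefficient \<open>\<xi>\<^sub>k\<close> is bounded and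
  measurable for \<open>G \<tau>\<^sub>k \<tau>\<^sub>k\<^sub>+\<^sub>1\<close>. A forward integral takes for \<open>G u v\<close> the information available
  at \<open>u\<close>, a backward integral the information available at \<open>v\<close>. The choice of the endpoints
  at which the indicators vanish is immaterial for \<open>L\<^sup>2\<close> limits.\<close>

definition elementary ::
  "'w measure \<Rightarrow> (real \<Rightarrow> real \<Rightarrow> 'w measure) \<Rightarrow> real \<Rightarrow> real
     \<Rightarrow> nat \<Rightarrow> (nat \<Rightarrow> real) \<Rightarrow> (nat \<Rightarrow> 'w \<Rightarrow> 'e::euclidean_space) \<Rightarrow> bool" where
  "elementary M G s t n \<tau> \<xi> \<longleftrightarrow>
     \<tau> 0 = s \<and> \<tau> n = t \<and> (\<forall>k<n. \<tau> k < \<tau> (Suc k)) \<and>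
     (\<forall>k<n. \<xi> k \<in> borel_measurable (G (\<tau> k) (\<tau> (Suc k))) \<and> bounded (\<xi> k ` space M))"

definition elem_process ::
  "nat \<Rightarrow> (nat \<Rightarrow> real) \<Rightarrow> (nat \<Rightarrow> 'w \<Rightarrow> 'e::euclidean_space) \<Rightarrow> real \<Rightarrow> 'w \<Rightarrow> 'e" where
  "elem_process n \<tau> \<xi> r \<omega> = (\<Sum>k<n. indicator {\<tau> k<..\<tau> (Suc k)} r *\<^sub>R \<xi> k \<omega>)"

definition elem_integral ::
  "(real \<Rightarrow> 'w \<Rightarrow> 'e::euclidean_space) \<Rightarrow> nat \<Rightarrow> (nat \<Rightarrow> real) \<Rightarrow> (nat \<Rightarrow> 'w \<Rightarrow> 'e) \<Rightarrow> 'w \<Rightarrow> real" where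
  "elem_integral V n \<tau> \<xi> \<omega> = (\<Sum>k<n. \<xi> k \<omega> \<bullet> (V (\<tau> (Suc k)) \<omega> - V (\<tau> k) \<omega>))"

text \<open>\<open>J\<close> is (a version of) the integral over \<open>[s, t]\<close> of the vector valued integrand \<open>\<Phi>\<close>
  against the vector valued Brownian motion \<open>V\<close>, that is
  \<open>\<Sum>\<^sub>e \<integral> (\<Phi> \<bullet> e) d(V \<bullet> e)\<close>, as the \<open>L\<^sup>2\<close> limit of integrals of elementary integrands
  converging to \<open>\<Phi>\<close> in \<open>L\<^sup>2(\<Omega> \<times> [s, t])\<close>.\<close>

definition has_ito_integral ::
  "'w measure \<Rightarrow> (real \<Rightarrow> real \<Rightarrow> 'w measure) \<Rightarrow> (real \<Rightarrow> 'w \<Rightarrow> 'e::euclidean_space) \<Rightarrow> real \<Rightarrow> real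
     \<Rightarrow> (real \<Rightarrow> 'w \<Rightarrow> 'e) \<Rightarrow> ('w \<Rightarrow> real) \<Rightarrow> bool" where
  "has_ito_integral M G V s t \<Phi> J \<longleftrightarrow>
     (\<lambda>(r, \<omega>). \<Phi> r \<omega>) \<in> borel_measurable (restrict_space borel {s..t} \<Otimes>\<^sub>M M) \<and>
     J \<in> borel_measurable M \<and>
     (\<exists>(n :: nat \<Rightarrow> nat) (\<tau> :: nat \<Rightarrow> nat \<Rightarrow> real) (\<xi> :: nat \<Rightarrow> nat \<Rightarrow> 'w \<Rightarrow> 'e).
        (\<forall>m. elementary M G s t (n m) (\<tau> m) (\<xi> m)) \<and>
        (\<lambda>m. \<integral>\<^sup>+\<omega>. (\<integral>\<^sup>+r\<in>{s..t}.
               ennreal ((norm (\<Phi> r \<omega> - elem_process (n m) (\<tau> m) (\<xi> m) r \<omega>))\<^sup>2) \<partial>lborel) \<partial>M)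
          \<longlonglongrightarrow> 0 \<and>
        (\<lambda>m. \<integral>\<^sup>+\<omega>. ennreal ((J \<omega> - elem_integral V (n m) (\<tau> m) (\<xi> m) \<omega>)\<^sup>2) \<partial>M) \<longlonglongrightarrow> 0)"

text \<open>\<open>\<F>\<^sub>t\<close> is not a filtration. The forward integral of an \<open>\<F>\<^sub>t\<close>-measurable integrand is the
  Ito integral in the filtration \<open>\<F>\<^sup>W\<^sub>0\<^sub>,\<^sub>t \<or> \<F>\<^sup>B\<^sub>0\<^sub>,\<^sub>T \<or> \<N>\<close>, in which \<open>W\<close> is a Brownian motion by
  independence; the backward integral is the Ito integral run backwards in time, in the decreasing
  family \<open>\<F>\<^sup>W\<^sub>0\<^sub>,\<^sub>T \<or> \<F>\<^sup>B\<^sub>t\<^sub>,\<^sub>T \<or> \<N>\<close>.\<close>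

definition has_fwd_integral ::
  "'w measure \<Rightarrow> (real \<Rightarrow> 'w \<Rightarrow> 'e::euclidean_space) \<Rightarrow> (real \<Rightarrow> 'w \<Rightarrow> real) \<Rightarrow> real
     \<Rightarrow> real \<Rightarrow> real \<Rightarrow> (real \<Rightarrow> 'w \<Rightarrow> 'e) \<Rightarrow> ('w \<Rightarrow> real) \<Rightarrow> bool" where
  "has_fwd_integral M W B T s t = has_ito_integral M (\<lambda>u v. info M W B T u 0) W s t"

definition has_bwd_integral ::
  "'w measure \<Rightarrow> (real \<Rightarrow> 'w \<Rightarrow> 'e::euclidean_space) \<Rightarrow> (real \<Rightarrow> 'w \<Rightarrow> real) \<Rightarrow> real
     \<Rightarrow> real \<Rightarrow> real \<Rightarrow> (real \<Rightarrow> 'w \<Rightarrow> real) \<Rightarrow> ('w \<Rightarrow> real) \<Rightarrow> bool" where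
  "has_bwd_integral M W B T s t = has_ito_integral M (\<lambda>u v. info M W B T T v) B s t"


section \<open>The equations\<close>

definition sde_solution ::
  "'w measure \<Rightarrow> (real \<Rightarrow> 'w \<Rightarrow> real^'d) \<Rightarrow> (real \<Rightarrow> 'w \<Rightarrow> real) \<Rightarrow> real
     \<Rightarrow> (real^'d \<Rightarrow> real^'d) \<Rightarrow> (real^'d \<Rightarrow> real^'d^'d) \<Rightarrow> real^'d
     \<Rightarrow> (real \<Rightarrow> 'w \<Rightarrow> real^'d) \<Rightarrow> bool" where
  "sde_solution M W B T b \<sigma> x X \<longleftrightarrow>
     process M T X \<and>
     (AE \<omega> in M. continuous_on {0..T} (\<lambda>t. X t \<omega>)) \<and>
     (\<forall>t\<in>{0..T}. X t \<in> borel_measurable (info M W B T t T)) \<and>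
     (\<forall>t\<in>{0..T}. \<forall>i. \<exists>J.
        has_fwd_integral M W B T 0 t (\<lambda>r \<omega>. \<sigma> (X r \<omega>) $ i) J \<and>
        (AE \<omega> in M. set_integrable lborel {0..t} (\<lambda>r. b (X r \<omega>) $ i) \<and>
           X t \<omega> $ i = x $ i + (LINT r:{0..t}|lborel. b (X r \<omega>) $ i) + J \<omega>))"

text \<open>\<open>Y\<^sub>s = \<zeta> + \<integral>\<^sub>s\<^sup>T F\<^sub>r dr + \<integral>\<^sub>s\<^sup>T G\<^sub>r dB\<^sub>r - \<integral>\<^sub>s\<^sup>T Z\<^sub>r dW\<^sub>r\<close>, the \<open>dB\<close> integral being backward. The processes \<open>F\<close> and
  \<open>G\<close> are the coefficients already evaluated along the solution, so that the same notion serves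
  for the nonlinear equation and for the linear one.\<close>

definition bdsde_solution ::
  "'w measure \<Rightarrow> (real \<Rightarrow> 'w \<Rightarrow> real^'d) \<Rightarrow> (real \<Rightarrow> 'w \<Rightarrow> real) \<Rightarrow> real
     \<Rightarrow> ('w \<Rightarrow> real) \<Rightarrow> (real \<Rightarrow> 'w \<Rightarrow> real) \<Rightarrow> (real \<Rightarrow> 'w \<Rightarrow> real)
     \<Rightarrow> (real \<Rightarrow> 'w \<Rightarrow> real) \<Rightarrow> (real \<Rightarrow> 'w \<Rightarrow> real^'d) \<Rightarrow> bool" where
  "bdsde_solution M W B T \<zeta> F G Y Z \<longleftrightarrow>
     process M T Y \<and> process M T Z \<and>
     (AE \<omega> in M. continuous_on {0..T} (\<lambda>t. Y t \<omega>)) \<and>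
     (\<forall>t\<in>{0..T}. Y t \<in> borel_measurable (info M W B T t t) \<and>
                  Z t \<in> borel_measurable (info M W B T t t)) \<and>
     (\<integral>\<^sup>+\<omega>. (SUP s\<in>{0..T}. ennreal (\<bar>Y s \<omega>\<bar>\<^sup>2)) \<partial>M) < \<infinity> \<and>
     (\<integral>\<^sup>+\<omega>. (\<integral>\<^sup>+s\<in>{0..T}. ennreal ((norm (Z s \<omega>))\<^sup>2) \<partial>lborel) \<partial>M) < \<infinity> \<and>
     (\<forall>s\<in>{0..T}. \<exists>J K.
        has_bwd_integral M W B T s T G J \<and>
        has_fwd_integral M W B T s T Z K \<and>
        (AE \<omega> in M. set_integrable lborel {s..T} (\<lambda>r. F r \<omega>) \<and>
           Y s \<omega> = \<zeta> \<omega> + (LINT r:{s..T}|lborel. F r \<omega>) + J \<omega> - K \<omega>))"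

end

theory Submission
  imports Defs
begin

text \<open>
  Write \<open>Z = \<nabla>Y A\<close> with \<open>A = (\<nabla>X)\<^sup>-\<^sup>1 \<sigma>(X)\<close>. The factor \<open>A\<close> only depends on \<open>W\<close> and satisfies
  \<open>E |A\<^sub>t - A\<^sub>s|^4 <= C (t - s)^2\<close>; this is read off the Euler scheme of \<open>X\<close>, its difference quotients
  and an explicit discrete inverse flow, whose moments are bounded uniformly in the mesh. Each
  \<open>\<partial>\<^sub>jY\<close> solves a linear equation, for which a discretized Ito formula gives energy estimates under any
  weight that is a function of \<open>W\<close> up to the current time. With \<open>|A\<^sub>t - A\<^sub>s|^2\<close> as weight they control
  \<open>\<nabla>Y\<^sub>t (A\<^sub>t - A\<^sub>s)\<close> without fourth moments of \<open>\<nabla>Y\<close>; with the running maxima of \<open>|A|^2\<close> along the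
  subdivision, which increase and are bounded by chaining, they control the sum of the
  \<open>(\<nabla>Y\<^sub>t - \<nabla>Y\<^sub>s) A\<^sub>s\<close>.\<close>

text \<open>No equation for \<open>DX\<close> is given and \<open>DX\<close> is not assumed
  invertible: it is only the almost sure derivative at \<open>x\<close> for each fixed time. So its
  moments, its inverse and an adapted version of that inverse are all taken from the scheme. Fatou's
  lemma carries the moments to the limit, and an approximate left inverse whose error vanishes with
  the mesh forces invertibility. For the gradient of \<open>Y\<close> only second moments are at
  hand; the gap \<open>1 - \<alpha>\<close> absorbs, in L^2, the part of the energy of
  \<open>DZ\<close> that the backward integral returns. A product with the factor must therefore be
  handled by a weight. A weight known from \<open>W\<close> up to the left end point is admissible
  for both integrals at once: the forward information contains the past of \<open>W\<close>, the
  backward information contains all of \<open>W\<close>. Hence both isometries hold under it and no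
  cross terms appear. It has to be bounded for the expectations to be finite; truncation and
  monotone convergence remove the bound. The absorption only works for short steps. Subdivisions
  with a mesh above a fixed threshold need no regularity at all, since a constant is then at most a
  multiple of the mesh.\<close>

abbreviation bm :: "'a measure => ('a => 'b::topological_space) set" where
 "bm N \<equiv> borel_measurable N"

notation (in prob_space) expectation (binder "\<E>" 10)

abbreviation (in prob_space) nn_expectation :: "('a => ennreal) => ennreal" (binder "\<E>\<^sup>+" 10) where
 "nn_expectation f \<equiv> nn_integral M f"

section \<open>Increments of Brownian motion\<close>

text \<open>Sets prescribing one time only are not closed under intersection. Prescribing finitely
  many times gives a pi-system, from which independence extends to the generated
  sigma-algebra.\<close>

definition cylinders :: "'w measure => real set => (real => 'w => 'e::euclidean_space) => 'w set set" where
 "cylinders M I U = {{w\<in>space M. \<forall>r\<in>R. U r w \<in> A r} | R A.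
   finite R \<and> R \<subseteq> I \<and> (\<forall>r. A r \<in> sets borel)}"

lemma sigma_sets_cylinders: "sigma_sets (space M) (cylinders M I U) = generated_events M I U"
 unfolding generated_events_def
proof (intro sigma_sets_eqI)
 fix a assume "a \<in> cylinders M I U"
 then obtain R A where RA: "finite R" "R \<subseteq> I" "\<And>r. A r \<in> sets borel"
  and a: "a = {w\<in>space M. \<forall>r\<in>R. U r w \<in> A r}" by (auto simp: cylinders_def)
 let ?S = "sigma (space M) {U r -` A \<inter> space M |r A. r \<in> I \<and> A \<in> sets borel}"
 have sp: "space ?S = space M" and se: "sets ?S = sigma_sets (space M) {U r -` A \<inter> space M |r A. r \<in> I \<and> A \<in> sets borel}"
  by (auto intro!: space_measure_of sets_measure_of)
 have "{w\<in>space ?S. \<forall>r\<in>R. U r w \<in> A r} \<in> sets ?S"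
 proof (rule sets.sets_Collect_finite_All)
  fix r assume "r \<in> R"
  then have "U r -` A r \<inter> space M \<in> sets ?S"
   unfolding se using RA by (intro sigma_sets.Basic) auto
  then show "{w \<in> space ?S. U r w \<in> A r} \<in> sets ?S"
   unfolding sp by (simp add: vimage_def Int_def conj_commute)
 qed fact
 then show "a \<in> sigma_sets (space M) {U r -` A \<inter> space M |r A. r \<in> I \<and> A \<in> sets borel}"
  unfolding sp se a .
next
 fix b assume "b \<in> {U r -` A \<inter> space M |r A. r \<in> I \<and> A \<in> sets borel}"
 then obtain r A where "r \<in> I" "A \<in> sets borel" "b = U r -` A \<inter> space M" by auto
 then have "b \<in> cylinders M I U" unfolding cylinders_def
  by (intro CollectI exI[of _ "{r}"] exI[of _ "\<lambda>_. A"]) auto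
 then show "b \<in> sigma_sets (space M) (cylinders M I U)" by (rule sigma_sets.Basic)
qed

lemma Int_stable_cylinders: "Int_stable (cylinders M I U)"
proof (rule Int_stableI)
 fix a b assume "a \<in> cylinders M I U" "b \<in> cylinders M I U"
 then obtain R A R' A' where RA: "finite R" "R \<subseteq> I" "\<And>r. A r \<in> sets borel"
  "finite R'" "R' \<subseteq> I" "\<And>r. A' r \<in> sets borel"
  and ab: "a = {w\<in>space M. \<forall>r\<in>R. U r w \<in> A r}" "b = {w\<in>space M. \<forall>r\<in>R'. U r w \<in> A' r}"
  unfolding cylinders_def by blast
 let ?A = "\<lambda>r. (if r \<in> R then A r else UNIV) \<inter> (if r \<in> R' then A' r else UNIV)"
 have "a \<inter> b = {w\<in>space M. \<forall>r\<in>R \<union> R'. U r w \<in> ?A r}" unfolding ab by (auto split: if_splits)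
 moreover have "?A r \<in> sets borel" for r using RA by auto
 ultimately show "a \<inter> b \<in> cylinders M I U"
  unfolding cylinders_def using RA by (intro CollectI exI[of _ "R \<union> R'"] exI[of _ ?A]) auto
qed

text \<open>\<open>std_brownian_motion\<close> gives independence only for the increments along one
  finite chain of times. The hypothesis \<open>chain\<close> threads any finite set of times into a
  chain that has \<open>u\<close>, \<open>v\<close> as neighbours and in which every
  \<open>V r - V c\<close> is a sum of other increments. One proof then covers conditioning on the
  times before and on the times after the increment.\<close>

lemma (in prob_space) indep_set_increment:
 fixes V :: "real => 'a => 'e::euclidean_space"
 assumes bm: "std_brownian_motion M T V"
  and chain: "\<And>R. finite R \<Longrightarrow> R \<subseteq> I \<Longrightarrow> \<exists>n (p::nat => real) K k.
   0 <= p 0 \<and> (\<forall>k<n. p k <= p (Suc k)) \<and> p n <= T \<and> K \<subseteq> {..<n} \<and> k < n \<and> k \<notin> K \<and>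
   p k = u \<and> p (Suc k) = v \<and>
   (\<forall>r\<in>R. \<exists>L\<subseteq>K. \<forall>w. V r w - V c w = (\<Sum>i\<in>L. V (p (Suc i)) w - V (p i) w))"
 shows "indep_set (generated_events M I (\<lambda>r w. V r w - V c w))
  (sigma_sets (space M) {(\<lambda>w. V v w - V u w) -` A \<inter> space M | A. A \<in> sets borel})"
 unfolding sigma_sets_cylinders[symmetric]
proof (intro indep_set_sigma_sets Int_stable_cylinders)
 let ?D = "\<lambda>w. V v w - V u w"
 show "Int_stable {?D -` A \<inter> space M | A. A \<in> sets borel}"
 proof (rule Int_stableI)
  fix a b assume "a \<in> {?D -` A \<inter> space M | A. A \<in> sets borel}" "b \<in> {?D -` A \<inter> space M | A. A \<in> sets borel}"
  then obtain A A' where "A \<in> sets borel" "A' \<in> sets borel"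
   and "a = ?D -` A \<inter> space M" "b = ?D -` A' \<inter> space M" by blast
  then show "a \<inter> b \<in> {?D -` A \<inter> space M | A. A \<in> sets borel}"
   by (intro CollectI exI[of _ "A \<inter> A'"]) auto
 qed
 have key: "e \<in> events \<and> ?D -` A \<inter> space M \<in> events \<and>
   prob (e \<inter> (?D -` A \<inter> space M)) = prob e * prob (?D -` A \<inter> space M)"
  if e: "e \<in> cylinders M I (\<lambda>r w. V r w - V c w)" and A: "A \<in> sets borel" for e A
 proof -
  obtain R E where R: "finite R" "R \<subseteq> I" "\<And>r. E r \<in> sets borel"
   and e': "e = {w\<in>space M. \<forall>r\<in>R. V r w - V c w \<in> E r}"
   using e unfolding cylinders_def by blast
  obtain n K k and p :: "nat => real" where
   t: "0 <= p 0 \<and> (\<forall>k<n. p k <= p (Suc k)) \<and> p n <= T"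
   and K: "K \<subseteq> {..<n}" "k < n" "k \<notin> K" "p k = u" "p (Suc k) = v"
   and "\<forall>r\<in>R. \<exists>L\<subseteq>K. \<forall>w. V r w - V c w = (\<Sum>i\<in>L. V (p (Suc i)) w - V (p i) w)"
   using chain[OF R(1,2)] by blast
  then obtain L where L: "\<And>r. r \<in> R \<Longrightarrow> L r \<subseteq> K"
   "\<And>r w. r \<in> R \<Longrightarrow> V r w - V c w = (\<Sum>i\<in>L r. V (p (Suc i)) w - V (p i) w)"
   by metis
  let ?X = "\<lambda>i w. V (p (Suc i)) w - V (p i) w"
  have "indep_vars (\<lambda>_. borel) ?X {..<n}"
   using bm t unfolding std_brownian_motion_def by blast
  then have iv: "indep_var (PiM K (\<lambda>_. borel)) (\<lambda>w. restrict (\<lambda>i. ?X i w) K)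
    (PiM {k} (\<lambda>_. borel)) (\<lambda>w. restrict (\<lambda>i. ?X i w) {k})"
   by (rule indep_var_restrict) (use K in auto)
  let ?PK = "PiM K (\<lambda>_. borel :: 'e measure)"
  have *: "(\<lambda>f. \<Sum>i\<in>L r. f i) \<in> bm ?PK" if "r \<in> R" for r
   using L(1)[OF that] by (intro borel_measurable_sum measurable_component_singleton) auto
  have SA: "{f\<in>space ?PK. \<forall>r\<in>R. (\<Sum>i\<in>L r. f i) \<in> E r} \<in> sets ?PK" (is "?S \<in> _")
   using * R by (intro sets.sets_Collect_finite_All measurable_sets_Collect[where M="borel" and P="\<lambda>x. x \<in> E _"]) auto
  have SB: "{f\<in>space (PiM {k} (\<lambda>_. borel)). f k \<in> A} \<in> sets (PiM {k} (\<lambda>_. borel))" (is "?S' \<in> _")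
   using A by measurable
  have r1: "(\<lambda>w. restrict (\<lambda>i. ?X i w) K) -` ?S \<inter> space M = e"
  proof -
   have "(\<Sum>i\<in>L r. restrict (\<lambda>i. ?X i w) K i) = V r w - V c w" if "r \<in> R" for r w
    unfolding L(2)[OF that] using L(1)[OF that] by (intro sum.cong) auto
   then show ?thesis unfolding e' by (auto simp: space_PiM)
  qed
  have r2: "(\<lambda>w. restrict (\<lambda>i. ?X i w) {k}) -` ?S' \<inter> space M = ?D -` A \<inter> space M"
   using K by (auto simp: space_PiM)
  have m: "e \<in> events" "?D -` A \<inter> space M \<in> events"
   using measurable_sets[OF indep_var_rv1[OF iv] SA] measurable_sets[OF indep_var_rv2[OF iv] SB]
   unfolding r1 r2 by auto
  have "prob ((\<lambda>w. (restrict (\<lambda>i. ?X i w) K, restrict (\<lambda>i. ?X i w) {k})) -` (?S \<times> ?S') \<inter> space M)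
   = prob ((\<lambda>w. restrict (\<lambda>i. ?X i w) K) -` ?S \<inter> space M) *
    prob ((\<lambda>w. restrict (\<lambda>i. ?X i w) {k}) -` ?S' \<inter> space M)"
   by (rule indep_varD[OF iv SA SB])
  moreover have "(\<lambda>w. (restrict (\<lambda>i. ?X i w) K, restrict (\<lambda>i. ?X i w) {k})) -` (?S \<times> ?S') \<inter> space M
   = e \<inter> (?D -` A \<inter> space M)" unfolding r1[symmetric] r2[symmetric] by auto
  ultimately show ?thesis unfolding r1 r2 using m by auto
 qed
 show "indep_set (cylinders M I (\<lambda>r w. V r w - V c w)) {?D -` A \<inter> space M | A. A \<in> sets borel}"
 proof (rule indep_setI)
  show "cylinders M I (\<lambda>r w. V r w - V c w) \<subseteq> events" using key[OF _ sets.empty_sets] by blast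
  show "{?D -` A \<inter> space M | A. A \<in> sets borel} \<subseteq> events"
  proof safe
   fix A :: "'e set" assume A: "A \<in> sets borel"
   have "space M \<in> cylinders M I (\<lambda>r w. V r w - V c w)"
    unfolding cylinders_def by (intro CollectI exI[of _ "{}"]) auto
   from key[OF this A] show "?D -` A \<inter> space M \<in> events" by simp
  qed
 qed (use key in blast)
qed

lemma (in prob_space) indep_set_future_increment:
 fixes V :: "real => 'a => 'e::euclidean_space"
 assumes bm: "std_brownian_motion M T V" and uv: "0 <= u" "u <= v" "v <= T"
 shows "indep_set (generated_events M {0..u} (\<lambda>r w. V r w - V 0 w))
  (sigma_sets (space M) {(\<lambda>w. V v w - V u w) -` A \<inter> space M | A. A \<in> sets borel})"
proof (rule indep_set_increment[OF bm])
 fix R assume R: "finite R" "R \<subseteq> {0..u}"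
 define l where "l = sorted_list_of_set (R \<union> {0,u})"
 define m where "m = length l"
 have l: "set l = R \<union> {0,u}" "sorted l"
  unfolding l_def using R by (simp_all only: finite_Un finite.intros set_sorted_list_of_set sorted_sorted_list_of_set)
 have m: "m > 0" using l(1) unfolding m_def by (cases l) auto
 have l0: "l ! 0 = 0" 
 proof -
  obtain i where "i < m" "l ! i = 0" using l(1) unfolding m_def by (metis Un_iff in_set_conv_nth insertCI)
  then have "l ! 0 <= 0" using sorted_nth_mono[OF l(2), of 0 i] by (auto simp: m_def)
  moreover have "l ! 0 \<in> R \<union> {0,u}" using m l(1) nth_mem unfolding m_def by blast
  then have "l ! 0 \<ge> 0" using R uv by auto
  ultimately show ?thesis by auto
 qed
 have lm: "l ! (m - 1) = u" 
 proof -
  obtain i where i: "i < m" "l ! i = u" using l(1) unfolding m_def by (metis Un_iff in_set_conv_nth insertCI)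
  then have "u <= l ! (m-1)" using sorted_nth_mono[OF l(2), of i "m-1"] m by (auto simp: m_def)
  moreover have "l ! (m-1) \<in> R \<union> {0,u}" using m l(1) nth_mem unfolding m_def by (metis diff_less zero_less_one)
  then have "l ! (m-1) <= u" using R uv by auto
  ultimately show ?thesis by auto
 qed
 \<comment> \<open>The sorted times end at \<open>u\<close>, so appending \<open>v\<close> makes
   \<open>m - 1\<close> the step from \<open>u\<close> to \<open>v\<close>; the steps below it carry
   the conditioning times.\<close>
 define p where "p k = (if k < m then l ! k else v)" for k
 have mono: "p k <= p (Suc k)" if "k < m" for k
 proof (cases "Suc k < m")
  case True then show ?thesis using sorted_nth_mono[OF l(2), of k "Suc k"] by (auto simp: p_def m_def)
 next
  case False
  then have "k = m - 1" using that by auto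
  then show ?thesis using lm uv m False by (auto simp: p_def)
 qed
 have "\<exists>L\<subseteq>{..<m-1}. \<forall>w. V r w - V 0 w = (\<Sum>i\<in>L. V (p (Suc i)) w - V (p i) w)" if "r \<in> R" for r
 proof -
  obtain j where j: "j < m" "l ! j = r" using l(1) \<open>r \<in> R\<close> unfolding m_def by (metis Un_iff in_set_conv_nth)
  have "V r w - V 0 w = (\<Sum>i<j. V (p (Suc i)) w - V (p i) w)" for w
   using sum_lessThan_telescope[of "\<lambda>i. V (p i) w" j] j m l0 by (simp add: p_def)
  then show ?thesis using j by (intro exI[of _ "{..<j}"]) auto
 qed
 then show "\<exists>n (p::nat => real) K k.
   0 <= p 0 \<and> (\<forall>k<n. p k <= p (Suc k)) \<and> p n <= T \<and> K \<subseteq> {..<n} \<and> k < n \<and> k \<notin> K \<and>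
   p k = u \<and> p (Suc k) = v \<and>
   (\<forall>r\<in>R. \<exists>L\<subseteq>K. \<forall>w. V r w - V 0 w = (\<Sum>i\<in>L. V (p (Suc i)) w - V (p i) w))"
  using mono m lm l0 uv
  by (intro exI[of _ m] exI[of _ p] exI[of _ "{..<m-1}"] exI[of _ "m-1"]) (auto simp: p_def)
qed

lemma (in prob_space) indep_set_past_increment:
 fixes V :: "real => 'a => 'e::euclidean_space"
 assumes bm: "std_brownian_motion M T V" and uv: "0 <= u" "u <= v" "v <= T"
 shows "indep_set (generated_events M {v..T} (\<lambda>r w. V r w - V v w))
  (sigma_sets (space M) {(\<lambda>w. V v w - V u w) -` A \<inter> space M | A. A \<in> sets borel})"
proof (rule indep_set_increment[OF bm])
 fix R assume R: "finite R" "R \<subseteq> {v..T}"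
 define l where "l = sorted_list_of_set (R \<union> {v})"
 define m where "m = length l"
 have l: "set l = R \<union> {v}" "sorted l"
  unfolding l_def using R by (simp_all only: finite_Un finite.intros set_sorted_list_of_set sorted_sorted_list_of_set)
 have m: "m > 0" using l(1) unfolding m_def by (cases l) auto
 have l0: "l ! 0 = v" 
 proof -
  obtain i where "i < m" "l ! i = v" using l(1) unfolding m_def by (metis Un_iff in_set_conv_nth insertCI)
  then have "l ! 0 <= v" using sorted_nth_mono[OF l(2), of 0 i] by (auto simp: m_def)
  moreover have "l ! 0 \<in> R \<union> {v}" using m l(1) nth_mem unfolding m_def by blast
  then have "l ! 0 \<ge> v" using R uv by auto
  ultimately show ?thesis by auto
 qed
 \<comment> \<open>Mirror image: \<open>u\<close> is put in front of the sorted times, which begin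
   with \<open>v\<close>. Step 0 is the increment in question, and all later times are reached by
   the steps from 1 on.\<close>
 define p where "p k = (if k = 0 then u else l ! (k - 1))" for k
 have mono: "p k <= p (Suc k)" if "k < m" for k
  using sorted_nth_mono[OF l(2), of "k-1" k] that l0 uv by (auto simp: p_def m_def)
 have "\<exists>L\<subseteq>{1..<m}. \<forall>w. V r w - V v w = (\<Sum>i\<in>L. V (p (Suc i)) w - V (p i) w)" if "r \<in> R" for r
 proof -
  obtain j where j: "j < m" "l ! j = r" using l(1) \<open>r \<in> R\<close> unfolding m_def by (metis Un_iff in_set_conv_nth)
  have "V r w - V v w = (\<Sum>i\<in>{1..<Suc j}. V (p (Suc i)) w - V (p i) w)" for w
   using sum_Suc_diff'[of 1 "Suc j" "\<lambda>i. V (p i) w"] j m l0 by (simp add: p_def)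
  then show ?thesis using j by (intro exI[of _ "{1..<Suc j}"]) auto
 qed
 moreover have "p m <= T"
 proof -
  have "l ! (m-1) \<in> R \<union> {v}" using m l(1) nth_mem unfolding m_def by (metis diff_less zero_less_one)
  then show ?thesis using R uv m by (auto simp: p_def)
 qed
 ultimately show "\<exists>n (p::nat => real) K k.
   0 <= p 0 \<and> (\<forall>k<n. p k <= p (Suc k)) \<and> p n <= T \<and> K \<subseteq> {..<n} \<and> k < n \<and> k \<notin> K \<and>
   p k = u \<and> p (Suc k) = v \<and>
   (\<forall>r\<in>R. \<exists>L\<subseteq>K. \<forall>w. V r w - V v w = (\<Sum>i\<in>L. V (p (Suc i)) w - V (p i) w))"
  using mono m l0 uv
  by (intro exI[of _ m] exI[of _ p] exI[of _ "{1..<m}"] exI[of _ 0]) (auto simp: p_def)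
qed

section \<open>Sigma-algebras of information and their independence of increments\<close>

lemma generated_events_subset:
 assumes "\<And>r. r \<in> I \<Longrightarrow> U r \<in> bm N" "space N = space M"
 shows "generated_events M I U \<subseteq> sets N"
 unfolding generated_events_def assms(2)[symmetric]
 by (rule sets.sigma_sets_subset) (use assms(1) measurable_sets in blast)

lemma generated_events_Pow: "generated_events M I U \<subseteq> Pow (space M)"
proof
 fix x assume "x \<in> generated_events M I U"
 then have "x \<subseteq> space M" unfolding generated_events_def by (rule sigma_sets_into_sp[rotated]) auto
 then show "x \<in> Pow (space M)" by simp
qed

lemma generated_events_space: "space M \<in> generated_events M I U"
 unfolding generated_events_def by (rule sigma_sets_top)

lemma generated_events_vimage:
 assumes "r \<in> I" "A \<in> sets borel"
 shows "U r -` A \<inter> space M \<in> generated_events M I U"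
 unfolding generated_events_def using assms by (intro sigma_sets.Basic) auto

lemma sigma_algebra_generated: "sigma_algebra (space M) (generated_events M I U)"
 unfolding generated_events_def by (rule sigma_algebra_sigma_sets) auto

lemma Int_stable_generated_events: "Int_stable (generated_events M I U)"
 by (rule algebra.Int_stable[OF sigma_algebra.axioms(1)[OF sigma_algebra_generated]])

lemma space_info [simp]: "space (info M W B T u v) = space M"
 unfolding info_def by (intro space_measure_of) (auto dest: sets.sets_into_space generated_events_Pow[THEN subsetD])

lemma sets_info: "sets (info M W B T u v) = sigma_sets (space M)
   (generated_events M {0..u} (\<lambda>r w. W r w - W 0 w) \<union>
   generated_events M {v..T} (\<lambda>r w. B r w - B v w) \<union> null_sets M)"
 unfolding info_def by (intro sets_measure_of) (auto dest: sets.sets_into_space generated_events_Pow[THEN subsetD])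

lemma measurable_info_left:
 assumes "0 <= r" "r <= u"
 shows "(\<lambda>w. W r w - W 0 w) \<in> bm (info M W B T u v)"
proof (rule measurableI)
 fix A :: "'b set" assume "A \<in> sets borel"
 then have "(\<lambda>w. W r w - W 0 w) -` A \<inter> space M \<in> generated_events M {0..u} (\<lambda>r w. W r w - W 0 w)"
  using assms by (intro generated_events_vimage) auto
 then show "(\<lambda>w. W r w - W 0 w) -` A \<inter> space (info M W B T u v) \<in> sets (info M W B T u v)"
  unfolding space_info sets_info by (rule sigma_sets.Basic[OF UnI1[OF UnI1]])
qed simp

lemma measurable_info_right:
 assumes "v <= r" "r <= T"
 shows "(\<lambda>w. B r w - B v w) \<in> bm (info M W B T u v)"
proof (rule measurableI)
 fix A :: "real set" assume "A \<in> sets borel"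
 then have "(\<lambda>w. B r w - B v w) -` A \<inter> space M \<in> generated_events M {v..T} (\<lambda>r w. B r w - B v w)"
  using assms by (intro generated_events_vimage) auto
 then show "(\<lambda>w. B r w - B v w) -` A \<inter> space (info M W B T u v) \<in> sets (info M W B T u v)"
  unfolding space_info sets_info by (rule sigma_sets.Basic[OF UnI1[OF UnI2]])
qed simp

lemma measurable_info_W:
 fixes W :: "real => 'w => 'e::euclidean_space"
 assumes "0 <= r" "r <= r'" "r' <= u"
 shows "(\<lambda>w. W r' w - W r w) \<in> bm (info M W B T u v)"
 using borel_measurable_diff[OF measurable_info_left[where r=r'] measurable_info_left[where r=r], of u W M B T v] assms by simp

lemma measurable_info_B:
 assumes "v <= r" "r <= r'" "r' <= T"
 shows "(\<lambda>w. B r' w - B r w) \<in> bm (info M W B T u v)"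
 using borel_measurable_diff[OF measurable_info_right[where r=r'] measurable_info_right[where r=r], of v T B M W u] assms by simp

lemma null_sets_info: "null_sets M \<subseteq> sets (info M W B T u v)"
 unfolding sets_info by (intro subsetI sigma_sets.Basic UnI2)

lemma info_mono:
 fixes W :: "real => 'w => 'e::euclidean_space"
 assumes "u <= u'" "v' <= v"
 shows "sets (info M W B T u v) \<subseteq> sets (info M W B T u' v')"
proof -
 have 1: "generated_events M {0..u} (\<lambda>r w. W r w - W 0 w) \<subseteq> sets (info M W B T u' v')"
  using assms by (intro generated_events_subset measurable_info_left) auto
 have 2: "generated_events M {v..T} (\<lambda>r w. B r w - B v w) \<subseteq> sets (info M W B T u' v')"
  using assms by (intro generated_events_subset measurable_info_B) auto
 show ?thesis unfolding sets_info[of M W B T u v] space_info[of M W B T u' v', symmetric]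
  by (rule sets.sigma_sets_subset) (use 1 2 null_sets_info[of M W B T u' v'] in simp)
qed

lemma measurable_info_mono:
 fixes W :: "real => 'w => 'e::euclidean_space"
 assumes "f \<in> measurable (info M W B T u v) N" "u <= u'" "v' <= v"
 shows "f \<in> measurable (info M W B T u' v') N"
 using assms(1) info_mono[OF assms(2,3), of M W B T] unfolding measurable_def space_info by blast

lemma measurable_info_AE:
 assumes f: "f \<in> bm M" and g: "g \<in> bm (info M W B T u v)"
  and sub: "sets (info M W B T u v) \<subseteq> sets M" and AE: "AE w in M. f w = g w"
 shows "f \<in> bm (info M W B T u v)"
proof (rule measurableI)
 fix A :: "'b set" assume A: "A \<in> sets borel"
 obtain N where N: "N \<in> null_sets M" "{w\<in>space M. f w \<noteq> g w} \<subseteq> N"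
  using AE by (auto simp: eventually_ae_filter)
 have m: "f -` A \<inter> space M \<in> sets M" "g -` A \<inter> space M \<in> sets (info M W B T u v)"
  using measurable_sets[OF f A] measurable_sets[OF g A] by auto
 have "f -` A \<inter> space M \<inter> N \<in> null_sets M"
  using null_set_Int1[OF N(1) m(1)] by (simp add: Int_commute)
 then have n: "f -` A \<inter> space M \<inter> N \<in> sets (info M W B T u v)" "N \<in> sets (info M W B T u v)"
  using N(1) by (auto intro: subsetD[OF null_sets_info])
 have "f -` A \<inter> space M = (g -` A \<inter> space M - N) \<union> (f -` A \<inter> space M \<inter> N)"
  using N(2) by auto
 also have "... \<in> sets (info M W B T u v)" using m n by (intro sets.Un sets.Diff)
 finally show "f -` A \<inter> space (info M W B T u v) \<in> sets (info M W B T u v)" by simp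
qed simp

text \<open>On the pi-system of sets \<open>a \<inter> c\<close>, with the null sets added, the
  probability factorizes twice: \<open>C\<close> splits off because \<open>A\<close> and
  \<open>D\<close> both lie in the component \<open>S1\<close> independent of it, and
  \<open>A\<close> splits from \<open>D\<close>. In this way the path of the other Brownian motion
  and the null sets join the information without destroying independence.\<close>

lemma (in prob_space) indep_set_join:
 assumes S: "sigma_algebra (space M) S1" and S12: "indep_set S1 S2"
  and a: "A \<subseteq> S1" "D \<subseteq> S1"
  and C: "C \<subseteq> S2" "Int_stable A" "Int_stable C" "Int_stable D"
  and AD: "indep_set A D" and sp: "space M \<in> A" "space M \<in> C"
 shows "indep_set (sigma_sets (space M) (A \<union> C \<union> null_sets M)) (sigma_sets (space M) D)"
proof -
 let ?P = "{a \<inter> c | a c. a \<in> A \<and> c \<in> C} \<union> null_sets M"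
 have CW: "C \<subseteq> events" using indep_setD_ev2[OF S12] C by auto
 have AW: "A \<subseteq> events" "D \<subseteq> events" using indep_setD_ev1[OF S12] a by auto
 interpret GW: sigma_algebra "space M" S1 by fact
 have "indep_set ?P D"
 proof (rule indep_setI)
  show "?P \<subseteq> events" "D \<subseteq> events" using CW AW by auto
  fix p d assume p: "p \<in> ?P" and d: "d \<in> D"
  show "prob (p \<inter> d) = prob p * prob d"
  proof (cases "p \<in> null_sets M")
   case True
   then have "p \<inter> d \<in> null_sets M" using d AW by (intro null_set_Int2) auto
   then show ?thesis using True by (simp add: measure_eq_0_null_sets)
  next
   case False
   then obtain a' c where ac: "p = a' \<inter> c" "a' \<in> A" "c \<in> C" using p by auto
   have "prob (p \<inter> d) = prob ((a' \<inter> d) \<inter> c)" unfolding ac by (simp add: Int_ac)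
   also have "... = prob (a' \<inter> d) * prob c"
    using ac a d C by (intro indep_setD[OF S12]) auto
   also have "prob (a' \<inter> d) = prob a' * prob d" using ac d by (intro indep_setD[OF AD])
   also have "prob a' * prob d * prob c = (prob a' * prob c) * prob d" by simp
   also have "prob a' * prob c = prob p" unfolding ac(1)
    using ac a C by (intro indep_setD[OF S12, symmetric]) auto
   finally show ?thesis .
  qed
 qed
 moreover have "Int_stable ?P"
 proof (rule Int_stableI)
  fix p q assume pq: "p \<in> ?P" "q \<in> ?P"
  have ev: "p \<in> events" "q \<in> events" using pq AW CW by auto
  show "p \<inter> q \<in> ?P"
  proof (cases "p \<in> null_sets M \<or> q \<in> null_sets M")
   case True
   then have "p \<inter> q \<in> null_sets M" using ev by (auto intro: null_set_Int1 null_set_Int2)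
   then show ?thesis by simp
  next
   case False
   then obtain a1 c1 a2 c2 where "p = a1 \<inter> c1" "q = a2 \<inter> c2" "a1 \<in> A" "a2 \<in> A" "c1 \<in> C" "c2 \<in> C"
    using pq by auto
   then have "p \<inter> q = (a1 \<inter> a2) \<inter> (c1 \<inter> c2)" "a1 \<inter> a2 \<in> A" "c1 \<inter> c2 \<in> C"
    using C by (auto simp: Int_stable_def)
   then show ?thesis by blast
  qed
 qed
 ultimately have i: "indep_set (sigma_sets (space M) ?P) (sigma_sets (space M) D)"
  using C by (intro indep_set_sigma_sets)
 have sub: "sigma_sets (space M) (A \<union> C \<union> null_sets M) \<subseteq> sigma_sets (space M) ?P"
 proof (rule sigma_sets_mono, intro subsetI)
  fix x assume x: "x \<in> A \<union> C \<union> null_sets M"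
  then have "x \<subseteq> space M" using AW CW sets.sets_into_space by blast
  then have "x = x \<inter> space M" "x = space M \<inter> x" by auto
  then have "x \<in> ?P" using x sp by blast
  then show "x \<in> sigma_sets (space M) ?P" by (rule sigma_sets.Basic)
 qed
 show "indep_set (sigma_sets (space M) (A \<union> C \<union> null_sets M)) (sigma_sets (space M) D)"
  using i sub unfolding indep_sets2_eq by blast
qed

locale two_brownian_motions = prob_space M for M :: "'w measure" +
 fixes T :: real and W :: "real => 'w => real^'d" and B :: "real => 'w => real"
 assumes T_pos: "T > 0"
  and bmW: "std_brownian_motion M T W" and bmB: "std_brownian_motion M T B"
  and indWB: "independent_processes M T W B"
begin

text \<open>Three uses recur: \<open>\<F> u 0\<close> (past of \<open>W\<close>, all of
  \<open>B\<close>) adapts forward integrands, \<open>\<F> T v\<close> (all of \<open>W\<close>,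
  future of \<open>B\<close>) adapts backward ones, and \<open>\<F> s T\<close> carries
  \<open>W\<close> alone, so that its variables are admissible in both directions.\<close>

abbreviation \<F> :: "real => real => 'w measure" where "\<F> \<equiv> info M W B T"

lemma W_measurable: "0 <= t \<Longrightarrow> t <= T \<Longrightarrow> W t \<in> bm M"
 using bmW unfolding std_brownian_motion_def by auto

lemma B_measurable: "0 <= t \<Longrightarrow> t <= T \<Longrightarrow> B t \<in> bm M"
 using bmB unfolding std_brownian_motion_def by auto

lemma info_events:
 assumes "u <= T" "0 <= v"
 shows "sets (\<F> u v) \<subseteq> events"
proof -
 have "generated_events M {0..u} (\<lambda>r w. W r w - W 0 w) \<subseteq> events"
  using assms T_pos by (intro generated_events_subset borel_measurable_diff W_measurable) auto
 moreover have "generated_events M {v..T} (\<lambda>r w. B r w - B v w) \<subseteq> events"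
  using assms T_pos by (intro generated_events_subset borel_measurable_diff B_measurable) auto
 ultimately show ?thesis unfolding sets_info by (intro sets.sigma_sets_subset) auto
qed

lemma measurable_info_events:
 assumes "f \<in> measurable (\<F> u v) N" "u <= T" "0 <= v"
 shows "f \<in> measurable M N"
 using assms(1) info_events[OF assms(2,3)] unfolding measurable_def space_info by blast

lemma generated_events_idem: "sigma_sets (space M) (generated_events M I U) = generated_events M I U"
 using sigma_algebra.sigma_sets_eq[OF sigma_algebra_generated] .

lemma generated_events_mono: "I \<subseteq> J \<Longrightarrow> generated_events M I V \<subseteq> generated_events M J V"
 unfolding generated_events_def by (intro sigma_sets_mono') auto

lemma vimage_increment_subset:
 fixes V :: "real => 'w => 'e::euclidean_space"
 assumes "u \<in> I" "v \<in> I"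
 shows "sigma_sets (space M) {(\<lambda>w. V v w - V u w) -` A \<inter> space M | A. A \<in> sets borel} \<subseteq> generated_events M I V"
  and "generated_events M J (\<lambda>r w. V r w - V u w) \<subseteq> generated_events M (insert u J) V"
proof -
 let ?N = "\<lambda>I. sigma (space M) (generated_events M I V)"
 have N: "space (?N I) = space M" "sets (?N I) = generated_events M I V" for I
  using generated_events_Pow[of M I V] generated_events_idem[of I V] by auto
 have V: "V r \<in> bm (?N I)" if "r \<in> I" for r I
  using that by (intro measurableI) (simp_all add: N generated_events_vimage)
 have "(\<lambda>w. V v w - V u w) -` A \<inter> space M \<in> sets (?N I)" if "A \<in> sets borel" for A
  using measurable_sets[OF borel_measurable_diff[OF V[OF assms(2)] V[OF assms(1)]] that] N by auto
 then have "sigma_sets (space (?N I)) {(\<lambda>w. V v w - V u w) -` A \<inter> space M | A. A \<in> sets borel} \<subseteq> sets (?N I)"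
  by (intro sets.sigma_sets_subset) auto
 then show "sigma_sets (space M) {(\<lambda>w. V v w - V u w) -` A \<inter> space M | A. A \<in> sets borel} \<subseteq> generated_events M I V"
  unfolding N .
 have "generated_events M J (\<lambda>r w. V r w - V u w) \<subseteq> sets (?N (insert u J))"
  by (intro generated_events_subset borel_measurable_diff V N(1)) auto
 then show "generated_events M J (\<lambda>r w. V r w - V u w) \<subseteq> generated_events M (insert u J) V"
  unfolding N(2) .
qed

lemma indep_var_of_indep_set:
 fixes f :: "'w => real" and g :: "'b::euclidean_space => real"
 assumes ind: "indep_set S (sigma_sets (space M) {D -` A \<inter> space M | A. A \<in> sets borel})"
  and "sets N = S" "space N = space M" "f \<in> bm N" "random_variable borel D"
  and g: "g \<in> bm borel"
 shows "indep_var borel f borel (\<lambda>w. g (D w))"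
proof -
 have "S \<subseteq> events" using assms(1) by (rule indep_setD_ev1)
 then have f: "random_variable borel f" using assms by (auto simp: measurable_def)
 have 1: "sigma_sets (space M) {f -` A \<inter> space M | A. A \<in> sets borel} \<subseteq> S"
  using sets.sigma_sets_subset[of "{f -` A \<inter> space M | A. A \<in> sets borel}" N] measurable_sets[OF assms(4)] assms(2,3)
  by auto
 have 2: "sigma_sets (space M) {(\<lambda>w. g (D w)) -` A \<inter> space M | A. A \<in> sets borel} \<subseteq>
   sigma_sets (space M) {D -` A \<inter> space M | A. A \<in> sets borel}"
 proof (rule sigma_sets_mono', intro subsetI)
  fix x assume "x \<in> {(\<lambda>w. g (D w)) -` A \<inter> space M | A. A \<in> sets borel}"
  then obtain A where A: "A \<in> sets borel" "x = (\<lambda>w. g (D w)) -` A \<inter> space M" by blast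
  have "g -` A \<in> sets borel" using measurable_sets[OF g A(1)] by simp
  moreover have "x = D -` (g -` A) \<inter> space M" using A by auto
  ultimately show "x \<in> {D -` A \<inter> space M | A. A \<in> sets borel}" by blast
 qed
 have "indep_set (sigma_sets (space M) {f -` A \<inter> space M | A. A \<in> sets borel})
   (sigma_sets (space M) {(\<lambda>w. g (D w)) -` A \<inter> space M | A. A \<in> sets borel})"
  unfolding indep_sets2_eq using ind[unfolded indep_sets2_eq] 1 2 by (meson subset_eq)
 moreover have "random_variable borel (\<lambda>w. g (D w))" using g assms(5) by measurable
 ultimately show ?thesis unfolding indep_var_eq using f by simp
qed

lemma indep_W:
 assumes "0 <= u" "u <= v" "v <= T" "f \<in> bm (\<F> u 0)"
  and "g \<in> bm borel"
 shows "indep_var borel (f :: 'w => real) borel (\<lambda>w. g (W v w - W u w))"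
proof -
 let ?D = "sigma_sets (space M) {(\<lambda>w. W v w - W u w) -` A \<inter> space M | A. A \<in> sets borel}"
 have i: "indep_set (generated_events M {0..u} (\<lambda>r w. W r w - W 0 w)) ?D"
  by (rule indep_set_future_increment[OF bmW assms(1-3)])
 have "indep_set (sigma_sets (space M) (generated_events M {0..u} (\<lambda>r w. W r w - W 0 w) \<union>
   generated_events M {0..T} (\<lambda>r w. B r w - B 0 w) \<union> null_sets M)) (sigma_sets (space M) ?D)"
 proof (rule indep_set_join[OF sigma_algebra_generated indWB[unfolded independent_processes_def]])
  show "generated_events M {0..u} (\<lambda>r w. W r w - W 0 w) \<subseteq> generated_events M {0..T} W"
   using vimage_increment_subset(2)[of 0 "{0..T}" 0 "{0..u}" W] generated_events_mono[of "insert 0 {0..u}" "{0..T}" W] assms T_pos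
   by auto
  show "?D \<subseteq> generated_events M {0..T} W" using assms by (intro vimage_increment_subset) auto
  show "generated_events M {0..T} (\<lambda>r w. B r w - B 0 w) \<subseteq> generated_events M {0..T} B"
   using vimage_increment_subset(2)[of 0 "{0..T}" 0 "{0..T}" B] T_pos by (simp add: insert_absorb)
  show "Int_stable ?D"
   by (rule algebra.Int_stable[OF sigma_algebra.axioms(1)[OF sigma_algebra_sigma_sets]]) auto
 qed (use i in \<open>auto intro: Int_stable_generated_events generated_events_space\<close>)
 then have "indep_set (sets (\<F> u 0)) ?D"
  unfolding sets_info by (subst (asm) sigma_sets_sigma_sets_eq) auto
 then show ?thesis
  using assms by (intro indep_var_of_indep_set[OF _ refl, where g=g]) (auto intro!: borel_measurable_diff W_measurable)
qed

lemma indep_B: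
 assumes "0 <= u" "u <= v" "v <= T" "f \<in> bm (\<F> T v)"
  and "g \<in> bm borel"
 shows "indep_var borel (f :: 'w => real) borel (\<lambda>w. g (B v w - B u w))"
proof -
 let ?D = "sigma_sets (space M) {(\<lambda>w. B v w - B u w) -` A \<inter> space M | A. A \<in> sets borel}"
 have i: "indep_set (generated_events M {v..T} (\<lambda>r w. B r w - B v w)) ?D"
  by (rule indep_set_past_increment[OF bmB assms(1-3)])
 have swap: "indep_set (generated_events M {0..T} B) (generated_events M {0..T} W)"
  using indWB unfolding independent_processes_def indep_sets2_eq by (metis Int_commute mult.commute)
 have "indep_set (sigma_sets (space M) (generated_events M {v..T} (\<lambda>r w. B r w - B v w) \<union>
   generated_events M {0..T} (\<lambda>r w. W r w - W 0 w) \<union> null_sets M)) (sigma_sets (space M) ?D)"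
 proof (rule indep_set_join[OF sigma_algebra_generated swap])
  show "generated_events M {v..T} (\<lambda>r w. B r w - B v w) \<subseteq> generated_events M {0..T} B"
   using vimage_increment_subset(2)[of v "{0..T}" v "{v..T}" B] generated_events_mono[of "insert v {v..T}" "{0..T}" B] assms T_pos
   by auto
  show "?D \<subseteq> generated_events M {0..T} B" using assms by (intro vimage_increment_subset) auto
  show "generated_events M {0..T} (\<lambda>r w. W r w - W 0 w) \<subseteq> generated_events M {0..T} W"
   using vimage_increment_subset(2)[of 0 "{0..T}" 0 "{0..T}" W] T_pos by (simp add: insert_absorb)
  show "Int_stable ?D"
   by (rule algebra.Int_stable[OF sigma_algebra.axioms(1)[OF sigma_algebra_sigma_sets]]) auto
 qed (use i in \<open>auto intro: Int_stable_generated_events generated_events_space\<close>)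
 then have "indep_set (sets (\<F> T v)) ?D"
  unfolding sets_info by (subst (asm) sigma_sets_sigma_sets_eq) (auto simp: Un_ac)
 then show ?thesis
  using assms by (intro indep_var_of_indep_set[OF _ refl, where g=g]) (auto intro!: borel_measurable_diff B_measurable)
qed

end

section \<open>Gaussian moments of increments\<close>

lemma sum_power_le:
 fixes a :: "'i => real"
 assumes "finite I" "I \<noteq> {}" "\<And>i. i \<in> I \<Longrightarrow> 0 <= a i"
 shows "(\<Sum>i\<in>I. a i) ^ q <= real (card I) ^ q * (\<Sum>i\<in>I. a i ^ q)"
proof -
 \<comment> \<open>Every summand is compared with the largest one. This loses a factor
   \<open>card I\<close> against Jensen's inequality but avoids convexity; the size of the constants
   does not matter.\<close>
 define m where "m = Max (a ` I)"
 have "m \<in> a ` I" unfolding m_def using assms by (intro Max_in) auto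
 then obtain j where j: "j \<in> I" "a j = m" by auto
 have "(\<Sum>i\<in>I. a i) <= real (card I) * m"
  using sum_bounded_above[of I a m] assms by (auto simp: m_def)
 then have "(\<Sum>i\<in>I. a i) ^ q <= (real (card I) * m) ^ q"
  using assms by (intro power_mono sum_nonneg) auto
 also have "... = real (card I) ^ q * a j ^ q" using j by (simp add: power_mult_distrib)
 also have "a j ^ q <= (\<Sum>i\<in>I. a i ^ q)" using assms j by (intro member_le_sum) auto
 finally show ?thesis by (simp add: mult_left_mono)
qed

lemma norm_power_le_sum_Basis:
 fixes x :: "'e::euclidean_space"
 shows "norm x ^ (2 * q) <= real DIM('e) ^ q * (\<Sum>e\<in>Basis. (x \<bullet> e) ^ (2 * q))"
proof -
 have "norm x ^ (2 * q) = (\<Sum>e\<in>Basis. (x \<bullet> e)^2) ^ q"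
  unfolding power_mult norm_eq_sqrt_inner
  by (simp add: euclidean_inner[of x x] power2_eq_square[symmetric] sum_nonneg)
 also have "... <= real DIM('e) ^ q * (\<Sum>e\<in>Basis. ((x \<bullet> e)^2) ^ q)"
  by (rule sum_power_le) auto
 finally show ?thesis by (simp add: power_mult)
qed

lemma (in prob_space)
 fixes V :: "real => 'a => 'e::euclidean_space"
 assumes bm: "std_brownian_motion M T V" and uv: "0 <= u" "u <= v" "v <= T" and e: "e \<in> Basis"
 shows integrable_increment_power: "integrable M (\<lambda>w. ((V v w - V u w) \<bullet> e) ^ k)"
  and expectation_increment_power_even:
   "(\<E> w. ((V v w - V u w) \<bullet> e) ^ (2 * q)) = fact (2 * q) / (2 ^ q * fact q) * (v - u) ^ q"
  and expectation_increment: "(\<E> w. (V v w - V u w) \<bullet> e) = 0"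
proof -
 have "integrable M (\<lambda>w. ((V v w - V u w) \<bullet> e) ^ k) \<and>
  (\<E> w. ((V v w - V u w) \<bullet> e) ^ (2 * q)) = fact (2 * q) / (2 ^ q * fact q) * (v - u) ^ q \<and>
  (\<E> w. (V v w - V u w) \<bullet> e) = 0"
 \<comment> \<open>The Gaussian law is only prescribed for \<open>u < v\<close>. For
   \<open>u = v\<close> all claims concern the zero variable, with \<open>0 ^ 0 = 1\<close> when
   \<open>q = 0\<close>.\<close>
 proof (cases "u = v")
  case True
  then show ?thesis by (cases q; cases k) (auto simp: prob_space power_0_left)
 next
  case False
  then have d: "v - u > 0" using uv by auto
  let ?f = "normal_density 0 (sqrt (v - u))"
  have "0 <= u \<and> u < v \<and> v <= T" using uv d by auto
  then have D: "distributed M lborel (\<lambda>w. (V v w - V u w) \<bullet> e) (\<lambda>y. ennreal (?f y))"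
   using bm e unfolding std_brownian_motion_def by blast
  have i: "integrable M (\<lambda>w. ((V v w - V u w) \<bullet> e) ^ k)"
   using integrable_normal_moment[of "sqrt (v - u)" 0 k] d
   by (subst distributed_integrable[OF D, symmetric]) auto
  have "(\<E> w. ((V v w - V u w) \<bullet> e) ^ (2 * q)) = (\<integral>y. ?f y * y ^ (2 * q) \<partial>lborel)"
   by (subst distributed_integral[OF D, symmetric]) auto
  also have "... = fact (2 * q) / ((2 / (v - u)) ^ q * fact q)"
   using integral_normal_moment_even[of "sqrt (v - u)" 0 q] d by simp
  also have "... = fact (2 * q) / (2 ^ q * fact q) * (v - u) ^ q"
   using d by (simp add: power_divide field_simps)
  finally have 2: "(\<E> w. ((V v w - V u w) \<bullet> e) ^ (2 * q)) = fact (2 * q) / (2 ^ q * fact q) * (v - u) ^ q" .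
  have "(\<E> w. (V v w - V u w) \<bullet> e) = (\<integral>y. ?f y * y \<partial>lborel)"
   by (subst distributed_integral[OF D, symmetric]) auto
  also have "... = 0" using integral_normal_moment_odd[of "sqrt (v - u)" 0 0] d by simp
  finally show ?thesis using i 2 by blast
 qed
 then show "integrable M (\<lambda>w. ((V v w - V u w) \<bullet> e) ^ k)"
  "(\<E> w. ((V v w - V u w) \<bullet> e) ^ (2 * q)) = fact (2 * q) / (2 ^ q * fact q) * (v - u) ^ q"
  "(\<E> w. (V v w - V u w) \<bullet> e) = 0" by auto
qed

lemma std_brownian_motion_measurable:
 "std_brownian_motion M T V \<Longrightarrow> 0 <= t \<Longrightarrow> t <= T \<Longrightarrow> V t \<in> bm M"
 unfolding std_brownian_motion_def by auto

lemma (in prob_space) covariance_increment: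
 fixes V :: "real => 'a => 'e::euclidean_space"
 assumes bm: "std_brownian_motion M T V" and uv: "0 <= u" "u <= v" "v <= T"
  and e: "e \<in> Basis" "e' \<in> Basis"
 shows "integrable M (\<lambda>w. ((V v w - V u w) \<bullet> e) * ((V v w - V u w) \<bullet> e'))"
  and "(\<E> w. ((V v w - V u w) \<bullet> e) * ((V v w - V u w) \<bullet> e')) = (if e = e' then v - u else 0)"
proof -
 let ?x = "\<lambda>e w. (V v w - V u w) \<bullet> e"
 have *: "integrable M (\<lambda>w. ?x e w * ?x e' w) \<and>
  (\<E> w. ?x e w * ?x e' w) = (if e = e' then v - u else 0)"
 proof (cases "e = e' \<or> u = v")
  case True
  then show ?thesis
   using integrable_increment_power[OF bm uv e(1), of 2] expectation_increment_power_even[OF bm uv e(1), of 1]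
   by (auto simp: power2_eq_square)
 next
  case False
  then have "0 <= u \<and> u < v \<and> v <= T" using uv by auto
  then have "indep_vars (\<lambda>_. borel) ?x Basis"
   using bm unfolding std_brownian_motion_def by blast
  then have "indep_var (PiM {e} (\<lambda>_. borel)) (\<lambda>w. restrict (\<lambda>i. ?x i w) {e}) (PiM {e'} (\<lambda>_. borel)) (\<lambda>w. restrict (\<lambda>i. ?x i w) {e'})"
   by (rule indep_var_restrict) (use e False in auto)
  then have "indep_var borel ((\<lambda>f. f e) \<circ> (\<lambda>w. restrict (\<lambda>i. ?x i w) {e}))
    borel ((\<lambda>f. f e') \<circ> (\<lambda>w. restrict (\<lambda>i. ?x i w) {e'}))"
   by (rule indep_var_compose) (auto intro!: measurable_component_singleton)
  then have "indep_var borel (?x e) borel (?x e')" by (simp add: comp_def)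
  moreover have "integrable M (?x e)" "integrable M (?x e')"
   using integrable_increment_power[OF bm uv e(1), of 1] integrable_increment_power[OF bm uv e(2), of 1] by auto
  ultimately show ?thesis
   using indep_var_lebesgue_integral[of "?x e" "?x e'"] indep_var_integrable[of "?x e" "?x e'"]
    expectation_increment[OF bm uv e(1)] False by auto
 qed
 show "integrable M (\<lambda>w. ?x e w * ?x e' w)" "(\<E> w. ?x e w * ?x e' w) = (if e = e' then v - u else 0)"
  using * by blast+
qed

lemma (in prob_space)
 fixes V :: "real => 'a => 'e::euclidean_space"
 assumes bm: "std_brownian_motion M T V" and uv: "0 <= u" "u <= v" "v <= T"
 shows integrable_norm_increment: "integrable M (\<lambda>w. norm (V v w - V u w) ^ (2 * q))"
  and expectation_norm_increment: "(\<E> w. norm (V v w - V u w) ^ (2 * q))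
   <= real DIM('e) ^ q * (real DIM('e) * (fact (2 * q) / (2 ^ q * fact q))) * (v - u) ^ q"
proof -
 let ?b = "\<lambda>w. real DIM('e) ^ q * (\<Sum>e\<in>Basis. ((V v w - V u w) \<bullet> e) ^ (2 * q))"
 have m: "V u \<in> bm M" "V v \<in> bm M"
  using bm uv by (auto intro!: std_brownian_motion_measurable)
 have i: "integrable M ?b"
  by (intro integrable_mult_right Bochner_Integration.integrable_sum integrable_increment_power[OF bm uv]) auto
 show 1: "integrable M (\<lambda>w. norm (V v w - V u w) ^ (2 * q))"
  by (rule Bochner_Integration.integrable_bound[OF i])
   (use m in \<open>auto intro!: norm_power_le_sum_Basis order_trans[OF norm_power_le_sum_Basis]\<close>)
 have "(\<E> w. norm (V v w - V u w) ^ (2 * q)) <= (\<E> w. ?b w)"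
  by (intro integral_mono 1 i norm_power_le_sum_Basis)
 also have "... = real DIM('e) ^ q * (\<Sum>e::'e\<in>Basis. fact (2 * q) / (2 ^ q * fact q) * (v - u) ^ q)"
  by (subst integral_mult_right_zero, subst Bochner_Integration.integral_sum)
   (auto simp: integrable_increment_power[OF bm uv] expectation_increment_power_even[OF bm uv])
 finally show "(\<E> w. norm (V v w - V u w) ^ (2 * q))
   <= real DIM('e) ^ q * (real DIM('e) * (fact (2 * q) / (2 ^ q * fact q))) * (v - u) ^ q"
  by (simp add: mult_ac)
qed

section \<open>Ito integrals as limits of block integrals\<close>

text \<open>A block \<open>(u, v, \<xi>)\<close> stands for the integrand \<open>1\<^bsub>(u, v]\<^esub> \<xi>\<close>. Blocks may overlap, which makes
 sums of integrands trivial.\<close>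

definition block_process :: "(real \<times> real \<times> ('w => 'e::euclidean_space)) list => real \<times> 'w => 'e" where
 "block_process bs p = (\<Sum>(u, v, \<xi>)\<leftarrow>bs. indicator {u<..v} (fst p) *\<^sub>R \<xi> (snd p))"

definition block_integral ::
 "(real => 'w => 'e::euclidean_space) => (real \<times> real \<times> ('w => 'e)) list => 'w => real" where
 "block_integral V bs w = (\<Sum>(u, v, \<xi>)\<leftarrow>bs. \<xi> w \<bullet> (V v w - V u w))"

lemma integrable_times_square_integrable:
 fixes f g :: "'a => real"
 assumes [measurable]: "f \<in> bm M" "g \<in> bm M"
  and "integrable M (\<lambda>x. (f x)^2)" "integrable M (\<lambda>x. (g x)^2)"
 shows "integrable M (\<lambda>x. f x * g x)"
proof (rule Bochner_Integration.integrable_bound)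
 show "integrable M (\<lambda>x. (f x)^2 + (g x)^2)" using assms by simp
 have "\<bar>a * b\<bar> <= a^2 + b^2" for a b :: real
  using sum_squares_bound[of "\<bar>a\<bar>" "\<bar>b\<bar>"] mult_nonneg_nonneg[of "\<bar>a\<bar>" "\<bar>b\<bar>"]
  by (simp add: abs_mult del: mult_nonneg_nonneg)
 then show "AE x in M. norm (f x * g x) <= norm ((f x)^2 + (g x)^2)" by auto
qed measurable

lemma integrable_bounded_times:
 fixes f g :: "'a => real"
 assumes [measurable]: "f \<in> bm M" "integrable M g"
  and "\<And>x. x \<in> space M \<Longrightarrow> \<bar>f x\<bar> <= R"
 shows "integrable M (\<lambda>x. f x * g x)"
proof (rule Bochner_Integration.integrable_bound)
 show "integrable M (\<lambda>x. R * \<bar>g x\<bar>)" using assms by simp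
 show "AE x in M. norm (f x * g x) <= norm (R * \<bar>g x\<bar>)"
 proof (rule AE_I2)
  fix x assume "x \<in> space M"
  then show "norm (f x * g x) <= norm (R * \<bar>g x\<bar>)"
   using mult_right_mono[OF order_trans[OF assms(3) abs_ge_self], of x "\<bar>g x\<bar>"] by (simp add: abs_mult)
 qed
qed measurable

text \<open>Forward and backward integrals obey the same L^2 theory. \<open>G u v\<close> is what
  the coefficient of a block on \<open>(u, v]\<close> may depend on. The arrow of time appears only
  in the disjunction \<open>order\<close>: either earlier increments are known later, or later
  increments are known earlier.\<close>

locale ito_direction = prob_space M for M :: "'w measure" +
 fixes T :: real and G :: "real => real => 'w measure" and V :: "real => 'w => 'e::euclidean_space"
 assumes bm: "std_brownian_motion M T V"
  and G_space: "\<And>u v. space (G u v) = space M"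
  and G_sets: "\<And>u v. 0 <= u \<Longrightarrow> u <= v \<Longrightarrow> v <= T \<Longrightarrow> sets (G u v) \<subseteq> events"
  and G_mono: "\<And>u u' v v'. 0 <= u \<Longrightarrow> u <= u' \<Longrightarrow> u' <= v' \<Longrightarrow> v' <= v \<Longrightarrow> v <= T \<Longrightarrow> sets (G u v) \<subseteq> sets (G u' v')"
  and indep: "\<And>u v f g. 0 <= u \<Longrightarrow> u <= v \<Longrightarrow> v <= T \<Longrightarrow> f \<in> bm (G u v) \<Longrightarrow>
   g \<in> bm borel \<Longrightarrow>
   indep_var borel (f :: 'w => real) borel (\<lambda>w. g (V v w - V u w))"
  and order: "(\<forall>u v u' v'. 0 <= u \<longrightarrow> u <= v \<longrightarrow> v <= u' \<longrightarrow> u' <= v' \<longrightarrow> v' <= T \<longrightarrow>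
    sets (G u v) \<subseteq> sets (G u' v') \<and> (\<lambda>w. V v w - V u w) \<in> bm (G u' v')) \<or>
   (\<forall>u v u' v'. 0 <= u \<longrightarrow> u <= v \<longrightarrow> v <= u' \<longrightarrow> u' <= v' \<longrightarrow> v' <= T \<longrightarrow>
    sets (G u' v') \<subseteq> sets (G u v) \<and> (\<lambda>w. V v' w - V u' w) \<in> bm (G u v))"
begin

lemma measurable_G_mono:
 assumes "f \<in> measurable (G u v) N" "sets (G u v) \<subseteq> sets (G u' v')"
 shows "f \<in> measurable (G u' v') N" using assms unfolding measurable_def G_space by blast

lemma measurable_G_events:
 assumes "f \<in> measurable (G u v) N" "0 <= u" "u <= v" "v <= T"
 shows "f \<in> measurable M N"
 using assms(1) G_sets[OF assms(2-4)] unfolding measurable_def G_space by blast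

lemma V_measurable: "0 <= t \<Longrightarrow> t <= T \<Longrightarrow> V t \<in> bm M"
 using bm by (rule std_brownian_motion_measurable)

definition valid :: "real => real => real \<times> real \<times> ('w => 'e) => bool" where
 "valid s t b \<longleftrightarrow> (case b of (u, v, \<xi>) => s <= u \<and> u <= v \<and> v <= t \<and>
   \<xi> \<in> bm (G u v) \<and> bounded (\<xi> ` space M))"

text \<open>Measurability for every block inside \<open>[s, t]\<close> lets \<open>d\<close> be
  multiplied into any coefficient. In the forward direction this amounts to being known at
  \<open>s\<close>, in the backward direction to being known at \<open>t\<close>.\<close>

definition weight :: "real => real => ('w => real) => bool" where
 "weight s t d \<longleftrightarrow> (\<forall>u v. s <= u \<longrightarrow> u <= v \<longrightarrow> v <= t \<longrightarrow> d \<in> bm (G u v))"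

lemma indep_increment:
 assumes "0 <= u" "u <= v" "v <= T" "f \<in> bm (G u v)" "integrable M (f :: 'w => real)"
  and "g \<in> bm borel" "integrable M (\<lambda>w. g (V v w - V u w))"
 shows "integrable M (\<lambda>w. f w * g (V v w - V u w))"
  and "(\<E> w. f w * g (V v w - V u w)) = (\<E> w. f w) * (\<E> w. g (V v w - V u w))"
proof -
 note indep[OF assms(1-4,6)]
 with assms show "integrable M (\<lambda>w. f w * g (V v w - V u w))"
  "(\<E> w. f w * g (V v w - V u w)) = (\<E> w. f w) * (\<E> w. g (V v w - V u w))"
  by (auto intro: indep_var_integrable indep_var_lebesgue_integral)
qed

lemma integrable_component_increment:
 assumes "0 <= u" "u <= v" "v <= T" "e \<in> Basis"
 shows "integrable M (\<lambda>w. (V v w - V u w) \<bullet> e)"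
 using integrable_increment_power[OF bm assms, of 1] by simp

lemma
 assumes "0 <= u" "u <= v" "v <= T" "\<xi> \<in> bm (G u v)" "bounded (\<xi> ` space M)"
 shows block_square_integrable: "integrable M (\<lambda>w. (\<xi> w \<bullet> (V v w - V u w))^2)"
  and block_integrable: "integrable M (\<lambda>w. \<xi> w \<bullet> (V v w - V u w))"
  and block_measurable: "(\<lambda>w. \<xi> w \<bullet> (V v w - V u w)) \<in> bm M"
proof -
 obtain R where R: "\<And>w. w \<in> space M \<Longrightarrow> norm (\<xi> w) <= R"
  using assms(5) unfolding bounded_iff by auto
 have [measurable]: "\<xi> \<in> bm M" using measurable_G_events assms by blast
 have [measurable]: "V u \<in> bm M" "V v \<in> bm M" using assms V_measurable by auto
 show m [measurable]: "(\<lambda>w. \<xi> w \<bullet> (V v w - V u w)) \<in> bm M" by measurable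
 have i: "integrable M (\<lambda>w. R^2 * norm (V v w - V u w) ^ (2 * 1))"
  by (intro integrable_mult_right integrable_norm_increment[OF bm assms(1-3)])
 show "integrable M (\<lambda>w. (\<xi> w \<bullet> (V v w - V u w))^2)"
 proof (rule Bochner_Integration.integrable_bound[OF i])
  show "AE w in M. norm ((\<xi> w \<bullet> (V v w - V u w))^2) <= norm (R^2 * norm (V v w - V u w) ^ (2 * 1))"
  proof (rule AE_I2)
   fix w assume "w \<in> space M"
   have "\<bar>\<xi> w \<bullet> (V v w - V u w)\<bar> <= R * norm (V v w - V u w)"
    using order_trans[OF Cauchy_Schwarz_ineq2 mult_right_mono[OF R[OF \<open>w \<in> space M\<close>] norm_ge_zero]] .
   then show "norm ((\<xi> w \<bullet> (V v w - V u w))^2) <= norm (R^2 * norm (V v w - V u w) ^ (2 * 1))"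
    using power_mono[of "\<bar>\<xi> w \<bullet> (V v w - V u w)\<bar>" "R * norm (V v w - V u w)" 2]
    by (simp add: power_mult_distrib)
  qed
 qed measurable
 then show "integrable M (\<lambda>w. \<xi> w \<bullet> (V v w - V u w))"
  by (rule square_integrable_imp_integrable[OF m])
qed

text \<open>Integrable components instead of a bounded coefficient: in
  \<open>block_orthogonal\<close> the coefficient contains a Gaussian increment.\<close>

lemma block_mean:
 assumes "0 <= u" "u <= v" "v <= T" "\<xi> \<in> bm (G u v)"
  and "\<And>e. e \<in> Basis \<Longrightarrow> integrable M (\<lambda>w. \<xi> w \<bullet> e)"
 shows "(\<E> w. \<xi> w \<bullet> (V v w - V u w)) = 0"
proof -
 have *: "integrable M (\<lambda>w. (\<xi> w \<bullet> e) * ((V v w - V u w) \<bullet> e)) \<and>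
   (\<E> w. (\<xi> w \<bullet> e) * ((V v w - V u w) \<bullet> e)) = 0" if e: "e \<in> Basis" for e
  using indep_increment[OF assms(1-3), of "\<lambda>w. \<xi> w \<bullet> e" "\<lambda>x. x \<bullet> e"] assms(4) assms(5)[OF e]
   integrable_component_increment[OF assms(1-3) e] expectation_increment[OF bm assms(1-3) e] by auto
 have "(\<E> w. \<xi> w \<bullet> (V v w - V u w)) = (\<E> w. (\<Sum>e\<in>Basis. (\<xi> w \<bullet> e) * ((V v w - V u w) \<bullet> e)))"
  by (intro Bochner_Integration.integral_cong refl euclidean_inner)
 then show ?thesis using * by (subst (asm) Bochner_Integration.integral_sum) auto
qed

text \<open>The coefficients are independent of the increment, so every product of components splits
  under the expectation; off the diagonal the covariance of the components vanishes.\<close>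

lemma block_isometry:
 assumes uv: "0 <= u" "u <= v" "v <= T"
  and m: "\<xi> \<in> bm (G u v)" "h \<in> bm (G u v)" "d \<in> bm (G u v)"
  and b: "bounded (\<xi> ` space M)" "bounded (h ` space M)" "bounded (d ` space M)"
 shows "(\<E> w. d w * (\<xi> w \<bullet> (V v w - V u w)) * (h w \<bullet> (V v w - V u w))) =
  (v - u) * (\<E> w. d w * (\<xi> w \<bullet> h w))"
proof -
 let ?D = "\<lambda>w. V v w - V u w"
 have [measurable]: "\<xi> \<in> bm M" "h \<in> bm M" "d \<in> bm M"
  using measurable_G_events m uv by blast+
 obtain R1 where R1: "\<And>w. w \<in> space M \<Longrightarrow> norm (\<xi> w) <= R1" using b(1) unfolding bounded_iff by auto
 obtain R2 where R2: "\<And>w. w \<in> space M \<Longrightarrow> norm (h w) <= R2" using b(2) unfolding bounded_iff by auto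
 obtain R3 where R3: "\<And>w. w \<in> space M \<Longrightarrow> norm (d w) <= R3" using b(3) unfolding bounded_iff by auto
 note R = R1 R2 R3
 let ?k = "\<lambda>e e' w. d w * (\<xi> w \<bullet> e) * (h w \<bullet> e')"
 have k: "integrable M (?k e e')" if "e \<in> Basis" "e' \<in> Basis" for e e'
 proof (rule integrable_const_bound[of _ "R3 * R1 * R2"])
  show "AE w in M. norm (?k e e' w) <= R3 * R1 * R2"
  proof (rule AE_I2)
   fix w assume w: "w \<in> space M"
   have "\<bar>\<xi> w \<bullet> e\<bar> <= R1" "\<bar>h w \<bullet> e'\<bar> <= R2"
    using R[OF w] Basis_le_norm[of e "\<xi> w"] Basis_le_norm[of e' "h w"] that by auto
   then show "norm (?k e e' w) <= R3 * R1 * R2"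
    using R(3)[OF w] by (auto simp: abs_mult intro!: mult_mono mult_nonneg_nonneg)
  qed
 qed measurable
 have *: "integrable M (\<lambda>w. ?k e e' w * ((?D w \<bullet> e) * (?D w \<bullet> e'))) \<and>
  (\<E> w. ?k e e' w * ((?D w \<bullet> e) * (?D w \<bullet> e'))) = (\<E> w. ?k e e' w) * (if e = e' then v - u else 0)"
  if "e \<in> Basis" "e' \<in> Basis" for e e'
  using indep_increment[OF uv, of "?k e e'" "\<lambda>x. (x \<bullet> e) * (x \<bullet> e')"] m k[OF that]
   covariance_increment[OF bm uv that] by auto
 have "(\<E> w. d w * (\<xi> w \<bullet> ?D w) * (h w \<bullet> ?D w)) =
   (\<E> w. (\<Sum>e\<in>Basis. \<Sum>e'\<in>Basis. ?k e e' w * ((?D w \<bullet> e) * (?D w \<bullet> e'))))"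
 proof (intro Bochner_Integration.integral_cong refl)
  fix w
  have "d w * (\<xi> w \<bullet> ?D w) * (h w \<bullet> ?D w) = d w * ((\<Sum>e\<in>Basis. (\<xi> w \<bullet> e) * (?D w \<bullet> e)) *
    (\<Sum>e\<in>Basis. (h w \<bullet> e) * (?D w \<bullet> e)))"
   using euclidean_inner[of "\<xi> w" "?D w"] euclidean_inner[of "h w" "?D w"] by simp
  then show "d w * (\<xi> w \<bullet> ?D w) * (h w \<bullet> ?D w) =
    (\<Sum>e\<in>Basis. \<Sum>e'\<in>Basis. ?k e e' w * ((?D w \<bullet> e) * (?D w \<bullet> e')))"
   unfolding sum_product unfolding sum_distrib_left by (simp only: mult_ac)
 qed
 also have "... = (\<Sum>e\<in>Basis. \<Sum>e'\<in>Basis. (\<E> w. ?k e e' w) * (if e = e' then v - u else 0))"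
  using * by (subst Bochner_Integration.integral_sum)
   (auto intro!: sum.cong Bochner_Integration.integrable_sum simp: Bochner_Integration.integral_sum)
 also have "... = (\<Sum>e\<in>Basis. (\<E> w. ?k e e w) * (v - u))"
  by (intro sum.cong refl) (subst sum.remove, auto intro!: sum.neutral split: if_splits)
 also have "... = (v - u) * (\<E> w. d w * (\<xi> w \<bullet> h w))"
 proof -
  have "(\<E> w. d w * (\<xi> w \<bullet> h w)) = (\<E> w. (\<Sum>e\<in>Basis. ?k e e w))"
  proof (intro Bochner_Integration.integral_cong refl)
   fix w show "d w * (\<xi> w \<bullet> h w) = (\<Sum>e\<in>Basis. ?k e e w)"
    by (subst euclidean_inner) (simp add: sum_distrib_left mult_ac)
  qed
  also have "... = (\<Sum>e\<in>Basis. (\<E> w. ?k e e w))"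
   using k by (subst Bochner_Integration.integral_sum) auto
  finally show ?thesis by (simp add: sum_distrib_left mult_ac)
 qed
 finally show ?thesis .
qed

end

section \<open>Joint measurability and convergence in L^2 under bounded weights\<close>

lemma measurable_restrict_indicator:
 fixes f :: "real \<times> 'w => 'b::{real_normed_vector, second_countable_topology}"
 assumes f: "f \<in> bm (restrict_space borel A \<Otimes>\<^sub>M M)" and A: "A \<in> sets borel"
 shows "(\<lambda>p. indicator A (fst p) *\<^sub>R f p) \<in> bm (lborel \<Otimes>\<^sub>M M)"
proof (cases "A = {}")
 case False
 then obtain a where a: "a \<in> A" by blast
 \<comment> \<open>A retraction of the line onto \<open>A\<close>: composing with it extends
   \<open>f\<close> measurably, and the indicator removes the values created outside
   \<open>A\<close>.\<close>
 have 1: "(\<lambda>r. if r \<in> A then r else a) \<in> measurable borel (restrict_space borel A)"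
  using a A by (intro measurable_restrict_space2 measurable_If_set) auto
 have "(\<lambda>p. f ((if fst p \<in> A then fst p else a), snd p)) \<in> bm (borel \<Otimes>\<^sub>M M)"
  by (rule measurable_compose[OF measurable_Pair[OF measurable_compose[OF measurable_fst 1] measurable_snd] f])
 moreover have "(\<lambda>p. indicator A (fst p) :: real) \<in> bm (borel \<Otimes>\<^sub>M M)"
  using A by measurable
 ultimately have "(\<lambda>p. indicator A (fst p) *\<^sub>R f ((if fst p \<in> A then fst p else a), snd p)) \<in> bm (borel \<Otimes>\<^sub>M M)"
  by (intro borel_measurable_scaleR) simp_all
 also have "(\<lambda>p. indicator A (fst p) *\<^sub>R f ((if fst p \<in> A then fst p else a), snd p)) = (\<lambda>p. indicator A (fst p) *\<^sub>R f p)"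
  by (auto simp: fun_eq_iff indicator_def)
 finally show ?thesis by (simp cong: measurable_cong_sets)
qed simp

lemma square_add_le: "(a + b)^2 <= 2 * a^2 + 2 * (b::real)^2"
 using sum_squares_bound[of a b] by (simp add: power2_sum)

lemma norm_square_add_le: "(norm (a + b))^2 <= 2 * (norm a)^2 + 2 * (norm (b::'b::real_normed_vector))^2"
 using order_trans[OF power_mono[OF norm_triangle_ineq[of a b]] square_add_le[of "norm a" "norm b"]] by simp

lemma norm_square_diff_le: "(norm (a - b))^2 <= 2 * (norm a)^2 + 2 * (norm (b::'b::real_normed_vector))^2"
 using norm_square_add_le[of a "-b"] by simp

text \<open>Made for limits: the first coefficient may explode as \<open>eps\<close> shrinks,
  because it multiplies a quantity tending to 0, while the second term becomes small
  uniformly.\<close>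

lemma abs_norm_square_diff_le:
 fixes a b :: "'b::real_normed_vector"
 assumes "eps > 0"
 shows "\<bar>(norm a)^2 - (norm b)^2\<bar> <= (1 + 1 / eps) * (norm (a - b))^2 + eps * (norm b)^2"
proof -
 let ?x = "norm (a - b)"
 have "\<bar>norm a - norm b\<bar> <= ?x" by (rule norm_triangle_ineq3)
 have "\<bar>(norm a)^2 - (norm b)^2\<bar> = \<bar>norm a - norm b\<bar> * (norm a + norm b)"
  by (simp add: power2_eq_square square_diff_square_factored abs_mult mult.commute)
 also have "... <= ?x * (?x + 2 * norm b)"
  using norm_triangle_ineq2[of a b] by (intro mult_mono norm_triangle_ineq3) auto
 also have "... = ?x^2 + 2 * (?x / sqrt eps) * (sqrt eps * norm b)"
  using assms by (simp add: power2_eq_square algebra_simps)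
 also have "... <= ?x^2 + ((?x / sqrt eps)^2 + (sqrt eps * norm b)^2)"
  using sum_squares_bound[of "?x / sqrt eps" "sqrt eps * norm b"] by simp
 also have "... = (1 + 1 / eps) * ?x^2 + eps * (norm b)^2"
  using assms by (simp add: power_divide power_mult_distrib algebra_simps)
 finally show ?thesis .
qed

lemma square_integrable_iff:
 fixes f :: "'a => 'b::{banach, second_countable_topology}"
 assumes "f \<in> bm N"
 shows "integrable N (\<lambda>x. (norm (f x))^2) \<longleftrightarrow> (\<integral>\<^sup>+x. ennreal ((norm (f x))^2) \<partial>N) < \<infinity>"
 using assms by (auto simp: integrable_iff_bounded)

lemma square_integrable_add:
 fixes f g :: "'a => 'b::{banach, second_countable_topology}"
 assumes [measurable]: "f \<in> bm N" "g \<in> bm N"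
  and "integrable N (\<lambda>x. (norm (f x))^2)" "integrable N (\<lambda>x. (norm (g x))^2)"
 shows "integrable N (\<lambda>x. (norm (f x + g x))^2)"
proof (rule Bochner_Integration.integrable_bound)
 show "integrable N (\<lambda>x. 2 * (norm (f x))^2 + 2 * (norm (g x))^2)" using assms by simp
qed (auto intro!: norm_square_add_le)

lemma square_integrable_diff:
 fixes f g :: "'a => 'b::{banach, second_countable_topology}"
 assumes "f \<in> bm N" "g \<in> bm N"
  and "integrable N (\<lambda>x. (norm (f x))^2)" "integrable N (\<lambda>x. (norm (g x))^2)"
 shows "integrable N (\<lambda>x. (norm (f x - g x))^2)"
 using square_integrable_add[of f N "\<lambda>x. - g x"] assms by simp

text \<open>Finiteness of the norms is deliberately not part of it.\<close>

definition conv2 :: "'a measure => (nat => 'a => 'b::real_normed_vector) => ('a => 'b) => bool" where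
 "conv2 N f g \<longleftrightarrow> (\<lambda>m. \<integral>\<^sup>+x. ennreal ((norm (g x - f m x))^2) \<partial>N) \<longlonglongrightarrow> 0"

text \<open>Eventually the distance is below 1, so \<open>g\<close> differs from some
  \<open>f m\<close> by a square integrable function, and finiteness passes to the limit.\<close>

lemma conv2_square_integrable:
 fixes g :: "'a => 'b::{banach, second_countable_topology}"
 assumes c: "conv2 N f g" and [measurable]: "g \<in> bm N" "\<And>m. f m \<in> bm N"
  and i: "\<And>m. integrable N (\<lambda>x. (norm (f m x))^2)"
 shows "integrable N (\<lambda>x. (norm (g x))^2)"
proof -
 have "\<forall>\<^sub>F m in sequentially. (\<integral>\<^sup>+x. ennreal ((norm (g x - f m x))^2) \<partial>N) < 1"
  using c unfolding conv2_def by (rule order_tendstoD) simp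
 then obtain m where "(\<integral>\<^sup>+x. ennreal ((norm (g x - f m x))^2) \<partial>N) < 1"
  by (auto simp: eventually_sequentially)
 then have "(\<integral>\<^sup>+x. ennreal ((norm (g x - f m x))^2) \<partial>N) < \<infinity>"
  by (rule less_trans) simp
 then have "integrable N (\<lambda>x. (norm (g x - f m x))^2)"
  by (subst square_integrable_iff) auto
 from square_integrable_add[OF _ _ this i[of m]] show ?thesis by simp
qed

lemma conv2_integral_tendsto:
 fixes g :: "'a => 'b::{banach, second_countable_topology}"
 assumes c: "conv2 N f g" and [measurable]: "g \<in> bm N" "\<And>m. f m \<in> bm N"
  and i: "\<And>m. integrable N (\<lambda>x. (norm (f m x))^2)"
 shows "(\<lambda>m. \<integral>x. (norm (g x - f m x))^2 \<partial>N) \<longlonglongrightarrow> 0"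
proof -
 have d: "integrable N (\<lambda>x. (norm (g x - f m x))^2)" for m
  using conv2_square_integrable[OF assms] i by (intro square_integrable_diff) auto
 have "(\<integral>\<^sup>+x. ennreal ((norm (g x - f m x))^2) \<partial>N) = ennreal (\<integral>x. (norm (g x - f m x))^2 \<partial>N)" for m
  by (rule nn_integral_eq_integral[OF d]) auto
 then show ?thesis using c unfolding conv2_def by (simp add: tendsto_ennreal_iff[of _ _ 0, simplified])
qed

lemma conv2_weighted_tendsto:
 fixes g :: "'a => 'b::{banach, second_countable_topology}"
 assumes c: "conv2 N f g" and [measurable]: "g \<in> bm N" "\<And>m. f m \<in> bm N"
  and i: "\<And>m. integrable N (\<lambda>x. (norm (f m x))^2)"
  and [measurable]: "w \<in> bm N" and w: "\<And>x. x \<in> space N \<Longrightarrow> \<bar>w x\<bar> <= R"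
 shows "(\<lambda>m. \<integral>x. w x * (norm (f m x))^2 \<partial>N) \<longlonglongrightarrow> (\<integral>x. w x * (norm (g x))^2 \<partial>N)"
proof (cases "space N = {}")
 case True
 then show ?thesis by (simp add: Bochner_Integration.integral_empty)
next
 case False
 then have R: "R \<ge> 0" using w by (meson abs_ge_zero ex_in_conv order_trans)
 note g = conv2_square_integrable[OF assms(1-4)]
 note lim = conv2_integral_tendsto[OF assms(1-4)]
 let ?d = "\<lambda>m. \<integral>x. (norm (g x - f m x))^2 \<partial>N" and ?G = "\<integral>x. (norm (g x))^2 \<partial>N"
 have G: "?G \<ge> 0" by simp
 have d: "integrable N (\<lambda>x. (norm (g x - f m x))^2)" for m
  using g i by (intro square_integrable_diff) auto
 have est: "\<bar>(\<integral>x. w x * (norm (f m x))^2 \<partial>N) - (\<integral>x. w x * (norm (g x))^2 \<partial>N)\<bar>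
   <= R * ((1 + 1 / eps) * ?d m + eps * ?G)" if e: "eps > 0" for m eps
 proof -
  have wi: "integrable N (\<lambda>x. w x * (norm (f m x))^2)" "integrable N (\<lambda>x. w x * (norm (g x))^2)"
   using w i g by (auto intro!: integrable_bounded_times)
  have "(\<integral>x. w x * (norm (f m x))^2 \<partial>N) - (\<integral>x. w x * (norm (g x))^2 \<partial>N)
    = (\<integral>x. w x * ((norm (f m x))^2 - (norm (g x))^2) \<partial>N)"
   using wi by (simp add: right_diff_distrib)
  also have "\<bar>...\<bar> <= (\<integral>x. \<bar>w x * ((norm (f m x))^2 - (norm (g x))^2)\<bar> \<partial>N)"
   by (rule integral_abs_bound)
  also have "... <= (\<integral>x. R * ((1 + 1 / eps) * (norm (g x - f m x))^2 + eps * (norm (g x))^2) \<partial>N)"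
  proof (rule integral_mono_AE)
   show "integrable N (\<lambda>x. \<bar>w x * ((norm (f m x))^2 - (norm (g x))^2)\<bar>)"
    using wi by (simp add: right_diff_distrib)
   show "integrable N (\<lambda>x. R * ((1 + 1 / eps) * (norm (g x - f m x))^2 + eps * (norm (g x))^2))"
    using d g by simp
   show "AE x in N. \<bar>w x * ((norm (f m x))^2 - (norm (g x))^2)\<bar>
     <= R * ((1 + 1 / eps) * (norm (g x - f m x))^2 + eps * (norm (g x))^2)"
   proof (rule AE_I2)
    fix x assume "x \<in> space N"
    then show "\<bar>w x * ((norm (f m x))^2 - (norm (g x))^2)\<bar>
     <= R * ((1 + 1 / eps) * (norm (g x - f m x))^2 + eps * (norm (g x))^2)"
     unfolding abs_mult using abs_norm_square_diff_le[OF e, of "f m x" "g x"] w R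
     by (intro mult_mono) (auto simp: norm_minus_commute)
   qed
  qed
  also have "... = R * ((1 + 1 / eps) * ?d m + eps * ?G)" using d g by simp
  finally show ?thesis .
 qed
 show ?thesis
 proof (rule LIMSEQ_I)
  fix r :: real assume r: "r > 0"
  \<comment> \<open>Gives each of the two error terms half of \<open>r\<close>; the summand 1 keeps
    the denominator positive when \<open>R * ?G = 0\<close>.\<close>
  define eps where "eps = r / (2 * (R * ?G + 1))"
  have RG: "R * ?G + 1 > 0" using R G by (simp add: add_nonneg_pos)
  then have e: "eps > 0" using r by (simp add: eps_def)
  have "R * (eps * ?G) = r / 2 * (R * ?G / (R * ?G + 1))" using RG by (simp add: eps_def field_simps)
  also have "... <= r / 2 * 1" using r RG R G by (intro mult_left_mono) (auto simp: field_simps)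
  finally have 1: "R * (eps * ?G) <= r / 2" by simp
  have "(\<lambda>m. R * ((1 + 1 / eps) * ?d m)) \<longlonglongrightarrow> R * ((1 + 1 / eps) * 0)"
   by (intro tendsto_mult tendsto_const lim)
  then have "\<forall>\<^sub>F m in sequentially. R * ((1 + 1 / eps) * ?d m) < r / 2"
   using r by (intro order_tendstoD(2)[of _ 0]) auto
  then obtain m0 where m0: "\<And>m. m \<ge> m0 \<Longrightarrow> R * ((1 + 1 / eps) * ?d m) < r / 2"
   by (auto simp: eventually_sequentially)
  show "\<exists>no. \<forall>m\<ge>no. norm ((\<integral>x. w x * (norm (f m x))^2 \<partial>N) - (\<integral>x. w x * (norm (g x))^2 \<partial>N)) < r"
  proof (intro exI[of _ m0] allI impI)
   fix m assume "m \<ge> m0"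
   from est[OF e, of m, unfolded distrib_left] m0[OF this] 1
   show "norm ((\<integral>x. w x * (norm (f m x))^2 \<partial>N) - (\<integral>x. w x * (norm (g x))^2 \<partial>N)) < r"
    unfolding real_norm_def by linarith
  qed
 qed
qed

lemma conv2_diff:
 fixes g :: "'a => 'b::{banach, second_countable_topology}"
 assumes c: "conv2 N f g" "conv2 N f' g'"
  and [measurable]: "g \<in> bm N" "\<And>m. f m \<in> bm N"
   "g' \<in> bm N" "\<And>m. f' m \<in> bm N"
 shows "conv2 N (\<lambda>m x. f m x - f' m x) (\<lambda>x. g x - g' x)" unfolding conv2_def
proof (rule tendsto_sandwich[OF always_eventually always_eventually tendsto_const])
 let ?a = "\<lambda>m. \<integral>\<^sup>+x. ennreal ((norm (g x - f m x))^2) \<partial>N" and ?b = "\<lambda>m. \<integral>\<^sup>+x. ennreal ((norm (g' x - f' m x))^2) \<partial>N"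
 show "(\<lambda>m. 2 * ?a m + 2 * ?b m) \<longlonglongrightarrow> 0"
  using tendsto_add[OF ennreal_tendsto_cmult[OF _ c(1)[unfolded conv2_def], of 2] ennreal_tendsto_cmult[OF _ c(2)[unfolded conv2_def], of 2]]
  by simp
 show "\<forall>m. (\<integral>\<^sup>+x. ennreal ((norm (g x - g' x - (f m x - f' m x)))^2) \<partial>N) <= 2 * ?a m + 2 * ?b m"
 proof
  fix m
  have "(\<integral>\<^sup>+x. ennreal ((norm (g x - g' x - (f m x - f' m x)))^2) \<partial>N)
   <= (\<integral>\<^sup>+x. 2 * ennreal ((norm (g x - f m x))^2) + 2 * ennreal ((norm (g' x - f' m x))^2) \<partial>N)"
  proof (rule nn_integral_mono)
   fix x
   have "(norm (g x - g' x - (f m x - f' m x)))^2 <= 2 * (norm (g x - f m x))^2 + 2 * (norm (g' x - f' m x))^2"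
    using norm_square_diff_le[of "g x - f m x" "g' x - f' m x"] by (simp add: algebra_simps)
   then have "ennreal ((norm (g x - g' x - (f m x - f' m x)))^2) <= ennreal (2 * (norm (g x - f m x))^2 + 2 * (norm (g' x - f' m x))^2)"
    by (rule ennreal_leI)
   then show "ennreal ((norm (g x - g' x - (f m x - f' m x)))^2) <= 2 * ennreal ((norm (g x - f m x))^2) + 2 * ennreal ((norm (g' x - f' m x))^2)"
    by (simp add: ennreal_plus ennreal_mult)
  qed
  also have "... = 2 * ?a m + 2 * ?b m" by (simp add: nn_integral_add nn_integral_cmult)
  finally show "(\<integral>\<^sup>+x. ennreal ((norm (g x - g' x - (f m x - f' m x)))^2) \<partial>N) <= 2 * ?a m + 2 * ?b m" .
 qed
qed simp

section \<open>Orthogonality of blocks and the weighted isometry\<close>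

context ito_direction
begin

abbreviation PM :: "(real \<times> 'w) measure" where "PM \<equiv> lborel \<Otimes>\<^sub>M M"

sublocale pair: pair_sigma_finite lborel M ..

text \<open>Of two consecutive blocks, the one that comes last in the direction of \<open>G\<close>
  has a centred increment independent of everything else in the product. The other increment is
  absorbed into its coefficient.\<close>

lemma block_orthogonal:
 assumes b: "valid s t (u, v, \<xi>)" "valid s t (u', v', h)" and uv: "0 <= s" "t <= T" "v <= u'"
  and w: "weight s t d" "bounded (d ` space M)"
 shows "(\<E> w. d w * (\<xi> w \<bullet> (V v w - V u w)) * (h w \<bullet> (V v' w - V u' w))) = 0"
proof -
 let ?D = "\<lambda>w. V v w - V u w" and ?D' = "\<lambda>w. V v' w - V u' w"
 have 1: "0 <= u" "u <= v" "v <= T" "\<xi> \<in> bm (G u v)" "bounded (\<xi> ` space M)"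
  and 2: "0 <= u'" "u' <= v'" "v' <= T" "h \<in> bm (G u' v')" "bounded (h ` space M)"
  and r: "d \<in> bm (G u v)" "d \<in> bm (G u' v')"
  using b uv w by (auto simp: valid_def weight_def)
 obtain R1 where R1: "\<And>w. w \<in> space M \<Longrightarrow> norm (\<xi> w) <= R1" using 1 unfolding bounded_iff by auto
 obtain R2 where R2: "\<And>w. w \<in> space M \<Longrightarrow> norm (h w) <= R2" using 2 unfolding bounded_iff by auto
 obtain R3 where R3: "\<And>w. w \<in> space M \<Longrightarrow> norm (d w) <= R3" using w unfolding bounded_iff by auto
 have [measurable]: "\<xi> \<in> bm M" "h \<in> bm M" "d \<in> bm M"
  using measurable_G_events 1 2 r by blast+
 have bb: "\<bar>d w * (\<zeta> \<bullet> e)\<bar> <= R3 * R" if "w \<in> space M" "norm \<zeta> <= R" "e \<in> Basis" for w \<zeta> e R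
  using R3[OF that(1)] Basis_le_norm[OF that(3), of \<zeta>] that(2) unfolding abs_mult
  by (intro mult_mono) auto
 from order show ?thesis
 proof (elim disjE)
  assume "\<forall>u v u' v'. 0 <= u \<longrightarrow> u <= v \<longrightarrow> v <= u' \<longrightarrow> u' <= v' \<longrightarrow> v' <= T \<longrightarrow>
    sets (G u v) \<subseteq> sets (G u' v') \<and> (\<lambda>w. V v w - V u w) \<in> bm (G u' v')"
  then have *: "sets (G u v) \<subseteq> sets (G u' v')" and [measurable]: "?D \<in> bm (G u' v')"
   using 1 2 uv by auto
  have [measurable]: "\<xi> \<in> bm (G u' v')" by (rule measurable_G_mono[OF 1(4) *])
  have "(\<E> w. ((d w * (\<xi> w \<bullet> ?D w)) *\<^sub>R h w) \<bullet> ?D' w) = 0"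
  proof (rule block_mean[OF 2(1-3)])
   show "(\<lambda>w. (d w * (\<xi> w \<bullet> ?D w)) *\<^sub>R h w) \<in> bm (G u' v')"
    using r 2 by measurable
   fix e :: 'e assume e: "e \<in> Basis"
   have "integrable M (\<lambda>w. (d w * (h w \<bullet> e)) * (\<xi> w \<bullet> ?D w))"
    by (rule integrable_bounded_times[OF _ block_integrable[OF 1], where R="R3 * R2"]) (auto intro!: bb R2 e)
   then show "integrable M (\<lambda>w. (d w * (\<xi> w \<bullet> ?D w)) *\<^sub>R h w \<bullet> e)" by (simp add: mult_ac)
  qed
  then show ?thesis by simp
 next
  assume "\<forall>u v u' v'. 0 <= u \<longrightarrow> u <= v \<longrightarrow> v <= u' \<longrightarrow> u' <= v' \<longrightarrow> v' <= T \<longrightarrow>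
    sets (G u' v') \<subseteq> sets (G u v) \<and> (\<lambda>w. V v' w - V u' w) \<in> bm (G u v)"
  then have *: "sets (G u' v') \<subseteq> sets (G u v)" and [measurable]: "?D' \<in> bm (G u v)"
   using 1 2 uv by auto
  have [measurable]: "h \<in> bm (G u v)" by (rule measurable_G_mono[OF 2(4) *])
  have "(\<E> w. ((d w * (h w \<bullet> ?D' w)) *\<^sub>R \<xi> w) \<bullet> ?D w) = 0"
  proof (rule block_mean[OF 1(1-3)])
   show "(\<lambda>w. (d w * (h w \<bullet> ?D' w)) *\<^sub>R \<xi> w) \<in> bm (G u v)"
    using r 1 by measurable
   fix e :: 'e assume e: "e \<in> Basis"
   have "integrable M (\<lambda>w. (d w * (\<xi> w \<bullet> e)) * (h w \<bullet> ?D' w))"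
    by (rule integrable_bounded_times[OF _ block_integrable[OF 2], where R="R3 * R1"]) (auto intro!: bb R1 e)
   then show "integrable M (\<lambda>w. (d w * (h w \<bullet> ?D' w)) *\<^sub>R \<xi> w \<bullet> e)" by (simp add: mult_ac)
  qed
  then show ?thesis by (simp add: mult_ac)
 qed
qed

lemma block_product_integrable:
 assumes b: "valid s t (u, v, \<xi>)" "valid s t (u', v', h)" and uv: "0 <= s" "s <= t" "t <= T"
  and w: "weight s t d" "bounded (d ` space M)"
 shows "integrable M (\<lambda>w. d w * (\<xi> w \<bullet> (V v w - V u w)) * (h w \<bullet> (V v' w - V u' w)))"
proof -
 have 1: "0 <= u" "u <= v" "v <= T" "\<xi> \<in> bm (G u v)" "bounded (\<xi> ` space M)"
  and 2: "0 <= u'" "u' <= v'" "v' <= T" "h \<in> bm (G u' v')" "bounded (h ` space M)"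
  and r: "d \<in> bm (G u v)" using b uv w by (auto simp: valid_def weight_def)
 obtain R3 where R3: "\<And>w. w \<in> space M \<Longrightarrow> \<bar>d w\<bar> <= R3" using w unfolding bounded_iff by auto
 have "d \<in> bm M" using measurable_G_events[OF r 1(1-3)] .
 from integrable_bounded_times[OF this integrable_times_square_integrable[OF
   block_measurable[OF 1] block_measurable[OF 2] block_square_integrable[OF 1] block_square_integrable[OF 2]] R3]
 show ?thesis by (simp add: mult.assoc)
qed

lemma valid_sub:
 assumes "valid s t (u, v, \<xi>)" "u <= u'" "u' <= v'" "v' <= v" "0 <= s" "t <= T"
 shows "valid s t (u', v', \<xi>)"
proof -
 have 1: "s <= u" "v <= t" "\<xi> \<in> bm (G u v)" "bounded (\<xi> ` space M)"
  using assms(1) by (auto simp: valid_def)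
 have "sets (G u v) \<subseteq> sets (G u' v')" using 1 assms by (intro G_mono) auto
 from measurable_G_mono[OF 1(3) this] show ?thesis using 1 assms by (auto simp: valid_def)
qed

text \<open>Cutting both blocks at \<open>u'\<close> and at \<open>m = min v v'\<close> leaves one
  piece in common. All other pairs of pieces are consecutive or contain an empty piece, so only the
  isometry of the common piece contributes.\<close>

lemma block_bilinear_aux:
 assumes b: "valid s t (u, v, \<xi>)" "valid s t (u', v', h)" and uv: "0 <= s" "s <= t" "t <= T" "u <= u'"
  and w: "weight s t d" "bounded (d ` space M)"
 shows "(\<E> w. d w * (\<xi> w \<bullet> (V v w - V u w)) * (h w \<bullet> (V v' w - V u' w))) =
  max 0 (min v v' - u') * (\<E> w. d w * (\<xi> w \<bullet> h w))"
proof (cases "v <= u'")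
 case True
 then show ?thesis using block_orthogonal[OF b uv(1,3) True w] by simp
next
 case False
 define m where "m = min v v'"
 have le: "s <= u" "u <= v" "v <= t" "u' <= v'" "v' <= t" using b by (auto simp: valid_def)
 have m: "u' <= m" "m <= v" "m <= v'" using False le by (auto simp: m_def)
 let ?X = "\<lambda>a b w. \<xi> w \<bullet> (V b w - V a w)" and ?Y = "\<lambda>a b w. h w \<bullet> (V b w - V a w)"
 have v1: "valid s t (u, u', \<xi>)" "valid s t (u', m, \<xi>)" "valid s t (m, v, \<xi>)"
  using valid_sub[OF b(1)] False uv m le by auto
 have v2: "valid s t (u', m, h)" "valid s t (m, v', h)" using valid_sub[OF b(2)] uv m le by auto
 note i = block_product_integrable[OF _ _ uv(1-3) w]
 note o = block_orthogonal[OF _ _ uv(1,3) _ w]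
 have 1: "(\<E> w. d w * ?X u u' w * ?Y u' v' w) = 0" by (rule o[OF v1(1) b(2)]) simp
 have 2: "(\<E> w. d w * ?X u' m w * ?Y m v' w) = 0" by (rule o[OF v1(2) v2(2)]) simp
 have 3: "(\<E> w. d w * ?X m v w * ?Y u' m w) = 0"
  using o[OF v2(1) v1(3)] by (simp add: mult_ac)
 \<comment> \<open>\<open>m\<close> is one of \<open>v\<close> and \<open>v'\<close>, so one of the
   two pieces beyond \<open>m\<close> is empty.\<close>
 have 4: "(\<E> w. d w * ?X m v w * ?Y m v' w) = 0"
  by (cases "m = v") (auto simp: m_def min_def split: if_splits)
 have mm: "\<xi> \<in> bm (G u' m)" "h \<in> bm (G u' m)" "d \<in> bm (G u' m)"
  using v1 v2 w m le uv by (auto simp: valid_def weight_def)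
 have 5: "(\<E> w. d w * ?X u' m w * ?Y u' m w) = (m - u') * (\<E> w. d w * (\<xi> w \<bullet> h w))"
  by (rule block_isometry) (use mm m le uv w b in \<open>auto simp: valid_def\<close>)
 have "(\<E> w. d w * ?X u v w * ?Y u' v' w) = (\<E> w. d w * ?X u u' w * ?Y u' v' w +
   (d w * ?X u' m w * ?Y u' m w + (d w * ?X u' m w * ?Y m v' w +
   (d w * ?X m v w * ?Y u' m w + d w * ?X m v w * ?Y m v' w))))"
  by (intro Bochner_Integration.integral_cong refl) (simp add: inner_diff_right algebra_simps)
 also have "... = (m - u') * (\<E> w. d w * (\<xi> w \<bullet> h w))"
  using i[OF v1(1) b(2)] i[OF v1(2) v2(1)] i[OF v1(2) v2(2)] i[OF v1(3) v2(1)] i[OF v1(3) v2(2)] 1 2 3 4 5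
  by simp
 also have "m - u' = max 0 (min v v' - u')" using m by (auto simp: m_def)
 finally show ?thesis .
qed

text \<open>The factor is the length of the overlap, written so that it is 0 for disjoint
  blocks.\<close>

lemma block_bilinear:
 assumes b: "valid s t (u, v, \<xi>)" "valid s t (u', v', h)" and uv: "0 <= s" "s <= t" "t <= T"
  and w: "weight s t d" "bounded (d ` space M)"
 shows "(\<E> w. d w * (\<xi> w \<bullet> (V v w - V u w)) * (h w \<bullet> (V v' w - V u' w))) =
  max 0 (min v v' - max u u') * (\<E> w. d w * (\<xi> w \<bullet> h w))"
proof (cases "u <= u'")
 case True
 then show ?thesis using block_bilinear_aux[OF b uv True w] by (simp add: max_absorb2)
next
 case False
 then have "u' <= u" by simp
 from block_bilinear_aux[OF b(2,1) uv this w] show ?thesis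
  using False by (simp add: max_absorb1 inner_commute mult_ac min.commute)
qed

lemma product_integral:
 assumes k: "integrable M k" and A: "A \<in> sets borel" "emeasure lborel A < \<infinity>"
 shows "integrable PM (\<lambda>p. indicator A (fst p) * (k (snd p) :: real))"
  and "(\<integral>p. indicator A (fst p) * k (snd p) \<partial>PM) = measure lborel A * (\<E> w. k w)"
proof -
 have [measurable]: "k \<in> bm M" using k by simp
 have iA: "integrable lborel (\<lambda>r. indicator A r :: real)" using A by simp
 show i: "integrable PM (\<lambda>p. indicator A (fst p) * k (snd p))"
 proof (rule pair.Fubini_integrable)
  show "(\<lambda>p. indicator A (fst p) * k (snd p)) \<in> bm PM" using A by measurable
  show "integrable lborel (\<lambda>x. \<E> y. norm (indicator A (fst (x, y)) * k (snd (x, y))))"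
   using iA by (simp add: abs_mult)
 qed (use k in auto)
 show "(\<integral>p. indicator A (fst p) * k (snd p) \<partial>PM) = measure lborel A * (\<E> w. k w)"
  using A by (subst pair.integral_fst'[OF i, symmetric]) simp
qed

end

context ito_direction
begin

lemma block_pair_isometry:
 assumes b: "valid s t b" "valid s t c" and st: "0 <= s" "s <= t" "t <= T"
  and w: "weight s t d" "bounded (d ` space M)"
 shows "integrable M (\<lambda>w. d w * (block_integral V [b] w * block_integral V [c] w)) \<and>
  integrable PM (\<lambda>p. d (snd p) * (block_process [b] p \<bullet> block_process [c] p)) \<and>
  (\<E> w. d w * (block_integral V [b] w * block_integral V [c] w)) =
  (\<integral>p. d (snd p) * (block_process [b] p \<bullet> block_process [c] p) \<partial>PM)"
proof -
 obtain u v \<xi> where b': "b = (u, v, \<xi>)" by (cases b)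
 obtain u' v' h where c': "c = (u', v', h)" by (cases c)
 note bc = b[unfolded b' c']
 have 1: "0 <= u" "u <= v" "v <= T" "\<xi> \<in> bm (G u v)" "bounded (\<xi> ` space M)"
  and 2: "0 <= u'" "u' <= v'" "v' <= T" "h \<in> bm (G u' v')" "bounded (h ` space M)"
  and r: "d \<in> bm (G u v)" using bc st w by (auto simp: valid_def weight_def)
 have [measurable]: "\<xi> \<in> bm M" "h \<in> bm M" "d \<in> bm M"
  using measurable_G_events 1 2 r by blast+
 obtain R1 where R1: "\<And>w. w \<in> space M \<Longrightarrow> norm (\<xi> w) <= R1" using 1 unfolding bounded_iff by auto
 obtain R2 where R2: "\<And>w. w \<in> space M \<Longrightarrow> norm (h w) <= R2" using 2 unfolding bounded_iff by auto
 obtain R3 where R3: "\<And>w. w \<in> space M \<Longrightarrow> norm (d w) <= R3" using w unfolding bounded_iff by auto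
 have k: "integrable M (\<lambda>w. d w * (\<xi> w \<bullet> h w))"
 proof (rule integrable_const_bound[of _ "R3 * (R1 * R2)"])
  show "AE w in M. norm (d w * (\<xi> w \<bullet> h w)) <= R3 * (R1 * R2)"
  proof (rule AE_I2)
   fix w assume w: "w \<in> space M"
   have "\<bar>\<xi> w \<bullet> h w\<bar> <= norm (\<xi> w) * norm (h w)" by (rule Cauchy_Schwarz_ineq2)
   also have "... <= R1 * R2" using R1[OF w] R2[OF w] by (intro mult_mono) (auto intro: order_trans[OF norm_ge_zero])
   finally show "norm (d w * (\<xi> w \<bullet> h w)) <= R3 * (R1 * R2)"
    unfolding norm_mult using R3[OF w] by (intro mult_mono) (auto intro: order_trans[OF norm_ge_zero])
  qed
 qed measurable
 let ?A = "{max u u'<..min v v'}"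
 have m: "measure lborel ?A = max 0 (min v v' - max u u')"
  by (cases "max u u' <= min v v'") (auto simp: max_def min_def split: if_splits)
 have e: "d (snd p) * (block_process [b] p \<bullet> block_process [c] p) =
   indicator ?A (fst p) * (d (snd p) * (\<xi> (snd p) \<bullet> h (snd p)))" for p
  unfolding block_process_def b' c' by (auto simp: indicator_def)
 have fin: "emeasure lborel ?A < \<infinity>"
  by (cases "max u u' <= min v v'") (auto simp: max_def min_def split: if_splits)
 show ?thesis
  using block_product_integrable[OF bc st w] block_bilinear[OF bc st w] product_integral[OF k _ fin]
  unfolding e m by (simp add: block_integral_def b' c' mult.assoc)
qed

lemma block_integral_Cons: "block_integral U (b # bs) w = block_integral U [b] w + block_integral U bs w"
 by (simp add: block_integral_def)

lemma block_process_Cons: "block_process (b # bs) p = block_process [b] p + block_process bs p"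
 by (simp add: block_process_def)

text \<open>Both sides are bilinear in the blocks and each pair obeys
  \<open>block_pair_isometry\<close>, overlaps included. Hence no common refinement of the two lists
  has to be built.\<close>

lemma block_list_bilinear:
 assumes b: "\<forall>b\<in>set bs. valid s t b" "\<forall>c\<in>set cs. valid s t c" and st: "0 <= s" "s <= t" "t <= T"
  and w: "weight s t d" "bounded (d ` space M)"
 shows "integrable M (\<lambda>w. d w * (block_integral V bs w * block_integral V cs w)) \<and>
  integrable PM (\<lambda>p. d (snd p) * (block_process bs p \<bullet> block_process cs p)) \<and>
  (\<E> w. d w * (block_integral V bs w * block_integral V cs w)) =
  (\<integral>p. d (snd p) * (block_process bs p \<bullet> block_process cs p) \<partial>PM)"
 using b(1)
proof (induction bs)
 case Nil
 then show ?case by (simp add: block_integral_def block_process_def)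
next
 case (Cons b bs)
 have b: "valid s t b" using Cons by simp
 have "integrable M (\<lambda>w. d w * (block_integral V [b] w * block_integral V cs w)) \<and>
  integrable PM (\<lambda>p. d (snd p) * (block_process [b] p \<bullet> block_process cs p)) \<and>
  (\<E> w. d w * (block_integral V [b] w * block_integral V cs w)) =
  (\<integral>p. d (snd p) * (block_process [b] p \<bullet> block_process cs p) \<partial>PM)"
  using \<open>\<forall>c\<in>set cs. valid s t c\<close>
 proof (induction cs)
  case Nil
  then show ?case by (simp add: block_integral_def block_process_def)
 next
  case (Cons c cs)
  then have IH: "integrable M (\<lambda>w. d w * (block_integral V [b] w * block_integral V cs w))"
   "integrable PM (\<lambda>p. d (snd p) * (block_process [b] p \<bullet> block_process cs p))"
   "(\<E> w. d w * (block_integral V [b] w * block_integral V cs w)) =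
   (\<integral>p. d (snd p) * (block_process [b] p \<bullet> block_process cs p) \<partial>PM)" by auto
  have "valid s t c" using Cons by simp
  note * = block_pair_isometry[OF b this st w]
  show ?case unfolding block_integral_Cons[of _ c cs] block_process_Cons[of c cs]
   using * IH by (simp add: distrib_left inner_add_right)
 qed
 then show ?case unfolding block_integral_Cons[of _ b bs] block_process_Cons[of b bs]
  using Cons by (simp add: distrib_left distrib_right inner_add_left)
qed

lemma block_list_isometry:
 assumes b: "\<forall>b\<in>set bs. valid s t b" and st: "0 <= s" "s <= t" "t <= T"
  and w: "weight s t d" "bounded (d ` space M)"
 shows "(\<E> w. d w * (norm (block_integral V bs w))^2) = (\<integral>p. d (snd p) * (norm (block_process bs p))^2 \<partial>PM)"
 using block_list_bilinear[OF b b st w] by (simp add: power2_eq_square[of "block_integral V bs _"] power2_norm_eq_inner)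

lemma weight_const: "weight s t (\<lambda>_. c)" by (simp add: weight_def)

lemma block_list_square_integrable:
 assumes b: "\<forall>b\<in>set bs. valid s t b" and st: "0 <= s" "s <= t" "t <= T"
 shows "integrable M (\<lambda>w. (norm (block_integral V bs w))^2)" "integrable PM (\<lambda>p. (norm (block_process bs p))^2)"
  and "(\<E> w. (norm (block_integral V bs w))^2) = (\<integral>p. (norm (block_process bs p))^2 \<partial>PM)"
 using block_list_bilinear[OF b b st weight_const[of _ _ 1]]
 by (auto simp: power2_eq_square[of "block_integral V bs _"] power2_norm_eq_inner bounded_iff)

lemma block_list_mean:
 assumes b: "\<forall>b\<in>set bs. valid s t b" and st: "0 <= s" "s <= t" "t <= T"
  and w: "weight s t d" "bounded (d ` space M)"
 shows "integrable M (\<lambda>w. d w * block_integral V bs w) \<and> (\<E> w. d w * block_integral V bs w) = 0"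
 using b
proof (induction bs)
 case Nil
 then show ?case by (simp add: block_integral_def)
next
 case (Cons b bs)
 obtain u v \<xi> where b': "b = (u, v, \<xi>)" by (cases b)
 have 1: "0 <= u" "u <= v" "v <= T" "\<xi> \<in> bm (G u v)" "bounded (\<xi> ` space M)"
  and r: "d \<in> bm (G u v)" using Cons st w by (auto simp: valid_def weight_def b')
 have [measurable]: "\<xi> \<in> bm M" "d \<in> bm M" using measurable_G_events 1 r by blast+
 obtain R1 where R1: "\<And>w. w \<in> space M \<Longrightarrow> norm (\<xi> w) <= R1" using 1 unfolding bounded_iff by auto
 obtain R3 where R3: "\<And>w. w \<in> space M \<Longrightarrow> norm (d w) <= R3" using w unfolding bounded_iff by auto
 have i: "integrable M (\<lambda>w. d w * (\<xi> w \<bullet> (V v w - V u w)))"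
  by (rule integrable_bounded_times[OF _ block_integrable[OF 1], where R=R3]) (use R3 in auto)
 have "(\<E> w. (d w *\<^sub>R \<xi> w) \<bullet> (V v w - V u w)) = 0"
 proof (rule block_mean[OF 1(1-3)])
  show "(\<lambda>w. d w *\<^sub>R \<xi> w) \<in> bm (G u v)" using r 1 by measurable
  fix e :: 'e assume e: "e \<in> Basis"
  show "integrable M (\<lambda>w. (d w *\<^sub>R \<xi> w) \<bullet> e)"
  proof (rule integrable_const_bound[of _ "R3 * R1"])
   show "AE w in M. norm ((d w *\<^sub>R \<xi> w) \<bullet> e) <= R3 * R1"
   proof (rule AE_I2)
    fix w assume w: "w \<in> space M"
    show "norm ((d w *\<^sub>R \<xi> w) \<bullet> e) <= R3 * R1"
     using R3[OF w] R1[OF w] Basis_le_norm[OF e, of "\<xi> w"]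
     by (auto simp: abs_mult intro!: mult_mono)
   qed
  qed measurable
 qed
 then show ?case unfolding block_integral_Cons[of _ b bs]
  using i Cons by (simp add: block_integral_def b' distrib_left)
qed

lemma block_integral_measurable:
 assumes b: "\<forall>b\<in>set bs. valid s t b" and st: "0 <= s" "s <= t" "t <= T"
 shows "block_integral V bs \<in> bm M" using b
proof (induction bs)
 case Nil
 then show ?case by (simp add: block_integral_def[abs_def])
next
 case (Cons b bs)
 obtain u v \<xi> where b': "b = (u, v, \<xi>)" by (cases b)
 have "(\<lambda>w. \<xi> w \<bullet> (V v w - V u w)) \<in> bm M"
  by (rule block_measurable) (use Cons st in \<open>auto simp: valid_def b'\<close>)
 moreover have "block_integral V (b # bs) = (\<lambda>w. \<xi> w \<bullet> (V v w - V u w) + block_integral V bs w)"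
  by (simp add: fun_eq_iff block_integral_def b')
 ultimately show ?case using Cons by simp
qed

lemma block_process_measurable:
 assumes b: "\<forall>b\<in>set bs. valid s t b" and st: "0 <= s" "s <= t" "t <= T"
 shows "block_process bs \<in> bm PM" using b
proof (induction bs)
 case Nil
 then show ?case by (simp add: block_process_def[abs_def])
next
 case (Cons b bs)
 obtain u v \<xi> where b': "b = (u, v, \<xi>)" by (cases b)
 have [measurable]: "\<xi> \<in> bm M"
  by (rule measurable_G_events[of _ u v]) (use Cons st in \<open>auto simp: valid_def b'\<close>)
 have "(\<lambda>p. indicator {u<..v} (fst p) *\<^sub>R \<xi> (snd p)) \<in> bm PM" by measurable
 moreover have "block_process (b # bs) = (\<lambda>p. indicator {u<..v} (fst p) *\<^sub>R \<xi> (snd p) + block_process bs p)"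
  by (simp add: fun_eq_iff block_process_def b')
 ultimately show ?case using Cons by simp
qed

text \<open>Integrands are functions on the whole product space, cut off by indicators, so that
  integrals over different intervals can be subtracted. \<open>has_ito_integral\<close> enters only
  through \<open>ito_of_has_ito_integral\<close>.\<close>

definition ito :: "real => real => (real \<times> 'w => 'e) => ('w => real) => bool" where
 "ito s t \<Psi> J \<longleftrightarrow> \<Psi> \<in> bm PM \<and> J \<in> bm M \<and>
  (\<exists>bs. (\<forall>m. \<forall>b\<in>set (bs m). valid s t b) \<and>
   conv2 PM (\<lambda>m. block_process (bs m)) \<Psi> \<and> conv2 M (\<lambda>m. block_integral V (bs m)) J)"

lemma itoE:
 assumes "ito s t \<Psi> J"
 obtains bs where "\<forall>m. \<forall>b\<in>set (bs m). valid s t b" "conv2 PM (\<lambda>m. block_process (bs m)) \<Psi>"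
  "conv2 M (\<lambda>m. block_integral V (bs m)) J" using assms unfolding ito_def by blast

lemma ito_measurable: "ito s t \<Psi> J \<Longrightarrow> \<Psi> \<in> bm PM" "ito s t \<Psi> J \<Longrightarrow> J \<in> bm M"
 by (auto simp: ito_def)

lemma ito_square_integrable:
 assumes I: "ito s t \<Psi> J" and st: "0 <= s" "s <= t" "t <= T"
 shows "integrable PM (\<lambda>p. (norm (\<Psi> p))^2)" "integrable M (\<lambda>w. (J w)^2)"
proof -
 obtain bs where bs: "\<forall>m. \<forall>b\<in>set (bs m). valid s t b" "conv2 PM (\<lambda>m. block_process (bs m)) \<Psi>"
  "conv2 M (\<lambda>m. block_integral V (bs m)) J" by (rule itoE[OF I])
 note bs = bs(1)[THEN spec] bs(2,3)
 show "integrable PM (\<lambda>p. (norm (\<Psi> p))^2)"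
  by (rule conv2_square_integrable[OF bs(2)])
   (use ito_measurable[OF I] block_process_measurable[OF bs(1) st] block_list_square_integrable[OF bs(1) st] in auto)
 have "integrable M (\<lambda>w. (norm (J w))^2)" by (rule conv2_square_integrable[OF bs(3)])
   (use ito_measurable[OF I] block_integral_measurable[OF bs(1) st] block_list_square_integrable[OF bs(1) st] in auto)
 then show "integrable M (\<lambda>w. (J w)^2)" by simp
qed

lemma weight_measurable: "weight s t d \<Longrightarrow> 0 <= s \<Longrightarrow> s <= t \<Longrightarrow> t <= T \<Longrightarrow> d \<in> bm M"
 by (rule measurable_G_events[of _ s t]) (auto simp: weight_def)

text \<open>Unlike in the classical isometry a random weight stays under both expectations; the
  weighted energy estimates rest on this form.\<close>

lemma ito_isometry:
 assumes I: "ito s t \<Psi> J" and st: "0 <= s" "s <= t" "t <= T"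
  and w: "weight s t d" "bounded (d ` space M)"
 shows "(\<E> w. d w * (J w)^2) = (\<integral>p. d (snd p) * (norm (\<Psi> p))^2 \<partial>PM)"
proof -
 obtain bs where bs: "\<forall>m. \<forall>b\<in>set (bs m). valid s t b" "conv2 PM (\<lambda>m. block_process (bs m)) \<Psi>"
  "conv2 M (\<lambda>m. block_integral V (bs m)) J" by (rule itoE[OF I])
 note bs = bs(1)[THEN spec] bs(2,3)
 obtain R where R: "\<And>w. w \<in> space M \<Longrightarrow> \<bar>d w\<bar> <= R" using w unfolding bounded_iff by auto
 have [measurable]: "d \<in> bm M" by (rule weight_measurable[OF w(1) st])
 have 1: "(\<lambda>m. \<integral>p. d (snd p) * (norm (block_process (bs m) p))^2 \<partial>PM) \<longlonglongrightarrow> (\<integral>p. d (snd p) * (norm (\<Psi> p))^2 \<partial>PM)"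
  by (rule conv2_weighted_tendsto[OF bs(2), where R=R])
   (use ito_measurable[OF I] block_process_measurable[OF bs(1) st] block_list_square_integrable[OF bs(1) st] R
    in \<open>auto simp: space_pair_measure\<close>)
 have 2: "(\<lambda>m. \<E> w. d w * (norm (block_integral V (bs m) w))^2) \<longlonglongrightarrow> (\<E> w. d w * (norm (J w))^2)"
  by (rule conv2_weighted_tendsto[OF bs(3), where R=R])
   (use ito_measurable[OF I] block_integral_measurable[OF bs(1) st] block_list_square_integrable[OF bs(1) st] R
    in auto)
 have "(\<E> w. d w * (norm (J w))^2) = (\<integral>p. d (snd p) * (norm (\<Psi> p))^2 \<partial>PM)"
  using LIMSEQ_unique[OF 2[unfolded block_list_isometry[OF bs(1) st w]] 1] .
 then show ?thesis by simp
qed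

lemma ito_mean:
 assumes I: "ito s t \<Psi> J" and st: "0 <= s" "s <= t" "t <= T"
  and w: "weight s t d" "bounded (d ` space M)"
 shows "(\<E> w. d w * J w) = 0"
proof -
 obtain bs where bs: "\<forall>m. \<forall>b\<in>set (bs m). valid s t b" "conv2 PM (\<lambda>m. block_process (bs m)) \<Psi>"
  "conv2 M (\<lambda>m. block_integral V (bs m)) J" by (rule itoE[OF I])
 note bs = bs(1)[THEN spec] bs(2,3)
 obtain R where R: "\<And>w. w \<in> space M \<Longrightarrow> \<bar>d w\<bar> <= R" using w unfolding bounded_iff by auto
 obtain w\<^sub>0 where "w\<^sub>0 \<in> space M" using not_empty by blast
 then have Rp: "R \<ge> 0" using R[of w\<^sub>0] by linarith
 have [measurable]: "d \<in> bm M" by (rule weight_measurable[OF w(1) st])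
 have [measurable]: "J \<in> bm M" "\<And>m. block_integral V (bs m) \<in> bm M"
  using ito_measurable[OF I] block_integral_measurable[OF bs(1) st] by auto
 let ?D = "\<lambda>m w. J w - block_integral V (bs m) w"
 have lim: "(\<lambda>m. \<E> w. (norm (?D m w))^2) \<longlonglongrightarrow> 0"
  by (rule conv2_integral_tendsto[OF bs(3)])
   (use ito_measurable[OF I] block_integral_measurable[OF bs(1) st] block_list_square_integrable[OF bs(1) st] in auto)
 have D2: "integrable M (\<lambda>w. (?D m w)^2)" for m
  using square_integrable_diff[of J M "block_integral V (bs m)"] ito_square_integrable[OF I st] block_list_square_integrable[OF bs(1) st]
  by simp
 have D1: "integrable M (?D m)" for m by (rule square_integrable_imp_integrable[OF _ D2]) simp
 have J1: "integrable M J" by (rule square_integrable_imp_integrable[OF _ ito_square_integrable(2)[OF I st]]) simp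
 \<comment> \<open>The block integrals have weighted mean zero, so only the distance to them counts.
   The bound \<open>\<bar>x\<bar> <= eps + x^2 / eps\<close> takes the role of the Cauchy-Schwarz
   inequality: \<open>m\<close> goes to infinity for fixed \<open>eps\<close>, and
   \<open>eps\<close> to 0 afterwards.\<close>
 have e: "\<bar>\<integral>w. d w * J w \<partial>M\<bar> <= R * (eps + (\<E> w. (norm (?D m w))^2) / eps)" if ep: "eps > 0" for m eps
 proof -
  have "(\<E> w. d w * J w) = (\<E> w. d w * ?D m w + d w * block_integral V (bs m) w)"
   by (intro Bochner_Integration.integral_cong) (auto simp: algebra_simps)
  also have "... = (\<E> w. d w * ?D m w)"
   using block_list_mean[OF bs(1) st w, of m] integrable_bounded_times[OF _ D1[of m] R] by simp
  also have "\<bar>...\<bar> <= (\<E> w. \<bar>d w * ?D m w\<bar>)" by (rule integral_abs_bound)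
  also have "... <= (\<E> w. R * (eps + (?D m w)^2 / eps))"
  proof (rule integral_mono_AE)
   show "integrable M (\<lambda>w. \<bar>d w * ?D m w\<bar>)" using integrable_bounded_times[OF _ D1[of m] R] by simp
   show "integrable M (\<lambda>w. R * (eps + (?D m w)^2 / eps))" using D2 by simp
   have x: "\<bar>x\<bar> <= eps + x^2 / eps" for x
   proof (cases "\<bar>x\<bar> <= eps")
    case False
    then have "eps * \<bar>x\<bar> <= \<bar>x\<bar> * \<bar>x\<bar>" by (intro mult_right_mono) auto
    then have "\<bar>x\<bar> <= x^2 / eps" using ep by (simp add: field_simps power2_eq_square)
    then show ?thesis using ep by simp
   next
    case True
    then show ?thesis using ep by (intro order_trans[OF True]) simp
   qed
   show "AE w in M. \<bar>d w * ?D m w\<bar> <= R * (eps + (?D m w)^2 / eps)"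
    unfolding abs_mult using R x Rp by (intro AE_I2 mult_mono) auto
  qed
  also have "... = R * (eps + (\<E> w. (norm (?D m w))^2) / eps)"
   using D2 by (simp add: prob_space)
  finally show ?thesis .
 qed
 have "\<bar>\<integral>w. d w * J w \<partial>M\<bar> <= R * (eps + 0 / eps)" if ep: "eps > 0" for eps
  by (rule tendsto_lowerbound[OF tendsto_mult[OF tendsto_const tendsto_add[OF tendsto_const tendsto_divide[OF lim tendsto_const]]]])
   (use ep e[OF ep] in auto)
 then have *: "\<bar>\<integral>w. d w * J w \<partial>M\<bar> <= R * eps" if "eps > 0" for eps using that by simp
 have "\<bar>\<integral>w. d w * J w \<partial>M\<bar> <= 0"
 proof (rule field_le_epsilon)
  fix r :: real assume "r > 0"
  have "R * (r / (R + 1)) <= r" using Rp \<open>r > 0\<close> by (simp add: field_simps)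
  then show "\<bar>\<integral>w. d w * J w \<partial>M\<bar> <= 0 + r" using *[of "r / (R + 1)"] \<open>r > 0\<close> Rp by simp
 qed
 then show ?thesis by simp
qed

text \<open>Extends \<open>ito_mean\<close> to unbounded \<open>y\<close>. Setting \<open>y\<close>
  to 0 where it exceeds \<open>R\<close> keeps it measurable for the same sigma-algebras, and the
  absolute value of \<open>y w * J w\<close> dominates.\<close>

lemma ito_orthogonal:
 assumes I: "ito s t \<Psi> J" and st: "0 <= s" "s <= t" "t <= T"
  and y: "weight s t y" "integrable M (\<lambda>w. (y w)^2)"
 shows "(\<E> w. y w * J w) = 0" "integrable M (\<lambda>w. y w * J w)"
proof -
 have [measurable]: "y \<in> bm M" by (rule weight_measurable[OF y(1) st])
 have [measurable]: "J \<in> bm M" using ito_measurable[OF I] by simp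
 show i: "integrable M (\<lambda>w. y w * J w)"
  by (rule integrable_times_square_integrable[OF _ _ y(2) ito_square_integrable(2)[OF I st]]) auto
 let ?y = "\<lambda>R w. y w * indicator {z. \<bar>z\<bar> <= real R} (y w)"
 have "(\<E> w. ?y R w * J w) = 0" for R :: nat
 proof (rule ito_mean[OF I st])
  show "weight s t (?y R)" unfolding weight_def
  proof (intro allI impI)
   fix u v assume "s <= u" "u <= v" "v <= t"
   then have [measurable]: "y \<in> bm (G u v)" using y(1) by (auto simp: weight_def)
   show "?y R \<in> bm (G u v)" by measurable
  qed
  show "bounded (?y R ` space M)" unfolding bounded_iff by (auto simp: indicator_def intro!: exI[of _ "real R"])
 qed
 moreover have "(\<lambda>R. \<E> w. ?y R w * J w) \<longlonglongrightarrow> (\<E> w. y w * J w)"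
 proof (rule integral_dominated_convergence[where w="\<lambda>w. \<bar>y w * J w\<bar>"])
  show "AE w in M. (\<lambda>R. ?y R w * J w) \<longlonglongrightarrow> y w * J w"
  proof (rule AE_I2)
   fix w
   obtain N :: nat where N: "\<bar>y w\<bar> <= real N" using real_arch_simple by blast
   have "?y R w * J w = y w * J w" if "R \<ge> N" for R using N that by (auto simp: indicator_def)
   then show "(\<lambda>R. ?y R w * J w) \<longlonglongrightarrow> y w * J w"
    by (intro tendsto_eventually) (auto simp: eventually_sequentially)
  qed
 qed (use i in \<open>auto simp: indicator_def\<close>)
 ultimately have "(\<lambda>R::nat. 0) \<longlonglongrightarrow> (\<E> w. y w * J w)" by simp
 from LIMSEQ_unique[OF this tendsto_const] show "(\<E> w. y w * J w) = 0" .
qed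

lemma ito_mono:
 assumes "ito s t \<Psi> J" "s' <= s" "t <= t'"
 shows "ito s' t' \<Psi> J"
proof -
 have "valid s t b \<Longrightarrow> valid s' t' b" for b using assms(2,3) by (cases b) (auto simp: valid_def)
 then show ?thesis using assms(1) unfolding ito_def by blast
qed

definition block_uminus :: "real \<times> real \<times> ('w => 'e) => real \<times> real \<times> ('w => 'e)" where
 "block_uminus = (\<lambda>(u, v, \<xi>). (u, v, \<lambda>w. - \<xi> w))"

lemma valid_block_uminus: "valid s t b \<Longrightarrow> valid s t (block_uminus b)"
 by (cases b) (auto simp: valid_def block_uminus_def bounded_iff)

lemma block_process_diff: "block_process (bs @ map block_uminus cs) p = block_process bs p - block_process cs p"
proof -
 have "block_process (map block_uminus cs) p = - block_process cs p"
  by (induction cs) (auto simp: block_process_def block_uminus_def split: prod.splits)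
 then show ?thesis by (simp add: block_process_def)
qed

lemma block_integral_diff: "block_integral V (bs @ map block_uminus cs) w = block_integral V bs w - block_integral V cs w"
proof -
 have "block_integral V (map block_uminus cs) w = - block_integral V cs w"
  by (induction cs) (auto simp: block_integral_def block_uminus_def split: prod.splits)
 then show ?thesis by (simp add: block_integral_def)
qed

lemma ito_diff:
 assumes I: "ito s t \<Psi> J" "ito s t \<Psi>' J'" and st: "0 <= s" "s <= t" "t <= T"
 shows "ito s t (\<lambda>p. \<Psi> p - \<Psi>' p) (\<lambda>w. J w - J' w)"
proof -
 obtain bs where bs: "\<forall>m. \<forall>b\<in>set (bs m). valid s t b" "conv2 PM (\<lambda>m. block_process (bs m)) \<Psi>"
  "conv2 M (\<lambda>m. block_integral V (bs m)) J" by (rule itoE[OF I(1)])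
 obtain cs where cs: "\<forall>m. \<forall>b\<in>set (cs m). valid s t b" "conv2 PM (\<lambda>m. block_process (cs m)) \<Psi>'"
  "conv2 M (\<lambda>m. block_integral V (cs m)) J'" by (rule itoE[OF I(2)])
 note m = ito_measurable[OF I(1)] ito_measurable[OF I(2)]
  block_process_measurable[OF bs(1)[THEN spec] st] block_process_measurable[OF cs(1)[THEN spec] st]
  block_integral_measurable[OF bs(1)[THEN spec] st] block_integral_measurable[OF cs(1)[THEN spec] st]
 let ?bs = "\<lambda>m. bs m @ map block_uminus (cs m)"
 have "conv2 PM (\<lambda>m. block_process (?bs m)) (\<lambda>p. \<Psi> p - \<Psi>' p)"
  using conv2_diff[OF bs(2) cs(2)] m by (simp add: block_process_diff[abs_def] conv2_def)
 moreover have "conv2 M (\<lambda>m. block_integral V (?bs m)) (\<lambda>w. J w - J' w)"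
  using conv2_diff[OF bs(3) cs(3)] m by (simp add: block_integral_diff[abs_def] conv2_def)
 moreover have "\<forall>m. \<forall>b\<in>set (?bs m). valid s t b"
  using bs(1) cs(1) unfolding set_append set_map by (blast intro: valid_block_uminus)
 ultimately show ?thesis unfolding ito_def using m by (intro conjI exI[of _ ?bs]) auto
qed

lemma ito_block_list:
 assumes "\<forall>b\<in>set bs. valid s t b" "0 <= s" "s <= t" "t <= T"
 shows "ito s t (block_process bs) (block_integral V bs)"
 unfolding ito_def using assms block_process_measurable[OF assms] block_integral_measurable[OF assms]
 by (intro conjI exI[of _ "\<lambda>_. bs"]) (auto simp: conv2_def)

text \<open>A block that misses the interval becomes a null block instead of disappearing, so
  clipping a list is a plain \<open>map\<close>.\<close>

definition block_clip :: "real => real => real \<times> real \<times> ('w => 'e) => real \<times> real \<times> ('w => 'e)" where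
 "block_clip s t = (\<lambda>(u, v, \<xi>). if max u s <= min v t then (max u s, min v t, \<xi>) else (s, s, \<lambda>_. 0))"

lemma valid_block_clip:
 assumes "valid s t b" "0 <= s" "t <= T" "s' <= t'"
 shows "valid s' t' (block_clip s' t' b)"
proof -
 obtain u v \<xi> where b: "b = (u, v, \<xi>)" by (cases b)
 show ?thesis
 proof (cases "max u s' <= min v t'")
  case True
  have "valid s t (max u s', min v t', \<xi>)"
   by (rule valid_sub[OF assms(1)[unfolded b]]) (use True assms in auto)
  then show ?thesis using True by (auto simp: valid_def block_clip_def b)
 next
  case False
  then have "block_clip s' t' b = (s', s', \<lambda>_. 0)" unfolding block_clip_def b case_prod_conv by (rule if_not_P)
  moreover have "valid s' t' (s', s', \<lambda>_. 0)" using assms by (auto simp: valid_def bounded_iff intro!: exI[of _ 1])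
  ultimately show ?thesis by simp
 qed
qed

lemma block_process_clip:
 "block_process (map (block_clip s t) bs) p = indicator {s<..t} (fst p) *\<^sub>R block_process bs p"
proof (induction bs)
 case Nil
 then show ?case by (simp add: block_process_def)
next
 case (Cons b bs)
 obtain u v \<xi> where b: "b = (u, v, \<xi>)" by (cases b)
 have "block_process [block_clip s t b] p = indicator {s<..t} (fst p) *\<^sub>R block_process [b] p"
 proof (cases "max u s <= min v t")
  case True
  then have "block_clip s t b = (max u s, min v t, \<xi>)" unfolding block_clip_def b case_prod_conv by (rule if_P)
  then show ?thesis unfolding b by (auto simp: block_process_def indicator_def)
 next
  case False
  then have "block_clip s t b = (s, s, \<lambda>_. 0)" unfolding block_clip_def b case_prod_conv by (rule if_not_P)
  then show ?thesis using False unfolding b by (auto simp: block_process_def indicator_def)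
 qed
 then show ?case using Cons block_process_Cons[of b bs p] block_process_Cons[of "block_clip s t b" "map (block_clip s t) bs" p]
  by (simp add: scaleR_right_distrib)
qed

text \<open>Approximating blocks may reach beyond \<open>(s', t']\<close>, where the integrand
  vanishes. Clipping brings the processes no farther from \<open>\<Psi>\<close>, and by the isometry
  the discarded integrals tend to 0, so the same \<open>J\<close> is the limit.\<close>

lemma ito_restrict:
 assumes I: "ito s t \<Psi> J" and st: "0 <= s" "s <= s'" "s' <= t'" "t' <= t" "t <= T"
  and z: "\<And>p. fst p \<notin> {s'<..t'} \<Longrightarrow> \<Psi> p = 0"
 shows "ito s' t' \<Psi> J"
proof -
 have st': "0 <= s" "s <= t" "t <= T" "0 <= s'" "t' <= T" using st by auto
 obtain bs where bs: "\<forall>m. \<forall>b\<in>set (bs m). valid s t b" "conv2 PM (\<lambda>m. block_process (bs m)) \<Psi>"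
  "conv2 M (\<lambda>m. block_integral V (bs m)) J" by (rule itoE[OF I])
 define cs where "cs m = map (block_clip s' t') (bs m)" for m
 have cs: "\<forall>b\<in>set (cs m). valid s' t' b" for m
  using bs(1) valid_block_clip[OF _ st'(1,3) st(3)] unfolding cs_def set_map by blast
 have cs': "\<forall>b\<in>set (cs m). valid s t b" for m
 proof
  fix b assume "b \<in> set (cs m)"
  then show "valid s t b" using cs[of m] st by (cases b) (auto simp: valid_def)
 qed
 note m [measurable] = ito_measurable[OF I] block_process_measurable[OF bs(1)[THEN spec] st'(1-3)] block_process_measurable[OF cs' st'(1-3)]
  block_integral_measurable[OF bs(1)[THEN spec] st'(1-3)] block_integral_measurable[OF cs' st'(1-3)]
 have le: "norm (\<Psi> p - block_process (cs m) p) <= norm (\<Psi> p - block_process (bs m) p)"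
  "norm (block_process (bs m) p - block_process (cs m) p) <= norm (\<Psi> p - block_process (bs m) p)" for m p
  using z[of p] unfolding cs_def block_process_clip by (auto simp: indicator_def norm_minus_commute)
 have 1: "conv2 PM (\<lambda>m. block_process (cs m)) \<Psi>" unfolding conv2_def
  by (rule tendsto_sandwich[OF always_eventually always_eventually tendsto_const bs(2)[unfolded conv2_def]])
   (auto intro!: nn_integral_mono ennreal_leI power_mono le)
 have eq: "(\<E>\<^sup>+ w. ennreal ((norm (block_integral V (bs m) w - block_integral V (cs m) w))^2)) =
   (\<integral>\<^sup>+p. ennreal ((norm (block_process (bs m) p - block_process (cs m) p))^2) \<partial>PM)" for m
 proof -
  have v: "\<forall>b\<in>set (bs m @ map block_uminus (cs m)). valid s t b"
   using bs(1) cs' unfolding set_append set_map by (blast intro: valid_block_uminus)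
  note * = block_list_square_integrable[OF v st'(1-3), unfolded block_integral_diff block_process_diff]
  show ?thesis
   using nn_integral_eq_integral[OF *(1)] nn_integral_eq_integral[OF *(2)] *(3) by simp
 qed
 have 2: "conv2 M (\<lambda>m w. block_integral V (bs m) w - block_integral V (cs m) w) (\<lambda>w. 0)"
  unfolding conv2_def
 proof (rule tendsto_sandwich[OF always_eventually always_eventually tendsto_const bs(2)[unfolded conv2_def]])
  show "\<forall>m. (\<E>\<^sup>+ w. ennreal ((norm (0 - (block_integral V (bs m) w - block_integral V (cs m) w)))^2))
    <= (\<integral>\<^sup>+p. ennreal ((norm (\<Psi> p - block_process (bs m) p))^2) \<partial>PM)"
  proof
   fix m
   have "(\<E>\<^sup>+ w. ennreal ((norm (0 - (block_integral V (bs m) w - block_integral V (cs m) w)))^2)) =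
    (\<E>\<^sup>+ w. ennreal ((norm (block_integral V (bs m) w - block_integral V (cs m) w))^2))"
    by (intro nn_integral_cong) (simp add: power2_commute)
   also have "... <= (\<integral>\<^sup>+p. ennreal ((norm (\<Psi> p - block_process (bs m) p))^2) \<partial>PM)"
    unfolding eq by (auto intro!: nn_integral_mono ennreal_leI power_mono le)
   finally show "(\<E>\<^sup>+ w. ennreal ((norm (0 - (block_integral V (bs m) w - block_integral V (cs m) w)))^2))
    <= (\<integral>\<^sup>+p. ennreal ((norm (\<Psi> p - block_process (bs m) p))^2) \<partial>PM)" .
  qed
 qed simp
 have "conv2 M (\<lambda>m. block_integral V (cs m)) J"
  using conv2_diff[OF bs(3) 2] m by (simp add: conv2_def)
 with 1 cs m show ?thesis unfolding ito_def by (intro conjI exI[of _ cs]) auto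
qed

text \<open>Elementary integrands vanish at the left end point and outside \<open>[s, t]\<close>,
  hence the half-open indicator on the integrand.\<close>

lemma ito_of_has_ito_integral:
 assumes I: "has_ito_integral M G V s t \<Phi> J" and st: "0 <= s" "s <= t" "t <= T"
 shows "ito s t (\<lambda>p. indicator {s<..t} (fst p) *\<^sub>R \<Phi> (fst p) (snd p)) J"
proof -
 let ?\<Psi> = "\<lambda>p. indicator {s<..t} (fst p) *\<^sub>R \<Phi> (fst p) (snd p)"
 have "(\<lambda>p. \<Phi> (fst p) (snd p)) \<in> bm (restrict_space borel {s..t} \<Otimes>\<^sub>M M)"
  using I by (simp add: has_ito_integral_def case_prod_unfold)
 from measurable_restrict_indicator[OF this]
 have "(\<lambda>p. indicator {s..t} (fst p) *\<^sub>R \<Phi> (fst p) (snd p)) \<in> bm PM" by simp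
 then have "(\<lambda>p. indicator {s<..t} (fst p) *\<^sub>R (indicator {s..t} (fst p) *\<^sub>R \<Phi> (fst p) (snd p))) \<in> bm PM"
  by (rule borel_measurable_scaleR[rotated]) measurable
 also have "(\<lambda>p. indicator {s<..t} (fst p) *\<^sub>R (indicator {s..t} (fst p) *\<^sub>R \<Phi> (fst p) (snd p))) = ?\<Psi>"
  by (auto simp: fun_eq_iff indicator_def)
 finally have \<Psi> [measurable]: "?\<Psi> \<in> bm PM" .
 have J: "J \<in> bm M" using I by (simp add: has_ito_integral_def)
 obtain n :: "nat => nat" and h \<xi> where e: "\<forall>m. elementary M G s t (n m) (h m) (\<xi> m)"
  and l1: "(\<lambda>m. \<E>\<^sup>+ w. (\<integral>\<^sup>+r\<in>{s..t}.
        ennreal ((norm (\<Phi> r w - elem_process (n m) (h m) (\<xi> m) r w))^2) \<partial>lborel)) \<longlonglongrightarrow> 0"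
  and l2: "(\<lambda>m. \<E>\<^sup>+ w. ennreal ((J w - elem_integral V (n m) (h m) (\<xi> m) w)^2)) \<longlonglongrightarrow> 0"
  using I unfolding has_ito_integral_def by blast
 define bs where "bs m = map (\<lambda>k. (h m k, h m (Suc k), \<xi> m k)) [0..<n m]" for m
 have mono: "h m i <= h m j" if "i <= j" "j <= n m" for m i j using that
 proof (induction j)
  case (Suc j)
  have "h m j < h m (Suc j)" using e Suc.prems by (auto simp: elementary_def)
  then show ?case using Suc by (cases "i = Suc j") auto
 qed simp
 have v: "\<forall>b\<in>set (bs m). valid s t b" for m
 proof
  fix b assume "b \<in> set (bs m)"
  then obtain k where k: "k < n m" "b = (h m k, h m (Suc k), \<xi> m k)" by (auto simp: bs_def)
  then show "valid s t b"
   using e mono[of 0 k m] mono[of "Suc k" "n m" m] mono[of k "Suc k" m] by (auto simp: valid_def elementary_def)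
 qed
 have bp: "block_process (bs m) p = elem_process (n m) (h m) (\<xi> m) (fst p) (snd p)" for m p
  by (simp add: block_process_def elem_process_def bs_def comp_def sum_list_distinct_conv_sum_set atLeast0LessThan)
 have bi: "block_integral V (bs m) w = elem_integral V (n m) (h m) (\<xi> m) w" for m w
  by (simp add: block_integral_def elem_integral_def bs_def comp_def sum_list_distinct_conv_sum_set atLeast0LessThan)
 note m [measurable] = block_process_measurable[OF v st]
 have out: "block_process (bs m) p = 0" if "fst p \<notin> {s<..t}" for m p
 proof -
  have "indicator {h m k<..h m (Suc k)} (fst p) = (0::real)" if "k < n m" for k
   using \<open>fst p \<notin> {s<..t}\<close> e mono[of 0 k m] mono[of "Suc k" "n m" m] that
   by (auto simp: indicator_def elementary_def)
  then show ?thesis unfolding bp elem_process_def by (intro sum.neutral) simp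
 qed
 have "conv2 PM (\<lambda>m. block_process (bs m)) ?\<Psi>" unfolding conv2_def
 proof (rule tendsto_sandwich[OF always_eventually always_eventually tendsto_const l1])
  show "\<forall>m. (\<integral>\<^sup>+p. ennreal ((norm (?\<Psi> p - block_process (bs m) p))^2) \<partial>PM) <= (\<E>\<^sup>+ w. (\<integral>\<^sup>+r\<in>{s..t}.
        ennreal ((norm (\<Phi> r w - elem_process (n m) (h m) (\<xi> m) r w))^2) \<partial>lborel))"
  proof
   fix m
   have "(\<integral>\<^sup>+p. ennreal ((norm (?\<Psi> p - block_process (bs m) p))^2) \<partial>PM) =
    (\<E>\<^sup>+ w. (\<integral>\<^sup>+r. ennreal ((norm (?\<Psi> (r, w) - block_process (bs m) (r, w)))^2) \<partial>lborel))"
    by (rule pair.nn_integral_snd[symmetric]) measurable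
   also have "... <= (\<E>\<^sup>+ w. (\<integral>\<^sup>+r\<in>{s..t}.
        ennreal ((norm (\<Phi> r w - elem_process (n m) (h m) (\<xi> m) r w))^2) \<partial>lborel))"
   proof (intro nn_integral_mono)
    fix w r
    show "ennreal ((norm (?\<Psi> (r, w) - block_process (bs m) (r, w)))^2) \<le>
      ennreal ((norm (\<Phi> r w - elem_process (n m) (h m) (\<xi> m) r w))^2) * indicator {s..t} r"
     using out[of "(r, w)" m] bp[of m "(r, w)"] by (cases "r \<in> {s<..t}") auto
   qed
   finally show "(\<integral>\<^sup>+p. ennreal ((norm (?\<Psi> p - block_process (bs m) p))^2) \<partial>PM) <= (\<E>\<^sup>+ w. (\<integral>\<^sup>+r\<in>{s..t}.
        ennreal ((norm (\<Phi> r w - elem_process (n m) (h m) (\<xi> m) r w))^2) \<partial>lborel))" .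
  qed
 qed simp
 moreover have "conv2 M (\<lambda>m. block_integral V (bs m)) J"
  using l2 unfolding conv2_def bi by simp
 moreover have "\<forall>m. \<forall>b\<in>set (bs m). valid s t b" using v by (intro allI)
 ultimately show ?thesis unfolding ito_def using \<Psi> J by (intro conjI exI[of _ bs])
qed

text \<open>On the common part the two integrands cancel. \<open>{a<..b}\<close> is the upper piece
  for the forward equation, whose integrals start at 0, and the lower piece for the backward
  equation, whose integrals end at \<open>T\<close>.\<close>

lemma ito_increment:
 assumes I: "ito s t (\<lambda>p. indicator {s<..t} (fst p) *\<^sub>R \<Phi> p) J"
  and I': "ito s' t' (\<lambda>p. indicator {s'<..t'} (fst p) *\<^sub>R \<Phi> p) J'"
  and st: "0 <= s" "s <= s'" "s' <= t'" "t' <= t" "t <= T"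
  and ab: "{s<..t} - {s'<..t'} = {a<..b}" "s <= a" "a <= b" "b <= t"
 shows "ito a b (\<lambda>p. indicator {a<..b} (fst p) *\<^sub>R \<Phi> p) (\<lambda>w. J w - J' w)"
proof -
 have "ito s t (\<lambda>p. indicator {s<..t} (fst p) *\<^sub>R \<Phi> p - indicator {s'<..t'} (fst p) *\<^sub>R \<Phi> p) (\<lambda>w. J w - J' w)"
  using st by (intro ito_diff[OF I ito_mono[OF I']]) auto
 moreover have "indicator {s<..t} (fst p) *\<^sub>R \<Phi> p - indicator {s'<..t'} (fst p) *\<^sub>R \<Phi> p = indicator {a<..b} (fst p) *\<^sub>R \<Phi> p" for p
  using st unfolding ab(1)[symmetric] by (auto simp: indicator_def)
 ultimately have "ito s t (\<lambda>p. indicator {a<..b} (fst p) *\<^sub>R \<Phi> p) (\<lambda>w. J w - J' w)" by simp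
 then show ?thesis by (rule ito_restrict) (use st ab in auto)
qed

end

text \<open>The norm of \<open>real^'n^'m\<close> is the Euclidean norm of all entries, so the bound
  is the Cauchy-Schwarz inequality in each row.\<close>

lemma norm_matrix_vector_mult:
 fixes A :: "real^'n^'m"
 shows "norm (A *v x) <= norm A * norm x"
proof -
 have "norm (A *v x) = L2_set (\<lambda>i. \<bar>(A *v x) $ i\<bar>) UNIV" by (simp add: norm_vec_def)
 also have "... <= L2_set (\<lambda>i. norm (A $ i) * norm x) UNIV"
  by (rule L2_set_mono) (auto simp: matrix_vector_mul_component Cauchy_Schwarz_ineq2)
 also have "... = norm A * norm x" by (simp add: norm_vec_def[of A] L2_set_left_distrib)
 finally show ?thesis .
qed

lemma norm_vector_matrix_mult:
 fixes A :: "real^'n^'m"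
 shows "norm (x v* A) <= norm x * norm A"
proof -
 have "(norm (x v* A))^2 = x \<bullet> (A *v (x v* A))"
  by (simp add: power2_norm_eq_inner dot_lmul_matrix)
 also have "... <= norm x * norm (A *v (x v* A))" by (rule norm_cauchy_schwarz)
 also have "... <= norm x * (norm A * norm (x v* A))"
  by (intro mult_left_mono norm_matrix_vector_mult) simp
 finally show ?thesis by (cases "x v* A = 0") (auto simp: power2_eq_square)
qed

section \<open>Bounds for functions of class \<open>C\<^sup>3\<^sub>b\<close>\<close>

lemma frechet_derivative_Basis:
 fixes f :: "'a::euclidean_space => 'b::real_normed_vector"
 assumes "f differentiable (at x)"
 shows "frechet_derivative f (at x) h = (\<Sum>e\<in>Basis. (h \<bullet> e) *\<^sub>R partials [e] f x)"
proof -
 interpret bounded_linear "frechet_derivative f (at x)"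
  using assms by (intro has_derivative_bounded_linear) (simp add: frechet_derivative_works)
 show ?thesis
  by (subst euclidean_representation[of h, symmetric]) (simp only: sum scaleR partials.simps)
qed

lemma norm_frechet_derivative_le:
 fixes f :: "'a::euclidean_space => 'b::real_normed_vector"
 assumes "f differentiable (at x)" "\<And>e. e \<in> Basis \<Longrightarrow> norm (partials [e] f x) <= K"
 shows "norm (frechet_derivative f (at x) h) <= real DIM('a) * K * norm h"
proof -
 have "norm (frechet_derivative f (at x) h) <= (\<Sum>e\<in>(Basis::'a set). norm h * K)"
  unfolding frechet_derivative_Basis[OF assms(1)]
 proof (rule sum_norm_le)
  fix e :: 'a assume e: "e \<in> Basis"
  show "norm ((h \<bullet> e) *\<^sub>R partials [e] f x) <= norm h * K"
   unfolding norm_scaleR using assms(2)[OF e] Basis_le_norm[OF e, of h] by (intro mult_mono) auto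
 qed
 then show ?thesis by (simp add: mult_ac)
qed

lemma lipschitz_of_partials:
 fixes f :: "'a::euclidean_space => 'b::real_normed_vector"
 assumes "\<And>x. f differentiable (at x)" "\<And>x e. e \<in> Basis \<Longrightarrow> norm (partials [e] f x) <= K"
 shows "norm (f x - f y) <= real DIM('a) * K * norm (x - y)"
proof (rule differentiable_bound[of UNIV])
 fix x :: 'a assume "x \<in> UNIV"
 show "(f has_derivative frechet_derivative f (at x)) (at x within UNIV)"
  using assms(1) by (simp add: frechet_derivative_works)
 show "onorm (frechet_derivative f (at x)) <= real DIM('a) * K"
  using norm_frechet_derivative_le[OF assms] by (intro onorm_le) auto
qed auto

text \<open>There are finitely many iterated partials, so one constant bounds them all. The second
  partials give the Lipschitz constant of the derivative, which in turn bounds the Taylor remainder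
  along the segment.\<close>

lemma class_Cb_3_bounds:
 fixes f :: "'a::euclidean_space => 'b::real_normed_vector"
 assumes "class_Cb 3 f"
 obtains K where "K \<ge> 0" "\<And>x. norm (f x) <= K"
  "\<And>x h. norm (frechet_derivative f (at x) h) <= K * norm h"
  "\<And>x y. norm (f x - f y) <= K * norm (x - y)"
  "\<And>x y. norm (f y - f x - frechet_derivative f (at x) (y - x)) <= K * (norm (y - x))^2"
  "\<And>x. linear (frechet_derivative f (at x))"
  "\<And>h. continuous_on UNIV (\<lambda>x. frechet_derivative f (at x) h)" "continuous_on UNIV f"
proof -
 let ?d = "real DIM('a)"
 have d: "\<And>x es. set es \<subseteq> Basis \<Longrightarrow> length es < 3 \<Longrightarrow> partials es f differentiable (at x)"
  and c: "\<And>es. set es \<subseteq> Basis \<Longrightarrow> length es <= 3 \<Longrightarrow> continuous_on UNIV (partials es f)"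
  and b: "\<And>es. set es \<subseteq> Basis \<Longrightarrow> length es <= 3 \<Longrightarrow> bounded (range (partials es f))"
  using assms unfolding class_Cb_def class_C_def by auto
 have d0: "f differentiable (at x)" for x using d[of "[]" x] by simp
 have b1: "\<exists>K. \<forall>x. \<forall>es\<in>{es. set es \<subseteq> Basis \<and> length es <= 3}. norm (partials es f x) <= K"
 proof -
  have fin: "finite {es::'a list. set es \<subseteq> Basis \<and> length es <= 3}"
   by (rule finite_lists_length_le) simp
  have "bounded (\<Union>es\<in>{es. set es \<subseteq> Basis \<and> length es <= 3}. range (partials es f))"
   using b by (intro bounded_UN fin) auto
  then obtain K where K: "\<forall>y\<in>(\<Union>es\<in>{es. set es \<subseteq> Basis \<and> length es <= 3}. range (partials es f)). norm y <= K"
   unfolding bounded_iff ..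
  show ?thesis by (intro exI[of _ K] allI ballI K[rule_format]) auto
 qed
 then obtain K where "\<forall>x. \<forall>es\<in>{es. set es \<subseteq> Basis \<and> length es <= 3}. norm (partials es f x) <= K" ..
 then have K: "norm (partials es f x) <= K" if "set es \<subseteq> Basis" "length es <= 3" for x es
  using that by simp
 have K0: "K \<ge> 0" using K[of "[]" 0] norm_ge_zero[of "f 0"] by (simp del: norm_ge_zero)
 have K1: "norm (partials [e] f x) <= K" if "e \<in> Basis" for x e using K[of "[e]" x] that by simp
 have lip: "norm (partials [e] f x - partials [e] f y) <= ?d * K * norm (x - y)" if "e \<in> Basis" for e x y
 proof (rule lipschitz_of_partials)
  show "partials [e] f differentiable (at x)" for x using d[of "[e]"] that by simp
  show "norm (partials [e'] (partials [e] f) x) <= K" if "e' \<in> Basis" for x e'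
   using K[of "[e', e]" x] that \<open>e \<in> Basis\<close> by simp
 qed
 have lin: "linear (frechet_derivative f (at x))" for x
  by (rule has_derivative_linear[OF iffD1[OF frechet_derivative_works d0]])
 have ld: "norm (frechet_derivative f (at x) h - frechet_derivative f (at y) h) <= ?d * (?d * K) * norm (x - y) * norm h" for x y h
 proof -
  have "norm (frechet_derivative f (at x) h - frechet_derivative f (at y) h) =
    norm (\<Sum>e\<in>Basis. (h \<bullet> e) *\<^sub>R (partials [e] f x - partials [e] f y))"
   unfolding frechet_derivative_Basis[OF d0] by (simp only: sum_subtractf scaleR_diff_right)
  also have "... <= (\<Sum>e\<in>(Basis::'a set). norm h * (?d * K * norm (x - y)))"
  proof (rule sum_norm_le)
   fix e :: 'a assume e: "e \<in> Basis"
   show "norm ((h \<bullet> e) *\<^sub>R (partials [e] f x - partials [e] f y)) <= norm h * (?d * K * norm (x - y))"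
    unfolding norm_scaleR using lip[OF e] Basis_le_norm[OF e, of h] by (intro mult_mono) auto
  qed
  finally show ?thesis by (simp add: mult_ac)
 qed
 have taylor: "norm (f y - f x - frechet_derivative f (at x) (y - x)) <= (?d * (?d * K)) * (norm (y - x))^2" for x y
 proof -
  have "norm (f y - f x - frechet_derivative f (at x) (y - x)) <= norm (y - x) * (?d * (?d * K) * norm (y - x))"
  proof (rule differentiable_bound_linearization[of x y "closed_segment x y" f "\<lambda>x. frechet_derivative f (at x)" x])
   show "x + t *\<^sub>R (y - x) \<in> closed_segment x y" if "t \<in> {0..1}" for t
    using that unfolding in_segment by (intro exI[of _ t]) (auto simp: algebra_simps)
   show "(f has_derivative frechet_derivative f (at z)) (at z within closed_segment x y)" for z
    by (rule has_derivative_at_withinI[OF iffD1[OF frechet_derivative_works d0]])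
   show "onorm (frechet_derivative f (at z) - frechet_derivative f (at x)) <= ?d * (?d * K) * norm (y - x)"
    if "z \<in> closed_segment x y" for z
   proof (rule onorm_le)
    fix h
    have "norm ((frechet_derivative f (at z) - frechet_derivative f (at x)) h) <= ?d * (?d * K) * norm (z - x) * norm h"
     using ld[of z h x] by simp
    also have "... <= ?d * (?d * K) * norm (y - x) * norm h"
     using segment_bound1[OF that] K0 by (intro mult_right_mono mult_left_mono) (auto simp: norm_minus_commute)
    finally show "norm ((frechet_derivative f (at z) - frechet_derivative f (at x)) h) <= ?d * (?d * K) * norm (y - x) * norm h" .
   qed
  qed simp
  then show ?thesis by (simp add: power2_eq_square mult_ac)
 qed
 define K' where "K' = K + ?d * K + ?d * (?d * K)"
 have K': "K <= K'" "?d * K <= K'" "?d * (?d * K) <= K'" "0 <= K'"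
  using K0 by (auto simp: K'_def)
 show thesis
 proof (rule that[of K'])
  show "norm (f x) <= K'" for x using K[of "[]" x] K' by simp
  show "norm (frechet_derivative f (at x) h) <= K' * norm h" for x h
   by (rule order_trans[OF norm_frechet_derivative_le[OF d0 K1] mult_right_mono[OF K'(2)]]) auto
  show "norm (f x - f y) <= K' * norm (x - y)" for x y
   by (rule order_trans[OF lipschitz_of_partials[OF d0 K1] mult_right_mono[OF K'(2)]]) auto
  show "norm (f y - f x - frechet_derivative f (at x) (y - x)) <= K' * (norm (y - x))^2" for x y
   by (rule order_trans[OF taylor mult_right_mono[OF K'(3)]]) auto
  show "continuous_on UNIV (\<lambda>x. frechet_derivative f (at x) h)" for h
   unfolding frechet_derivative_Basis[OF d0] using c[of "[_]"] by (intro continuous_intros) auto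
  show "continuous_on UNIV f" using c[of "[]"] by simp
 qed (use K' lin in auto)
qed

section \<open>Moments of Gaussian recursions\<close>

context two_brownian_motions
begin

text \<open>Adding all of \<open>B\<close> leaves the increments of \<open>W\<close> independent of
  the past and makes \<open>\<F> t t\<close>-measurable integrands adapted.\<close>

sublocale fwd: ito_direction M T "\<lambda>u v. \<F> u 0" W
proof
 show "(\<forall>u v u' v'. 0 <= u \<longrightarrow> u <= v \<longrightarrow> v <= u' \<longrightarrow> u' <= v' \<longrightarrow> v' <= T \<longrightarrow>
    sets (\<F> u 0) \<subseteq> sets (\<F> u' 0) \<and> (\<lambda>w. W v w - W u w) \<in> bm (\<F> u' 0)) \<or>
   (\<forall>u v u' v'. 0 <= u \<longrightarrow> u <= v \<longrightarrow> v <= u' \<longrightarrow> u' <= v' \<longrightarrow> v' <= T \<longrightarrow>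
    sets (\<F> u' 0) \<subseteq> sets (\<F> u 0) \<and> (\<lambda>w. W v' w - W u' w) \<in> bm (\<F> u 0))"
  by (intro disjI1 allI impI conjI info_mono measurable_info_W) auto
qed (fact bmW | rule space_info | (rule info_events; use T_pos in linarith) | (rule info_mono; simp) | (rule indep_W; assumption))+

text \<open>Time runs backwards: the sigma-algebras decrease in \<open>v\<close>, and
  \<open>order\<close> holds in its second form.\<close>

sublocale bwd: ito_direction M T "\<lambda>u v. \<F> T v" B
proof
 show "(\<forall>u v u' v'. 0 <= u \<longrightarrow> u <= v \<longrightarrow> v <= u' \<longrightarrow> u' <= v' \<longrightarrow> v' <= T \<longrightarrow>
    sets (\<F> T v) \<subseteq> sets (\<F> T v') \<and> (\<lambda>w. B v w - B u w) \<in> bm (\<F> T v')) \<or>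
   (\<forall>u v u' v'. 0 <= u \<longrightarrow> u <= v \<longrightarrow> v <= u' \<longrightarrow> u' <= v' \<longrightarrow> v' <= T \<longrightarrow>
    sets (\<F> T v') \<subseteq> sets (\<F> T v) \<and> (\<lambda>w. B v' w - B u' w) \<in> bm (\<F> T v))"
  by (intro disjI2 allI impI conjI info_mono measurable_info_B) auto
qed (fact bmB | rule space_info | (rule info_events; use T_pos in linarith) | (rule info_mono; simp) | (rule indep_B; assumption))+

end

lemma power_mult_le_sum:
 fixes x y :: real
 assumes "0 <= x" "0 <= y"
 shows "x ^ i * y ^ j <= x ^ (i + j) + y ^ (i + j)"
proof (cases "x <= y")
 case True
 then have "x ^ i * y ^ j <= y ^ i * y ^ j" using assms by (intro mult_right_mono power_mono) auto
 then show ?thesis using assms by (simp add: power_add add_increasing)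
next
 case False
 then have "x ^ i * y ^ j <= x ^ i * x ^ j" using assms by (intro mult_left_mono power_mono) auto
 then show ?thesis using assms by (simp add: power_add add_increasing2)
qed

lemma power_pred:
 fixes x :: real
 assumes "1 <= q"
 shows "x ^ (2 * q - 2) * x = x ^ (2 * q - 1)"
proof -
 have "2 * q - 1 = Suc (2 * q - 2)" using assms by arith
 then show ?thesis by (simp only: power_Suc2)
qed

lemma power_add_le: "0 <= x \<Longrightarrow> 0 <= y \<Longrightarrow> (x + y) ^ n <= 2 ^ n * (x ^ n + (y::real) ^ n)"
 using sum_power_le[of "{0::nat, 1}" "\<lambda>i. if i = 0 then x else y" n] by simp

lemma power_add3_le: "0 <= x \<Longrightarrow> 0 <= y \<Longrightarrow> 0 <= z \<Longrightarrow> (x + y + z) ^ n <= 3 ^ n * (x ^ n + y ^ n + (z::real) ^ n)"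
 using sum_power_le[of "{0::nat, 1, 2}" "\<lambda>i. if i = 0 then x else if i = 1 then y else z" n] by (simp add: add_ac)

text \<open>The term linear in \<open>y\<close> is kept exactly, because its martingale part will
  have expectation 0; everything else is of second order. With
  \<open>d = 2 (x \<bullet> y) + |y|^2\<close> in the binomial formula for
  \<open>(d + |x|^2)^q\<close>, each power with \<open>j >= 2\<close> is at most \<open>3^q\<close>
  times the bracket, and the binomial coefficients add up to \<open>2^q\<close>, hence
  \<open>6^q\<close>. The summand \<open>q\<close> comes from \<open>|y|^2\<close> in the term
  \<open>j = 1\<close>.\<close>

lemma norm_add_power_le:
 fixes x y :: "'b::real_inner"
 assumes q: "q \<ge> 1"
 shows "norm (x + y) ^ (2 * q) <= norm x ^ (2 * q) + 2 * real q * norm x ^ (2 * q - 2) * (x \<bullet> y)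
  + (6 ^ q + real q) * (norm x ^ (2 * q - 2) * (norm y)^2 + norm y ^ (2 * q))"
proof -
 define X Y where "X = norm x" "Y = norm y"
 define d where "d = 2 * (x \<bullet> y) + Y^2"
 have XY: "X \<ge> 0" "Y \<ge> 0" by (auto simp: X_Y_def)
 have "\<bar>x \<bullet> y\<bar> <= X * Y" unfolding X_Y_def by (rule Cauchy_Schwarz_ineq2)
 then have dle: "\<bar>d\<bar> <= 2 * (X * Y) + Y^2" unfolding d_def using zero_le_power2[of Y] by linarith
 have "(norm (x + y))^2 = d + X^2"
  by (simp add: power2_norm_eq_inner inner_add d_def X_Y_def inner_commute)
 then have eq: "norm (x + y) ^ (2 * q) = (d + X^2) ^ q" by (simp add: power_mult)
 let ?E = "X ^ (2 * q - 2) * Y^2 + Y ^ (2 * q)"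
 have E0: "?E \<ge> 0" using XY by simp
 have trm: "real (q choose j) * d ^ j * X\<^sup>2 ^ (q - j) <= real (q choose j) * (3 ^ q * ?E)" if j: "2 <= j" "j <= q" for j
 proof -
  have Xq: "X\<^sup>2 ^ (q - j) = X ^ (2 * q - 2 * j)" by (simp add: power_mult[symmetric] diff_mult_distrib2)
  have a1: "X ^ (2 * q - j) = X ^ j * X ^ (2 * q - 2 * j)"
   using power_add[of X j "2 * q - 2 * j"] j by simp
  have a2: "Y ^ j = Y^2 * Y ^ (j - 2)" unfolding power_add[of Y 2 "j - 2", symmetric] using j by (intro arg_cong[of _ _ "power Y"]) simp
  have a3: "X ^ (2 * q - 2) = X ^ (2 * q - j) * X ^ (j - 2)"
   unfolding power_add[of X "2 * q - j" "j - 2", symmetric] using j by (intro arg_cong[of _ _ "power X"]) simp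
  have "d ^ j * X\<^sup>2 ^ (q - j) <= \<bar>d\<bar> ^ j * X\<^sup>2 ^ (q - j)"
   by (intro mult_right_mono) (auto simp: power_abs[symmetric])
  also have "... <= 3 ^ j * ?E"
  proof (cases "Y <= X")
   case True
   then have "Y * Y <= X * Y" using XY by (intro mult_right_mono) auto
   then have "\<bar>d\<bar> <= 3 * (X * Y)" using dle by (simp add: power2_eq_square)
   then have "\<bar>d\<bar> ^ j * X\<^sup>2 ^ (q - j) <= (3 * (X * Y)) ^ j * X ^ (2 * q - 2 * j)"
    unfolding Xq using XY by (intro mult_right_mono power_mono) auto
   also have "... = 3 ^ j * (X ^ (2 * q - j) * (Y^2 * Y ^ (j - 2)))"
    unfolding power_mult_distrib a1 a2 by (simp only: mult_ac)
   also have "... <= 3 ^ j * (X ^ (2 * q - j) * (Y^2 * X ^ (j - 2)))"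
    using True XY by (intro mult_left_mono power_mono) auto
   also have "... = 3 ^ j * (X ^ (2 * q - 2) * Y^2)"
    unfolding a3 by (simp only: mult_ac)
   also have "... <= 3 ^ j * ?E" using XY by simp
   finally show ?thesis .
  next
   case False
   then have "X * Y <= Y * Y" using XY by (intro mult_right_mono) auto
   then have "\<bar>d\<bar> <= 3 * Y^2" using dle by (simp add: power2_eq_square)
   then have "\<bar>d\<bar> ^ j * X\<^sup>2 ^ (q - j) <= (3 * Y^2) ^ j * Y\<^sup>2 ^ (q - j)"
    using XY False by (intro mult_mono power_mono) auto
   also have "... = 3 ^ j * Y ^ (2 * q)"
    using j by (simp add: power_mult_distrib power_add[symmetric] power_mult)
   also have "... <= 3 ^ j * ?E" using XY by simp
   finally show ?thesis .
  qed
  also have "... <= 3 ^ q * ?E" using E0 j by (intro mult_right_mono power_increasing) auto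
  finally show ?thesis by (simp add: mult.assoc mult_left_mono)
 qed
 have "2 * (q - 1) = 2 * q - 2" by arith
 then have Xq1: "X\<^sup>2 ^ (q - 1) = X ^ (2 * q - 2)" unfolding power_mult[symmetric] by (rule arg_cong)
 have splt: "{..q} = insert 0 (insert 1 {2..q})" using q by auto
 have "(d + X^2) ^ q = (\<Sum>j\<le>q. real (q choose j) * d ^ j * X\<^sup>2 ^ (q - j))" by (rule binomial_ring)
 also have "... = X\<^sup>2 ^ q + real q * d * X\<^sup>2 ^ (q - 1) + (\<Sum>j\<in>{2..q}. real (q choose j) * d ^ j * X\<^sup>2 ^ (q - j))"
  unfolding splt by simp
 also have "(\<Sum>j\<in>{2..q}. real (q choose j) * d ^ j * X\<^sup>2 ^ (q - j)) <= (\<Sum>j\<in>{2..q}. real (q choose j) * (3 ^ q * ?E))"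
  using trm by (intro sum_mono) auto
 also have "... <= (\<Sum>j\<le>q. real (q choose j) * (3 ^ q * ?E))"
  using E0 by (intro sum_mono2) auto
 also have "... = 6 ^ q * ?E"
  unfolding sum_distrib_right[symmetric] of_nat_sum[symmetric] choose_row_sum
  by (simp add: power_mult_distrib[symmetric] mult.assoc[symmetric])
 also have "X\<^sup>2 ^ q + real q * d * X\<^sup>2 ^ (q - 1) + 6 ^ q * ?E =
   X ^ (2 * q) + 2 * real q * X ^ (2 * q - 2) * (x \<bullet> y) + real q * (X ^ (2 * q - 2) * Y^2) + 6 ^ q * ?E"
  unfolding Xq1 d_def by (simp add: power_mult[symmetric] algebra_simps)
 also have "... <= X ^ (2 * q) + 2 * real q * X ^ (2 * q - 2) * (x \<bullet> y) + (6 ^ q + real q) * ?E"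
  using XY by (simp add: distrib_right distrib_left)
 finally show ?thesis unfolding eq[symmetric] by (simp add: X_Y_def)
qed

text \<open>Adding \<open>d\<close> to \<open>a\<close> turns the affine recursion into a linear
  one, and \<open>1 + eps <= exp eps\<close>.\<close>

lemma gronwall_product:
 fixes a eps :: "nat => real"
 assumes "\<And>k. i <= k \<Longrightarrow> k < n \<Longrightarrow> a (Suc k) <= (1 + eps k) * a k + eps k * d"
  and "\<And>k. i <= k \<Longrightarrow> k < n \<Longrightarrow> 0 <= eps k" "0 <= d" "0 <= a i" "i <= n"
 shows "a n <= exp (\<Sum>k\<in>{i..<n}. eps k) * (a i + d)"
proof -
 have "a n + d <= exp (\<Sum>k\<in>{i..<n}. eps k) * (a i + d)"
  using \<open>i <= n\<close> assms(1,2)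
 proof (induction n rule: dec_induct)
  case (step k)
  have IH: "a k + d <= exp (\<Sum>k\<in>{i..<k}. eps k) * (a i + d)" using step by auto
  have e: "0 <= eps k" using step by auto
  have "a (Suc k) + d <= (1 + eps k) * (a k + d)" using step(4)[of k] step(1) by (simp add: algebra_simps)
  also have "... <= (1 + eps k) * (exp (\<Sum>k\<in>{i..<k}. eps k) * (a i + d))" using IH e by (intro mult_left_mono) auto
  also have "... <= exp (eps k) * (exp (\<Sum>k\<in>{i..<k}. eps k) * (a i + d))"
   using assms by (intro mult_right_mono exp_ge_add_one_self) (auto intro!: mult_nonneg_nonneg)
  also have "... = exp (\<Sum>k\<in>{i..<Suc k}. eps k) * (a i + d)"
   using step by (simp add: exp_add mult_ac)
  finally show ?case .
 qed simp
 then show ?thesis using assms(3) by simp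
qed

text \<open>\<open>fact (2 i) / (2^i fact i)\<close> is the moment of order \<open>2 i\<close> of a
  standard normal variable; the powers of the dimension come from summing over the components with
  \<open>sum_power_le\<close>.\<close>

definition gauss_moment :: "nat => nat => real" where
 "gauss_moment D i = real D ^ i * (real D * (fact (2 * i) / (2 ^ i * fact i)))"

lemma gauss_moment_nonneg: "0 <= gauss_moment D i" by (simp add: gauss_moment_def)

text \<open>The size of a drift-like error over a step of length \<open>dt <= h^2\<close> with Gaussian increment of norm
 \<open>w\<close>. The quartic term absorbs cubic ones: \<open>w\<^sup>3 <= h (w^2 + w\<^sup>4 / h^2)\<close>.\<close>

definition step_size :: "real => real => real => real" where
 "step_size h dt w = dt + w^2 + w ^ 4 / h^2"

lemma step_size_nonneg: "0 <= dt \<Longrightarrow> 0 <= step_size h dt w"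
 by (simp add: step_size_def)

text \<open>Compares the \<open>i\<close>-th moment of \<open>step_size\<close> with
  \<open>dt^i\<close>: the condition \<open>dt <= h^2\<close> makes the quartic term as small as the
  other two, and \<open>3^i\<close> splits the power of a sum of three.\<close>

definition step_const :: "nat => nat => real" where
 "step_const D i = 3 ^ i * (1 + gauss_moment D i + gauss_moment D (2 * i))"

lemma step_const_nonneg: "0 <= step_const D i" by (simp add: step_const_def gauss_moment_nonneg)

text \<open>The three groups come from pairing \<open>v\<close> with the drift-like part, from the
  quadratic term and from the power \<open>2 q\<close> in \<open>norm_add_power_le\<close>, each
  integrated over a Gaussian increment.\<close>

definition growth_const :: "nat => real => nat => real => real" where
 "growth_const D T q K = 2 * real q * K * sqrt T * step_const D 1 + (6 ^ q + real q) *
   (2 * K^2 * (gauss_moment D 1 + step_const D 2 * T) +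
   (2 * K) ^ (2 * q) * (gauss_moment D q + step_const D (2 * q) * T ^ q))"

lemma growth_const_nonneg: "0 <= K \<Longrightarrow> 0 <= T \<Longrightarrow> 0 <= growth_const D T q K"
 unfolding growth_const_def
 by (intro add_nonneg_nonneg mult_nonneg_nonneg step_const_nonneg gauss_moment_nonneg) auto

context two_brownian_motions
begin

lemma
 assumes "0 <= u" "u <= v" "v <= T"
 shows integrable_dW: "integrable M (\<lambda>w. norm (W v w - W u w) ^ (2 * i))"
  and expectation_dW: "(\<E> w. norm (W v w - W u w) ^ (2 * i)) <= gauss_moment CARD('d) i * (v - u) ^ i"
 using integrable_norm_increment[OF bmW assms] expectation_norm_increment[OF bmW assms] by (auto simp: gauss_moment_def)

lemma
 assumes uv: "0 <= u" "u <= v" "v <= T" and h: "0 < h" "v - u <= h^2"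
 shows integrable_step_size: "integrable M (\<lambda>w. step_size h (v - u) (norm (W v w - W u w)) ^ i)"
  and expectation_step_size: "(\<E> w. step_size h (v - u) (norm (W v w - W u w)) ^ i) <= step_const CARD('d) i * (v - u) ^ i"
proof -
 let ?D = "v - u" and ?w = "\<lambda>w. norm (W v w - W u w)" and ?k = "gauss_moment CARD('d)"
 have [measurable]: "W u \<in> bm M" "W v \<in> bm M" using uv by (auto intro: W_measurable)
 let ?b = "\<lambda>w. 3 ^ i * (?D ^ i + ?w w ^ (2 * i) + ?w w ^ (2 * (2 * i)) / h ^ (2 * i))"
 have ib: "integrable M ?b"
  by (intro integrable_mult_right Bochner_Integration.integrable_add integrable_const integrable_divide integrable_dW[OF uv])
 have le: "step_size h ?D (?w w) ^ i <= ?b w" for w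
  using power_add3_le[of ?D "(?w w)^2" "?w w ^ 4 / h^2" i] uv
  by (simp add: step_size_def power_divide power_mult[symmetric] mult_ac)
 have nn: "0 <= step_size h ?D (?w w) ^ i" for w using uv by (simp add: step_size_nonneg)
 show 1: "integrable M (\<lambda>w. step_size h ?D (?w w) ^ i)"
 proof (rule Bochner_Integration.integrable_bound[OF ib])
  show "AE w in M. norm (step_size h ?D (?w w) ^ i) <= norm (?b w)"
   unfolding real_norm_def abs_of_nonneg[OF nn] by (intro AE_I2 order_trans[OF le abs_ge_self])
 qed (simp add: step_size_def)
 have "(\<E> w. step_size h ?D (?w w) ^ i) <= (\<E> w. ?b w)" by (intro integral_mono 1 ib le)
 also have "... = 3 ^ i * (?D ^ i + (\<E> w. ?w w ^ (2 * i)) + (\<E> w. ?w w ^ (2 * (2 * i))) / h ^ (2 * i))"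
  using integrable_dW[OF uv, of i] integrable_dW[OF uv, of "2 * i"] by (simp add: prob_space)
 also have "... <= 3 ^ i * (?D ^ i + ?k i * ?D ^ i + ?k (2 * i) * ?D ^ (2 * i) / h ^ (2 * i))"
  using expectation_dW[OF uv, of i] expectation_dW[OF uv, of "2 * i"] h
  by (intro mult_left_mono add_mono divide_right_mono) auto
 also have "?k (2 * i) * ?D ^ (2 * i) / h ^ (2 * i) = ?k (2 * i) * ?D ^ i * (?D / h^2) ^ i"
  by (simp add: power_divide power_mult power2_eq_square power_mult_distrib)
 also have "3 ^ i * (?D ^ i + ?k i * ?D ^ i + ?k (2 * i) * ?D ^ i * (?D / h^2) ^ i) \<le>
   3 ^ i * (?D ^ i + ?k i * ?D ^ i + ?k (2 * i) * ?D ^ i * 1)"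
  using h uv gauss_moment_nonneg by (intro mult_left_mono add_mono power_le_one) auto
 finally show "(\<E> w. step_size h ?D (?w w) ^ i) <= step_const CARD('d) i * ?D ^ i"
  by (simp add: step_const_def algebra_simps)
qed

text \<open>\<open>m\<close> is the martingale part of the step and \<open>g\<close> its part of
  drift size, both controlled by \<open>c\<close>. The free length \<open>S\<close> sets the scale:
  comparing \<open>|v|\<close> with \<open>sqrt S\<close> times \<open>c\<close> makes the growth
  rate \<open>(b - a) / S\<close> and lets \<open>c\<close> contribute with the factor
  \<open>S^q\<close>. Over an interval of length at most \<open>S\<close> the rates add up to at
  most a constant, which is how increments of order \<open>S^q\<close> arise.\<close>

lemma growth_step:
 fixes v m g :: "'w => 'b::euclidean_space" and \<zeta> :: "'w => real^'d"
 assumes ab: "0 <= a" "a <= b" "b <= T" and S: "b - a <= S" "0 < S" "S <= T"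
  and h: "0 < h" "b - a <= h^2" and q: "q \<ge> 1" and K: "K \<ge> 0"
  and v: "v \<in> bm (\<F> a 0)" and c: "c \<in> bm (\<F> a 0)"
  and \<zeta>: "\<zeta> \<in> bm (\<F> a 0)"
  and [measurable]: "m \<in> bm M" "g \<in> bm M"
  and c0: "\<And>w. 0 <= c w" and vm: "\<And>w. v w \<bullet> m w = \<zeta> w \<bullet> (W b w - W a w)"
  and \<zeta>b: "\<And>w. norm (\<zeta> w) <= K * c w * norm (v w)"
  and mb: "\<And>w. norm (m w) <= K * c w * norm (W b w - W a w)"
  and gb: "\<And>w. norm (g w) <= K * c w * step_size h (b - a) (norm (W b w - W a w))"
  and iv: "integrable M (\<lambda>w. norm (v w) ^ (2 * q))" and ic: "integrable M (\<lambda>w. c w ^ (2 * q))"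
 shows "integrable M (\<lambda>w. norm (v w + (m w + g w)) ^ (2 * q))"
  and "(\<E> w. norm (v w + (m w + g w)) ^ (2 * q)) \<le>
   (1 + growth_const CARD('d) T q K * ((b - a) / S)) * (\<E> w. norm (v w) ^ (2 * q)) +
   growth_const CARD('d) T q K * ((b - a) / S) * (S ^ q * (\<E> w. c w ^ (2 * q)))"
proof -
 have bT: "a <= T" using ab by simp
 have [measurable]: "v \<in> bm M" "c \<in> bm M" "\<zeta> \<in> bm M"
  using measurable_info_events[OF _ bT order_refl] v c \<zeta> by blast+
 have Wm [measurable]: "W a \<in> bm M" "W b \<in> bm M" using ab by (auto intro: W_measurable)
 let ?D = "b - a" and ?dW = "\<lambda>w. W b w - W a w"
 let ?w = "\<lambda>w. norm (?dW w)" and ?th = "\<lambda>w. step_size h ?D (norm (?dW w))"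
 let ?k = "gauss_moment CARD('d)" and ?t = "step_const CARD('d)"
 let ?cq = "6 ^ q + real q"
 define X where "X w = norm (v w)" for w
 \<comment> \<open>\<open>H\<close> is known at time \<open>a\<close> and \<open>ch\<close> is
   evaluated at the increment alone, so the remainder \<open>H w * ch (?dW w)\<close> factorizes
   under the expectation.\<close>
 define H where "H w = norm (v w) ^ (2 * q) + S ^ q * c w ^ (2 * q)" for w
 define ch where "ch d = 2 * real q * K * (step_size h ?D (norm d) / sqrt S) +
   ?cq * (2 * K^2 * ((norm d ^ (2 * 1) + step_size h ?D (norm d) ^ 2) / S) +
   (2 * K) ^ (2 * q) * ((norm d ^ (2 * q) + step_size h ?D (norm d) ^ (2 * q)) / S ^ q))" for d :: "real^'d"
 have th0: "0 <= ?th w" for w using ab by (simp add: step_size_nonneg)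
 have H0: "0 <= H w" for w using S c0[of w] by (simp add: H_def)
 have iH: "integrable M H" unfolding H_def using iv ic by simp
 have mH: "H \<in> bm (\<F> a 0)" unfolding H_def using v c by measurable
 have mch: "ch \<in> bm borel" unfolding ch_def step_size_def by measurable
 note idW = integrable_dW[OF ab] integrable_step_size[OF ab h]
 have ich: "integrable M (\<lambda>w. ch (?dW w))" unfolding ch_def using idW(2)[of 1]
  by (intro Bochner_Integration.integrable_add integrable_mult_right integrable_divide idW) auto
 have ech: "(\<E> w. ch (?dW w)) <= growth_const CARD('d) T q K * (?D / S)"
 proof -
  have D: "0 <= ?D" "?D <= T" "?D / S <= 1" "0 <= ?D / S" using ab S by auto
  have aux2: "(k * D ^ 1 + t * D ^ 2) / S = (k + t * D) * (D / S)" for k t D :: real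
   by (simp add: power2_eq_square distrib_right add_divide_distrib)
  have aux3: "(k * D ^ q + t * D ^ (2 * q)) / S ^ q = (k + t * D ^ q) * (D / S) ^ q" for k t D :: real
   by (simp add: mult_2 power_add power_divide distrib_right add_divide_distrib)
  have "(\<E> w. ch (?dW w)) = 2 * real q * K * ((\<E> w. ?th w ^ 1) / sqrt S) +
   ?cq * (2 * K^2 * (((\<E> w. ?w w ^ (2 * 1)) + (\<E> w. ?th w ^ 2)) / S) +
   (2 * K) ^ (2 * q) * (((\<E> w. ?w w ^ (2 * q)) + (\<E> w. ?th w ^ (2 * q))) / S ^ q))"
   unfolding ch_def
   using idW(1)[of 1] idW(1)[of q] idW(2)[of 1] idW(2)[of 2] idW(2)[of "2 * q"] by simp
  also have "... <= 2 * real q * K * ((?t 1 * ?D ^ 1) / sqrt S) +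
   ?cq * (2 * K^2 * ((?k 1 * ?D ^ 1 + ?t 2 * ?D ^ 2) / S) +
   (2 * K) ^ (2 * q) * ((?k q * ?D ^ q + ?t (2 * q) * ?D ^ (2 * q)) / S ^ q))"
   using S K by (intro add_mono mult_left_mono divide_right_mono expectation_dW[OF ab] expectation_step_size[OF ab h]) auto
  also have "... <= 2 * real q * K * (sqrt T * ?t 1 * (?D / S)) +
   ?cq * (2 * K^2 * ((?k 1 + ?t 2 * T) * (?D / S)) +
   (2 * K) ^ (2 * q) * ((?k q + ?t (2 * q) * T ^ q) * (?D / S)))"
  proof -
   obtain r where r: "r > 0" "S = r * r" "sqrt S = r" using S by (metis real_sqrt_gt_zero real_sqrt_mult_self abs_of_pos)
   have "(?t 1 * ?D ^ 1) / sqrt S = sqrt S * ?t 1 * (?D / S)"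
    unfolding r using r(1) by (simp add: field_simps)
   also have "... <= sqrt T * ?t 1 * (?D / S)"
    using S D step_const_nonneg by (intro mult_right_mono) auto
   finally have 1: "(?t 1 * ?D ^ 1) / sqrt S <= sqrt T * ?t 1 * (?D / S)" .
   have "(?k 1 * ?D ^ 1 + ?t 2 * ?D ^ 2) / S = (?k 1 + ?t 2 * ?D) * (?D / S)" by (rule aux2)
   also have "... <= (?k 1 + ?t 2 * T) * (?D / S)"
    using D step_const_nonneg by (intro mult_right_mono add_left_mono mult_left_mono) auto
   finally have 2: "(?k 1 * ?D ^ 1 + ?t 2 * ?D ^ 2) / S <= (?k 1 + ?t 2 * T) * (?D / S)" .
   have "(?k q * ?D ^ q + ?t (2 * q) * ?D ^ (2 * q)) / S ^ q = (?k q + ?t (2 * q) * ?D ^ q) * (?D / S) ^ q"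
    by (rule aux3)
   \<comment> \<open>As \<open>?D / S <= 1\<close> and \<open>q >= 1\<close>, the power is lowered
     to 1, the order at which the rates of consecutive steps can be added.\<close>
   also have "... <= (?k q + ?t (2 * q) * T ^ q) * (?D / S) ^ 1"
    using D q by (intro mult_mono add_left_mono mult_left_mono power_mono power_decreasing add_nonneg_nonneg mult_nonneg_nonneg
      step_const_nonneg gauss_moment_nonneg) auto
   finally have 3: "(?k q * ?D ^ q + ?t (2 * q) * ?D ^ (2 * q)) / S ^ q <= (?k q + ?t (2 * q) * T ^ q) * (?D / S)" by simp
   show ?thesis using 1 2 3 K by (intro add_mono mult_left_mono) auto
  qed
  also have "... = growth_const CARD('d) T q K * (?D / S)"
   unfolding growth_const_def by (simp only: distrib_right distrib_left mult_ac)
  finally show ?thesis .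
 qed
 have pw: "norm (v w + (m w + g w)) ^ (2 * q) \<le>
   X w ^ (2 * q) + 2 * real q * X w ^ (2 * q - 2) * (\<zeta> w \<bullet> ?dW w) + H w * ch (?dW w)" for w
 proof -
  define s where "s = sqrt S * c w"
  have s: "0 <= s" "0 <= X w" using S c0 by (auto simp: s_def X_def)
  have Hs: "H w = X w ^ (2 * q) + s ^ (2 * q)"
   using S by (simp add: H_def X_def s_def power_mult_distrib power_mult)
  have cs: "c w = s / sqrt S" using S by (simp add: s_def)
  let ?y = "m w + g w"
  have y1: "norm ?y <= K * c w * (?w w + ?th w)"
   using norm_triangle_ineq[of "m w" "g w"] mb[of w] gb[of w] by (simp add: distrib_left)
  have y2: "norm ?y ^ n <= K ^ n * c w ^ n * (2 ^ n * (?w w ^ n + ?th w ^ n))" for n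
  proof -
   have "norm ?y ^ n <= (K * c w * (?w w + ?th w)) ^ n" using y1 by (intro power_mono) auto
   also have "... = K ^ n * c w ^ n * (?w w + ?th w) ^ n" by (simp add: power_mult_distrib)
   also have "... <= K ^ n * c w ^ n * (2 ^ n * (?w w ^ n + ?th w ^ n))"
    using K c0 th0 by (intro mult_left_mono power_add_le) auto
   finally show ?thesis .
  qed
  have "v w \<bullet> ?y <= \<zeta> w \<bullet> ?dW w + X w * (K * c w * ?th w)"
   unfolding inner_add_right vm X_def
   using norm_cauchy_schwarz[of "v w" "g w"] mult_left_mono[OF gb[of w], of "norm (v w)"] by simp
  then have i1: "2 * real q * X w ^ (2 * q - 2) * (v w \<bullet> ?y) <= 2 * real q * X w ^ (2 * q - 2) * (\<zeta> w \<bullet> ?dW w)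
    + 2 * real q * X w ^ (2 * q - 2) * (X w * (K * c w * ?th w))"
   using s by (simp only: distrib_left[symmetric]) (intro mult_left_mono, auto)
  have e1: "X w ^ (2 * q - 2) * X w = X w ^ (2 * q - 1)" by (rule power_pred[OF q])
  have "2 * real q * X w ^ (2 * q - 2) * (X w * (K * c w * ?th w)) =
    (2 * real q * K * (?th w / sqrt S)) * (X w ^ (2 * q - 1) * s ^ 1)"
   unfolding e1[symmetric] cs by simp
  also have "... <= (2 * real q * K * (?th w / sqrt S)) * H w"
   using power_mult_le_sum[OF s(2,1), of "2 * q - 1" 1] q K th0 S Hs by (intro mult_left_mono) auto
  finally have i2: "2 * real q * X w ^ (2 * q - 2) * (X w * (K * c w * ?th w)) <= (2 * real q * K * (?th w / sqrt S)) * H w" .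
  have sq: "sqrt S ^ 2 = S" "sqrt S ^ (2 * q) = S ^ q" using S by (auto simp: power_mult)
  have "2 * q - 2 + 2 = 2 * q" using q by arith
  then have h2: "X w ^ (2 * q - 2) * s ^ 2 <= H w"
   using power_mult_le_sum[OF s(2,1), of "2 * q - 2" 2] Hs by metis
  have "(norm ?y)^2 <= (K * c w * (?w w + ?th w))^2" using y1 by (intro power_mono) auto
  also have "... = K^2 * (c w)^2 * (?w w + ?th w)^2" by (simp add: power_mult_distrib)
  also have "... <= K^2 * (c w)^2 * (2 * (?w w)^2 + 2 * (?th w)^2)"
   by (intro mult_left_mono square_add_le) auto
  also have "... = s^2 * (2 * K^2 * ((?w w ^ (2 * 1) + ?th w ^ 2) / S))"
   unfolding s_def power_mult_distrib sq using S by (simp add: field_simps power2_eq_square)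
  finally have "X w ^ (2 * q - 2) * (norm ?y)^2 <= X w ^ (2 * q - 2) * (s^2 * (2 * K^2 * ((?w w ^ (2 * 1) + ?th w ^ 2) / S)))"
   using s by (intro mult_left_mono) auto
  also have "... = (2 * K^2 * ((?w w ^ (2 * 1) + ?th w ^ 2) / S)) * (X w ^ (2 * q - 2) * s ^ 2)" by simp
  also have "... <= (2 * K^2 * ((?w w ^ (2 * 1) + ?th w ^ 2) / S)) * H w"
   using h2 K S by (intro mult_left_mono) auto
  finally have i3: "X w ^ (2 * q - 2) * (norm ?y)^2 <= (2 * K^2 * ((?w w ^ (2 * 1) + ?th w ^ 2) / S)) * H w" .
  have "norm ?y ^ (2 * q) <= s ^ (2 * q) * ((2 * K) ^ (2 * q) * ((?w w ^ (2 * q) + ?th w ^ (2 * q)) / S ^ q))"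
  proof -
   have "K ^ (2 * q) * c w ^ (2 * q) * (2 ^ (2 * q) * E) = s ^ (2 * q) * ((2 * K) ^ (2 * q) * (E / S ^ q))" for E
    unfolding s_def power_mult_distrib sq using S by simp
   then show ?thesis using y2[of "2 * q"] by simp
  qed
  also have "... <= H w * ((2 * K) ^ (2 * q) * ((?w w ^ (2 * q) + ?th w ^ (2 * q)) / S ^ q))"
   using K S th0 Hs s by (intro mult_right_mono mult_nonneg_nonneg divide_nonneg_nonneg add_nonneg_nonneg) auto
  finally have i4: "norm ?y ^ (2 * q) <= ((2 * K) ^ (2 * q) * ((?w w ^ (2 * q) + ?th w ^ (2 * q)) / S ^ q)) * H w" by (simp only: mult.commute)
  have "norm (v w + ?y) ^ (2 * q) <= X w ^ (2 * q) + 2 * real q * X w ^ (2 * q - 2) * (v w \<bullet> ?y) +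
    ?cq * (X w ^ (2 * q - 2) * (norm ?y)^2 + norm ?y ^ (2 * q))"
   unfolding X_def by (rule norm_add_power_le[OF q])
  also have "... <= X w ^ (2 * q) + (2 * real q * X w ^ (2 * q - 2) * (\<zeta> w \<bullet> ?dW w) + (2 * real q * K * (?th w / sqrt S)) * H w) +
    ?cq * ((2 * K^2 * ((?w w ^ (2 * 1) + ?th w ^ 2) / S)) * H w + ((2 * K) ^ (2 * q) * ((?w w ^ (2 * q) + ?th w ^ (2 * q)) / S ^ q)) * H w)"
   using i1 i2 i3 i4 by (intro add_mono mult_left_mono order_refl) auto
  also have "... = X w ^ (2 * q) + 2 * real q * X w ^ (2 * q - 2) * (\<zeta> w \<bullet> ?dW w) + H w * ch (?dW w)"
   unfolding ch_def by (simp only: distrib_left distrib_right mult_ac add_ac)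
  finally show ?thesis .
 qed
 note hc = fwd.indep_increment[OF ab mH iH mch ich]
 \<comment> \<open>The coefficient of the first-order term is unbounded; its integrability is what
   allows \<open>block_mean\<close> to remove that term.\<close>
 have z: "integrable M (\<lambda>w. (X w ^ (2 * q - 2) *\<^sub>R \<zeta> w) \<bullet> ?dW w)" "(\<E> w. (X w ^ (2 * q - 2) *\<^sub>R \<zeta> w) \<bullet> ?dW w) = 0"
 proof -
  have mz: "(\<lambda>w. X w ^ (2 * q - 2) *\<^sub>R \<zeta> w) \<in> bm (\<F> a 0)"
   unfolding X_def using v \<zeta> by measurable
  have nz: "norm (X w ^ (2 * q - 2) *\<^sub>R \<zeta> w) <= K * (norm (v w) ^ (2 * q) + c w ^ (2 * q))" for w
  proof -
   have "norm (X w ^ (2 * q - 2) *\<^sub>R \<zeta> w) <= X w ^ (2 * q - 2) * (K * c w * X w)"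
    using \<zeta>b[of w] by (simp add: X_def mult_left_mono)
   also have "... = K * (X w ^ (2 * q - 1) * c w ^ 1)"
    using power_pred[OF q, of "X w"] by simp
   also have "... <= K * (X w ^ (2 * q) + c w ^ (2 * q))"
    using power_mult_le_sum[of "X w" "c w" "2 * q - 1" 1] q K c0 by (intro mult_left_mono) (auto simp: X_def)
   finally show ?thesis by (simp add: X_def)
  qed
  have iz: "integrable M (\<lambda>w. X w ^ (2 * q - 2) *\<^sub>R \<zeta> w \<bullet> e)" if e: "e \<in> Basis" for e
  proof (rule Bochner_Integration.integrable_bound[where f="\<lambda>w. K * (norm (v w) ^ (2 * q) + c w ^ (2 * q))"])
   show "integrable M (\<lambda>w. K * (norm (v w) ^ (2 * q) + c w ^ (2 * q)))" using iv ic by simp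
   show "AE w in M. norm (X w ^ (2 * q - 2) *\<^sub>R \<zeta> w \<bullet> e) <= norm (K * (norm (v w) ^ (2 * q) + c w ^ (2 * q)))"
   proof (rule AE_I2)
    fix w
    show "norm (X w ^ (2 * q - 2) *\<^sub>R \<zeta> w \<bullet> e) <= norm (K * (norm (v w) ^ (2 * q) + c w ^ (2 * q)))"
     using order_trans[OF Basis_le_norm[OF e] nz[of w]] by (metis abs_ge_self order_trans real_norm_def)
   qed
  qed (simp add: X_def)
  show "(\<E> w. (X w ^ (2 * q - 2) *\<^sub>R \<zeta> w) \<bullet> ?dW w) = 0" by (rule fwd.block_mean[OF ab mz iz])
  have "integrable M (\<lambda>w. (X w ^ (2 * q - 2) *\<^sub>R \<zeta> w \<bullet> e) * (?dW w \<bullet> e))" if e: "e \<in> Basis" for e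
   using fwd.indep_increment(1)[OF ab borel_measurable_inner[OF mz borel_measurable_const] iz[OF e], of "\<lambda>x. x \<bullet> e"]
    fwd.integrable_component_increment[OF ab e] by simp
  then show "integrable M (\<lambda>w. (X w ^ (2 * q - 2) *\<^sub>R \<zeta> w) \<bullet> ?dW w)"
   by (subst euclidean_inner) (intro Bochner_Integration.integrable_sum)
 qed
 define bd where "bd w = norm (v w) ^ (2 * q) + 2 * real q * ((X w ^ (2 * q - 2) *\<^sub>R \<zeta> w) \<bullet> ?dW w) + H w * ch (?dW w)" for w
 have ibd: "integrable M bd" unfolding bd_def by (intro Bochner_Integration.integrable_add integrable_mult_right iv z hc)
 have pw': "norm (v w + (m w + g w)) ^ (2 * q) <= bd w" for w
  using pw[of w] by (simp add: bd_def X_def)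
 show i: "integrable M (\<lambda>w. norm (v w + (m w + g w)) ^ (2 * q))"
  by (rule Bochner_Integration.integrable_bound[OF ibd]) (auto intro!: order_trans[OF pw' abs_ge_self])
 have "(\<E> w. norm (v w + (m w + g w)) ^ (2 * q)) <= (\<E> w. bd w)"
  by (intro integral_mono i ibd pw')
 also have "... = (\<E> w. norm (v w) ^ (2 * q)) + (\<E> w. H w) * (\<E> w. ch (?dW w))"
  unfolding bd_def using iv z hc by simp
 also have "... <= (\<E> w. norm (v w) ^ (2 * q)) + (\<E> w. H w) * (growth_const CARD('d) T q K * (?D / S))"
  using H0 by (intro add_left_mono mult_left_mono ech integral_nonneg_AE AE_I2) auto
 also have "(\<E> w. H w) = (\<E> w. norm (v w) ^ (2 * q)) + S ^ q * (\<E> w. c w ^ (2 * q))"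
  unfolding H_def using iv ic by simp
 finally show "(\<E> w. norm (v w + (m w + g w)) ^ (2 * q)) \<le>
   (1 + growth_const CARD('d) T q K * ((b - a) / S)) * (\<E> w. norm (v w) ^ (2 * q)) +
   growth_const CARD('d) T q K * ((b - a) / S) * (S ^ q * (\<E> w. c w ^ (2 * q)))"
  by (simp add: algebra_simps)
qed

end

section \<open>The Euler scheme and its inverse flow\<close>

lemma bounded_bilinear_matrix_vector_mult:
 "bounded_bilinear ((*v) :: real^'n^'m => real^'n => real^'m)"
proof
 show "\<exists>K. \<forall>A x. norm ((A :: real^'n^'m) *v x) <= norm A * norm x * K"
  using norm_matrix_vector_mult by (intro exI[of _ 1]) auto
qed (simp_all add: matrix_vector_mult_add_rdistrib matrix_vector_right_distrib matrix_vector_mult_scaleR scaleR_matrix_vector_assoc)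

lemma bounded_bilinear_vector_matrix_mult:
 "bounded_bilinear ((v*) :: real^'m => real^'n^'m => real^'n)"
proof
 show "\<exists>K. \<forall>x A. norm ((x :: real^'m) v* (A :: real^'n^'m)) <= norm x * norm A * K"
  using norm_vector_matrix_mult by (intro exI[of _ 1]) auto
qed (simp_all add: vec_eq_iff vector_matrix_mult_def algebra_simps sum.distrib sum_distrib_left)

lemma measurable_matrix_vector_mult [measurable (raw)]:
 fixes A :: "'a => real^'n^'m"
 assumes "A \<in> bm N" "x \<in> bm N"
 shows "(\<lambda>w. A w *v x w) \<in> bm N"
 by (rule borel_measurable_continuous_Pair[OF assms bounded_bilinear.continuous_on[OF bounded_bilinear_matrix_vector_mult
  continuous_on_fst[OF continuous_on_id] continuous_on_snd[OF continuous_on_id]]])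

lemma measurable_vector_matrix_mult [measurable (raw)]:
 fixes A :: "'a => real^'n^'m"
 assumes "x \<in> bm N" "A \<in> bm N"
 shows "(\<lambda>w. x w v* A w) \<in> bm N"
 by (rule borel_measurable_continuous_Pair[OF assms bounded_bilinear.continuous_on[OF bounded_bilinear_vector_matrix_mult
  continuous_on_fst[OF continuous_on_id] continuous_on_snd[OF continuous_on_id]]])

lemma measurable_vec_nth [measurable (raw)]:
 fixes f :: "'a => 'b::euclidean_space^'n"
 shows "f \<in> bm N \<Longrightarrow> (\<lambda>x. f x $ j) \<in> bm N"
 by (rule measurable_compose[OF _ borel_measurable_continuous_onI]) (auto intro!: continuous_intros)

lemma measurable_vec_lambda:
 fixes f :: "'a => 'n::finite => 'b::euclidean_space"
 assumes "\<And>j. (\<lambda>x. f x j) \<in> bm N"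
 shows "(\<lambda>x. \<chi> j. f x j) \<in> bm N"
proof (subst borel_measurable_euclidean_space, intro ballI)
 fix i :: "'b^'n" assume "i \<in> Basis"
 then obtain j u where "i = axis j u" by (auto simp: Basis_vec_def)
 then show "(\<lambda>x. (\<chi> j. f x j) \<bullet> i) \<in> bm N" using assms by (simp add: inner_axis)
qed

context two_brownian_motions
begin

definition grid :: "(nat => real) => nat => bool" where
 "grid p n \<longleftrightarrow> 0 <= p 0 \<and> (\<forall>k<n. p k <= p (Suc k)) \<and> p n <= T"

lemma grid_mono: "grid p n \<Longrightarrow> i <= j \<Longrightarrow> j <= n \<Longrightarrow> p i <= p j"
proof (rotate_tac, induction j rule: dec_induct)
 case (step k)
 then have "p k <= p (Suc k)" by (auto simp: grid_def)
 then show ?case using step by auto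
qed simp

lemma grid_bounds: "grid p n \<Longrightarrow> k <= n \<Longrightarrow> 0 <= p k \<and> p k <= T"
 using grid_mono[of p n 0 k] grid_mono[of p n k n] by (auto simp: grid_def)

text \<open>\<open>A\<close> and \<open>C\<close> describe how the multiplier \<open>c\<close>
  depends on \<open>v\<close>: \<open>A = 0\<close> if its moments are known beforehand,
  \<open>A = 1\<close> and \<open>C = 0\<close> if it is \<open>|v|\<close> itself. The normalized
  steps \<open>(p (Suc k) - p k) / S\<close> add up to at most 1, so the exponential does not depend
  on the grid. Integrability is carried through the induction, since \<open>ic\<close> presupposes
  it.\<close>

lemma growth_chain_aux:
 fixes v m g :: "nat => 'w => 'b::euclidean_space" and \<zeta> :: "nat => 'w => real^'d"
 assumes gr: "grid p n" and i: "i <= n" and S: "p n - p i <= S" "0 < S" "S <= T"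
  and h: "0 < h" "\<And>k. k < n \<Longrightarrow> p (Suc k) - p k <= h^2" and q: "q \<ge> 1" and K: "K \<ge> 0"
  and mv: "\<And>k. i <= k \<Longrightarrow> k < n \<Longrightarrow> v k \<in> bm (\<F> (p k) 0)"
  and mc: "\<And>k. i <= k \<Longrightarrow> k < n \<Longrightarrow> c k \<in> bm (\<F> (p k) 0)"
  and mz: "\<And>k. i <= k \<Longrightarrow> k < n \<Longrightarrow> \<zeta> k \<in> bm (\<F> (p k) 0)"
  and mm: "\<And>k. i <= k \<Longrightarrow> k < n \<Longrightarrow> m k \<in> bm M"
  and mg: "\<And>k. i <= k \<Longrightarrow> k < n \<Longrightarrow> g k \<in> bm M"
  and c0: "\<And>k w. 0 <= c k w"
  and vS: "\<And>k w. i <= k \<Longrightarrow> k < n \<Longrightarrow> v (Suc k) w = v k w + (m k w + g k w)"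
  and vm: "\<And>k w. i <= k \<Longrightarrow> k < n \<Longrightarrow> v k w \<bullet> m k w = \<zeta> k w \<bullet> (W (p (Suc k)) w - W (p k) w)"
  and zb: "\<And>k w. i <= k \<Longrightarrow> k < n \<Longrightarrow> norm (\<zeta> k w) <= K * c k w * norm (v k w)"
  and mb: "\<And>k w. i <= k \<Longrightarrow> k < n \<Longrightarrow> norm (m k w) <= K * c k w * norm (W (p (Suc k)) w - W (p k) w)"
  and gb: "\<And>k w. i <= k \<Longrightarrow> k < n \<Longrightarrow> norm (g k w) <= K * c k w *
   step_size h (p (Suc k) - p k) (norm (W (p (Suc k)) w - W (p k) w))"
  and iv: "integrable M (\<lambda>w. norm (v i w) ^ (2 * q))"
  and ic: "\<And>k. i <= k \<Longrightarrow> k < n \<Longrightarrow> integrable M (\<lambda>w. norm (v k w) ^ (2 * q)) \<Longrightarrow>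
   integrable M (\<lambda>w. c k w ^ (2 * q)) \<and> (\<E> w. c k w ^ (2 * q)) <= A * (\<E> w. norm (v k w) ^ (2 * q)) + C"
  and A: "0 <= A" "0 <= C"
 shows "integrable M (\<lambda>w. norm (v n w) ^ (2 * q)) \<and>
  (\<E> w. norm (v n w) ^ (2 * q)) \<le>
   exp (growth_const CARD('d) T q K * (1 + A * S ^ q)) * ((\<E> w. norm (v i w) ^ (2 * q)) + S ^ q * C)"
proof -
 let ?a = "\<lambda>k. \<E> w. norm (v k w) ^ (2 * q)" and ?G = "growth_const CARD('d) T q K"
 let ?e = "\<lambda>k. ?G * (1 + A * S ^ q) * ((p (Suc k) - p k) / S)"
 have G: "0 <= ?G" using K T_pos by (intro growth_const_nonneg) auto
 have int: "integrable M (\<lambda>w. norm (v k w) ^ (2 * q))" and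
  stp: "k < n \<Longrightarrow> ?a (Suc k) <= (1 + ?G * ((p (Suc k) - p k) / S)) * ?a k + ?G * ((p (Suc k) - p k) / S) * (S ^ q * (A * ?a k + C))"
  if "i <= k" "k <= n" for k
 proof -
  have s: "integrable M (\<lambda>w. norm (v (Suc k) w) ^ (2 * q)) \<and>
    ?a (Suc k) <= (1 + ?G * ((p (Suc k) - p k) / S)) * ?a k + ?G * ((p (Suc k) - p k) / S) * (S ^ q * (A * ?a k + C))"
   if k: "i <= k" "k < n" and ik: "integrable M (\<lambda>w. norm (v k w) ^ (2 * q))" for k
  proof -
   have t: "0 <= p k" "p k <= p (Suc k)" "p (Suc k) <= T"
    using grid_bounds[OF gr] gr k by (auto simp: grid_def)
   have t': "p (Suc k) - p k <= S"
    using grid_mono[OF gr, of i k] grid_mono[OF gr, of "Suc k" n] k S by auto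
   note ick = ic[OF k ik]
   note gs = growth_step[OF t t' S(2,3) h(1) h(2)[OF k(2)] q K mv[OF k] mc[OF k] mz[OF k] mm[OF k] mg[OF k] c0 vm[OF k]
    zb[OF k] mb[OF k] gb[OF k] ik conjunct1[OF ick], folded vS[OF k]]
   have "?G * ((p (Suc k) - p k) / S) * (S ^ q * (\<E> w. c k w ^ (2 * q))) \<le>
    ?G * ((p (Suc k) - p k) / S) * (S ^ q * (A * ?a k + C))"
    using ick t S G by (intro mult_left_mono) auto
   then show ?thesis using gs by linarith
  qed
  have I: "integrable M (\<lambda>w. norm (v k w) ^ (2 * q))" if "i <= k" "k <= n" for k
   using that
  proof (induction k rule: dec_induct)
   case (step k)
   then show ?case using s[of k] by auto
  qed (rule iv)
  show "integrable M (\<lambda>w. norm (v k w) ^ (2 * q))" by (rule I[OF that])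
  show "k < n \<Longrightarrow> ?a (Suc k) <= (1 + ?G * ((p (Suc k) - p k) / S)) * ?a k + ?G * ((p (Suc k) - p k) / S) * (S ^ q * (A * ?a k + C))"
   using s[of k] I[of k] that by auto
 qed
 have "?a n <= exp (\<Sum>k\<in>{i..<n}. ?e k) * (?a i + S ^ q * C)"
 proof (rule gronwall_product[OF _ _ _ _ i])
  fix k assume k: "i <= k" "k < n"
  let ?d = "(p (Suc k) - p k) / S"
  have d: "0 <= ?d" using gr k S by (auto simp: grid_def)
  then show "0 <= ?e k" using G A S by (intro mult_nonneg_nonneg add_nonneg_nonneg) auto
  have "?a (Suc k) <= (1 + ?G * ?d) * ?a k + ?G * ?d * (S ^ q * (A * ?a k + C))"
   using stp[of k] k by auto
  also have "... = (1 + ?e k) * ?a k + ?G * 1 * ?d * (S ^ q * C)" by (simp add: algebra_simps)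
  also have "... <= (1 + ?e k) * ?a k + ?e k * (S ^ q * C)"
   using d G A S by (intro add_left_mono mult_right_mono mult_left_mono) auto
  finally show "?a (Suc k) <= (1 + ?e k) * ?a k + ?e k * (S ^ q * C)" .
 qed (use A S in auto)
 also have "(\<Sum>k\<in>{i..<n}. ?e k) = ?G * (1 + A * S ^ q) * ((p n - p i) / S)"
  using sum_Suc_diff'[OF i, of p] by (simp add: sum_distrib_left[symmetric] sum_divide_distrib[symmetric])
 also have "exp (?G * (1 + A * S ^ q) * ((p n - p i) / S)) * (?a i + S ^ q * C) <= exp (?G * (1 + A * S ^ q)) * (?a i + S ^ q * C)"
 proof (intro mult_right_mono iffD2[OF exp_le_cancel_iff])
  have "?G * (1 + A * S ^ q) * ((p n - p i) / S) <= ?G * (1 + A * S ^ q) * 1"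
   using S G A by (intro mult_left_mono) auto
  then show "?G * (1 + A * S ^ q) * ((p n - p i) / S) <= ?G * (1 + A * S ^ q)" by simp
  show "0 <= ?a i + S ^ q * C" using A S by (intro add_nonneg_nonneg integral_nonneg_AE) auto
 qed
 finally show ?thesis using int[OF i order_refl] by simp
qed

end

text \<open>Everything about the coefficients that the flow estimates use, with a single constant:
  \<open>Db\<close> and \<open>D\<sigma>\<close> are linear maps tied to \<open>b\<close> and
  \<open>\<sigma>\<close> by a quadratic Taylor remainder.\<close>

locale diffusion = two_brownian_motions M T W B
 for M :: "'w measure" and T :: real and W :: "real => 'w => real^'d" and B :: "real => 'w => real" +
 fixes b :: "real^'d => real^'d" and \<sigma> :: "real^'d => real^'d^'d"
  and Db :: "real^'d => real^'d => real^'d" and D\<sigma> :: "real^'d => real^'d => real^'d^'d" and K :: real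
 assumes K: "0 <= K"
  and b_bound: "\<And>x. norm (b x) <= K" and s_bound: "\<And>x. norm (\<sigma> x) <= K"
  and Db_bound: "\<And>x h. norm (Db x h) <= K * norm h" and Ds_bound: "\<And>x h. norm (D\<sigma> x h) <= K * norm h"
  and b_lip: "\<And>x y. norm (b x - b y) <= K * norm (x - y)" and s_lip: "\<And>x y. norm (\<sigma> x - \<sigma> y) <= K * norm (x - y)"
  and b_taylor: "\<And>x y. norm (b y - b x - Db x (y - x)) <= K * (norm (y - x))^2"
  and s_taylor: "\<And>x y. norm (\<sigma> y - \<sigma> x - D\<sigma> x (y - x)) <= K * (norm (y - x))^2"
  and Db_lin: "\<And>x. linear (Db x)" and Ds_lin: "\<And>x. linear (D\<sigma> x)"
  and Db_cont: "\<And>h. continuous_on UNIV (\<lambda>x. Db x h)" and Ds_cont: "\<And>h. continuous_on UNIV (\<lambda>x. D\<sigma> x h)"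
  and b_cont: "continuous_on UNIV b" and s_cont: "continuous_on UNIV \<sigma>"
begin

lemma b_meas [measurable]: "b \<in> bm borel" by (rule borel_measurable_continuous_onI[OF b_cont])

lemma s_meas [measurable]: "\<sigma> \<in> bm borel"
 by (rule borel_measurable_continuous_onI[OF s_cont])

lemma Db_meas [measurable]: "(\<lambda>x. Db x h) \<in> bm borel"
 by (rule borel_measurable_continuous_onI[OF Db_cont])

lemma Ds_meas [measurable]: "(\<lambda>x. D\<sigma> x h) \<in> bm borel"
 by (rule borel_measurable_continuous_onI[OF Ds_cont])

lemma vec_axis_sum: "(h :: real^'d) = (\<Sum>j\<in>UNIV. h $ j *\<^sub>R axis j 1)"
 using basis_expansion[of h] by (simp add: scalar_mult_eq_scaleR)

lemma Db_axis: "Db x h = (\<Sum>j\<in>UNIV. h $ j *\<^sub>R Db x (axis j 1))"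
proof -
 interpret linear "Db x" by (rule Db_lin)
 show ?thesis by (subst vec_axis_sum[of h]) (simp only: sum scale)
qed

lemma Ds_axis: "D\<sigma> x h = (\<Sum>j\<in>UNIV. h $ j *\<^sub>R D\<sigma> x (axis j 1))"
proof -
 interpret linear "D\<sigma> x" by (rule Ds_lin)
 show ?thesis by (subst vec_axis_sum[of h]) (simp only: sum scale)
qed

lemma measurable_Db [measurable (raw)]:
 "f \<in> bm N \<Longrightarrow> h \<in> bm N \<Longrightarrow> (\<lambda>w. Db (f w) (h w)) \<in> bm N"
 by (subst Db_axis) (intro borel_measurable_sum borel_measurable_scaleR measurable_vec_nth measurable_compose[OF _ Db_meas])

lemma measurable_Ds [measurable (raw)]:
 "f \<in> bm N \<Longrightarrow> h \<in> bm N \<Longrightarrow> (\<lambda>w. D\<sigma> (f w) (h w)) \<in> bm N"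
 by (subst Ds_axis) (intro borel_measurable_sum borel_measurable_scaleR measurable_vec_nth measurable_compose[OF _ Ds_meas])

text \<open>The linearized one-step map of the scheme is \<open>h \<mapsto> h + act x dt d h\<close>; \<open>adj\<close> is its transposed increment.\<close>

definition act :: "real^'d => real => real^'d => real^'d => real^'d" where
 "act x dt d h = dt *\<^sub>R Db x h + D\<sigma> x h *v d"

definition adj :: "real^'d => real => real^'d => real^'d => real^'d" where
 "adj x dt d u = (\<chi> j. u \<bullet> act x dt d (axis j 1))"

lemma act_axis: "act x dt d h = (\<Sum>j\<in>UNIV. h $ j *\<^sub>R act x dt d (axis j 1))"
proof -
 have "act x dt d h = dt *\<^sub>R (\<Sum>j\<in>UNIV. h $ j *\<^sub>R Db x (axis j 1)) + (\<Sum>j\<in>UNIV. h $ j *\<^sub>R D\<sigma> x (axis j 1)) *v d"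
  unfolding act_def using Db_axis[of x h] Ds_axis[of x h] by simp
 also have "... = (\<Sum>j\<in>UNIV. h $ j *\<^sub>R act x dt d (axis j 1))"
  unfolding act_def scaleR_right_distrib sum.distrib bounded_bilinear.sum_left[OF bounded_bilinear_matrix_vector_mult]
  by (simp add: scaleR_sum_right mult.commute scaleR_matrix_vector_assoc)
 finally show ?thesis .
qed

lemma adj_inner: "adj x dt d u \<bullet> h = u \<bullet> act x dt d h"
proof -
 have "adj x dt d u \<bullet> h = (\<Sum>j\<in>UNIV. h $ j * (u \<bullet> act x dt d (axis j 1)))"
  unfolding inner_vec_def[of "adj x dt d u" h] by (simp add: adj_def mult.commute)
 also have "... = u \<bullet> (\<Sum>j\<in>UNIV. h $ j *\<^sub>R act x dt d (axis j 1))" by (simp add: inner_sum_right)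
 finally show ?thesis using act_axis[of x dt d h] by simp
qed

lemma adj_split: "adj x dt d u = adj x dt 0 u + adj x 0 d u"
 by (simp add: adj_def act_def vec_eq_iff inner_add_right)

lemma norm_act: "0 <= dt \<Longrightarrow> norm (act x dt d h) <= K * (dt + norm d) * norm h"
proof -
 assume d: "0 <= dt"
 have "norm (act x dt d h) <= dt * norm (Db x h) + norm (D\<sigma> x h) * norm d"
  unfolding act_def using norm_triangle_ineq[of "dt *\<^sub>R Db x h" "D\<sigma> x h *v d"] norm_matrix_vector_mult[of "D\<sigma> x h" d] d by simp
 also have "... <= dt * (K * norm h) + K * norm h * norm d"
  using d by (intro add_mono mult_left_mono mult_right_mono Db_bound Ds_bound) auto
 finally show ?thesis by (simp add: algebra_simps)
qed

text \<open>By duality with \<open>norm_act\<close>: the transposed map is tested with its own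
  value.\<close>

lemma norm_adj: assumes "0 <= dt" shows "norm (adj x dt d u) <= K * (dt + norm d) * norm u"
proof -
 let ?a = "adj x dt d u"
 have "(norm ?a)^2 = u \<bullet> act x dt d ?a" by (simp add: power2_norm_eq_inner adj_inner)
 also have "... <= norm u * norm (act x dt d ?a)" by (rule norm_cauchy_schwarz)
 also have "... <= norm u * (K * (dt + norm d) * norm ?a)"
  by (intro mult_left_mono norm_act assms) auto
 finally show ?thesis using assms K by (cases "?a = 0") (auto simp: power2_eq_square mult_ac)
qed

lemma measurable_act [measurable (raw)]:
 "f \<in> bm N \<Longrightarrow> d \<in> bm N \<Longrightarrow> h \<in> bm N \<Longrightarrow> (\<lambda>w. act (f w) dt (d w) (h w)) \<in> bm N"
 unfolding act_def
 by (intro borel_measurable_add borel_measurable_scaleR borel_measurable_const measurable_Db measurable_matrix_vector_mult measurable_Ds)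

lemma measurable_adj [measurable (raw)]:
 "f \<in> bm N \<Longrightarrow> d \<in> bm N \<Longrightarrow> h \<in> bm N \<Longrightarrow> (\<lambda>w. adj (f w) dt (d w) (h w)) \<in> bm N"
 unfolding adj_def by (intro measurable_vec_lambda borel_measurable_inner measurable_act borel_measurable_const)

primrec euler :: "(nat => real) => real^'d => nat => 'w => real^'d" where
 "euler p x 0 w = x"
| "euler p x (Suc k) w = euler p x k w +
  (\<sigma> (euler p x k w) *v (W (p (Suc k)) w - W (p k) w) + (p (Suc k) - p k) *\<^sub>R b (euler p x k w))"

text \<open>A row of the inverse flow: to second order \<open>u (I + N)\<^sup>-\<^sup>1 = u - u N + u N^2\<close>, and the product with
 the flow then only changes by \<open>u N\<^sup>3\<close> in each step.\<close>

primrec inv_row :: "(nat => real) => real^'d => real^'d => nat => 'w => real^'d" where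
 "inv_row p x u 0 w = u"
| "inv_row p x u (Suc k) w = (let a = adj (euler p x k w) (p (Suc k) - p k) (W (p (Suc k)) w - W (p k) w)
   in inv_row p x u k w - a (inv_row p x u k w) + a (a (inv_row p x u k w)))"

lemma measurable_info_step:
 assumes gr: "grid p n" and k: "Suc k <= n"
 shows "(\<lambda>w. W (p (Suc k)) w - W (p k) w) \<in> bm (\<F> (p (Suc k)) r)"
  and "f \<in> measurable (\<F> (p k) r) N \<Longrightarrow> f \<in> measurable (\<F> (p (Suc k)) r) N"
 using grid_bounds[OF gr, of k] grid_mono[OF gr, of k "Suc k"] k
 by (auto intro!: measurable_info_W measurable_info_mono[of f M W B T "p k" r N])

lemma euler_measurable:
 assumes gr: "grid p n" and k: "k <= n"
 shows "euler p x k \<in> bm (\<F> (p k) r)" using k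
proof (induction k)
 case 0
 have "euler p x 0 = (\<lambda>w. x)" by (simp add: fun_eq_iff)
 then show ?case by simp
next
 case (Suc k)
 note [measurable] = measurable_info_step(1)[OF gr Suc.prems, of r] measurable_info_step(2)[OF gr Suc.prems, OF Suc.IH]
 have "(\<lambda>w. \<sigma> (euler p x k w) *v (W (p (Suc k)) w - W (p k) w)) \<in> bm (\<F> (p (Suc k)) r)"
  using Suc.prems by (intro measurable_matrix_vector_mult) measurable
 then show ?case using Suc.prems by (simp add: fun_eq_iff[of "euler p x (Suc k)"] euler.simps(2)[abs_def])
qed

lemma inv_row_measurable:
 assumes gr: "grid p n" and k: "k <= n"
 shows "inv_row p x u k \<in> bm (\<F> (p k) r)" using k
proof (induction k)
 case 0
 have "inv_row p x u 0 = (\<lambda>w. u)" by (simp add: fun_eq_iff)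
 then show ?case by simp
next
 case (Suc k)
 have m: "(\<lambda>w. W (p (Suc k)) w - W (p k) w) \<in> bm (\<F> (p (Suc k)) r)"
  "euler p x k \<in> bm (\<F> (p (Suc k)) r)" "inv_row p x u k \<in> bm (\<F> (p (Suc k)) r)"
  using measurable_info_step(1)[OF gr Suc.prems, of r] measurable_info_step(2)[OF gr Suc.prems, OF euler_measurable[OF gr]]
   measurable_info_step(2)[OF gr Suc.prems] Suc by auto
 show ?case unfolding inv_row.simps(2)[abs_def] Let_def
  by (intro borel_measurable_add borel_measurable_diff measurable_adj m)
qed

end

section \<open>Moments of the scheme, of the inverse rows and of differences in the initial
  value\<close>

context diffusion
begin

lemma grid_le: "grid p n \<Longrightarrow> k <= n \<Longrightarrow> grid p k"
 using grid_bounds[of p n k] by (auto simp: grid_def)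

lemma grid_step: "grid p n \<Longrightarrow> k < n \<Longrightarrow> 0 <= p k \<and> p k <= p (Suc k) \<and> p (Suc k) <= T \<and> p k <= T"
 using grid_bounds[of p n k] grid_bounds[of p n "Suc k"] by (auto simp: grid_def)

text \<open>Allows \<open>h = sqrt T\<close> in \<open>growth_chain_aux\<close> wherever no
  smallness of the mesh is to be gained.\<close>

lemma grid_mesh: "grid p n \<Longrightarrow> k < n \<Longrightarrow> p (Suc k) - p k <= (sqrt T)^2"
 using grid_step[of p n k] T_pos by auto

lemma dW_measurable: "grid p n \<Longrightarrow> k < n \<Longrightarrow> (\<lambda>w. W (p (Suc k)) w - W (p k) w) \<in> bm M"
 using grid_step[of p n k] by (intro borel_measurable_diff W_measurable) auto

lemma euler_events: "grid p n \<Longrightarrow> k <= n \<Longrightarrow> euler p x k \<in> bm M"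
 using measurable_info_events[OF euler_measurable[of p n k x 0]] grid_bounds[of p n k] by auto

lemma inv_row_events: "grid p n \<Longrightarrow> k <= n \<Longrightarrow> inv_row p x u k \<in> bm M"
 using measurable_info_events[OF inv_row_measurable[of p n k x u 0]] grid_bounds[of p n k] by auto

lemma step_size_ge: "0 <= dt \<Longrightarrow> dt <= step_size h dt w" "0 <= dt \<Longrightarrow> w^2 <= step_size h dt w"
 by (auto simp: step_size_def)

text \<open>The coefficients are bounded, so the multiplier is \<open>c = 1\<close>, with
  \<open>A = 0\<close> and \<open>C = 1\<close>.\<close>

lemma euler_increment_moment:
 assumes gr: "grid p n" and i: "i <= n" and S: "p n - p i <= S" "0 < S" "S <= T" and q: "q \<ge> 1"
 shows "integrable M (\<lambda>w. norm (euler p x n w - euler p x i w) ^ (2 * q)) \<and>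
  (\<E> w. norm (euler p x n w - euler p x i w) ^ (2 * q)) <= exp (growth_const CARD('d) T q K) * S ^ q"
proof -
 let ?E = "euler p x" and ?dW = "\<lambda>k w. W (p (Suc k)) w - W (p k) w"
 let ?m = "\<lambda>k w. \<sigma> (?E k w) *v ?dW k w" and ?g = "\<lambda>k w. (p (Suc k) - p k) *\<^sub>R b (?E k w)"
 have me: "(\<lambda>w. ?E k w - ?E i w) \<in> bm (\<F> (p k) 0)" if "i <= k" "k < n" for k
  using euler_measurable[OF gr, of k x 0] measurable_info_mono[OF euler_measurable[OF gr i, of x 0], of "p k" 0]
   grid_mono[OF gr, of i k] that by (intro borel_measurable_diff) auto
 have 1: "integrable M (\<lambda>w. norm (?E n w - ?E i w) ^ (2 * q)) \<and>
  (\<E> w. norm (?E n w - ?E i w) ^ (2 * q)) \<le>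
   exp (growth_const CARD('d) T q K * (1 + 0 * S ^ q)) * ((\<E> w. norm (?E i w - ?E i w) ^ (2 * q)) + S ^ q * 1)"
 proof (rule growth_chain_aux[where v="\<lambda>k w. ?E k w - ?E i w" and m="?m" and g="?g" and c="\<lambda>_ _. 1"
   and \<zeta>="\<lambda>k w. (?E k w - ?E i w) v* \<sigma> (?E k w)", OF gr i S _ grid_mesh[OF gr] q K])
  show "0 < sqrt T" using T_pos by simp
  fix k assume k: "i <= k" "k < n"
  have [measurable]: "?E k \<in> bm M" "?dW k \<in> bm M"
   using euler_events[OF gr] dW_measurable[OF gr] k by auto
  note d = grid_step[OF gr k(2)]
  show "(\<lambda>w. ?E k w - ?E i w) \<in> bm (\<F> (p k) 0)" by (rule me[OF k])
  show "(\<lambda>w. (?E k w - ?E i w) v* \<sigma> (?E k w)) \<in> bm (\<F> (p k) 0)"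
   by (intro measurable_vector_matrix_mult me[OF k] measurable_compose[OF euler_measurable[OF gr] s_meas]) (use k in auto)
  show "?m k \<in> bm M" by (intro measurable_matrix_vector_mult) measurable
  show "?g k \<in> bm M" by measurable
  fix w
  let ?w = "norm (?dW k w)"
  show "?E (Suc k) w - ?E i w = ?E k w - ?E i w + (?m k w + ?g k w)" by simp
  show "(?E k w - ?E i w) \<bullet> ?m k w = ((?E k w - ?E i w) v* \<sigma> (?E k w)) \<bullet> ?dW k w"
   by (simp add: dot_lmul_matrix)
  show "norm ((?E k w - ?E i w) v* \<sigma> (?E k w)) <= K * 1 * norm (?E k w - ?E i w)"
   using order_trans[OF norm_vector_matrix_mult mult_left_mono[OF s_bound norm_ge_zero]] by (simp add: mult.commute)
  show "norm (?m k w) <= K * 1 * ?w"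
   using order_trans[OF norm_matrix_vector_mult mult_right_mono[OF s_bound norm_ge_zero]] by simp
  have "norm (?g k w) <= (p (Suc k) - p k) * K" using d b_bound by (simp add: mult_left_mono)
  also have "... <= step_size (sqrt T) (p (Suc k) - p k) ?w * K"
   using d K by (intro mult_right_mono step_size_ge) auto
  finally show "norm (?g k w) <= K * 1 * step_size (sqrt T) (p (Suc k) - p k) ?w" by (simp add: mult.commute)
 qed (auto simp: prob_space power_0_left)
 then show ?thesis using q by (simp add: power_0_left)
qed

text \<open>The second summand pays for the quadratic term of the inverse step, as
  \<open>(dt + |d|)^2\<close> is at most \<open>2 (T + 1)\<close> times
  \<open>step_size\<close>.\<close>

definition K_inv :: real where "K_inv = K + 2 * K^2 * (T + 1)"

lemma K_inv: "K <= K_inv" "0 <= K_inv" using K T_pos by (auto simp: K_inv_def)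

text \<open>Only the part of \<open>- u N\<close> that is linear in the Gaussian increment is a
  martingale term. The drift part of \<open>u N\<close> and the whole of \<open>u N^2\<close> are of
  drift size.\<close>

lemma inv_row_step:
 fixes p x u k w v
 defines "d \<equiv> W (p (Suc k)) w - W (p k) w" and "X \<equiv> euler p x k w" and "r \<equiv> inv_row p x u k w" and "dt \<equiv> p (Suc k) - p k"
 assumes D: "0 <= dt" "dt <= T"
 shows "inv_row p x u (Suc k) w = r + (- adj X 0 d r + (adj X dt d (adj X dt d r) - adj X dt 0 r))"
  and "v \<bullet> (- adj X 0 d r) = (- (r v* D\<sigma> X v)) \<bullet> d"
  and "norm (- (r v* D\<sigma> X v)) <= K_inv * norm r * norm v"
  and "norm (- adj X 0 d r) <= K_inv * norm r * norm d"
  and "norm (adj X dt d (adj X dt d r) - adj X dt 0 r) <= K_inv * norm r * step_size h dt (norm d)"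
proof -
 show "inv_row p x u (Suc k) w = r + (- adj X 0 d r + (adj X dt d (adj X dt d r) - adj X dt 0 r))"
  unfolding inv_row.simps Let_def d_def[symmetric] X_def[symmetric] r_def[symmetric] dt_def[symmetric]
  using adj_split[of X dt d r] by simp
 show "v \<bullet> (- adj X 0 d r) = (- (r v* D\<sigma> X v)) \<bullet> d"
 proof -
  have "v \<bullet> adj X 0 d r = r \<bullet> (D\<sigma> X v *v d)"
   using adj_inner[of X 0 d r v] by (simp add: act_def inner_commute)
  then show ?thesis by (simp add: dot_lmul_matrix)
 qed
 have "norm (r v* D\<sigma> X v) <= norm r * (K * norm v)"
  by (rule order_trans[OF norm_vector_matrix_mult mult_left_mono[OF Ds_bound]]) simp
 also have "... <= norm r * (K_inv * norm v)" using K_inv by (intro mult_left_mono mult_right_mono) auto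
 finally show "norm (- (r v* D\<sigma> X v)) <= K_inv * norm r * norm v" by (simp add: mult_ac)
 have "norm (adj X 0 d r) <= K * (0 + norm d) * norm r" by (rule norm_adj) simp
 also have "... <= K_inv * (0 + norm d) * norm r" using K_inv by (intro mult_right_mono) auto
 finally show "norm (- adj X 0 d r) <= K_inv * norm r * norm d" by (simp add: mult_ac)
 let ?t = "dt + norm d" and ?s = "step_size h dt (norm d)"
 have s: "dt <= ?s" "(norm d)^2 <= ?s" "0 <= ?s" using D by (auto intro: step_size_ge step_size_nonneg)
 have "?t^2 <= 2 * dt^2 + 2 * (norm d)^2" by (rule square_add_le)
 also have "... <= 2 * (T * ?s) + 2 * ?s"
  unfolding power2_eq_square[of dt] using D s by (intro add_mono mult_left_mono mult_mono) auto
 finally have t2: "?t^2 <= 2 * (T + 1) * ?s" by (simp add: algebra_simps)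
 have "norm (adj X dt d (adj X dt d r)) <= K * ?t * norm (adj X dt d r)" by (rule norm_adj[OF D(1)])
 also have "... <= K * ?t * (K * ?t * norm r)" using K D by (intro mult_left_mono norm_adj) auto
 also have "... = K^2 * norm r * ?t^2" by (simp add: power2_eq_square)
 also have "... <= K^2 * norm r * (2 * (T + 1) * ?s)" using t2 by (intro mult_left_mono) auto
 finally have 1: "norm (adj X dt d (adj X dt d r)) <= K^2 * norm r * (2 * (T + 1) * ?s)" .
 have "norm (adj X dt 0 r) <= K * (dt + norm (0::real^'d)) * norm r" by (rule norm_adj[OF D(1)])
 also have "... <= K * ?s * norm r" using K s by (intro mult_right_mono mult_left_mono) auto
 finally have 2: "norm (adj X dt 0 r) <= K * ?s * norm r" .
 have "norm (adj X dt d (adj X dt d r) - adj X dt 0 r) <= K^2 * norm r * (2 * (T + 1) * ?s) + K * ?s * norm r"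
  using norm_triangle_ineq4[of "adj X dt d (adj X dt d r)" "adj X dt 0 r"] 1 2 by linarith
 then show "norm (adj X dt d (adj X dt d r) - adj X dt 0 r) <= K_inv * norm r * ?s"
  by (simp add: K_inv_def algebra_simps)
qed

text \<open>Subtracting \<open>z\<close>, known at \<open>p i\<close>, does not change the steps,
  and the multiplier is the norm of the row in every case. \<open>z = 0\<close> yields moments;
  taking for \<open>z\<close> the row at \<open>i\<close> yields increments.\<close>

lemma inv_row_chain:
 assumes gr: "grid p n" and i: "i <= n" and S: "p n - p i <= S" "0 < S" "S <= T" and q: "q \<ge> 1"
  and v: "\<And>k w. v k w = inv_row p x u k w - z w" and z: "z \<in> bm (\<F> (p i) 0)"
  and iv: "integrable M (\<lambda>w. norm (v i w) ^ (2 * q))"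
  and ic: "\<And>k. i <= k \<Longrightarrow> k < n \<Longrightarrow> integrable M (\<lambda>w. norm (v k w) ^ (2 * q)) \<Longrightarrow>
   integrable M (\<lambda>w. norm (inv_row p x u k w) ^ (2 * q)) \<and>
   (\<E> w. norm (inv_row p x u k w) ^ (2 * q)) <= A * (\<E> w. norm (v k w) ^ (2 * q)) + C"
  and A: "0 <= A" "0 <= C"
 shows "integrable M (\<lambda>w. norm (v n w) ^ (2 * q)) \<and>
  (\<E> w. norm (v n w) ^ (2 * q)) \<le>
   exp (growth_const CARD('d) T q K_inv * (1 + A * S ^ q)) * ((\<E> w. norm (v i w) ^ (2 * q)) + S ^ q * C)"
proof -
 let ?E = "euler p x" and ?r = "inv_row p x u" and ?dW = "\<lambda>k w. W (p (Suc k)) w - W (p k) w"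
 let ?D = "\<lambda>k. p (Suc k) - p k"
 let ?m = "\<lambda>k w. - adj (?E k w) 0 (?dW k w) (?r k w)"
 let ?g = "\<lambda>k w. adj (?E k w) (?D k) (?dW k w) (adj (?E k w) (?D k) (?dW k w) (?r k w)) - adj (?E k w) (?D k) 0 (?r k w)"
 have mv: "v k \<in> bm (\<F> (p k) 0)" if "i <= k" "k < n" for k
 proof -
  have "(\<lambda>w. ?r k w - z w) \<in> bm (\<F> (p k) 0)"
   using inv_row_measurable[OF gr, of k x u 0] measurable_info_mono[OF z, of "p k" 0]
    grid_mono[OF gr, of i k] that by (intro borel_measurable_diff) auto
  then show ?thesis by (simp add: v[abs_def])
 qed
 show ?thesis
 proof (rule growth_chain_aux[where m="?m" and g="?g" and c="\<lambda>k w. norm (?r k w)" and v=v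
   and \<zeta>="\<lambda>k w. - (?r k w v* D\<sigma> (?E k w) (v k w))", OF gr i S _ grid_mesh[OF gr] q K_inv(2)])
  show "0 < sqrt T" using T_pos by simp
  fix k assume k: "i <= k" "k < n"
  have mE: "?E k \<in> bm M" "?dW k \<in> bm M" "?r k \<in> bm M"
   using euler_events[OF gr] dW_measurable[OF gr] inv_row_events[OF gr] k by auto
  have d: "0 <= ?D k" "?D k <= T" using grid_step[OF gr k(2)] by auto
  show "v k \<in> bm (\<F> (p k) 0)" by (rule mv[OF k])
  show "(\<lambda>w. norm (?r k w)) \<in> bm (\<F> (p k) 0)"
   using inv_row_measurable[OF gr, of k x u 0] k by (intro measurable_compose[OF _ borel_measurable_norm]) auto
  show "(\<lambda>w. - (?r k w v* D\<sigma> (?E k w) (v k w))) \<in> bm (\<F> (p k) 0)"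
   by (intro borel_measurable_uminus measurable_vector_matrix_mult measurable_Ds mv[OF k] euler_measurable[OF gr] inv_row_measurable[OF gr]) (use k in auto)
  show "?m k \<in> bm M" by (intro borel_measurable_uminus measurable_adj mE)
  show "?g k \<in> bm M" by (intro borel_measurable_diff measurable_adj mE borel_measurable_const)
  fix w
  note st = inv_row_step[where p=p and k=k and x=x and u=u and w=w, OF d]
  show "v (Suc k) w = v k w + (?m k w + ?g k w)" unfolding v using st(1) by simp
  show "v k w \<bullet> ?m k w = (- (?r k w v* D\<sigma> (?E k w) (v k w))) \<bullet> ?dW k w" by (rule st(2))
  show "norm (- (?r k w v* D\<sigma> (?E k w) (v k w))) <= K_inv * norm (?r k w) * norm (v k w)" by (rule st(3))
  show "norm (?m k w) <= K_inv * norm (?r k w) * norm (?dW k w)" by (rule st(4))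
  show "norm (?g k w) <= K_inv * norm (?r k w) * step_size (sqrt T) (?D k) (norm (?dW k w))" by (rule st(5))
 qed (use iv ic A in auto)
qed

definition inv_const :: "nat => real" where
 "inv_const q = exp (growth_const CARD('d) T q K_inv * (1 + T ^ q))"

lemma inv_row_moment:
 assumes gr: "grid p n" and q: "q \<ge> 1"
 shows "integrable M (\<lambda>w. norm (inv_row p x u n w) ^ (2 * q)) \<and>
  (\<E> w. norm (inv_row p x u n w) ^ (2 * q)) <= inv_const q * norm u ^ (2 * q)"
proof -
 have "p n - p 0 <= T" using grid_bounds[OF gr, of 0] grid_bounds[OF gr, of n] by auto
 from inv_row_chain[OF gr le0 this T_pos order_refl q, where v="inv_row p x u" and z="\<lambda>_. 0" and A=1 and C=0 and x=x and u=u]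
 show ?thesis by (simp add: inv_const_def prob_space)
qed

lemma inv_row_increment_moment:
 assumes gr: "grid p n" and i: "i <= n" and S: "p n - p i <= S" "0 < S" "S <= T" and q: "q \<ge> 1"
 shows "integrable M (\<lambda>w. norm (inv_row p x u n w - inv_row p x u i w) ^ (2 * q)) \<and>
  (\<E> w. norm (inv_row p x u n w - inv_row p x u i w) ^ (2 * q)) \<le>
   exp (growth_const CARD('d) T q K_inv) * (S ^ q * (inv_const q * norm u ^ (2 * q)))"
proof -
 have "integrable M (\<lambda>w. norm (inv_row p x u n w - inv_row p x u i w) ^ (2 * q)) \<and>
  (\<E> w. norm (inv_row p x u n w - inv_row p x u i w) ^ (2 * q)) \<le>
   exp (growth_const CARD('d) T q K_inv * (1 + 0 * S ^ q)) * ((\<E> w. norm (inv_row p x u i w - inv_row p x u i w) ^ (2 * q)) +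
    S ^ q * (inv_const q * norm u ^ (2 * q)))"
 proof (rule inv_row_chain[OF gr i S q, where v="\<lambda>k w. inv_row p x u k w - inv_row p x u i w" and z="inv_row p x u i"])
  show "inv_row p x u i \<in> bm (\<F> (p i) 0)" by (rule inv_row_measurable[OF gr i])
  fix k assume "k < n"
  then show "integrable M (\<lambda>w. norm (inv_row p x u k w) ^ (2 * q)) \<and>
   (\<E> w. norm (inv_row p x u k w) ^ (2 * q)) <= 0 * (\<E> w. norm (inv_row p x u k w - inv_row p x u i w) ^ (2 * q)) + inv_const q * norm u ^ (2 * q)"
   using inv_row_moment[OF grid_le[OF gr] q, of k x u] by simp
 qed (auto simp: inv_const_def)
 then show ?thesis using q by (simp add: power_0_left)
qed

definition flow_const :: "nat => real" where
 "flow_const q = exp (growth_const CARD('d) T q K * (1 + T ^ q))"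

text \<open>The Lipschitz bounds make the recursion for the difference linear: the multiplier is its
  own norm, so \<open>A = 1\<close> and \<open>C = 0\<close>.\<close>

lemma euler_difference_moment:
 assumes gr: "grid p n" and q: "q \<ge> 1"
 shows "integrable M (\<lambda>w. norm (euler p y n w - euler p x n w) ^ (2 * q)) \<and>
  (\<E> w. norm (euler p y n w - euler p x n w) ^ (2 * q)) <= flow_const q * norm (y - x) ^ (2 * q)"
proof -
 let ?E = "euler p x" and ?F = "euler p y" and ?dW = "\<lambda>k w. W (p (Suc k)) w - W (p k) w"
 let ?v = "\<lambda>k w. ?F k w - ?E k w" and ?s = "\<lambda>k w. \<sigma> (?F k w) - \<sigma> (?E k w)"
 let ?m = "\<lambda>k w. ?s k w *v ?dW k w" and ?g = "\<lambda>k w. (p (Suc k) - p k) *\<^sub>R (b (?F k w) - b (?E k w))"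
 have S: "p n - p 0 <= T" using grid_bounds[OF gr, of 0] grid_bounds[OF gr, of n] by auto
 have 1: "integrable M (\<lambda>w. norm (?v n w) ^ (2 * q)) \<and>
  (\<E> w. norm (?v n w) ^ (2 * q)) \<le>
   exp (growth_const CARD('d) T q K * (1 + 1 * T ^ q)) * ((\<E> w. norm (?v 0 w) ^ (2 * q)) + T ^ q * 0)"
 proof (rule growth_chain_aux[where v="?v" and m="?m" and g="?g" and c="\<lambda>k w. norm (?v k w)"
   and \<zeta>="\<lambda>k w. ?v k w v* ?s k w", OF gr le0 S T_pos order_refl _ grid_mesh[OF gr] q K])
  show "0 < sqrt T" using T_pos by simp
  fix k assume k: "k < n"
  have mE: "?E k \<in> bm M" "?F k \<in> bm M" "?dW k \<in> bm M"
   using euler_events[OF gr] dW_measurable[OF gr] k by auto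
  have mi: "?E k \<in> bm (\<F> (p k) 0)" "?F k \<in> bm (\<F> (p k) 0)"
   using euler_measurable[OF gr] k by auto
  note d = grid_step[OF gr k]
  show "?v k \<in> bm (\<F> (p k) 0)" by (intro borel_measurable_diff mi)
  show "(\<lambda>w. norm (?v k w)) \<in> bm (\<F> (p k) 0)" by (intro measurable_compose[OF _ borel_measurable_norm] borel_measurable_diff mi)
  show "(\<lambda>w. ?v k w v* ?s k w) \<in> bm (\<F> (p k) 0)"
   by (intro measurable_vector_matrix_mult borel_measurable_diff mi measurable_compose[OF _ s_meas])
  show "?m k \<in> bm M" by (intro measurable_matrix_vector_mult borel_measurable_diff mE measurable_compose[OF _ s_meas])
  show "?g k \<in> bm M"
   by (intro borel_measurable_scaleR borel_measurable_const borel_measurable_diff mE measurable_compose[OF _ b_meas])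
  fix w
  let ?w = "norm (?dW k w)"
  show "?v (Suc k) w = ?v k w + (?m k w + ?g k w)"
   by (simp add: bounded_bilinear.diff_left[OF bounded_bilinear_matrix_vector_mult] scaleR_diff_right)
  show "?v k w \<bullet> ?m k w = (?v k w v* ?s k w) \<bullet> ?dW k w" by (simp add: dot_lmul_matrix)
  show "norm (?v k w v* ?s k w) <= K * norm (?v k w) * norm (?v k w)"
   using order_trans[OF norm_vector_matrix_mult mult_left_mono[OF s_lip norm_ge_zero]] by (simp add: mult_ac)
  show "norm (?m k w) <= K * norm (?v k w) * ?w"
   using order_trans[OF norm_matrix_vector_mult mult_right_mono[OF s_lip norm_ge_zero]] by simp
  have "norm (?g k w) <= (p (Suc k) - p k) * (K * norm (?v k w))" using d b_lip by (simp add: mult_left_mono)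
  also have "... <= step_size (sqrt T) (p (Suc k) - p k) ?w * (K * norm (?v k w))"
   using d K by (intro mult_right_mono step_size_ge) auto
  finally show "norm (?g k w) <= K * norm (?v k w) * step_size (sqrt T) (p (Suc k) - p k) ?w" by (simp add: mult.commute)
 qed (auto simp: prob_space power_0_left)
 then show ?thesis by (simp add: flow_const_def prob_space)
qed

end

section \<open>The inverse rows against the difference quotients\<close>

context diffusion
begin

lemma act_add: "act x dt d (h + h') = act x dt d h + act x dt d h'"
proof -
 interpret linear "Db x" by (rule Db_lin)
 interpret s: linear "D\<sigma> x" by (rule Ds_lin)
 show ?thesis by (simp add: act_def add s.add matrix_vector_mult_add_rdistrib scaleR_right_distrib)
qed

text \<open>The scheme is not differentiated. Its quotients in a direction \<open>e\<close> approach
  the columns of \<open>DX\<close> as soon as the error of the scheme is small compared with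
  \<open>eps\<close>.\<close>

definition diff_quotient :: "(nat => real) => real^'d => real => real^'d => nat => 'w => real^'d" where
 "diff_quotient p x eps e k w = (1 / eps) *\<^sub>R (euler p (x + eps *\<^sub>R e) k w - euler p x k w)"

lemma diff_quotient_moment:
 assumes gr: "grid p n" and q: "q \<ge> 1" and e: "eps \<noteq> 0" "norm e = 1"
 shows "integrable M (\<lambda>w. norm (diff_quotient p x eps e n w) ^ (2 * q)) \<and>
  (\<E> w. norm (diff_quotient p x eps e n w) ^ (2 * q)) <= flow_const q"
proof -
 have eq: "norm (diff_quotient p x eps e n w) ^ (2 * q) =
   (1 / \<bar>eps\<bar> ^ (2 * q)) * norm (euler p (x + eps *\<^sub>R e) n w - euler p x n w) ^ (2 * q)" for w
  by (simp add: diff_quotient_def power_divide)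
 have m: "integrable M (\<lambda>w. norm (euler p (x + eps *\<^sub>R e) n w - euler p x n w) ^ (2 * q))"
  "(\<E> w. norm (euler p (x + eps *\<^sub>R e) n w - euler p x n w) ^ (2 * q)) <= flow_const q * \<bar>eps\<bar> ^ (2 * q)"
  using euler_difference_moment[OF gr q, of "x + eps *\<^sub>R e" x] e by auto
 have "(1 / \<bar>eps\<bar> ^ (2 * q)) * (\<E> w. norm (euler p (x + eps *\<^sub>R e) n w - euler p x n w) ^ (2 * q)) \<le>
  (1 / \<bar>eps\<bar> ^ (2 * q)) * (flow_const q * \<bar>eps\<bar> ^ (2 * q))"
  by (intro mult_left_mono m) auto
 then show ?thesis unfolding eq using m(1) e by simp
qed

definition K_prod :: real where "K_prod = K + 2 * K^2 + 16 * K ^ 3"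

text \<open>Bounds the second moment of the multiplier \<open>|r| |h| (1 + |h|)\<close> of
  \<open>product_step\<close>, whose square is at most
  \<open>2 |r|^4 + |h|^4 + |h|^8\<close>.\<close>

definition size_const :: real where "size_const = 2 * inv_const 2 + flow_const 2 + flow_const 4"

text \<open>Multiplying \<open>r - r A + r A^2\<close> with \<open>h + A h + R\<close> leaves
  \<open>r h + r A^3 h + (r - r A + r A^2) R\<close>: the first and second powers of
  \<open>A\<close> cancel. \<open>Rs\<close> and \<open>Rb\<close> are Taylor remainders divided by
  \<open>eps\<close>, hence of size \<open>\<bar>eps\<bar> |h|^2\<close>, and the cube of
  \<open>dt + |d|\<close> is at most \<open>8 j\<close> times \<open>step_size\<close>. So every
  error term carries the factor \<open>j\<close>.\<close>

lemma product_step: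
 fixes p x u k w eps e and p0 :: real
 defines "d \<equiv> W (p (Suc k)) w - W (p k) w" and "X \<equiv> euler p x k w" and "r \<equiv> inv_row p x u k w"
  and "dt \<equiv> p (Suc k) - p k" and "X' \<equiv> euler p (x + eps *\<^sub>R e) k w" and "h \<equiv> diff_quotient p x eps e k w"
 defines "Rs \<equiv> (1 / eps) *\<^sub>R (\<sigma> X' - \<sigma> X - D\<sigma> X (X' - X))" and "Rb \<equiv> (1 / eps) *\<^sub>R (b X' - b X - Db X (X' - X))"
 defines "R \<equiv> Rs *v d + dt *\<^sub>R Rb" and "A \<equiv> act X dt d"
 defines "m \<equiv> r \<bullet> (Rs *v d)" and "g \<equiv> r \<bullet> A (A (A h)) + dt * (r \<bullet> Rb) - r \<bullet> A R + r \<bullet> A (A R)"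
  and "c \<equiv> norm r * norm h * (1 + norm h)"
 assumes D: "0 <= dt" "dt <= j^2" and j: "0 < j" "j <= 1" and eps: "eps \<noteq> 0" "\<bar>eps\<bar> <= j"
 shows "inv_row p x u (Suc k) w \<bullet> diff_quotient p x eps e (Suc k) w = r \<bullet> h + (m + g)"
  and "m = (r v* Rs) \<bullet> d"
  and "norm (r v* Rs) <= K_prod * (j * c)"
  and "\<bar>m\<bar> <= K_prod * (j * c) * norm d"
  and "\<bar>g\<bar> <= K_prod * (j * c) * step_size j dt (norm d)"
proof -
 have X': "X' - X = eps *\<^sub>R h" using eps by (simp add: h_def diff_quotient_def X'_def X_def)
 interpret lb: linear "Db X" by (rule Db_lin)
 interpret ls: linear "D\<sigma> X" by (rule Ds_lin)
 have "diff_quotient p x eps e (Suc k) w = (1 / eps) *\<^sub>R (X' - X + ((\<sigma> X' - \<sigma> X) *v d + dt *\<^sub>R (b X' - b X)))"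
  by (simp add: diff_quotient_def X_def[symmetric] X'_def[symmetric] d_def[symmetric] dt_def[symmetric]
   bounded_bilinear.diff_left[OF bounded_bilinear_matrix_vector_mult] scaleR_diff_right) (simp add: algebra_simps)
 also have "... = h + (((1 / eps) *\<^sub>R (\<sigma> X' - \<sigma> X)) *v d + dt *\<^sub>R ((1 / eps) *\<^sub>R (b X' - b X)))"
  using X' eps by (simp add: scaleR_right_distrib scaleR_matrix_vector_assoc)
 also have "(1 / eps) *\<^sub>R (\<sigma> X' - \<sigma> X) = D\<sigma> X h + Rs"
  using eps unfolding Rs_def X' ls.scale by (simp add: scaleR_diff_right)
 also have "(1 / eps) *\<^sub>R (b X' - b X) = Db X h + Rb"
  using eps unfolding Rb_def X' lb.scale by (simp add: scaleR_diff_right)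
 finally have q: "diff_quotient p x eps e (Suc k) w = h + A h + R"
  by (simp add: R_def A_def act_def matrix_vector_mult_add_rdistrib scaleR_right_distrib)
 have r: "inv_row p x u (Suc k) w \<bullet> y = r \<bullet> y - r \<bullet> A y + r \<bullet> A (A y)" for y
  unfolding inv_row.simps Let_def d_def[symmetric] X_def[symmetric] r_def[symmetric] dt_def[symmetric]
  by (simp add: inner_add_left inner_diff_left adj_inner A_def)
 have Aadd: "A (y + z) = A y + A z" for y z by (simp add: A_def act_add)
 show "inv_row p x u (Suc k) w \<bullet> diff_quotient p x eps e (Suc k) w = r \<bullet> h + (m + g)"
  unfolding r q Aadd m_def g_def by (simp add: R_def inner_add_right)
 show m: "m = (r v* Rs) \<bullet> d" by (simp add: m_def dot_lmul_matrix)
 have nh: "(norm (X' - X))^2 = \<bar>eps\<bar> * (\<bar>eps\<bar> * (norm h)^2)" unfolding X' by (simp add: power2_eq_square mult_ac)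
 have taylor: "1 / \<bar>eps\<bar> * a <= K * j * (norm h)^2" if "a <= K * (norm (X' - X))^2" for a
 proof -
  have "1 / \<bar>eps\<bar> * a <= (1 / \<bar>eps\<bar>) * (K * (norm (X' - X))^2)" using that by (intro mult_left_mono) auto
  also have "... = \<bar>eps\<bar> * (K * (norm h)^2)" unfolding nh using eps by simp
  also have "... <= j * (K * (norm h)^2)" using eps K by (intro mult_right_mono) auto
  finally show ?thesis by (simp add: mult_ac)
 qed
 have Rs: "norm Rs <= K * j * (norm h)^2" and Rb: "norm Rb <= K * j * (norm h)^2"
  unfolding Rs_def Rb_def norm_scaleR using taylor[OF s_taylor] taylor[OF b_taylor] by simp_all
 have c: "norm r * (norm h)^2 <= c" "norm r * norm h <= c" "0 <= c"
  by (auto simp: c_def power2_eq_square algebra_simps)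
 have KP: "K <= K_prod" using K by (simp add: K_prod_def)
 have "norm (r v* Rs) <= norm r * (K * j * (norm h)^2)"
  by (rule order_trans[OF norm_vector_matrix_mult mult_left_mono[OF Rs norm_ge_zero]])
 also have "... = K * j * (norm r * (norm h)^2)" by simp
 also have "... <= K_prod * j * c" using K KP j c by (intro mult_mono) auto
 finally show z: "norm (r v* Rs) <= K_prod * (j * c)" by (simp add: mult_ac)
 have "\<bar>m\<bar> <= norm (r v* Rs) * norm d" unfolding m by (rule Cauchy_Schwarz_ineq2)
 also have "... <= K_prod * (j * c) * norm d" by (intro mult_right_mono z) auto
 finally show "\<bar>m\<bar> <= K_prod * (j * c) * norm d" .
 let ?w = "norm d" and ?s = "step_size j dt (norm d)"
 define t where "t = dt + ?w"
 have t0: "0 <= t" using D by (simp add: t_def)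
 have s: "dt <= ?s" "?w^2 <= ?s" "0 <= ?s" using D by (auto intro: step_size_ge step_size_nonneg)
 have j1: "j^2 <= j" using j by (simp add: power2_eq_square mult_left_le)
 then have D1: "dt <= j" "dt <= 1" using D j by auto
 have "dt^2 <= dt" using D D1 by (simp add: power2_eq_square mult_left_le)
 have sd: "?s = dt + ?w^2 + ?w ^ 4 / j^2" by (simp add: step_size_def)
 have "t^2 <= 2 * dt^2 + 2 * ?w^2" unfolding t_def by (rule square_add_le)
 also have "... <= 2 * ?s"
 proof -
  obtain z where z: "?w ^ 4 / j^2 = z" "0 <= z" by simp
  show ?thesis using \<open>dt^2 <= dt\<close> z(2) unfolding sd z(1) by simp
 qed
 finally have t2: "t^2 <= 2 * ?s" .
 have "t ^ 3 <= 2 ^ 3 * (dt ^ 3 + ?w ^ 3)" unfolding t_def using D by (intro power_add_le) auto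
 also have "dt ^ 3 <= j * dt"
 proof -
  have "dt ^ 3 = dt^2 * dt" by (simp add: power3_eq_cube power2_eq_square)
  also have "... <= j * dt" using \<open>dt^2 <= dt\<close> D D1 by (intro mult_right_mono) auto
  finally show ?thesis .
 qed
 also have "?w ^ 3 <= j * (?w^2 + ?w ^ 4 / j^2)"
 proof -
  have "?w <= j + ?w^2 / j"
  proof (cases "?w <= j")
   case True
   then show ?thesis using j by (intro order_trans[OF True]) simp
  next
   case False
   then have "j * ?w <= ?w * ?w" by (intro mult_right_mono) auto
   then have "?w <= ?w^2 / j" using j by (simp add: field_simps power2_eq_square)
   then show ?thesis using j by simp
  qed
  then have "?w^2 * ?w <= ?w^2 * (j + ?w^2 / j)" by (intro mult_left_mono) auto
  also have "... = j * (?w^2 + ?w ^ 4 / j^2)" using j by (simp add: field_simps power2_eq_square power4_eq_xxxx)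
  finally show ?thesis by (simp add: power3_eq_cube power2_eq_square)
 qed
 also have "2 ^ 3 * (j * dt + j * (?w^2 + ?w ^ 4 / j^2)) = 8 * (j * ?s)" unfolding sd by (simp add: algebra_simps)
 finally have t3: "t ^ 3 <= 8 * (j * ?s)" by simp
 have nA: "norm (A y) <= K * t * norm y" for y unfolding A_def t_def by (rule norm_act[OF D(1)])
 have nA2: "norm (A (A y)) <= K^2 * t^2 * norm y" for y
 proof -
  have "norm (A (A y)) <= K * t * (K * t * norm y)"
   using K t0 by (intro order_trans[OF nA mult_left_mono[OF nA]]) auto
  then show ?thesis by (simp add: power2_eq_square mult_ac)
 qed
 have nA3: "norm (A (A (A y))) <= K ^ 3 * t ^ 3 * norm y" for y
 proof -
  have "norm (A (A (A y))) <= K^2 * t^2 * (K * t * norm y)"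
   using K t0 by (intro order_trans[OF nA2 mult_left_mono[OF nA]]) auto
  then show ?thesis by (simp add: power2_eq_square power3_eq_cube mult_ac)
 qed
 have nR: "norm R <= t * (K * j * (norm h)^2)"
 proof -
  have "norm R <= norm Rs * norm d + dt * norm Rb"
   unfolding R_def using norm_triangle_ineq[of "Rs *v d" "dt *\<^sub>R Rb"] norm_matrix_vector_mult[of Rs d] D by simp
  also have "... <= K * j * (norm h)^2 * norm d + dt * (K * j * (norm h)^2)"
   using D by (intro add_mono mult_right_mono mult_left_mono Rs Rb) auto
  finally show ?thesis by (simp add: t_def algebra_simps)
 qed
 have g1: "\<bar>r \<bullet> A (A (A h))\<bar> <= 8 * K ^ 3 * (j * ?s) * c"
 proof -
  have "\<bar>r \<bullet> A (A (A h))\<bar> <= norm r * (K ^ 3 * t ^ 3 * norm h)"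
   by (rule order_trans[OF Cauchy_Schwarz_ineq2 mult_left_mono[OF nA3]]) simp
  also have "... = K ^ 3 * t ^ 3 * (norm r * norm h)" by simp
  also have "... <= K ^ 3 * (8 * (j * ?s)) * c"
   using K t3 c s j t0 by (intro mult_mono mult_nonneg_nonneg zero_le_power) auto
  finally show ?thesis by simp
 qed
 have g2: "\<bar>dt * (r \<bullet> Rb)\<bar> <= K * (j * ?s) * c"
 proof -
  have "\<bar>dt * (r \<bullet> Rb)\<bar> <= dt * (norm r * (K * j * (norm h)^2))"
   unfolding abs_mult abs_of_nonneg[OF D(1)]
   by (intro mult_left_mono D order_trans[OF Cauchy_Schwarz_ineq2 mult_left_mono[OF Rb]]) auto
  also have "... = K * (j * dt) * (norm r * (norm h)^2)" by simp
  also have "... <= K * (j * ?s) * c"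
   using K c s j D by (intro mult_mono mult_nonneg_nonneg) auto
  finally show ?thesis .
 qed
 have g3: "\<bar>r \<bullet> A R\<bar> <= 2 * K^2 * (j * ?s) * c"
 proof -
  have "\<bar>r \<bullet> A R\<bar> <= norm r * (K * t * (t * (K * j * (norm h)^2)))"
   using K t0 by (intro order_trans[OF Cauchy_Schwarz_ineq2 mult_left_mono[OF order_trans[OF nA mult_left_mono[OF nR]]]]) auto
  also have "... = K^2 * (j * t^2) * (norm r * (norm h)^2)" by (simp add: power2_eq_square mult_ac)
  also have "... <= K^2 * (j * (2 * ?s)) * c"
   using K c s j t2 t0 by (intro mult_mono mult_nonneg_nonneg zero_le_power) auto
  finally show ?thesis by simp
 qed
 have g4: "\<bar>r \<bullet> A (A R)\<bar> <= 8 * K ^ 3 * (j * ?s) * c"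
 proof -
  have "\<bar>r \<bullet> A (A R)\<bar> <= norm r * (K^2 * t^2 * (t * (K * j * (norm h)^2)))"
   using K t0 by (intro order_trans[OF Cauchy_Schwarz_ineq2 mult_left_mono[OF order_trans[OF nA2 mult_left_mono[OF nR]]]]) auto
  also have "... = K ^ 3 * (j * t ^ 3) * (norm r * (norm h)^2)" by (simp add: power2_eq_square power3_eq_cube mult_ac)
  also have "... <= K ^ 3 * (j * (8 * (j * ?s))) * c"
   using K c s j t3 t0 by (intro mult_mono mult_nonneg_nonneg zero_le_power) auto
  also have "... = 8 * K ^ 3 * (j * (j * ?s)) * c" by simp
  also have "... <= 8 * K ^ 3 * (1 * (j * ?s)) * c"
   using K c s j by (intro mult_right_mono mult_left_mono) auto
  finally show ?thesis by simp
 qed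
 have "\<bar>g\<bar> <= \<bar>r \<bullet> A (A (A h))\<bar> + \<bar>dt * (r \<bullet> Rb)\<bar> + \<bar>r \<bullet> A R\<bar> + \<bar>r \<bullet> A (A R)\<bar>"
  unfolding g_def by linarith
 also have "... <= 8 * K ^ 3 * (j * ?s) * c + K * (j * ?s) * c + 2 * K^2 * (j * ?s) * c + 8 * K ^ 3 * (j * ?s) * c"
  by (intro add_mono g1 g2 g3 g4)
 also have "... = K_prod * (j * c) * ?s" by (simp add: K_prod_def algebra_simps)
 finally show "\<bar>g\<bar> <= K_prod * (j * c) * ?s" .
qed

text \<open>The product starts at \<open>u \<bullet> e\<close> and the multiplier of its steps
  contains \<open>h\<close>, so \<open>growth_chain_aux\<close> with \<open>A = 0\<close> bounds the
  deviation in L^2 by a multiple of \<open>h\<close>. In the limit the inverse rows form a left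
  inverse.\<close>

lemma inverse_flow_product:
 assumes gr: "grid p n" and h: "0 < h" "h <= 1" "\<And>k. k < n \<Longrightarrow> p (Suc k) - p k <= h^2"
  and e: "eps \<noteq> 0" "\<bar>eps\<bar> <= h" "norm e = 1" "norm u = 1"
 shows "(\<E>\<^sup>+ w. ennreal ((inv_row p x u n w \<bullet> diff_quotient p x eps e n w - u \<bullet> e)^2)) \<le>
   ennreal (exp (growth_const CARD('d) T 1 K_prod) * (T * (h^2 * size_const)))"
proof -
 let ?E = "euler p x" and ?F = "euler p (x + eps *\<^sub>R e)" and ?r = "inv_row p x u" and ?h = "diff_quotient p x eps e"
 let ?dW = "\<lambda>k w. W (p (Suc k)) w - W (p k) w" and ?D = "\<lambda>k. p (Suc k) - p k"
 let ?Rs = "\<lambda>k w. (1 / eps) *\<^sub>R (\<sigma> (?F k w) - \<sigma> (?E k w) - D\<sigma> (?E k w) (?F k w - ?E k w))"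
 let ?Rb = "\<lambda>k w. (1 / eps) *\<^sub>R (b (?F k w) - b (?E k w) - Db (?E k w) (?F k w - ?E k w))"
 let ?A = "\<lambda>k w. act (?E k w) (?D k) (?dW k w)"
 let ?R = "\<lambda>k w. ?Rs k w *v ?dW k w + ?D k *\<^sub>R ?Rb k w"
 let ?m = "\<lambda>k w. ?r k w \<bullet> (?Rs k w *v ?dW k w)"
 let ?g = "\<lambda>k w. ?r k w \<bullet> ?A k w (?A k w (?A k w (?h k w))) + ?D k * (?r k w \<bullet> ?Rb k w) - ?r k w \<bullet> ?A k w (?R k w)
   + ?r k w \<bullet> ?A k w (?A k w (?R k w))"
 let ?v = "\<lambda>k w. ?r k w \<bullet> ?h k w - u \<bullet> e"
 let ?c = "\<lambda>k w. norm (?r k w) * norm (?h k w) * (1 + norm (?h k w))"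
 have S: "p n - p 0 <= T" using grid_bounds[OF gr, of 0] grid_bounds[OF gr, of n] by auto
 have KP: "0 <= K_prod" using K by (simp add: K_prod_def)
 have SC: "0 <= size_const" by (simp add: size_const_def inv_const_def flow_const_def)
 have "integrable M (\<lambda>w. norm (?v n w) ^ (2 * 1)) \<and> (\<E> w. norm (?v n w) ^ (2 * 1)) \<le>
   exp (growth_const CARD('d) T 1 K_prod * (1 + 0 * T ^ 1)) * ((\<E> w. norm (?v 0 w) ^ (2 * 1)) + T ^ 1 * (h^2 * size_const))"
 proof (rule growth_chain_aux[where v="?v" and m="?m" and g="?g" and c="\<lambda>k w. h * ?c k w"
   and \<zeta>="\<lambda>k w. ?v k w *\<^sub>R (?r k w v* ?Rs k w)", OF gr le0 S T_pos order_refl h(1,3) order_refl KP])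
  fix k assume k: "k < n"
  have kn: "k <= n" using k by simp
  have mE: "?E k \<in> bm M" "?F k \<in> bm M" "?dW k \<in> bm M" "?r k \<in> bm M"
   using euler_events[OF gr kn] dW_measurable[OF gr k] inv_row_events[OF gr kn] by auto
  note mi = euler_measurable[OF gr kn, of x 0] euler_measurable[OF gr kn, of "x + eps *\<^sub>R e" 0] inv_row_measurable[OF gr kn, of x u 0]
  have hm: "?h k \<in> bm M" unfolding diff_quotient_def[abs_def]
   by (intro borel_measurable_scaleR borel_measurable_const borel_measurable_diff mE)
  have hi: "?h k \<in> bm (\<F> (p k) 0)" unfolding diff_quotient_def[abs_def]
   by (intro borel_measurable_scaleR borel_measurable_const borel_measurable_diff mi)
  have Rsm: "?Rs k \<in> bm M" and Rbm: "?Rb k \<in> bm M"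
   by (intro borel_measurable_scaleR borel_measurable_const borel_measurable_diff mE measurable_Ds measurable_Db
     measurable_compose[OF _ s_meas] measurable_compose[OF _ b_meas])+
  have Rsi: "?Rs k \<in> bm (\<F> (p k) 0)"
   by (intro borel_measurable_scaleR borel_measurable_const borel_measurable_diff mi measurable_Ds measurable_Db
     measurable_compose[OF _ s_meas])
  have D: "0 <= ?D k" "?D k <= h^2" using grid_step[OF gr k] h(3)[OF k] by auto
  show vi: "?v k \<in> bm (\<F> (p k) 0)"
   by (intro borel_measurable_diff borel_measurable_inner borel_measurable_const mi hi)
  show ci: "(\<lambda>w. h * ?c k w) \<in> bm (\<F> (p k) 0)"
   by (intro borel_measurable_times borel_measurable_add borel_measurable_const measurable_compose[OF _ borel_measurable_norm] mi hi)
  show "(\<lambda>w. ?v k w *\<^sub>R (?r k w v* ?Rs k w)) \<in> bm (\<F> (p k) 0)"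
   by (intro borel_measurable_scaleR vi measurable_vector_matrix_mult mi Rsi)
  show "?m k \<in> bm M" by (intro borel_measurable_inner measurable_matrix_vector_mult mE Rsm)
  have Am: "(\<lambda>w. ?A k w (y w)) \<in> bm M" if "y \<in> bm M" for y
   by (rule measurable_act[OF mE(1,3) that])
  have Rm: "?R k \<in> bm M"
   by (rule borel_measurable_add[OF measurable_matrix_vector_mult[OF Rsm mE(3)] borel_measurable_scaleR[OF borel_measurable_const Rbm]])
  have gm: "(\<lambda>w. ?r k w \<bullet> ?A k w (?A k w (?A k w (?h k w)))) \<in> bm M"
   "(\<lambda>w. ?D k * (?r k w \<bullet> ?Rb k w)) \<in> bm M"
   "(\<lambda>w. ?r k w \<bullet> ?A k w (?R k w)) \<in> bm M"
   "(\<lambda>w. ?r k w \<bullet> ?A k w (?A k w (?R k w))) \<in> bm M"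
   by (rule borel_measurable_inner[OF mE(4) Am[OF Am[OF Am[OF hm]]]],
     rule borel_measurable_times[OF borel_measurable_const borel_measurable_inner[OF mE(4) Rbm]],
     rule borel_measurable_inner[OF mE(4) Am[OF Rm]],
     rule borel_measurable_inner[OF mE(4) Am[OF Am[OF Rm]]])
  show "?g k \<in> bm M"
   by (rule borel_measurable_add[OF borel_measurable_diff[OF borel_measurable_add[OF gm(1,2)] gm(3)] gm(4)])
  fix w
  note st = product_step[where p=p and k=k and x=x and u=u and w=w and eps=eps and e=e, OF D h(1,2) e(1,2)]
  show "?v (Suc k) w = ?v k w + (?m k w + ?g k w)" using st(1) by linarith
  show "?v k w \<bullet> ?m k w = (?v k w *\<^sub>R (?r k w v* ?Rs k w)) \<bullet> ?dW k w"
   using st(2) by simp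
  show "norm (?v k w *\<^sub>R (?r k w v* ?Rs k w)) <= K_prod * (h * ?c k w) * norm (?v k w)"
   unfolding norm_scaleR using mult_left_mono[OF st(3), of "\<bar>?v k w\<bar>"] by (simp only: mult.commute real_norm_def abs_ge_zero)
  show "norm (?m k w) <= K_prod * (h * ?c k w) * norm (?dW k w)" using st(4) by simp
  show "norm (?g k w) <= K_prod * (h * ?c k w) * step_size h (?D k) (norm (?dW k w))" using st(5) by simp
 next
  fix k assume k: "k < n"
  then have kn: "k <= n" and gk: "grid p k" using grid_le[OF gr] by auto
  have mE: "?E k \<in> bm M" "?F k \<in> bm M" "?r k \<in> bm M"
   using euler_events[OF gr kn] inv_row_events[OF gr kn] by auto
  have hm: "?h k \<in> bm M" unfolding diff_quotient_def[abs_def]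
   by (intro borel_measurable_scaleR borel_measurable_const borel_measurable_diff mE)
  let ?b = "\<lambda>w. h^2 * (2 * norm (?r k w) ^ (2 * 2) + norm (?h k w) ^ (2 * 2) + norm (?h k w) ^ (2 * 4))"
  note ir = inv_row_moment[OF gk, of 2 x u] and ih = diff_quotient_moment[OF gk _ e(1,3), of 2 x] diff_quotient_moment[OF gk _ e(1,3), of 4 x]
  have le: "(h * ?c k w) ^ (2 * 1) <= ?b w" for w
  proof -
   let ?x = "norm (?r k w)" and ?y = "norm (?h k w)"
   have "(?c k w)^2 = ?x^2 * ?y^2 * (1 + ?y)^2" by (simp add: power_mult_distrib)
   also have "... <= ?x^2 * ?y^2 * (2 * 1^2 + 2 * ?y^2)" by (intro mult_left_mono square_add_le) auto
   also have "... = 2 * ?x^2 * ?y^2 + 2 * ?x^2 * (?y^2)^2" by (simp add: algebra_simps power2_eq_square)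
   also have "... <= ((?x^2)^2 + (?y^2)^2) + ((?x^2)^2 + ((?y^2)^2)^2)"
    by (intro add_mono sum_squares_bound)
   also have "... = 2 * ?x ^ (2 * 2) + ?y ^ (2 * 2) + ?y ^ (2 * 4)" by (simp flip: power_mult)
   finally have "h^2 * (?c k w)^2 <= ?b w" by (intro mult_left_mono) auto
   then show ?thesis by (simp add: power_mult_distrib)
  qed
  have ib: "integrable M ?b" using ir ih by (intro integrable_mult_right Bochner_Integration.integrable_add) auto
  have ic: "integrable M (\<lambda>w. (h * ?c k w) ^ (2 * 1))"
  proof (rule Bochner_Integration.integrable_bound[OF ib])
   show "(\<lambda>w. (h * ?c k w) ^ (2 * 1)) \<in> bm M"
    by (intro borel_measurable_power borel_measurable_times borel_measurable_add borel_measurable_const measurable_compose[OF _ borel_measurable_norm] mE hm)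
   show "AE w in M. norm ((h * ?c k w) ^ (2 * 1)) <= norm (?b w)"
   proof (rule AE_I2)
    fix w
    have "0 <= (h * ?c k w) ^ (2 * 1)" by (simp only: power_mult zero_le_power2 power_one_right)
    then have "norm ((h * ?c k w) ^ (2 * 1)) = (h * ?c k w) ^ (2 * 1)" unfolding real_norm_def by (rule abs_of_nonneg)
    also have "... <= norm (?b w)" unfolding real_norm_def by (rule order_trans[OF le abs_ge_self])
    finally show "norm ((h * ?c k w) ^ (2 * 1)) <= norm (?b w)" .
   qed
  qed
  have "(\<E> w. (h * ?c k w) ^ (2 * 1)) <= (\<E> w. ?b w)" by (intro integral_mono ic ib le)
  also have "... = h^2 * (2 * (\<E> w. norm (?r k w) ^ (2 * 2)) + (\<E> w. norm (?h k w) ^ (2 * 2)) + (\<E> w. norm (?h k w) ^ (2 * 4)))"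
   using ir ih by simp
  also have "... <= h^2 * (2 * (inv_const 2 * norm u ^ (2 * 2)) + flow_const 2 + flow_const 4)"
   using ir ih by (intro mult_left_mono add_mono) auto
  also have "... = h^2 * size_const" using e by (simp add: size_const_def)
  finally show "integrable M (\<lambda>w. (h * ?c k w) ^ (2 * 1)) \<and>
    (\<E> w. (h * ?c k w) ^ (2 * 1)) <= 0 * (\<E> w. norm (?v k w) ^ (2 * 1)) + h^2 * size_const"
   using ic by simp
 qed (use h SC e in \<open>auto simp: diff_quotient_def\<close>)
 moreover have "?v 0 w = 0" for w using e by (simp add: diff_quotient_def)
 ultimately have "integrable M (\<lambda>w. (?v n w)^2)" and
  "(\<E> w. (?v n w)^2) <= exp (growth_const CARD('d) T 1 K_prod) * (T * (h^2 * size_const))"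
  by auto
 then show ?thesis by (subst nn_integral_eq_integral) (auto intro: ennreal_leI)
qed

end

section \<open>Strong convergence of the Euler scheme\<close>

text \<open>The Cauchy-Schwarz inequality in a form whose right side may be infinite, so that it
  applies path by path.\<close>

lemma set_integral_square_le:
 fixes f :: "real => real"
 assumes f: "set_integrable lborel {s<..t} f" and st: "s <= t"
 shows "ennreal ((LINT r:{s<..t}|lborel. f r)^2) <= ennreal (t - s) * (\<integral>\<^sup>+r\<in>{s<..t}. ennreal ((f r)^2) \<partial>lborel)"
proof -
 let ?g = "\<lambda>r. ennreal \<bar>indicator {s<..t} r * f r\<bar>" and ?I = "LINT r:{s<..t}|lborel. f r"
 have [measurable]: "(\<lambda>r. indicator {s<..t} r * f r) \<in> bm lborel"
  using f by (simp add: set_integrable_def borel_measurable_integrable)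
 have "ennreal \<bar>?I\<bar> <= (\<integral>\<^sup>+r. ?g r \<partial>lborel)"
  using integral_norm_bound_ennreal[of lborel "\<lambda>r. indicator {s<..t} r *\<^sub>R f r"] f
  by (simp add: set_integrable_def set_lebesgue_integral_def)
 then have "ennreal (?I^2) <= (\<integral>\<^sup>+r. ?g r \<partial>lborel)^2"
  using power_mono[of "ennreal \<bar>?I\<bar>" _ 2] by (simp add: ennreal_power)
 also have "(\<integral>\<^sup>+r. ?g r \<partial>lborel) = (\<integral>\<^sup>+r. indicator {s<..t} r * ?g r \<partial>lborel)"
  by (intro nn_integral_cong) (auto simp: indicator_def)
 also have "...^2 <= (\<integral>\<^sup>+r. (indicator {s<..t} r)^2 \<partial>lborel) * (\<integral>\<^sup>+r. (?g r)^2 \<partial>lborel)"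
  by (rule Cauchy_Schwarz_nn_integral) measurable
 also have "(\<integral>\<^sup>+r. (indicator {s<..t} r)^2 \<partial>lborel) = (\<integral>\<^sup>+r. indicator {s<..t} r \<partial>lborel)"
  by (intro nn_integral_cong) (auto simp: indicator_def)
 also have "... = ennreal (t - s)" using st by simp
 also have "(\<integral>\<^sup>+r. (?g r)^2 \<partial>lborel) = (\<integral>\<^sup>+r\<in>{s<..t}. ennreal ((f r)^2) \<partial>lborel)"
  by (intro nn_integral_cong) (auto simp: indicator_def ennreal_power)
 finally show ?thesis .
qed

text \<open>With \<open>\<delta>\<close> proportional to the step length the main term is inflated
  by \<open>1 + O(dt)\<close> only, which survives iteration over a grid.\<close>

lemma square_sum_weighted_le:
 fixes a c :: real
 assumes "0 < \<delta>"
 shows "(a + c)^2 <= (1 + \<delta>) * a^2 + (1 + 1 / \<delta>) * c^2"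
proof -
 have "2 * (sqrt \<delta> * a) * (c / sqrt \<delta>) <= (sqrt \<delta> * a)^2 + (c / sqrt \<delta>)^2" by (rule sum_squares_bound)
 then have "2 * (a * c) <= \<delta> * a^2 + c^2 / \<delta>" using assms by (simp add: power_mult_distrib power_divide)
 then show ?thesis by (simp add: power2_sum algebra_simps)
qed

lemma nn_integral_square_add_orthogonal:
 fixes d e :: "'a => real"
 assumes d: "integrable N (\<lambda>x. (d x)^2)" and e: "integrable N (\<lambda>x. (e x)^2)"
  and de: "integrable N (\<lambda>x. d x * e x)" "(\<integral>x. d x * e x \<partial>N) = 0"
 shows "(\<integral>\<^sup>+x. ennreal ((d x + e x)^2) \<partial>N) = (\<integral>\<^sup>+x. ennreal ((d x)^2) \<partial>N) + (\<integral>\<^sup>+x. ennreal ((e x)^2) \<partial>N)"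
proof -
 have eq: "(d x + e x)^2 = (d x)^2 + (e x)^2 + 2 * (d x * e x)" for x by (simp add: power2_sum)
 have i: "integrable N (\<lambda>x. (d x + e x)^2)" unfolding eq using d e de by simp
 have "(\<integral>x. (d x + e x)^2 \<partial>N) = (\<integral>x. (d x)^2 \<partial>N) + (\<integral>x. (e x)^2 \<partial>N)"
  unfolding eq using d e de by simp
 then show ?thesis
  using nn_integral_eq_integral[OF i] nn_integral_eq_integral[OF d] nn_integral_eq_integral[OF e]
  by (simp add: ennreal_plus)
qed

lemma ennreal_norm_square_sum:
 fixes x :: "real^'n"
 shows "ennreal ((norm x)^2) = (\<Sum>i\<in>UNIV. ennreal ((x $ i)^2))"
proof -
 have "(norm x)^2 = (\<Sum>i\<in>UNIV. (x $ i)^2)"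
  unfolding power2_norm_eq_inner inner_vec_def by (simp add: power2_eq_square)
 then show ?thesis by (simp add: sum_ennreal)
qed

lemma sum_norm_rows: "(\<Sum>i\<in>UNIV. (norm (A $ i))^2) = (norm (A::real^'n^'m))^2"
 unfolding norm_vec_def[of A] L2_set_def by (simp add: sum_nonneg)

lemma process_measurable:
 fixes \<Phi> :: "real => 'w => 'b::{real_normed_vector, second_countable_topology}"
 assumes "process M T \<Phi>"
 shows "(\<lambda>p. indicator {0..T} (fst p) *\<^sub>R \<Phi> (fst p) (snd p)) \<in> bm (lborel \<Otimes>\<^sub>M M)"
 by (rule measurable_restrict_indicator) (use assms in \<open>auto simp: process_def case_prod_unfold\<close>)

lemma (in ito_direction) ito_nn_isometry:
 assumes I: "ito s t \<Psi> J" and st: "0 <= s" "s <= t" "t <= T"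
 shows "(\<E>\<^sup>+ w. ennreal ((J w)^2)) = (\<integral>\<^sup>+p. ennreal ((norm (\<Psi> p))^2) \<partial>PM)"
proof -
 have "bounded ((\<lambda>_. 1::real) ` space M)" by (auto simp: bounded_iff)
 from ito_isometry[OF I st weight_const this] show ?thesis
  using nn_integral_eq_integral[OF ito_square_integrable(1)[OF I st]]
   nn_integral_eq_integral[OF ito_square_integrable(2)[OF I st]] by simp
qed

lemma norm_vec_square: "(norm (x::real^'n))^2 = (\<Sum>i\<in>UNIV. (x $ i)^2)"
 by (simp add: norm_vec_def L2_set_def sum_nonneg)

text \<open>Bundles measurability and nonnegativity with a bound of the nonnegative integral, so
  that bounds combine without separate integrability proofs.\<close>

definition moment_le :: "'w measure => ('w => real) => real => bool" where
 "moment_le N f c \<longleftrightarrow> f \<in> bm N \<and> (\<forall>w. 0 <= f w) \<and> 0 <= c \<and> (\<integral>\<^sup>+w. ennreal (f w) \<partial>N) <= ennreal c"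

lemma moment_le_add: "moment_le N f c \<Longrightarrow> moment_le N g d \<Longrightarrow> moment_le N (\<lambda>w. f w + g w) (c + d)"
 unfolding moment_le_def by (auto simp: nn_integral_add add_mono)

lemma moment_le_cmult: "moment_le N f c \<Longrightarrow> 0 <= a \<Longrightarrow> moment_le N (\<lambda>w. a * f w) (a * c)"
 unfolding moment_le_def by (auto simp: ennreal_mult nn_integral_cmult mult_left_mono)

lemma moment_le_sum:
 assumes "\<And>i. i \<in> I \<Longrightarrow> moment_le N (f i) (c i)"
 shows "moment_le N (\<lambda>w. \<Sum>i\<in>I. f i w) (\<Sum>i\<in>I. c i)" using assms
proof (induction I rule: infinite_finite_induct)
 case (insert i I)
 then show ?case using moment_le_add[of N "f i" "c i"] by simp
qed (auto simp: moment_le_def)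

lemma moment_le_weaken: "moment_le N f c \<Longrightarrow> c <= d \<Longrightarrow> moment_le N f d"
 unfolding moment_le_def by (auto elim!: order_trans intro!: ennreal_leI)

lemma moment_le_mono:
 "moment_le N g c \<Longrightarrow> f \<in> bm N \<Longrightarrow> (\<And>w. 0 <= f w) \<Longrightarrow> (\<And>w. f w <= g w) \<Longrightarrow> moment_le N f c"
 unfolding moment_le_def using order_trans[OF nn_integral_mono[of N "\<lambda>w. ennreal (f w)" "\<lambda>w. ennreal (g w)"]]
 by (auto intro: ennreal_leI)

text \<open>Turns a bound at each fixed time into one on the product space; it asks for control at
  the times in \<open>A\<close> only.\<close>

lemma (in prob_space) strip_integral_le:
 assumes f [measurable]: "f \<in> bm (lborel \<Otimes>\<^sub>M M)" "A \<in> sets lborel"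
  and c: "\<And>r. r \<in> A \<Longrightarrow> (\<E>\<^sup>+ w. f (r, w)) <= c"
 shows "(\<integral>\<^sup>+p. f p * indicator A (fst p) \<partial>(lborel \<Otimes>\<^sub>M M)) <= c * emeasure lborel A"
proof -
 have "(\<integral>\<^sup>+p. f p * indicator A (fst p) \<partial>(lborel \<Otimes>\<^sub>M M)) = (\<integral>\<^sup>+r. (\<E>\<^sup>+ w. f (r, w) * indicator A r) \<partial>lborel)"
  by (subst nn_integral_fst[symmetric]) auto
 also have "... <= (\<integral>\<^sup>+r. c * indicator A r \<partial>lborel)"
  by (intro nn_integral_mono) (auto simp: indicator_def c)
 also have "... = c * emeasure lborel A" by (rule nn_integral_cmult_indicator) (rule assms)
 finally show ?thesis .
qed

text \<open>\<open>d\<close> and \<open>N\<close> are orthogonal, so their squares add without loss.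
  The drift is split off with \<open>\<delta> = t - s\<close>; the factor
  \<open>1 / \<delta>\<close> is paid for by the length that the Cauchy-Schwarz inequality in time
  provides.\<close>

lemma (in ito_direction) ito_step:
 assumes I: "ito s t \<Psi> N" and st: "0 <= s" "s < t" "t <= T"
  and d: "weight s t d" "integrable M (\<lambda>w. (d w)^2)" and f: "f \<in> bm PM"
  and x: "AE w in M. set_integrable lborel {s<..t} (\<lambda>r. f (r, w)) \<and> x w = d w + N w + (LINT r:{s<..t}|lborel. f (r, w))"
 shows "(\<E>\<^sup>+ w. ennreal ((x w)^2)) <= ennreal (1 + (t - s)) *
  ((\<E>\<^sup>+ w. ennreal ((d w)^2)) + (\<integral>\<^sup>+p. ennreal ((norm (\<Psi> p))^2 + indicator {s<..t} (fst p) * (f p)^2) \<partial>PM))"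
proof -
 have st': "s <= t" and D: "0 < t - s" using st by auto
 note I' = I st(1) st' st(3)
 note [measurable] = f weight_measurable[OF d(1) st(1) st' st(3)] ito_measurable[OF I]
 let ?c = "ennreal (1 + (t - s))" and ?g = "\<lambda>p. ennreal (indicator {s<..t} (fst p) * (f p)^2)"
 have "AE w in M. ennreal ((x w)^2) <= ?c * (ennreal ((d w + N w)^2) + (\<integral>\<^sup>+r. ?g (r, w) \<partial>lborel))"
  using x
 proof eventually_elim
  case (elim w)
  let ?V = "LINT r:{s<..t}|lborel. f (r, w)"
  have V: "ennreal (?V^2) <= ennreal (t - s) * (\<integral>\<^sup>+r. ?g (r, w) \<partial>lborel)"
   using set_integral_square_le[of s t "\<lambda>r. f (r, w)"] elim st'
   by (simp add: indicator_def of_bool_def if_distrib if_distribR cong: if_cong)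
  have "(x w)^2 <= (1 + (t - s)) * (d w + N w)^2 + (1 + 1 / (t - s)) * ?V^2"
   using elim square_sum_weighted_le[OF D] by simp
  then have "ennreal ((x w)^2) <= ?c * ennreal ((d w + N w)^2) + ennreal (1 + 1 / (t - s)) * ennreal (?V^2)"
   using D by (simp add: ennreal_leI ennreal_mult[symmetric] ennreal_plus[symmetric] del: ennreal_plus)
  also have "ennreal (1 + 1 / (t - s)) * ennreal (?V^2) <= ennreal (1 + 1 / (t - s)) * (ennreal (t - s) * (\<integral>\<^sup>+r. ?g (r, w) \<partial>lborel))"
   by (intro mult_left_mono V) simp
  also have "... = ?c * (\<integral>\<^sup>+r. ?g (r, w) \<partial>lborel)"
  proof -
   have "(1 + 1 / (t - s)) * (t - s) = 1 + (t - s)" using D by (simp add: field_simps)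
   then have "ennreal (1 + 1 / (t - s)) * ennreal (t - s) = ?c" using D by (subst ennreal_mult[symmetric]) auto
   then show ?thesis by (simp only: mult.assoc[symmetric])
  qed
  finally show ?case by (simp add: add_left_mono distrib_left)
 qed
 then have "(\<E>\<^sup>+ w. ennreal ((x w)^2)) <= (\<E>\<^sup>+ w. ?c * (ennreal ((d w + N w)^2) + (\<integral>\<^sup>+r. ?g (r, w) \<partial>lborel)))"
  by (rule nn_integral_mono_AE)
 also have "... = ?c * ((\<E>\<^sup>+ w. ennreal ((d w + N w)^2)) + (\<integral>\<^sup>+p. ?g p \<partial>PM))"
  by (subst pair.nn_integral_snd[symmetric]) (simp_all add: nn_integral_cmult nn_integral_add)
 also have "(\<E>\<^sup>+ w. ennreal ((d w + N w)^2)) = (\<E>\<^sup>+ w. ennreal ((d w)^2)) + (\<integral>\<^sup>+p. ennreal ((norm (\<Psi> p))^2) \<partial>PM)"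
  using nn_integral_square_add_orthogonal[OF d(2) ito_square_integrable(2)[OF I'] ito_orthogonal(2,1)[OF I' d]] ito_nn_isometry[OF I']
  by simp
 finally show ?thesis by (simp add: nn_integral_add add.assoc)
qed

context diffusion
begin

lemma sde_increment:
 assumes X: "sde_solution M W B T b \<sigma> x X" and st: "0 <= s" "s <= t" "t <= T"
 obtains J where "fwd.ito s t (\<lambda>p. indicator {s<..t} (fst p) *\<^sub>R (\<sigma> (X (fst p) (snd p)) $ i)) J"
  "AE w in M. set_integrable lborel {s<..t} (\<lambda>r. b (X r w) $ i) \<and>
   X t w $ i - X s w $ i = (LINT r:{s<..t}|lborel. b (X r w) $ i) + J w"
proof -
 have *: "\<exists>J. has_fwd_integral M W B T 0 u (\<lambda>r w. \<sigma> (X r w) $ i) J \<and>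
   (AE w in M. set_integrable lborel {0..u} (\<lambda>r. b (X r w) $ i) \<and>
   X u w $ i = x $ i + (LINT r:{0..u}|lborel. b (X r w) $ i) + J w)" if "0 <= u" "u <= T" for u
  using X that unfolding sde_solution_def by auto
 obtain J where J: "has_fwd_integral M W B T 0 t (\<lambda>r w. \<sigma> (X r w) $ i) J"
  "AE w in M. set_integrable lborel {0..t} (\<lambda>r. b (X r w) $ i) \<and>
   X t w $ i = x $ i + (LINT r:{0..t}|lborel. b (X r w) $ i) + J w" using *[of t] st by auto
 obtain J' where J': "has_fwd_integral M W B T 0 s (\<lambda>r w. \<sigma> (X r w) $ i) J'"
  "AE w in M. set_integrable lborel {0..s} (\<lambda>r. b (X r w) $ i) \<and>
   X s w $ i = x $ i + (LINT r:{0..s}|lborel. b (X r w) $ i) + J' w" using *[of s] st by auto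
 show thesis
 proof (rule that[of "\<lambda>w. J w - J' w"])
  show "fwd.ito s t (\<lambda>p. indicator {s<..t} (fst p) *\<^sub>R (\<sigma> (X (fst p) (snd p)) $ i)) (\<lambda>w. J w - J' w)"
  proof (rule fwd.ito_increment)
   show "fwd.ito 0 t (\<lambda>p. indicator {0<..t} (fst p) *\<^sub>R (\<sigma> (X (fst p) (snd p)) $ i)) J"
    using J(1) st unfolding has_fwd_integral_def by (intro fwd.ito_of_has_ito_integral) auto
   show "fwd.ito 0 s (\<lambda>p. indicator {0<..s} (fst p) *\<^sub>R (\<sigma> (X (fst p) (snd p)) $ i)) J'"
    using J'(1) st unfolding has_fwd_integral_def by (intro fwd.ito_of_has_ito_integral) auto
  qed (use st in auto)
  show "AE w in M. set_integrable lborel {s<..t} (\<lambda>r. b (X r w) $ i) \<and>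
   X t w $ i - X s w $ i = (LINT r:{s<..t}|lborel. b (X r w) $ i) + (J w - J' w)"
   using J(2) J'(2)
  proof eventually_elim
   case (elim w)
   let ?f = "\<lambda>r. b (X r w) $ i"
   have i: "set_integrable lborel {s<..t} ?f" "set_integrable lborel {0..s} ?f"
    using elim st by (auto intro: set_integrable_subset)
   have "{0..t} = {0..s} \<union> {s<..t}" using st by auto
   then have "(LINT r:{0..t}|lborel. ?f r) = (LINT r:{0..s}|lborel. ?f r) + (LINT r:{s<..t}|lborel. ?f r)"
    using set_integral_Un[OF _ i(2) i(1)] by (simp add: Int_def)
   then show ?case using elim i by auto
  qed
 qed
qed

abbreviation PM :: "(real \<times> 'w) measure" where "PM \<equiv> lborel \<Otimes>\<^sub>M M"

lemma nn_integral_PM_fst: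
 "f \<in> bm PM \<Longrightarrow> (\<integral>\<^sup>+p. f p \<partial>PM) = (\<integral>\<^sup>+r. (\<E>\<^sup>+ w. f (r, w)) \<partial>lborel)"
 by (rule nn_integral_fst[symmetric])

lemma sde_measurable:
 assumes "sde_solution M W B T b \<sigma> x X" "0 <= t" "t <= T"
 shows "X t \<in> bm (\<F> t T)" "X t \<in> bm M"
proof -
 show "X t \<in> bm (\<F> t T)" using assms by (auto simp: sde_solution_def)
 then show "X t \<in> bm M" by (rule measurable_info_events) (use assms T_pos in auto)
qed

lemma sde_process: "sde_solution M W B T b \<sigma> x X \<Longrightarrow> process M T X"
 by (simp add: sde_solution_def)

text \<open>One step from a starting value \<open>G\<close> with frozen coefficients \<open>S\<close> and \<open>\<beta>\<close>.\<close>

lemma sde_step: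
 assumes X: "sde_solution M W B T b \<sigma> x X" and st: "0 <= s" "s < t" "t <= T"
  and G: "G \<in> bm (\<F> s 0)" and S: "S \<in> bm (\<F> s 0)" "\<And>w. norm (S w) <= K"
  and \<beta>: "\<beta> \<in> bm (\<F> s 0)"
  and a: "moment_le M (\<lambda>w. (norm (X s w - G w))^2) a"
  and c: "\<And>r w. s <= r \<Longrightarrow> r <= t \<Longrightarrow> (norm (\<sigma> (X r w) - S w))^2 + (norm (b (X r w) - \<beta> w))^2 <= g r w"
   "\<And>r. s <= r \<Longrightarrow> r <= t \<Longrightarrow> moment_le M (g r) c"
 shows "moment_le M (\<lambda>w. (norm (X t w - (G w + (S w *v (W t w - W s w) + (t - s) *\<^sub>R \<beta> w))))^2)
  ((1 + (t - s)) * (a + c * (t - s)))"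
proof -
 have st': "s <= t" "s <= T" "0 <= t" using st by auto
 note Xi = sde_measurable(1)[OF X st(1) st'(2)]
 have M: "G \<in> bm M" "S \<in> bm M" "\<beta> \<in> bm M"
  using measurable_info_events[OF _ st'(2) order_refl] G S \<beta> by blast+
 note [measurable] = M sde_measurable(2)[OF X st(1) st'(2)] sde_measurable(2)[OF X st'(3) st(3)] W_measurable[OF st(1) st'(2)] W_measurable[OF st'(3) st(3)]
 \<comment> \<open>Extension by 0 outside \<open>[0, T]\<close>, where \<open>process\<close> says
   nothing; it makes the integrands jointly measurable on the whole line.\<close>
 define Y where "Y p = indicator {0..T} (fst p) *\<^sub>R X (fst p) (snd p)" for p
 have [measurable]: "Y \<in> bm PM" unfolding Y_def[abs_def] by (rule process_measurable[OF sde_process[OF X]])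
 have YX: "Y (r, w) = X r w" if "r \<in> {s<..t}" for r w using that st by (auto simp: Y_def)
 let ?x = "\<lambda>w. X t w - (G w + (S w *v (W t w - W s w) + (t - s) *\<^sub>R \<beta> w))" and ?d = "\<lambda>w. X s w - G w"
 let ?f = "\<lambda>p. b (Y p) - \<beta> (snd p)" and ?S = "\<lambda>p. \<sigma> (Y p) - S (snd p)"
 let ?h = "\<lambda>i p. (norm (indicator {s<..t} (fst p) *\<^sub>R ?S p $ i))^2 + indicator {s<..t} (fst p) * (?f p $ i)^2"
 have [measurable]: "(\<lambda>p. \<sigma> (Y p) $ i) \<in> bm PM" "(\<lambda>p. b (Y p) $ i) \<in> bm PM" for i by measurable
 have comp: "(\<E>\<^sup>+ w. ennreal ((?x w $ i)^2)) \<le>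
  ennreal (1 + (t - s)) * ((\<E>\<^sup>+ w. ennreal ((?d w $ i)^2)) + (\<integral>\<^sup>+p. ennreal (?h i p) \<partial>PM))" for i
 proof -
  obtain J where J: "fwd.ito s t (\<lambda>p. indicator {s<..t} (fst p) *\<^sub>R (\<sigma> (X (fst p) (snd p)) $ i)) J"
   and eq: "AE w in M. set_integrable lborel {s<..t} (\<lambda>r. b (X r w) $ i) \<and>
    X t w $ i - X s w $ i = (LINT r:{s<..t}|lborel. b (X r w) $ i) + J w"
   using sde_increment[OF X st(1) st'(1) st(3)] by blast
  let ?bs = "[(s, t, \<lambda>w. S w $ i)]"
  have "(\<lambda>w. S w $ i) \<in> bm (\<F> s 0)" by (intro measurable_vec_nth S)
  moreover have "bounded ((\<lambda>w. S w $ i) ` space M)"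
   using order_trans[OF Finite_Cartesian_Product.norm_nth_le S(2)] by (auto simp: bounded_iff)
  ultimately have v: "\<forall>b\<in>set ?bs. fwd.valid s t b" using st by (simp add: fwd.valid_def)
  have "fwd.ito s t (\<lambda>p. indicator {s<..t} (fst p) *\<^sub>R (\<sigma> (X (fst p) (snd p)) $ i) - block_process ?bs p) (\<lambda>w. J w - block_integral W ?bs w)"
   by (rule fwd.ito_diff[OF J fwd.ito_block_list[OF v st(1) st'(1) st(3)] st(1) st'(1) st(3)])
  moreover have "indicator {s<..t} (fst p) *\<^sub>R (\<sigma> (X (fst p) (snd p)) $ i) - block_process ?bs p = indicator {s<..t} (fst p) *\<^sub>R ?S p $ i" for p
   using YX[of "fst p" "snd p"] by (cases "fst p \<in> {s<..t}") (auto simp: block_process_def)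
  ultimately have N: "fwd.ito s t (\<lambda>p. indicator {s<..t} (fst p) *\<^sub>R ?S p $ i) (\<lambda>w. J w - block_integral W ?bs w)" by simp
  show ?thesis
  proof (rule fwd.ito_step[OF N st])
   show "fwd.weight s t (\<lambda>w. ?d w $ i)" unfolding fwd.weight_def using T_pos st
    by (auto intro!: measurable_vec_nth borel_measurable_diff measurable_info_mono[OF G] measurable_info_mono[OF Xi])
   have "(\<E>\<^sup>+ w. ennreal ((norm (?d w $ i))^2)) <= (\<E>\<^sup>+ w. ennreal ((norm (?d w))^2))"
    by (intro nn_integral_mono ennreal_leI power_mono Finite_Cartesian_Product.norm_nth_le) auto
   also have "... < \<infinity>" using a by (auto simp: moment_le_def intro: le_less_trans)
   finally show "integrable M (\<lambda>w. (?d w $ i)^2)" using square_integrable_iff[of "\<lambda>w. ?d w $ i" M] by simp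
   show "AE w in M. set_integrable lborel {s<..t} (\<lambda>r. ?f (r, w) $ i) \<and>
    ?x w $ i = ?d w $ i + (J w - block_integral W ?bs w) + (LINT r:{s<..t}|lborel. ?f (r, w) $ i)"
    using eq
   proof eventually_elim
    case (elim w)
    have c: "set_integrable lborel {s<..t} (\<lambda>r. \<beta> w $ i)" using st by (auto simp: set_integrable_def)
    have Yc: "set_integrable lborel {s<..t} (\<lambda>r. ?f (r, w) $ i) = set_integrable lborel {s<..t} (\<lambda>r. b (X r w) $ i - \<beta> w $ i)"
     "(LINT r:{s<..t}|lborel. ?f (r, w) $ i) = (LINT r:{s<..t}|lborel. b (X r w) $ i - \<beta> w $ i)"
     by (rule set_integrable_cong set_lebesgue_integral_cong; simp add: YX)+
    have "(LINT r:{s<..t}|lborel. b (X r w) $ i - \<beta> w $ i) = (LINT r:{s<..t}|lborel. b (X r w) $ i) - (t - s) * (\<beta> w $ i)"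
     using elim c st by (subst set_integral_diff(2)) (auto simp: set_lebesgue_integral_def)
    then show ?case unfolding Yc using elim set_integral_diff(1)[of lborel "{s<..t}", OF _ c]
     by (simp add: block_integral_def matrix_vector_mul_component)
   qed
  qed measurable
 qed
 have nrm: "(\<E>\<^sup>+ w. ennreal ((norm (v w))^2)) = (\<Sum>i\<in>UNIV. \<E>\<^sup>+ w. ennreal ((v w $ i)^2))"
  if [measurable]: "v \<in> bm M" for v :: "'w => real^'d"
  unfolding ennreal_norm_square_sum by (subst nn_integral_sum) auto
 have c0: "0 <= c" "0 <= a" using c(2)[of s] a st by (auto simp: moment_le_def)
 have "(\<E>\<^sup>+ w. ennreal ((norm (?x w))^2)) = (\<Sum>i\<in>UNIV. \<E>\<^sup>+ w. ennreal ((?x w $ i)^2))" by (rule nrm) measurable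
 also have "... <= (\<Sum>i\<in>UNIV. ennreal (1 + (t - s)) * ((\<E>\<^sup>+ w. ennreal ((?d w $ i)^2)) + (\<integral>\<^sup>+p. ennreal (?h i p) \<partial>PM)))"
  by (intro sum_mono comp)
 also have "... = ennreal (1 + (t - s)) * ((\<E>\<^sup>+ w. ennreal ((norm (?d w))^2)) + (\<Sum>i\<in>UNIV. \<integral>\<^sup>+p. ennreal (?h i p) \<partial>PM))"
  by (subst nrm) (auto simp: sum_distrib_left[symmetric] sum.distrib)
 also have "(\<Sum>i\<in>UNIV. \<integral>\<^sup>+p. ennreal (?h i p) \<partial>PM) = (\<integral>\<^sup>+p. (\<Sum>i\<in>UNIV. ennreal (?h i p)) \<partial>PM)"
  by (rule nn_integral_sum[symmetric]) measurable
 also have "... = (\<integral>\<^sup>+p. ennreal ((norm (?S p))^2 + (norm (?f p))^2) * indicator {s<..t} (fst p) \<partial>PM)"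
 proof (rule nn_integral_cong)
  fix p :: "real \<times> 'w"
  have "(\<Sum>i\<in>UNIV. (norm (?S p $ i))^2 + (?f p $ i)^2) = (norm (?S p))^2 + (norm (?f p))^2"
   by (simp only: sum.distrib sum_norm_rows norm_vec_square[symmetric])
  moreover have "(\<Sum>i\<in>UNIV. ennreal (?h i p)) = ennreal (\<Sum>i\<in>UNIV. ?h i p)" by (intro sum_ennreal) auto
  ultimately show "(\<Sum>i\<in>UNIV. ennreal (?h i p)) = ennreal ((norm (?S p))^2 + (norm (?f p))^2) * indicator {s<..t} (fst p)"
   by (cases "fst p \<in> {s<..t}") (simp_all del: ennreal_plus)
 qed
 also have "... <= ennreal c * emeasure lborel {s<..t}"
 proof (rule strip_integral_le)
  fix r assume r: "r \<in> {s<..t}"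
  then have "(\<E>\<^sup>+ w. ennreal ((norm (?S (r, w)))^2 + (norm (?f (r, w)))^2)) <= (\<E>\<^sup>+ w. ennreal (g r w))"
   by (intro nn_integral_mono ennreal_leI) (auto simp: YX intro: c(1))
  also have "... <= ennreal c" using c(2)[of r] r by (auto simp: moment_le_def)
  finally show "(\<E>\<^sup>+ w. ennreal ((norm (?S (r, w)))^2 + (norm (?f (r, w)))^2)) <= ennreal c" .
 qed measurable
 also have "... = ennreal (c * (t - s))" using st c0 by (simp add: ennreal_mult)
 finally have "(\<E>\<^sup>+ w. ennreal ((norm (?x w))^2)) \<le>
   ennreal (1 + (t - s)) * ((\<E>\<^sup>+ w. ennreal ((norm (?d w))^2)) + ennreal (c * (t - s)))" by (simp add: add_left_mono mult_left_mono)
 also have "... <= ennreal (1 + (t - s)) * (ennreal a + ennreal (c * (t - s)))"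
  using a by (intro mult_left_mono add_right_mono) (auto simp: moment_le_def)
 also have "... = ennreal ((1 + (t - s)) * (a + c * (t - s)))"
  using c0 st by (simp add: ennreal_mult)
 finally show ?thesis using c0 st by (simp add: moment_le_def)
qed

definition sde_const :: real where "sde_const = 2 * K^2 * (1 + T)"

lemma sde_const_nonneg: "0 <= sde_const" using T_pos by (simp add: sde_const_def)

text \<open>\<open>sde_step\<close> started at \<open>X s\<close> with frozen coefficients 0; the
  true coefficients are bounded, so the constant there is \<open>2 K^2\<close>.\<close>

lemma sde_increment_L2:
 assumes X: "sde_solution M W B T b \<sigma> x X" and st: "0 <= s" "s <= t" "t <= T"
 shows "moment_le M (\<lambda>w. (norm (X t w - X s w))^2) (sde_const * (t - s))"
proof (cases "s = t")
 case True then show ?thesis by (simp add: moment_le_def)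
next
 case False
 then have st': "s < t" "s <= T" using st by auto
 have "moment_le M (\<lambda>w. (norm (X t w - (X s w + (0 *v (W t w - W s w) + (t - s) *\<^sub>R 0))))^2) ((1 + (t - s)) * (0 + 2 * K^2 * (t - s)))"
 proof (rule sde_step[OF X st(1) st'(1) st(3), where g="\<lambda>_ _. 2 * K^2"])
  show "X s \<in> bm (\<F> s 0)"
   using T_pos by (intro measurable_info_mono[OF sde_measurable(1)[OF X st(1) st'(2)]]) auto
  show "(norm (\<sigma> (X r w) - 0))^2 + (norm (b (X r w) - 0))^2 <= 2 * K^2" for r w
   using power_mono[OF s_bound[of "X r w"], of 2] power_mono[OF b_bound[of "X r w"], of 2] by simp
 qed (use K in \<open>auto simp: moment_le_def emeasure_space_1\<close>)
 then have "moment_le M (\<lambda>w. (norm (X t w - X s w))^2) ((1 + (t - s)) * (0 + 2 * K^2 * (t - s)))" by simp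
 then show ?thesis
 proof (rule moment_le_weaken)
  have "(1 + (t - s)) * (2 * K^2 * (t - s)) <= (1 + T) * (2 * K^2 * (t - s))" using st by (intro mult_right_mono) auto
  then show "(1 + (t - s)) * (0 + 2 * K^2 * (t - s)) <= sde_const * (t - s)" by (simp add: sde_const_def mult_ac)
 qed
qed

text \<open>\<open>sde_solution\<close> contains no separate initial condition. It is the equation
  at time 0, where the isometry annihilates the stochastic integral.\<close>

lemma sde_initial:
 assumes X: "sde_solution M W B T b \<sigma> x X"
 shows "AE w in M. X 0 w = x"
proof -
 have "AE w in M. X 0 w $ i = x $ i" for i
 proof -
  have "0 \<in> {0..T}" using T_pos by auto
  then obtain J where J: "has_fwd_integral M W B T 0 0 (\<lambda>r w. \<sigma> (X r w) $ i) J"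
   and eq: "AE w in M. set_integrable lborel {0..0} (\<lambda>r. b (X r w) $ i) \<and>
   X 0 w $ i = x $ i + (LINT r:{0..0}|lborel. b (X r w) $ i) + J w"
   using X unfolding sde_solution_def by blast
  have I: "fwd.ito 0 0 (\<lambda>p. indicator {0<..0} (fst p) *\<^sub>R (\<sigma> (X (fst p) (snd p)) $ i)) J"
   using J T_pos unfolding has_fwd_integral_def by (intro fwd.ito_of_has_ito_integral) auto
  have [measurable]: "J \<in> bm M" by (rule fwd.ito_measurable[OF I])
  have "(\<E>\<^sup>+ w. ennreal ((J w)^2)) = 0"
   using fwd.ito_nn_isometry[OF I] T_pos by simp
  then have "AE w in M. ennreal ((J w)^2) = 0" by (subst (asm) nn_integral_0_iff_AE) auto
  then have "AE w in M. J w = 0" by auto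
  with eq show ?thesis
  proof eventually_elim
   case (elim w)
   have "(LINT r:{0::real}|lborel. b (X r w) $ i) = 0" unfolding set_lebesgue_integral_def
    by (rule integral_eq_zero_AE) (use AE_lborel_singleton[of "0::real"] in eventually_elim, simp)
   then show ?case using elim by simp
  qed
 qed
 then have "AE w in M. \<forall>i\<in>UNIV. X 0 w $ i = x $ i" by (intro AE_finite_allI) auto
 then show ?thesis by eventually_elim (simp add: vec_eq_iff)
qed

text \<open>Freezing the coefficients at \<open>F\<close> leaves errors of size
  \<open>|X r - F|\<close>, bounded by the error at \<open>s\<close> plus an increment of
  \<open>X\<close>. The increment contributes \<open>(t - s)^2\<close>, one order more than the step
  length, so that these contributions sum to the order of the mesh.\<close>

lemma euler_one_step:
 assumes X: "sde_solution M W B T b \<sigma> x X" and st: "0 <= s" "s <= t" "t <= T"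
  and F: "F \<in> bm (\<F> s 0)"
  and a: "moment_le M (\<lambda>w. (norm (X s w - F w))^2) a"
 shows "moment_le M (\<lambda>w. (norm (X t w - (F w + (\<sigma> (F w) *v (W t w - W s w) + (t - s) *\<^sub>R b (F w)))))^2)
  ((1 + (1 + 4 * K^2 * (1 + T)) * (t - s)) * a + (1 + T) * 4 * K^2 * sde_const * (t - s)^2)"
proof (cases "s = t")
 case True
 then show ?thesis using a by simp
next
 case False
 then have st': "s < t" "s <= T" using st by auto
 define D where "D = t - s"
 have D: "0 <= D" "D <= T" using st by (auto simp: D_def)
 have a0: "0 <= a" using a by (simp add: moment_le_def)
 note [measurable] = measurable_info_events[OF F st'(2) order_refl]
 have "moment_le M (\<lambda>w. (norm (X t w - (F w + (\<sigma> (F w) *v (W t w - W s w) + (t - s) *\<^sub>R b (F w)))))^2)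
   ((1 + (t - s)) * (a + 2 * K^2 * (2 * (sde_const * D) + 2 * a) * (t - s)))"
 proof (rule sde_step[OF X st(1) st'(1) st(3) F measurable_compose[OF F s_meas] s_bound measurable_compose[OF F b_meas] a,
   where g="\<lambda>r w. 2 * K^2 * (norm (X r w - F w))^2"])
  fix r assume r: "s <= r" "r <= t"
  show "(norm (\<sigma> (X r w) - \<sigma> (F w)))^2 + (norm (b (X r w) - b (F w)))^2 <= 2 * K^2 * (norm (X r w - F w))^2" for w
   using power_mono[OF s_lip[of "X r w" "F w"], of 2] power_mono[OF b_lip[of "X r w" "F w"], of 2] by (simp add: power_mult_distrib)
  have r': "0 <= r" "r <= T" using r st by auto
  note [measurable] = sde_measurable(2)[OF X r']
  have "sde_const * (r - s) <= sde_const * D" using r sde_const_nonneg by (intro mult_left_mono) (auto simp: D_def)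
  note i = moment_le_weaken[OF sde_increment_L2[OF X st(1) r(1) r'(2)] this]
  have le: "(norm (X r w - F w))^2 <= 2 * (norm (X r w - X s w))^2 + 2 * (norm (X s w - F w))^2" for w
   using norm_square_add_le[of "X r w - X s w" "X s w - F w"] by simp
  have "moment_le M (\<lambda>w. 2 * (norm (X r w - X s w))^2 + 2 * (norm (X s w - F w))^2) (2 * (sde_const * D) + 2 * a)"
   by (intro moment_le_add moment_le_cmult i a) auto
  then have "moment_le M (\<lambda>w. (norm (X r w - F w))^2) (2 * (sde_const * D) + 2 * a)"
   by (rule moment_le_mono[OF _ _ _ le]) auto
  then show "moment_le M (\<lambda>w. 2 * K^2 * (norm (X r w - F w))^2) (2 * K^2 * (2 * (sde_const * D) + 2 * a))"
   by (rule moment_le_cmult) simp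
 qed
 then show ?thesis
 proof (rule moment_le_weaken)
  have "(1 + D) * (4 * K^2 * D * a) <= (1 + T) * (4 * K^2 * D * a)" "(1 + D) * (4 * K^2 * sde_const * D^2) <= (1 + T) * (4 * K^2 * sde_const * D^2)"
   using D a0 sde_const_nonneg by (intro mult_right_mono; simp)+
  then show "(1 + (t - s)) * (a + 2 * K^2 * (2 * (sde_const * D) + 2 * a) * (t - s)) \<le>
    (1 + (1 + 4 * K^2 * (1 + T)) * (t - s)) * a + (1 + T) * 4 * K^2 * sde_const * (t - s)^2"
   unfolding D_def[symmetric] by (simp add: algebra_simps power2_eq_square)
 qed
qed

definition euler_const :: real where
 "euler_const = exp ((1 + 4 * K^2 * (1 + T)) * T) * ((1 + T) * 4 * K^2 * sde_const)"

lemma euler_converges: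
 assumes X: "sde_solution M W B T b \<sigma> x X" and gr: "grid p n" "p 0 = 0"
  and \<delta>: "\<And>k. k < n \<Longrightarrow> p (Suc k) - p k <= \<delta>" "0 <= \<delta>"
 shows "moment_le M (\<lambda>w. (norm (X (p n) w - euler p x n w))^2) (euler_const * \<delta>)"
proof -
 let ?c = "1 + 4 * K^2 * (1 + T)" and ?e = "(1 + T) * 4 * K^2 * sde_const"
 \<comment> \<open>The recursion supplied by \<open>euler_one_step\<close>; it starts at 0 because
   \<open>p 0 = 0\<close> and the initial value is exact.\<close>
 define a where "a = rec_nat 0 (\<lambda>k y. (1 + ?c * (p (Suc k) - p k)) * y + ?e * (p (Suc k) - p k)^2)"
 have a0: "a 0 = 0" and aS: "a (Suc k) = (1 + ?c * (p (Suc k) - p k)) * a k + ?e * (p (Suc k) - p k)^2" for k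
  by (auto simp: a_def)
 have c: "1 <= ?c" "0 <= ?e" using T_pos sde_const_nonneg by auto
 have "k <= n \<Longrightarrow> moment_le M (\<lambda>w. (norm (X (p k) w - euler p x k w))^2) (a k)" for k
 proof (induction k)
  case 0
  have [measurable]: "X 0 \<in> bm M" using sde_measurable(2)[OF X] T_pos by simp
  have "(\<E>\<^sup>+ w. ennreal ((norm (X 0 w - x))^2)) = (\<E>\<^sup>+ w. 0)"
   using sde_initial[OF X] by (intro nn_integral_cong_AE) (auto elim: eventually_mono)
  then show ?case using gr(2) a0 by (simp add: moment_le_def)
 next
  case (Suc k)
  then have k: "k < n" "k <= n" by auto
  have g: "0 <= p k" "p k <= p (Suc k)" "p (Suc k) <= T" using grid_step[OF gr(1) k(1)] by auto
  show ?case unfolding aS euler.simps by (rule euler_one_step[OF X g euler_measurable[OF gr(1) k(2)] Suc.IH[OF k(2)]])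
 qed
 note 1 = this[OF order_refl]
 have "a n <= exp (\<Sum>k\<in>{0..<n}. ?c * (p (Suc k) - p k)) * (a 0 + ?e * \<delta>)"
 proof (rule gronwall_product)
  fix k assume k: "k < n"
  have d: "0 <= p (Suc k) - p k" "p (Suc k) - p k <= \<delta>" using grid_step[OF gr(1) k] \<delta>(1)[OF k] by auto
  have "?e * (p (Suc k) - p k)^2 <= (1 * (p (Suc k) - p k)) * (?e * \<delta>)"
  proof -
   have gen: "y * z^2 <= (1 * z) * (y * \<delta>)" if "0 <= y" "0 <= z" "z <= \<delta>" for y z :: real
    using mult_left_mono[OF that(3), of "y * z"] that by (simp add: power2_eq_square mult_ac)
   show ?thesis by (rule gen[OF c(2) d])
  qed
  also have "... <= (?c * (p (Suc k) - p k)) * (?e * \<delta>)"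
   using c d \<delta> by (intro mult_right_mono) auto
  finally show "a (Suc k) <= (1 + ?c * (p (Suc k) - p k)) * a k + ?c * (p (Suc k) - p k) * (?e * \<delta>)"
   unfolding aS by simp
  show "0 <= ?c * (p (Suc k) - p k)" using c d by simp
 qed (use c \<delta> a0 in auto)
 also have "(\<Sum>k\<in>{0..<n}. ?c * (p (Suc k) - p k)) = ?c * (p n - p 0)"
  unfolding sum_distrib_left[symmetric] by (simp add: sum_Suc_diff')
 also have "exp (?c * (p n - p 0)) * (a 0 + ?e * \<delta>) <= exp (?c * T) * (?e * \<delta>)"
  using grid_bounds[OF gr(1) order_refl] gr(2) c \<delta> a0 by (auto intro!: mult_right_mono mult_left_mono mult_nonneg_nonneg sde_const_nonneg)
 also have "... = euler_const * \<delta>" by (simp add: euler_const_def)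
 finally show ?thesis by (rule moment_le_weaken[OF 1])
qed

end

section \<open>Inverse moments of the derivative flow\<close>

lemma norm_matrix_mult:
 fixes A :: "real^'n^'m" and C :: "real^'k^'n"
 shows "norm (A ** C) <= norm A * norm C"
proof -
 have row: "(A ** C) $ i = A $ i v* C" for i
  by (simp add: matrix_matrix_mult_def vector_matrix_mult_def vec_eq_iff mult.commute)
 have "norm (A ** C) = L2_set (\<lambda>i. norm (A $ i v* C)) UNIV" by (simp add: norm_vec_def[of "A ** C"] row)
 also have "... <= L2_set (\<lambda>i. norm (A $ i) * norm C) UNIV"
  by (rule L2_set_mono) (auto intro: norm_vector_matrix_mult)
 also have "... = norm A * norm C" by (simp add: norm_vec_def[of A] L2_set_left_distrib)
 finally show ?thesis .
qed

lemma bounded_bilinear_matrix_mult: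
 "bounded_bilinear ((**) :: real^'n^'m => real^'k^'n => real^'k^'m)"
proof
 show "\<exists>K. \<forall>A C. norm ((A :: real^'n^'m) ** (C :: real^'k^'n)) <= norm A * norm C * K"
  using norm_matrix_mult by (intro exI[of _ 1]) auto
qed (simp_all add: vec_eq_iff matrix_matrix_mult_def algebra_simps sum.distrib sum_distrib_left)

lemma matrix_inv_right:
 fixes D :: "real^'n^'n"
 assumes "invertible D"
 shows "D ** matrix_inv D = mat 1"
 using someI_ex[OF assms[unfolded invertible_def]] by (simp add: matrix_inv_def)

text \<open>If the approximate inverses \<open>U\<^sub>m\<close> do not escape to infinity, the limit of the \<open>Q\<^sub>m\<close> is invertible.\<close>

lemma approximate_inverse_limit:
 fixes U Q :: "nat => real^'n^'n"
 assumes Q: "Q \<longlonglongrightarrow> D" and UQ: "(\<lambda>m. U m ** Q m) \<longlonglongrightarrow> mat 1"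
  and bd: "\<exists>\<^sub>F m in sequentially. norm (U m) <= R"
 shows "invertible D" "U \<longlonglongrightarrow> matrix_inv D"
proof -
 \<comment> \<open>For \<open>v\<close> in the kernel \<open>Q m v\<close> tends to 0, and so does
   \<open>U m (Q m v)\<close> along the indices with \<open>norm (U m) <= R\<close>; but the whole
   sequence tends to \<open>v\<close>.\<close>
 have ker: "v = 0" if v: "D *v v = 0" for v
 proof -
  have 1: "(\<lambda>m. (U m ** Q m) *v v) \<longlonglongrightarrow> mat 1 *v v"
   by (rule bounded_bilinear.tendsto[OF bounded_bilinear_matrix_vector_mult UQ tendsto_const])
  have 2: "(\<lambda>m. Q m *v v) \<longlonglongrightarrow> D *v v"
   by (rule bounded_bilinear.tendsto[OF bounded_bilinear_matrix_vector_mult Q tendsto_const])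
  have 3: "(\<lambda>m. \<bar>R\<bar> * norm (Q m *v v) - norm ((U m ** Q m) *v v)) \<longlonglongrightarrow> \<bar>R\<bar> * norm (D *v v) - norm (mat 1 *v v)"
   by (intro tendsto_diff tendsto_mult tendsto_const tendsto_norm 1 2)
  have fr: "\<exists>\<^sub>F m in sequentially. 0 <= \<bar>R\<bar> * norm (Q m *v v) - norm ((U m ** Q m) *v v)"
   using bd
  proof (rule frequently_elim1)
   fix m assume "norm (U m) <= R"
   then have "norm (U m *v (Q m *v v)) <= \<bar>R\<bar> * norm (Q m *v v)"
    by (intro order_trans[OF norm_matrix_vector_mult mult_right_mono]) auto
   then show "0 <= \<bar>R\<bar> * norm (Q m *v v) - norm ((U m ** Q m) *v v)"
    by (simp add: matrix_vector_mul_assoc)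
  qed
  have "0 <= \<bar>R\<bar> * norm (D *v v) - norm (mat 1 *v v)"
  proof (rule ccontr)
   assume "\<not> ?thesis"
   then have "\<bar>R\<bar> * norm (D *v v) - norm (mat 1 *v v) < 0" by linarith
   then have "\<forall>\<^sub>F m in sequentially. \<bar>R\<bar> * norm (Q m *v v) - norm ((U m ** Q m) *v v) < 0"
    by (rule order_tendstoD(2)[OF 3])
   from frequently_eventually_frequently[OF fr this] have "\<exists>\<^sub>F m::nat in sequentially. False"
    by (rule frequently_elim1) linarith
   then show False by simp
  qed
  then show ?thesis using v by simp
 qed
 then obtain C where "C ** D = mat 1" using matrix_left_invertible_ker[of D] by blast
 then show inv: "invertible D" using invertible_left_inverse by blast
 let ?I = "matrix_inv D"
 have I: "D ** ?I = mat 1" using matrix_inv_right[OF inv] .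
 define a where "a m = norm (D - Q m) * norm ?I" for m
 define z where "z m = U m ** Q m ** ?I" for m
 \<comment> \<open>The last summand is at most \<open>a m\<close> times the norm of
   \<open>U m\<close> and is absorbed once \<open>a m < 1/2\<close>. With invertibility known, this
   controls the full sequence and not only the bounded part.\<close>
 have U: "U m = z m + U m ** ((D - Q m) ** ?I)" for m
 proof -
  have "U m = U m ** (D ** ?I)" by (simp add: I)
  also have "D ** ?I = Q m ** ?I + (D - Q m) ** ?I"
   by (simp add: bounded_bilinear.diff_left[OF bounded_bilinear_matrix_mult])
  finally show ?thesis by (simp add: matrix_add_ldistrib z_def matrix_mul_assoc)
 qed
 have a0: "a \<longlonglongrightarrow> 0"
 proof -
  have "(\<lambda>m. norm (D - Q m) * norm ?I) \<longlonglongrightarrow> norm (D - D) * norm ?I"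
   by (intro tendsto_mult tendsto_norm tendsto_diff tendsto_const Q)
  then show ?thesis by (simp add: a_def[abs_def])
 qed
 have z: "z \<longlonglongrightarrow> ?I"
  using bounded_bilinear.tendsto[OF bounded_bilinear_matrix_mult UQ tendsto_const[of ?I]] by (simp add: z_def[abs_def])
 have n: "norm (U m - z m) <= norm (U m) * a m" for m
 proof -
  have "U m - z m = U m ** ((D - Q m) ** ?I)" using U[of m] by (metis add_diff_cancel_left')
  then show ?thesis unfolding a_def
   using order_trans[OF norm_matrix_mult mult_left_mono[OF norm_matrix_mult norm_ge_zero]] by metis
 qed
 have ev: "\<forall>\<^sub>F m in sequentially. norm (U m - z m) <= 2 * norm (z m) * a m"
 proof (rule eventually_mono)
  show "\<forall>\<^sub>F m in sequentially. a m < 1/2" by (rule order_tendstoD(2)[OF a0]) simp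
  fix m assume elim: "a m < 1/2"
  have "norm (U m) <= norm (z m) + norm (U m - z m)" using norm_triangle_ineq[of "z m" "U m - z m"] by simp
  also have "norm (U m - z m) <= norm (U m) * a m" by (rule n)
  also have "norm (U m) * a m <= norm (U m) * (1/2)" using elim by (intro mult_left_mono) auto
  finally have "norm (U m) <= 2 * norm (z m)" by simp
  then have "norm (U m) * a m <= 2 * norm (z m) * a m" by (rule mult_right_mono) (simp add: a_def)
  then show "norm (U m - z m) <= 2 * norm (z m) * a m" using n[of m] by linarith
 qed
 have "(\<lambda>m. 2 * norm (z m) * a m) \<longlonglongrightarrow> 2 * norm ?I * 0"
  by (intro tendsto_mult tendsto_const tendsto_norm z a0)
 then have "(\<lambda>m. U m - z m) \<longlonglongrightarrow> 0"
  by (intro Lim_null_comparison[OF ev]) simp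
 from tendsto_add[OF this z] show "U \<longlonglongrightarrow> ?I" by simp
qed

text \<open>The expectation of the series is finite, so almost surely the series converges and its
  terms tend to 0.\<close>

lemma AE_tendsto_zero_of_summable:
 fixes f :: "nat => 'a => real"
 assumes m: "\<And>m. moment_le N (f m) (c * (1/2) ^ m)"
 shows "AE x in N. (\<lambda>m. f m x) \<longlonglongrightarrow> 0"
proof -
 have [measurable]: "f m \<in> bm N" and nn: "0 <= f m x" and b: "(\<integral>\<^sup>+x. ennreal (f m x) \<partial>N) <= ennreal (c * (1/2) ^ m)" for m x
  using m[of m] by (auto simp: moment_le_def)
 have c: "0 <= c" using m[of 0] by (simp add: moment_le_def)
 have "(\<integral>\<^sup>+x. (\<Sum>m. ennreal (f m x)) \<partial>N) = (\<Sum>m. \<integral>\<^sup>+x. ennreal (f m x) \<partial>N)"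
  by (rule nn_integral_suminf) simp
 also have "... <= (\<Sum>m. ennreal (c * (1/2) ^ m))" by (intro suminf_le b) auto
 also have "... = ennreal (\<Sum>m. c * (1/2) ^ m)" using c by (intro suminf_ennreal2) (auto intro!: summable_mult)
 finally have "(\<integral>\<^sup>+x. (\<Sum>m. ennreal (f m x)) \<partial>N) \<noteq> \<infinity>" by (auto simp: top_unique)
 then have "AE x in N. (\<Sum>m. ennreal (f m x)) \<noteq> \<infinity>" by (rule nn_integral_PInf_AE[rotated]) simp
 then show ?thesis
  by eventually_elim (use nn in \<open>auto intro!: summable_LIMSEQ_zero summable_suminf_not_top\<close>)
qed

text \<open>Fatou's lemma, applied to a bound that is uniform in \<open>m\<close>.\<close>

lemma moment_le_limit:
 fixes f :: "nat => 'a => real"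
 assumes m: "\<And>m. moment_le N (f m) c" and lim: "AE x in N. (\<lambda>m. f m x) \<longlonglongrightarrow> g x"
  and g: "g \<in> bm N" "\<And>x. 0 <= g x"
 shows "moment_le N g c"
proof -
 have [measurable]: "f m \<in> bm N" and b: "(\<integral>\<^sup>+x. ennreal (f m x) \<partial>N) <= ennreal c" for m
  using m[of m] by (auto simp: moment_le_def)
 have "(\<integral>\<^sup>+x. ennreal (g x) \<partial>N) = (\<integral>\<^sup>+x. liminf (\<lambda>m. ennreal (f m x)) \<partial>N)"
 proof (rule nn_integral_cong_AE)
  show "AE x in N. ennreal (g x) = liminf (\<lambda>m. ennreal (f m x))"
   using lim by eventually_elim (rule lim_imp_Liminf[symmetric], auto intro: tendsto_ennrealI)
 qed
 also have "... <= liminf (\<lambda>m. \<integral>\<^sup>+x. ennreal (f m x) \<partial>N)" by (rule nn_integral_liminf) simp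
 also have "... <= ennreal c"
  using Liminf_mono[OF always_eventually, of "\<lambda>m. \<integral>\<^sup>+x. ennreal (f m x) \<partial>N" "\<lambda>_. ennreal c" sequentially] b
  by (simp add: Liminf_const)
 finally show ?thesis using m[of 0] g by (simp add: moment_le_def)
qed

text \<open>Fatou's lemma makes the lower limit finite almost surely. The bounded subsequence
  depends on the point, which is enough for \<open>approximate_inverse_limit\<close>.\<close>

lemma AE_frequently_bounded:
 fixes f :: "nat => 'a => real"
 assumes m: "\<And>m. moment_le N (f m) c"
 shows "AE x in N. \<exists>R. \<exists>\<^sub>F m in sequentially. f m x <= R"
proof -
 have [measurable]: "f m \<in> bm N" and b: "(\<integral>\<^sup>+x. ennreal (f m x) \<partial>N) <= ennreal c" for m
  using m[of m] by (auto simp: moment_le_def)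
 have "(\<integral>\<^sup>+x. liminf (\<lambda>m. ennreal (f m x)) \<partial>N) <= liminf (\<lambda>m. \<integral>\<^sup>+x. ennreal (f m x) \<partial>N)"
  by (rule nn_integral_liminf) simp
 also have "... <= ennreal c"
  using Liminf_mono[OF always_eventually, of "\<lambda>m. \<integral>\<^sup>+x. ennreal (f m x) \<partial>N" "\<lambda>_. ennreal c" sequentially] b
  by (simp add: Liminf_const)
 finally have "(\<integral>\<^sup>+x. liminf (\<lambda>m. ennreal (f m x)) \<partial>N) \<noteq> \<infinity>" by (auto simp: top_unique)
 then have "AE x in N. liminf (\<lambda>m. ennreal (f m x)) \<noteq> \<infinity>" by (rule nn_integral_PInf_AE[rotated]) simp
 then show ?thesis
 proof eventually_elim
  case (elim x)
  define L where "L = enn2real (liminf (\<lambda>m. ennreal (f m x)))"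
  have L: "liminf (\<lambda>m. ennreal (f m x)) = ennreal L" "0 <= L" using elim by (auto simp: L_def less_top)
  show ?case
  proof (rule exI[of _ "L + 1"], rule ccontr)
   assume "\<not> (\<exists>\<^sub>F m in sequentially. f m x <= L + 1)"
   then have "\<forall>\<^sub>F m in sequentially. ennreal (L + 1) <= ennreal (f m x)"
    unfolding not_frequently by eventually_elim (auto intro: ennreal_leI)
   then have "ennreal (L + 1) <= ennreal L" unfolding L(1)[symmetric] by (rule Liminf_bounded)
   then show False using L(2) by (subst (asm) ennreal_le_iff) auto
  qed
 qed
qed

lemma has_derivative_difference_quotient:
 fixes f :: "'a::real_normed_vector => 'b::real_normed_vector"
 assumes f: "(f has_derivative f') (at x)" and e: "norm e = 1" and eps: "eps \<longlonglongrightarrow> 0" "\<And>m. 0 < eps m"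
 shows "(\<lambda>m. (1 / eps m) *\<^sub>R (f (x + eps m *\<^sub>R e) - f x)) \<longlonglongrightarrow> f' e"
proof -
 interpret bounded_linear f' using f by (rule has_derivative_bounded_linear)
 have lim: "((\<lambda>y. (1 / norm (y - x)) *\<^sub>R (f y - (f x + f' (y - x)))) \<longlongrightarrow> 0) (at x)"
  using f unfolding has_derivative_at2 by blast
 have "filterlim (\<lambda>m. x + eps m *\<^sub>R e) (at x) sequentially"
 proof (rule filterlim_atI)
  have "(\<lambda>m. x + eps m *\<^sub>R e) \<longlonglongrightarrow> x + 0 *\<^sub>R e" by (intro tendsto_intros eps)
  then show "(\<lambda>m. x + eps m *\<^sub>R e) \<longlonglongrightarrow> x" by simp
  have "eps m *\<^sub>R e \<noteq> 0" for m using eps(2)[of m] e by auto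
  then show "\<forall>\<^sub>F m in sequentially. x + eps m *\<^sub>R e \<noteq> x" by (auto intro: always_eventually)
 qed
 from filterlim_compose[OF lim this]
 have "(\<lambda>m. (1 / norm (eps m *\<^sub>R e)) *\<^sub>R (f (x + eps m *\<^sub>R e) - (f x + f' (eps m *\<^sub>R e)))) \<longlonglongrightarrow> 0" by simp
 moreover have "(1 / norm (eps m *\<^sub>R e)) *\<^sub>R (f (x + eps m *\<^sub>R e) - (f x + f' (eps m *\<^sub>R e))) =
   (1 / eps m) *\<^sub>R (f (x + eps m *\<^sub>R e) - f x) - f' e" for m
  using eps(2)[of m] e by (simp add: scaleR_diff_right scaleR_add_right scaleR)
 ultimately show ?thesis by (simp add: LIM_zero_iff)
qed

section \<open>The derivative flow as a limit of schemes\<close>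

context diffusion
begin

definition inv_matrix :: "(nat => real) => real^'d => nat => 'w => real^'d^'d" where
 "inv_matrix p x k w = (\<chi> i. inv_row p x (axis i 1) k w)"

definition quotient_matrix :: "(nat => real) => real^'d => real => nat => 'w => real^'d^'d" where
 "quotient_matrix p x eps k w = (\<chi> i j. diff_quotient p x eps (axis j 1) k w $ i)"

lemma inv_matrix_nth [simp]: "inv_matrix p x k w $ i = inv_row p x (axis i 1) k w"
 by (simp add: inv_matrix_def)

lemma inv_quotient_product:
 "(inv_matrix p x k w ** quotient_matrix p x eps k w) $ i $ j =
  inv_row p x (axis i 1) k w \<bullet> diff_quotient p x eps (axis j 1) k w"
 by (simp add: matrix_matrix_mult_def quotient_matrix_def inner_vec_def)

lemma norm_matrix_power_le:
 fixes A :: "real^'d^'d"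
 shows "norm A ^ (2 * q) <= real CARD('d) ^ q * (\<Sum>i\<in>UNIV. norm (A $ i) ^ (2 * q))"
proof -
 have "norm A ^ (2 * q) = (\<Sum>i\<in>UNIV. (norm (A $ i))^2) ^ q" by (simp add: power_mult sum_norm_rows)
 also have "... <= real CARD('d) ^ q * (\<Sum>i\<in>UNIV. ((norm (A $ i))^2) ^ q)" by (rule sum_power_le) auto
 finally show ?thesis by (simp add: power_mult)
qed

lemma moment_le_integral:
 assumes "integrable M f \<and> (\<E> w. f w) <= c" "\<And>w. 0 <= f w"
 shows "moment_le M f c"
proof -
 have "0 <= (\<E> w. f w)" using assms by simp
 from order_trans[OF this] assms(1) have "0 <= c" by blast
 then show ?thesis using assms by (auto simp: moment_le_def nn_integral_eq_integral ennreal_leI)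
qed

lemma matrix_moment_le:
 fixes A :: "'w => real^'d^'d"
 assumes "\<And>i. (\<lambda>w. A w $ i) \<in> bm M" and b: "\<And>i. moment_le M (\<lambda>w. norm (A w $ i) ^ (2 * q)) c"
 shows "moment_le M (\<lambda>w. norm (A w) ^ (2 * q)) (real CARD('d) ^ q * (real CARD('d) * c))"
proof -
 have "(\<lambda>w. \<chi> i. A w $ i) \<in> bm M" by (rule measurable_vec_lambda) (rule assms(1))
 then have [measurable]: "A \<in> bm M" by (simp add: vec_nth_inverse)
 have "moment_le M (\<lambda>w. real CARD('d) ^ q * (\<Sum>i\<in>UNIV. norm (A w $ i) ^ (2 * q))) (real CARD('d) ^ q * (\<Sum>i\<in>(UNIV::'d set). c))"
  by (intro moment_le_cmult moment_le_sum b) simp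
 then show ?thesis by (rule moment_le_mono[OF _ _ _ norm_matrix_power_le, THEN moment_le_weaken]) auto
qed

lemma inv_matrix_moment:
 assumes gr: "grid p n" and q: "q \<ge> 1"
 shows "moment_le M (\<lambda>w. norm (inv_matrix p x n w) ^ (2 * q)) (real CARD('d) ^ q * (real CARD('d) * inv_const q))"
 by (intro matrix_moment_le moment_le_integral)
   (use inv_row_events[OF gr] inv_row_moment[OF gr q, of x "axis _ 1"] in auto)

lemma inv_matrix_increment_moment:
 assumes gr: "grid p n" and i: "i <= n" and S: "p n - p i <= S" "0 < S" "S <= T" and q: "q \<ge> 1"
 shows "moment_le M (\<lambda>w. norm (inv_matrix p x n w - inv_matrix p x i w) ^ (2 * q))
  (real CARD('d) ^ q * (real CARD('d) * (exp (growth_const CARD('d) T q K_inv) * (S ^ q * inv_const q))))"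
 by (intro matrix_moment_le moment_le_integral)
   (use inv_row_events[OF gr] i inv_row_increment_moment[OF gr i S q, of x "axis _ 1"] in auto)

end

lemma norm_square_sum_columns: "(norm (A::real^'n^'m))^2 = (\<Sum>j\<in>UNIV. (norm (column j A))^2)"
proof -
 have "(norm A)^2 = (\<Sum>i\<in>UNIV. \<Sum>j\<in>UNIV. (A $ i $ j)^2)"
  by (simp only: sum_norm_rows[symmetric] norm_vec_square)
 also have "... = (\<Sum>j\<in>UNIV. \<Sum>i\<in>UNIV. (A $ i $ j)^2)" by (rule sum.swap)
 also have "... = (\<Sum>j\<in>UNIV. (norm (column j A))^2)" by (simp only: norm_vec_square) (simp add: column_def)
 finally show ?thesis .
qed

lemma norm_transpose: "norm (transpose (A::real^'n^'m)) = norm A"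
proof -
 have "(norm (transpose A))^2 = (norm A)^2"
  by (simp only: norm_square_sum_columns[of A] sum_norm_rows[symmetric, of "transpose A"]) (simp add: column_def transpose_def)
 then show ?thesis by simp
qed

lemma process_section:
 fixes \<Phi> :: "real => 'w => 'b::topological_space"
 assumes "process M T \<Phi>" "0 <= t" "t <= T"
 shows "\<Phi> t \<in> bm M"
proof -
 have "(\<lambda>w. (t, w)) \<in> M \<rightarrow>\<^sub>M restrict_space borel {0..T} \<Otimes>\<^sub>M M" using assms by (intro measurable_Pair) auto
 from measurable_compose[OF this assms(1)[unfolded process_def]] show ?thesis by simp
qed

text \<open>Both \<open>s\<close> and \<open>t\<close> have to be grid points, so
  \<open>[0, s]\<close> and \<open>[s, t]\<close> are divided into \<open>N\<close> steps each.
  These steps may have length 0, which is why \<open>grid\<close> admits repeated times.\<close>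

lemma (in two_brownian_motions) fine_grid:
 assumes st: "0 <= s" "s <= t" "t <= T" and \<delta>: "0 < \<delta>"
 shows "\<exists>p i n. grid p n \<and> i <= n \<and> p 0 = 0 \<and> p i = s \<and> p n = t \<and> (\<forall>k<n. p (Suc k) - p k <= \<delta>)"
proof -
 define N where "N = Suc (nat \<lceil>T / \<delta>\<rceil>)"
 define p where "p k = (if k <= N then s * (real k / real N) else s + (t - s) * ((real k - real N) / real N))" for k
 have N: "0 < real N" "T / \<delta> <= real N" by (auto simp: N_def) linarith
 then have TN: "T / real N <= \<delta>" using \<delta> by (simp add: field_simps)
 have step: "0 <= p (Suc k) - p k \<and> p (Suc k) - p k <= T / real N" for k
 proof (cases "Suc k <= N")
  case True
  then have "p (Suc k) - p k = s / real N" by (simp add: p_def add_divide_distrib distrib_left)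
  then show ?thesis using st N by (auto intro: divide_right_mono)
 next
  case False
  have "p (Suc k) - p k = (t - s) / real N"
  proof (cases "k = N")
   case True then show ?thesis using N by (simp add: p_def)
  next
   case False2: False
   then have "p (Suc k) - p k = (t - s) * ((real (Suc k) - real N) / real N - (real k - real N) / real N)"
    using False by (simp add: p_def right_diff_distrib)
   also have "... = (t - s) / real N" by (simp add: diff_divide_distrib[symmetric])
   finally show ?thesis .
  qed
  then show ?thesis using st N by (auto intro: divide_right_mono)
 qed
 have "p 0 = 0" "p N = s" "p (N + N) = t" using N by (auto simp: p_def)
 moreover have "grid p (N + N)" using step st calculation by (auto simp: grid_def)
 ultimately show ?thesis using step TN by (intro exI[of _ p] exI[of _ N] exI[of _ "N + N"]) (auto intro: order_trans)
qed

locale differentiable_flow = diffusion M T W B b \<sigma> Db D\<sigma> K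
 for M :: "'w measure" and T :: real and W :: "real => 'w => real^'d" and B :: "real => 'w => real"
  and b \<sigma> Db D\<sigma> K +
 fixes X :: "real^'d => real => 'w => real^'d" and x :: "real^'d" and DX :: "real => 'w => real^'d^'d"
 assumes X: "\<And>y. sde_solution M W B T b \<sigma> y (X y)"
  and DX_process: "process M T DX"
  and DX: "\<And>t. 0 <= t \<Longrightarrow> t <= T \<Longrightarrow> AE w in M. ((\<lambda>y. X y t w) has_derivative (\<lambda>h. DX t w *v h)) (at x)"
begin

lemma euler_const_nonneg: "0 <= euler_const"
 using T_pos sde_const_nonneg by (auto simp: euler_const_def intro!: mult_nonneg_nonneg)

text \<open>The squared error of the scheme, of order \<open>8^-m\<close> for both initial values,
  is divided by the square \<open>4^-m\<close> of \<open>eps = 2^-m\<close>. What remains is of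
  order \<open>2^-m\<close> and summable, so the quotients of the scheme and those of
  \<open>X\<close> have the same almost sure limit.\<close>

lemma diff_quotient_limit:
 assumes gr: "\<And>m. grid (p m) (n m)" and p: "\<And>m. p m 0 = 0" "\<And>m. p m (n m) = r"
  and mesh': "\<And>m. \<forall>k<n m. p m (Suc k) - p m k <= (1/8) ^ m"
 shows "AE w in M. (\<lambda>m. diff_quotient (p m) x ((1/2) ^ m) (axis j 1) (n m) w) \<longlonglongrightarrow> column j (DX r w)"
proof -
 note mesh = mesh'[rule_format]
 let ?e = "axis j 1 :: real^'d" and ?eps = "\<lambda>m. (1/2::real) ^ m"
 let ?q = "\<lambda>m. diff_quotient (p m) x (?eps m) ?e (n m)" and ?y = "\<lambda>m. x + ?eps m *\<^sub>R ?e"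
 let ?Q = "\<lambda>m w. (1 / ?eps m) *\<^sub>R (X (?y m) r w - X x r w)" and ?d = "\<lambda>y m w. X y r w - euler (p m) y (n m) w"
 have r: "0 <= r" "r <= T" using grid_bounds[OF gr[of 0] order_refl] p(2)[of 0] by auto
 have [measurable]: "X y r \<in> bm M" "euler (p m) y (n m) \<in> bm M" for y m
  using sde_measurable(2)[OF X r] euler_events[OF gr] by auto
 have d: "moment_le M (\<lambda>w. (norm (?d y m w))^2) (euler_const * (1/8) ^ m)" for y m
  using euler_converges[OF X[of y] gr[of m] p(1) mesh] p(2) by simp
 have "AE w in M. (\<lambda>m. (norm (?Q m w - ?q m w))^2) \<longlonglongrightarrow> 0"
 proof (rule AE_tendsto_zero_of_summable)
  fix m
  have le: "(norm (?Q m w - ?q m w))^2 <= 2 * 4 ^ m * ((norm (?d (?y m) m w))^2 + (norm (?d x m w))^2)" for w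
  proof -
   have "?Q m w - ?q m w = (2 ^ m) *\<^sub>R (?d (?y m) m w - ?d x m w)"
    by (simp add: diff_quotient_def power_one_over scaleR_diff_right)
   then have "(norm (?Q m w - ?q m w))^2 = (2 ^ m)^2 * (norm (?d (?y m) m w - ?d x m w))^2"
    by (simp add: power_mult_distrib)
   also have "(2 ^ m :: real)^2 = 4 ^ m" by (simp add: power2_eq_square power_mult_distrib[symmetric])
   finally show ?thesis using mult_left_mono[OF norm_square_diff_le[of "?d (?y m) m w" "?d x m w"], of "4 ^ m"] by (simp add: algebra_simps)
  qed
  have "moment_le M (\<lambda>w. 2 * 4 ^ m * ((norm (?d (?y m) m w))^2 + (norm (?d x m w))^2))
    (2 * 4 ^ m * (euler_const * (1/8) ^ m + euler_const * (1/8) ^ m))"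
   by (intro moment_le_cmult moment_le_add d) simp
  then have "moment_le M (\<lambda>w. (norm (?Q m w - ?q m w))^2) (2 * 4 ^ m * (euler_const * (1/8) ^ m + euler_const * (1/8) ^ m))"
   by (rule moment_le_mono[OF _ _ _ le]) (simp_all add: diff_quotient_def)
  moreover have "(4::real) ^ m * (1/8) ^ m = (1/2) ^ m" by (simp add: power_mult_distrib[symmetric])
  ultimately show "moment_le M (\<lambda>w. (norm (?Q m w - ?q m w))^2) (4 * euler_const * (1/2) ^ m)" by (simp add: algebra_simps)
 qed
 then show ?thesis using DX[OF r]
 proof eventually_elim
  case (elim w)
  have "(\<lambda>m. ?Q m w) \<longlonglongrightarrow> DX r w *v ?e"
   by (rule has_derivative_difference_quotient[OF elim(2)]) (auto intro: LIMSEQ_power_zero)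
  moreover have "(\<lambda>m. ?Q m w - ?q m w) \<longlonglongrightarrow> 0"
   using tendsto_real_sqrt[OF elim(1)] by (simp add: tendsto_norm_zero_iff)
  ultimately have "(\<lambda>m. ?Q m w - (?Q m w - ?q m w)) \<longlonglongrightarrow> DX r w *v ?e - 0" by (rule tendsto_diff)
  then show ?case by (simp add: matrix_vector_mult_basis)
 qed
qed

text \<open>The mesh \<open>8^-m\<close> is below \<open>h^2\<close> for \<open>h = 2^-m\<close>, as
  \<open>inverse_flow_product\<close> demands, so the approximate inverses times the quotients tend
  to the identity almost surely. Invertibility of \<open>DX r\<close> then comes out of
  \<open>approximate_inverse_limit\<close>.\<close>

lemma flow_limit:
 assumes gr: "\<And>m. grid (p m) (n m)" and p: "\<And>m. p m 0 = 0" "\<And>m. p m (n m) = r"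
  and mesh': "\<And>m. \<forall>k<n m. p m (Suc k) - p m k <= (1/8) ^ m"
 shows "AE w in M. (\<lambda>m. quotient_matrix (p m) x ((1/2) ^ m) (n m) w) \<longlonglongrightarrow> DX r w"
  and "AE w in M. invertible (DX r w) \<and> (\<lambda>m. inv_matrix (p m) x (n m) w) \<longlonglongrightarrow> matrix_inv (DX r w)"
  and "AE w in M. (\<lambda>m. euler (p m) x (n m) w) \<longlonglongrightarrow> X x r w"
proof -
 note mesh = mesh'[rule_format]
 let ?e = "\<lambda>j. axis j 1 :: real^'d" and ?eps = "\<lambda>m. (1/2::real) ^ m"
 let ?q = "\<lambda>m. quotient_matrix (p m) x (?eps m) (n m)" and ?u = "\<lambda>m. inv_matrix (p m) x (n m)"
 have r: "0 <= r" "r <= T" using grid_bounds[OF gr[of 0] order_refl] p(2)[of 0] by auto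
 have [measurable]: "euler (p m) y (n m) \<in> bm M" "inv_row (p m) y v (n m) \<in> bm M" for y m v
  using euler_events[OF gr] inv_row_events[OF gr] by auto
 have [measurable]: "diff_quotient (p m) x eps e (n m) \<in> bm M" for m eps e
  unfolding diff_quotient_def[abs_def] by measurable
 have "AE w in M. \<forall>j\<in>UNIV. (\<lambda>m. diff_quotient (p m) x (?eps m) (?e j) (n m) w) \<longlonglongrightarrow> column j (DX r w)"
  using diff_quotient_limit[OF gr p mesh'] by (intro AE_finite_allI) auto
 then show Q: "AE w in M. (\<lambda>m. ?q m w) \<longlonglongrightarrow> DX r w"
 proof eventually_elim
  case (elim w)
  show ?case
  proof (intro vec_tendstoI)
   fix i j
   have "(\<lambda>m. diff_quotient (p m) x (?eps m) (?e j) (n m) w $ i) \<longlonglongrightarrow> column j (DX r w) $ i"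
    using elim by (intro tendsto_vec_nth) auto
   then show "(\<lambda>m. ?q m w $ i $ j) \<longlonglongrightarrow> DX r w $ i $ j" by (simp add: quotient_matrix_def column_def)
  qed
 qed
 have inv_lim: "AE w in M. (\<lambda>m. (?u m w ** ?q m w) $ i $ j) \<longlonglongrightarrow> mat 1 $ i $ j" for i j
 proof -
  let ?p = "\<lambda>m w. (?u m w ** ?q m w) $ i $ j - ?e i \<bullet> ?e j" and ?C = "exp (growth_const CARD('d) T 1 K_prod)"
  have s0: "0 <= T * size_const" using T_pos by (auto simp: size_const_def inv_const_def flow_const_def)
  have s1: "0 <= ?C * (T * size_const)" using s0 by simp
  have "AE w in M. (\<lambda>m. (?p m w)^2) \<longlonglongrightarrow> 0"
  proof (rule AE_tendsto_zero_of_summable)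
   fix m
   have q4: "((1/2::real) ^ m)^2 = (1/4) ^ m" by (simp add: power2_eq_square power_mult_distrib[symmetric])
   have p48: "(1/8::real) ^ m <= (1/4) ^ m" "(1/4::real) ^ m <= (1/2) ^ m" by (rule power_mono; simp)+
   have "(\<E>\<^sup>+ w. ennreal ((?p m w)^2)) <= ennreal (?C * (T * ((?eps m)^2 * size_const)))"
    unfolding inv_quotient_product
    by (rule inverse_flow_product[OF gr]) (use mesh[of _ m] p48 q4 in \<open>auto intro: order_trans simp: power_le_one\<close>)
   also have "... <= ennreal (?C * (T * size_const) * (1/2) ^ m)"
    unfolding q4 using mult_left_mono[OF p48(2) s1] by (intro ennreal_leI) (simp add: algebra_simps)
   finally show "moment_le M (\<lambda>w. (?p m w)^2) (?C * (T * size_const) * (1/2) ^ m)"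
    using s0 by (simp add: moment_le_def inv_quotient_product)
  qed
  then show ?thesis
  proof eventually_elim
   case (elim w)
   have "(\<lambda>m. ?p m w) \<longlonglongrightarrow> 0" using tendsto_real_sqrt[OF elim] by (simp add: tendsto_rabs_zero_iff)
   then have "(\<lambda>m. (?u m w ** ?q m w) $ i $ j) \<longlonglongrightarrow> ?e i \<bullet> ?e j" by (simp add: LIM_zero_iff)
   moreover have "?e i \<bullet> ?e j = mat 1 $ i $ j" by (simp add: inner_axis_axis mat_def)
   ultimately show ?case by simp
  qed
 qed
 have "AE w in M. \<forall>i\<in>UNIV. \<forall>j\<in>UNIV. (\<lambda>m. (?u m w ** ?q m w) $ i $ j) \<longlonglongrightarrow> mat 1 $ i $ j"
  using inv_lim by (intro AE_finite_allI) auto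
 moreover have "AE w in M. \<exists>R. \<exists>\<^sub>F m in sequentially. norm (?u m w) ^ (2 * 1) <= R"
  by (rule AE_frequently_bounded) (rule inv_matrix_moment[OF gr order_refl])
 ultimately show "AE w in M. invertible (DX r w) \<and> (\<lambda>m. ?u m w) \<longlonglongrightarrow> matrix_inv (DX r w)" using Q
 proof eventually_elim
  case (elim w)
  then obtain R where "\<exists>\<^sub>F m in sequentially. norm (?u m w) ^ (2 * 1) <= R" by blast
  then have R: "\<exists>\<^sub>F m in sequentially. norm (?u m w) <= R + 1"
  proof (rule frequently_elim1)
   fix m assume "norm (?u m w) ^ (2 * 1) <= R"
   moreover have "2 * norm (?u m w) * 1 <= (norm (?u m w))^2 + 1^2" by (rule sum_squares_bound)
   ultimately show "norm (?u m w) <= R + 1" using norm_ge_zero[of "?u m w"] by (simp del: norm_ge_zero)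
  qed
  have UQ: "(\<lambda>m. ?u m w ** ?q m w) \<longlonglongrightarrow> mat 1" using elim(1) by (intro vec_tendstoI) auto
  show ?case using approximate_inverse_limit[OF elim(3) UQ R] by simp
 qed
 have "AE w in M. (\<lambda>m. (norm (X x r w - euler (p m) x (n m) w))^2) \<longlonglongrightarrow> 0"
 proof (rule AE_tendsto_zero_of_summable)
  fix m
  have "(1/8::real) ^ m <= (1/2) ^ m" by (rule power_mono) auto
  from mult_left_mono[OF this euler_const_nonneg] euler_converges[OF X[of x] gr[of m] p(1) mesh] p(2)
  show "moment_le M (\<lambda>w. (norm (X x r w - euler (p m) x (n m) w))^2) (euler_const * (1/2) ^ m)" by (auto intro: moment_le_weaken)
 qed
 then show "AE w in M. (\<lambda>m. euler (p m) x (n m) w) \<longlonglongrightarrow> X x r w"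
 proof eventually_elim
  case (elim w)
  have "(\<lambda>m. X x r w - euler (p m) x (n m) w) \<longlonglongrightarrow> 0"
   using tendsto_real_sqrt[OF elim] by (simp add: tendsto_norm_zero_iff)
  from tendsto_diff[OF tendsto_const[of "X x r w"] this] show ?case by simp
 qed
qed

text \<open>\<open>(\<nabla>X\<^sub>t)\<^sup>-\<^sup>1\<close> in a version that is adapted to the filtration of \<open>W\<close>.\<close>

definition inverse_flow :: "(real => 'w => real^'d^'d) => bool" where
 "inverse_flow U \<longleftrightarrow> (\<forall>t. 0 <= t \<longrightarrow> t <= T \<longrightarrow> U t \<in> bm (\<F> t T) \<and>
  (AE w in M. U t w = matrix_inv (DX t w)))"

text \<open>The limit of the discrete inverses is known from \<open>W\<close> up to
  \<open>t\<close>, as \<open>lim\<close> is measurable even where the sequence diverges.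
  \<open>matrix_inv (DX t)\<close> itself only agrees with it almost surely.\<close>

lemma inverse_flow_exists: "\<exists>U. inverse_flow U"
proof -
 have "\<exists>U. U \<in> bm (\<F> t T) \<and> (AE w in M. U w = matrix_inv (DX t w))" if t: "t \<in> {0..T}" for t
 proof -
  have t': "0 <= t" "t <= T" using t by auto
  have "\<forall>m. \<exists>p i n. grid p n \<and> i <= n \<and> p 0 = 0 \<and> p i = t \<and> p n = t \<and> (\<forall>k<n. p (Suc k) - p k <= (1/8::real) ^ m)"
   using fine_grid[OF t'(1) order_refl t'(2)] by auto
  then obtain p n where gr: "\<And>m. grid (p m) (n m)" and p: "\<And>m. p m 0 = 0" "\<And>m. p m (n m) = t"
    and mesh: "\<And>m. \<forall>k<n m. p m (Suc k) - p m k <= (1/8) ^ m" by metis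
  let ?U = "\<lambda>w. lim (\<lambda>m. inv_matrix (p m) x (n m) w)"
  have "AE w in M. ?U w = matrix_inv (DX t w)"
   using flow_limit(2)[OF gr p mesh] by eventually_elim (auto intro: limI)
  moreover have "inv_row (p m) x v (n m) \<in> bm (\<F> t T)" for m v
   using inv_row_measurable[OF gr order_refl, of m x v T] p(2) by simp
  then have "inv_matrix (p m) x (n m) \<in> bm (\<F> t T)" for m
   unfolding inv_matrix_def[abs_def] by (rule measurable_vec_lambda)
  then have "?U \<in> bm (\<F> t T)" by (rule borel_measurable_lim_metric)
  ultimately show ?thesis by (intro exI[of _ ?U] conjI)
 qed
 then have "\<forall>t\<in>{0..T}. \<exists>U. U \<in> bm (\<F> t T) \<and> (AE w in M. U w = matrix_inv (DX t w))" by (rule ballI)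
 from bchoice[OF this] obtain U where "\<forall>t\<in>{0..T}. U t \<in> bm (\<F> t T) \<and> (AE w in M. U t w = matrix_inv (DX t w))"
  by (rule exE)
 then show ?thesis by (intro exI[of _ U]) (simp add: inverse_flow_def)
qed

lemma inverse_flow_measurable: "inverse_flow U \<Longrightarrow> 0 <= t \<Longrightarrow> t <= T \<Longrightarrow> U t \<in> bm M"
 using measurable_info_events[of "U t" t T] T_pos by (simp add: inverse_flow_def)

text \<open>All bounds are those of the scheme on grids through \<open>s\<close> and
  \<open>t\<close>, with constants free of the mesh; \<open>moment_le_limit\<close> carries them
  over.\<close>

lemma flow_moments:
 assumes U: "inverse_flow U" and q: "q \<ge> 1"
 shows "\<exists>C\<ge>0. \<forall>s t. 0 <= s \<longrightarrow> s <= t \<longrightarrow> t <= T \<longrightarrow>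
  moment_le M (\<lambda>w. norm (DX t w) ^ (2 * q)) C \<and> moment_le M (\<lambda>w. norm (U t w) ^ (2 * q)) C \<and>
  moment_le M (\<lambda>w. norm (U t w - U s w) ^ (2 * q)) (C * (t - s) ^ q) \<and>
  moment_le M (\<lambda>w. norm (X x t w - X x s w) ^ (2 * q)) (C * (t - s) ^ q)"
proof -
 let ?d = "real CARD('d)"
 define c1 where "c1 = ?d ^ q * (?d * flow_const q)"
 define c2 where "c2 = ?d ^ q * (?d * inv_const q)"
 define c3 where "c3 = ?d ^ q * (?d * (exp (growth_const CARD('d) T q K_inv) * inv_const q))"
 define c4 where "c4 = exp (growth_const CARD('d) T q K)"
 have c: "0 <= c1" "0 <= c2" "0 <= c3" "0 <= c4"
  by (auto simp: c1_def c2_def c3_def c4_def flow_const_def inv_const_def)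
 define C where "C = c1 + c2 + c3 + c4"
 have C: "0 <= C" "c1 <= C" "c2 <= C" "c3 <= C" "c4 <= C" using c by (auto simp: C_def)
 have "moment_le M (\<lambda>w. norm (DX t w) ^ (2 * q)) C \<and> moment_le M (\<lambda>w. norm (U t w) ^ (2 * q)) C \<and>
   moment_le M (\<lambda>w. norm (U t w - U s w) ^ (2 * q)) (C * (t - s) ^ q) \<and>
   moment_le M (\<lambda>w. norm (X x t w - X x s w) ^ (2 * q)) (C * (t - s) ^ q)"
  if st: "0 <= s" "s <= t" "t <= T" for s t
 proof -
  have st': "0 <= t" "s <= T" using st by auto
  have "\<forall>m. \<exists>p i n. grid p n \<and> i <= n \<and> p 0 = 0 \<and> p i = s \<and> p n = t \<and> (\<forall>k<n. p (Suc k) - p k <= (1/8::real) ^ m)"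
   using fine_grid[OF st] by auto
  then obtain p i n where gr: "\<And>m. grid (p m) (n m)" and i: "\<And>m. i m <= n m" and p: "\<And>m. p m 0 = 0"
    "\<And>m. p m (i m) = s" "\<And>m. p m (n m) = t" and mesh: "\<And>m. \<forall>k<n m. p m (Suc k) - p m k <= (1/8) ^ m"
   by metis
  note gri = grid_le[OF gr i]
  have meshi: "\<forall>k<i m. p m (Suc k) - p m k <= (1/8) ^ m" for m using mesh[of m] i[of m] by simp
  note Lt = flow_limit[OF gr p(1) p(3) mesh] and Ls = flow_limit[OF gri p(1) p(2) meshi]
  have UDX: "AE w in M. U t w = matrix_inv (DX t w)" "AE w in M. U s w = matrix_inv (DX s w)"
   using U st st' by (auto simp: inverse_flow_def)
  note [measurable] = inverse_flow_measurable[OF U st'(1) st(3)] inverse_flow_measurable[OF U st(1) st'(2)]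
   sde_measurable(2)[OF X st'(1) st(3)] sde_measurable(2)[OF X st(1) st'(2)] process_section[OF DX_process st'(1) st(3)]
  have 1: "moment_le M (\<lambda>w. norm (DX t w) ^ (2 * q)) c1"
  proof (rule moment_le_limit)
   show "AE w in M. (\<lambda>m. norm (quotient_matrix (p m) x ((1/2) ^ m) (n m) w) ^ (2 * q)) \<longlonglongrightarrow> norm (DX t w) ^ (2 * q)"
    using Lt(1) by eventually_elim (intro tendsto_intros)
   fix m
   \<comment> \<open>The quotients are the columns of the matrix, while
     \<open>matrix_moment_le\<close> works with rows; transposing does not change the norm.\<close>
   have eq: "transpose (quotient_matrix (p m) x ((1/2) ^ m) (n m) w) $ j = diff_quotient (p m) x ((1/2) ^ m) (axis j 1) (n m) w" for w j
    by (simp add: transpose_def quotient_matrix_def vec_eq_iff)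
   have "moment_le M (\<lambda>w. norm (transpose (quotient_matrix (p m) x ((1/2) ^ m) (n m) w)) ^ (2 * q)) c1"
    unfolding c1_def
   proof (rule matrix_moment_le, unfold eq)
    show "diff_quotient (p m) x ((1/2) ^ m) (axis j 1) (n m) \<in> bm M" for j
     using euler_events[OF gr order_refl] unfolding diff_quotient_def[abs_def] by measurable
    show "moment_le M (\<lambda>w. norm (diff_quotient (p m) x ((1/2) ^ m) (axis j 1) (n m) w) ^ (2 * q)) (flow_const q)" for j
     by (rule moment_le_integral[OF diff_quotient_moment[OF gr q]]) auto
   qed
   then show "moment_le M (\<lambda>w. norm (quotient_matrix (p m) x ((1/2) ^ m) (n m) w) ^ (2 * q)) c1" by (simp add: norm_transpose)
  qed auto
  have 2: "moment_le M (\<lambda>w. norm (U t w) ^ (2 * q)) c2" unfolding c2_def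
  proof (rule moment_le_limit[OF inv_matrix_moment[OF gr q]])
   show "AE w in M. (\<lambda>m. norm (inv_matrix (p m) x (n m) w) ^ (2 * q)) \<longlonglongrightarrow> norm (U t w) ^ (2 * q)"
    using Lt(2) UDX(1) by eventually_elim (auto intro!: tendsto_intros)
  qed auto
  have 34: "moment_le M (\<lambda>w. norm (U t w - U s w) ^ (2 * q)) (c3 * (t - s) ^ q) \<and>
    moment_le M (\<lambda>w. norm (X x t w - X x s w) ^ (2 * q)) (c4 * (t - s) ^ q)"
  \<comment> \<open>The increment estimates normalize by \<open>S = t - s\<close>, which has to be
    positive.\<close>
  proof (cases "s = t")
   case True then show ?thesis using q by (simp add: zero_power moment_le_def)
  next
   case False
   then have S: "p m (n m) - p m (i m) <= t - s" "0 < t - s" "t - s <= T" for m using st p by auto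
   show ?thesis
   proof
    show "moment_le M (\<lambda>w. norm (U t w - U s w) ^ (2 * q)) (c3 * (t - s) ^ q)"
    proof (rule moment_le_limit)
     show "AE w in M. (\<lambda>m. norm (inv_matrix (p m) x (n m) w - inv_matrix (p m) x (i m) w) ^ (2 * q)) \<longlonglongrightarrow> norm (U t w - U s w) ^ (2 * q)"
      using Lt(2) Ls(2) UDX by eventually_elim (auto intro!: tendsto_intros)
     show "moment_le M (\<lambda>w. norm (inv_matrix (p m) x (n m) w - inv_matrix (p m) x (i m) w) ^ (2 * q)) (c3 * (t - s) ^ q)" for m
      using inv_matrix_increment_moment[OF gr i S q, of m x] unfolding c3_def by (simp add: mult_ac)
    qed auto
    show "moment_le M (\<lambda>w. norm (X x t w - X x s w) ^ (2 * q)) (c4 * (t - s) ^ q)"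
     unfolding c4_def
    proof (rule moment_le_limit[OF moment_le_integral[OF euler_increment_moment[OF gr i S q, of _ x]]])
     show "AE w in M. (\<lambda>m. norm (euler (p m) x (n m) w - euler (p m) x (i m) w) ^ (2 * q)) \<longlonglongrightarrow> norm (X x t w - X x s w) ^ (2 * q)"
      using Lt(3) Ls(3) by eventually_elim (auto intro!: tendsto_intros)
    qed auto
   qed
  qed
  have le: "c * (t - s) ^ q <= C * (t - s) ^ q" if "c <= C" for c
   using that st by (intro mult_right_mono) auto
  show ?thesis
   using moment_le_weaken[OF 1 C(2)] moment_le_weaken[OF 2 C(3)] moment_le_weaken[OF conjunct1[OF 34] le[OF C(4)]]
    moment_le_weaken[OF conjunct2[OF 34] le[OF C(5)]] by simp
 qed
 with C(1) show ?thesis by blast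
qed

end

section \<open>Chaining over finite sets of times\<close>

lemma sum_power4_weighted:
 fixes a l :: "nat => real"
 assumes l: "\<And>k. k < m \<Longrightarrow> 0 < l k" and a: "\<And>k. k < m \<Longrightarrow> 0 <= a k"
 shows "(\<Sum>k<m. a k) ^ 4 <= (\<Sum>k<m. l k) ^ 3 * (\<Sum>k<m. a k ^ 4 / l k ^ 3)"
proof -
 \<comment> \<open>The Cauchy-Schwarz inequality with weights; applying it twice gives Hoelder's
   inequality with exponents 4 and 4/3.\<close>
 have cs: "(\<Sum>k<m. c k)^2 <= (\<Sum>k<m. l k) * (\<Sum>k<m. (c k)^2 / l k)" for c :: "nat => real"
 proof -
  have "(\<Sum>k<m. c k) = (\<Sum>k<m. sqrt (l k) * (c k / sqrt (l k)))" by (rule sum.cong) (use l in force)+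
  also have "...^2 <= (\<Sum>k<m. (sqrt (l k))^2) * (\<Sum>k<m. (c k / sqrt (l k))^2)" by (rule Cauchy_Schwarz_ineq_sum)
  also have "... = (\<Sum>k<m. l k) * (\<Sum>k<m. (c k)^2 / l k)"
   using l by (intro arg_cong2[where f=times] sum.cong) (auto simp: power_divide less_imp_le)
  finally show ?thesis .
 qed
 let ?L = "\<Sum>k<m. l k"
 have L: "0 <= ?L" using l by (intro sum_nonneg) (auto intro: less_imp_le)
 have "(\<Sum>k<m. a k) ^ 4 = ((\<Sum>k<m. a k)^2)^2" by simp
 also have "... <= (?L * (\<Sum>k<m. (a k)^2 / l k))^2" by (intro power_mono cs) auto
 also have "... = ?L^2 * (\<Sum>k<m. (a k)^2 / l k)^2" by (rule power_mult_distrib)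
 also have "... <= ?L^2 * (?L * (\<Sum>k<m. ((a k)^2 / l k)^2 / l k))" by (intro mult_left_mono cs) auto
 also have "... = ?L ^ 3 * (\<Sum>k<m. a k ^ 4 / l k ^ 3)"
  by (simp add: power_divide power2_eq_square power3_eq_cube power4_eq_xxxx mult_ac)
 finally show ?thesis .
qed

text \<open>Kolmogorov's chaining argument. Without a continuous modification it bounds maxima over finite
 sets, by a constant that does not depend on the set.\<close>

lemma chaining:
 fixes A :: "real => 'w => 'a::euclidean_space"
 assumes A: "\<And>t. 0 <= t \<Longrightarrow> t <= T \<Longrightarrow> A t \<in> bm N" and T: "0 < T" and C: "0 <= C"
  and A0: "(\<integral>\<^sup>+w. ennreal (norm (A 0 w) ^ 4) \<partial>N) <= ennreal C"
  and inc: "\<And>s t. 0 <= s \<Longrightarrow> s <= t \<Longrightarrow> t <= T \<Longrightarrow> (\<integral>\<^sup>+w. ennreal (norm (A t w - A s w) ^ 4) \<partial>N) <= ennreal (C * (t - s)^2)"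
  and S: "finite S" "S \<subseteq> {0..T}"
 shows "\<exists>H. moment_le N H (81 * (C + 1000 * (C * T^2) + C)) \<and> (\<forall>w. \<forall>t\<in>S. norm (A t w) ^ 4 <= H w)"
proof -
 define p where "p k j = T * real j / 2 ^ k" for k j :: nat
 have p: "0 <= p k j \<and> p k j <= T" if "j <= 2 ^ k" for k j
  using that T by (auto simp: p_def divide_le_eq)
 have pp: "p (Suc k) (2 * j) = p k j" for k j by (simp add: p_def)
 define dA where "dA k j w = norm (A (p (Suc k) (2 * j + 1)) w - A (p k j) w)" for k j w
 \<comment> \<open>The largest increment from a dyadic point of level \<open>k\<close> to the new
   point on its right. Every dyadic point is reached from 0 by at most one such increment per
   level.\<close>
 define R where "R k w = Max ((\<lambda>j. dA k j w) ` {..<2 ^ k})" for k w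
 have R: "dA k j w <= R k w" if "j < 2 ^ k" for k j w unfolding R_def using that by (intro Max_ge) auto
 have R0: "0 <= R k w" for k w using R[of 0 k w] by (simp add: dA_def order_trans[OF norm_ge_zero])
 have R4: "R k w ^ 4 <= (\<Sum>j<2 ^ k. dA k j w ^ 4)" for k w
 proof -
  have "{..<2 ^ k :: nat} \<noteq> {}" by (simp add: lessThan_empty_iff)
  then have "R k w \<in> (\<lambda>j. dA k j w) ` {..<2 ^ k}" unfolding R_def by (intro Max_in) auto
  then obtain j where j: "j < 2 ^ k" "R k w = dA k j w" by auto
  then show ?thesis by (auto intro!: member_le_sum[of j] simp: dA_def)
 qed
 have lev: "norm (A (p m j) w) <= norm (A 0 w) + (\<Sum>k<m. R k w)" if "j < 2 ^ m" for m j w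
  using that
 proof (induction m arbitrary: j)
  case 0
  then show ?case by (simp add: p_def)
 next
  case (Suc m)
  show ?case
  proof (cases "even j")
   case True
   then obtain i where "j = 2 * i" by blast
   then show ?thesis using Suc.IH[of i] Suc.prems R0[of m w] pp[of m i] by simp
  next
   case False
   then obtain i where i: "j = 2 * i + 1" using oddE by blast
   then have "i < 2 ^ m" using Suc.prems by simp
   then have "norm (A (p m i) w) <= norm (A 0 w) + (\<Sum>k<m. R k w)" "dA m i w <= R m w" using Suc.IH[of i] R by auto
   moreover have "norm (A (p (Suc m) j) w) <= norm (A (p m i) w) + dA m i w"
    unfolding dA_def i using norm_triangle_ineq[of "A (p m i) w" "A (p (Suc m) (2 * i + 1)) w - A (p m i) w"] by simp
   ultimately show ?thesis by simp
  qed
 qed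
 have near: "\<exists>j<2 ^ m. p m j <= t \<and> t <= p m j + T / 2 ^ m" if t: "0 <= t" "t <= T" for m t
 proof (cases "t = T")
  case True
  then show ?thesis using T by (intro exI[of _ "2 ^ m - 1"]) (auto simp: p_def of_nat_diff field_simps)
 next
  case False
  define j where "j = nat \<lfloor>t * 2 ^ m / T\<rfloor>"
  have j: "real j <= t * 2 ^ m / T" "t * 2 ^ m / T <= real j + 1" using t T by (auto simp: j_def; linarith)+
  have "t * 2 ^ m / T < 2 ^ m" using False t T by (simp add: divide_less_eq)
  then have "real j < 2 ^ m" using j(1) by linarith
  then have "j < 2 ^ m" by simp
  then show ?thesis using j T by (intro exI[of _ j]) (auto simp: p_def field_simps)
 qed
 \<comment> \<open>So fine that the last links, from dyadic points to the points of
   \<open>S\<close>, cost at most \<open>C\<close> in total, however many points there are.\<close>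
 obtain m where m: "real (card S) * T^2 < 4 ^ m" using real_arch_pow[of 4] by auto
 have "\<forall>t\<in>S. \<exists>j. j < 2 ^ m \<and> p m j <= t \<and> t <= p m j + T / 2 ^ m"
 proof
  fix t assume "t \<in> S"
  then have "0 <= t" "t <= T" using S(2) by auto
  then show "\<exists>j. j < 2 ^ m \<and> p m j <= t \<and> t <= p m j + T / 2 ^ m" by (rule near)
 qed
 then obtain J where J: "\<And>t. t \<in> S \<Longrightarrow> J t < 2 ^ m \<and> p m (J t) <= t \<and> t <= p m (J t) + T / 2 ^ m" by metis
 \<comment> \<open>Weights with total at most 10. Level \<open>k\<close> has \<open>2^k\<close>
   increments with fourth moment at most \<open>C T^2 / (4 * 4^k)\<close>; after division by
   \<open>l k ^ 3\<close> the sum decays like the power \<open>k\<close> of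
   \<open>2 / (0.729 * 4)\<close>, which is below \<open>0.7\<close> and still summable.\<close>
 define l where "l k = (9/10 :: real) ^ k" for k :: nat
 define H1 where "H1 w = (\<Sum>k<m. (1 / l k ^ 3) * (\<Sum>j<2 ^ k. dA k j w ^ 4))" for w
 define H2 where "H2 w = (\<Sum>t\<in>S. norm (A t w - A (p m (J t)) w) ^ 4)" for w
 \<comment> \<open>\<open>81 = 3^4\<close> splits the fourth power of a sum of three terms, and
   \<open>1000 = 10^3\<close> is the cube of the bound on the total weight.\<close>
 define H where "H w = 81 * (norm (A 0 w) ^ 4 + 1000 * H1 w + H2 w)" for w
 have lsum: "0 <= (\<Sum>k<m. l k)" "(\<Sum>k<m. l k) <= 10"
 proof -
  have "(\<Sum>k<m. l k) = ((9/10) ^ m - 1) / (9/10 - 1)" unfolding l_def by (rule geometric_sum) simp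
  also have "... <= 10" by (simp add: field_simps)
  finally show "(\<Sum>k<m. l k) <= 10" .
 qed (auto intro!: sum_nonneg simp: l_def)
 have bound: "norm (A t w) ^ 4 <= H w" if t: "t \<in> S" for t w
 proof -
  let ?r = "norm (A t w - A (p m (J t)) w)"
  have R': "(\<Sum>k<m. R k w) ^ 4 <= 1000 * H1 w"
  proof -
   have "(\<Sum>k<m. R k w) ^ 4 <= (\<Sum>k<m. l k) ^ 3 * (\<Sum>k<m. R k w ^ 4 / l k ^ 3)"
    by (rule sum_power4_weighted) (auto simp: l_def R0)
   also have "... <= 10 ^ 3 * (\<Sum>k<m. R k w ^ 4 / l k ^ 3)"
    by (intro mult_right_mono power_mono lsum sum_nonneg divide_nonneg_nonneg) (auto simp: l_def R0)
   also have "... <= 10 ^ 3 * H1 w" unfolding H1_def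
    by (intro mult_left_mono sum_mono) (auto simp: l_def R4 divide_simps)
   finally show ?thesis by simp
  qed
  have "norm (A t w) <= norm (A (p m (J t)) w) + ?r"
   using norm_triangle_ineq[of "A (p m (J t)) w" "A t w - A (p m (J t)) w"] by simp
  also have "norm (A (p m (J t)) w) <= norm (A 0 w) + (\<Sum>k<m. R k w)" using J[OF t] by (intro lev) auto
  finally have "norm (A t w) ^ 4 <= (norm (A 0 w) + (\<Sum>k<m. R k w) + ?r) ^ 4" by (intro power_mono) auto
  also have "... <= 3 ^ 4 * (norm (A 0 w) ^ 4 + (\<Sum>k<m. R k w) ^ 4 + ?r ^ 4)"
   by (intro power_add3_le sum_nonneg R0) auto
  also have "?r ^ 4 <= H2 w" unfolding H2_def by (rule member_le_sum[OF t]) (use S(1) in auto)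
  also note R'
  finally show ?thesis by (simp add: H_def)
 qed
 have incm: "moment_le N (\<lambda>w. norm (A t w - A s w) ^ 4) (C * d^2)" if "0 <= s" "s <= t" "t <= T" "t - s <= d" for s t d
 proof -
  have [measurable]: "A t \<in> bm N" "A s \<in> bm N" using A that by auto
  have "ennreal (C * (t - s)^2) <= ennreal (C * d^2)" using that C by (intro ennreal_leI mult_left_mono power_mono) auto
  then show ?thesis using order_trans[OF inc] that C by (auto simp: moment_le_def)
 qed
 have m1: "moment_le N H1 (\<Sum>k<m. (1 / l k ^ 3) * (\<Sum>j<2 ^ k :: nat. C * (T / 2 ^ Suc k)^2))"
  unfolding H1_def[abs_def]
 proof (intro moment_le_sum moment_le_cmult)
  fix k j :: nat assume "j \<in> {..<2 ^ k}"
  then have j: "2 * j + 1 <= 2 ^ Suc k" "j <= 2 ^ k" by auto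
  have eq: "p (Suc k) (2 * j + 1) - p k j = T / 2 ^ Suc k" by (simp add: p_def field_simps)
  have "0 <= T / 2 ^ Suc k" using T by simp
  then have "p k j <= p (Suc k) (2 * j + 1)" using eq by linarith
  then show "moment_le N (\<lambda>w. dA k j w ^ 4) (C * (T / 2 ^ Suc k)^2)"
   unfolding dA_def using p[OF j(1)] p[OF j(2)] eq by (intro incm) auto
 qed (auto simp: l_def)
 have "(\<Sum>k<m. (1 / l k ^ 3) * (\<Sum>j<2 ^ k :: nat. C * (T / 2 ^ Suc k)^2)) <= (\<Sum>k<m. C * T^2 / 4 * (7/10) ^ k)"
 proof (rule sum_mono)
  fix k
  have lk: "l k ^ 3 = (729/1000) ^ k"
  proof -
   have "l k ^ 3 = ((9/10) ^ 3) ^ k" unfolding l_def by (simp only: power_mult[symmetric] mult.commute)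
   then show ?thesis by (simp add: power3_eq_cube)
  qed
  have "(2 ^ Suc k :: real)^2 = 4 * 4 ^ k" by (simp add: power_mult_distrib power2_eq_square power_mult_distrib[symmetric])
  then have "(1 / l k ^ 3) * (\<Sum>j<2 ^ k :: nat. C * (T / 2 ^ Suc k)^2) = (1 / (729/1000) ^ k) * (2 ^ k * (C * (T^2 / (4 * 4 ^ k))))"
   by (simp only: lk power_divide sum_constant card_lessThan) simp
  also have "... = C * T^2 / 4 * (2 ^ k / ((729/1000) ^ k * 4 ^ k))" by (simp add: mult_ac)
  also have "2 ^ k / ((729/1000) ^ k * 4 ^ k) = (2 / (729/1000 * 4) :: real) ^ k"
   by (simp only: power_divide power_mult_distrib)
  also have "C * T^2 / 4 * (2 / (729/1000 * 4) :: real) ^ k <= C * T^2 / 4 * (7/10) ^ k"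
   using C by (intro mult_left_mono power_mono) auto
  finally show "(1 / l k ^ 3) * (\<Sum>j<2 ^ k :: nat. C * (T / 2 ^ Suc k)^2) <= C * T^2 / 4 * (7/10) ^ k" .
 qed
 also have "... = C * T^2 / 4 * (((7/10) ^ m - 1) / (7/10 - 1))"
  unfolding sum_distrib_left[symmetric] by (subst geometric_sum) auto
 also have "... <= C * T^2 / 4 * 4" using C by (intro mult_left_mono) (auto simp: field_simps)
 finally have c1: "(\<Sum>k<m. (1 / l k ^ 3) * (\<Sum>j<2 ^ k :: nat. C * (T / 2 ^ Suc k)^2)) <= C * T^2" by simp
 have m2: "moment_le N H2 (\<Sum>t\<in>S. C * (T / 2 ^ m)^2)" unfolding H2_def[abs_def]
  by (intro moment_le_sum incm) (use J S p[of "J _" m] in \<open>auto simp: algebra_simps less_imp_le\<close>)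
 have "(\<Sum>t\<in>S. C * (T / 2 ^ m)^2) = C * (real (card S) * T^2 / 4 ^ m)"
  by (simp add: power_divide power2_eq_square power_mult_distrib[symmetric])
 also have "... <= C * 1" using m C by (intro mult_left_mono) (auto simp: divide_le_eq)
 finally have c2: "(\<Sum>t\<in>S. C * (T / 2 ^ m)^2) <= C" by simp
 have "moment_le N (\<lambda>w. norm (A 0 w) ^ 4) C" using A0 A[of 0] T C by (auto simp: moment_le_def)
 then have "moment_le N H (81 * (C + 1000 * (\<Sum>k<m. (1 / l k ^ 3) * (\<Sum>j<2 ^ k :: nat. C * (T / 2 ^ Suc k)^2)) + (\<Sum>t\<in>S. C * (T / 2 ^ m)^2)))"
  unfolding H_def[abs_def] by (intro moment_le_cmult moment_le_add m1 m2) auto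
 then have "moment_le N H (81 * (C + 1000 * (C * T^2) + C))"
  by (rule moment_le_weaken) (intro mult_left_mono add_mono order_refl c1 c2; simp)
 then show ?thesis using bound by blast
qed

section \<open>The factor \<open>(\<nabla>X)\<close> inverse times
  \<open>\<sigma>(X)\<close>\<close>

lemma measurable_matrix_mult:
 fixes f :: "'a => real^'n^'m" and g :: "'a => real^'k^'n"
 assumes "f \<in> bm N" "g \<in> bm N"
 shows "(\<lambda>w. f w ** g w) \<in> bm N" by (rule borel_measurable_continuous_Pair[OF assms])
   (intro bounded_bilinear.continuous_on[OF bounded_bilinear_matrix_mult] continuous_intros)

lemma young_half: "0 < h \<Longrightarrow> a * b <= h / 2 * a^2 + 1 / (2 * h) * (b::real)^2"
proof -
 assume h: "0 < h"
 have "2 * (sqrt h * a) * (b / sqrt h) <= (sqrt h * a)^2 + (b / sqrt h)^2" by (rule sum_squares_bound)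
 then show ?thesis using h by (simp add: power_mult_distrib power_divide field_simps)
qed

context differentiable_flow
begin

lemma factor_exists:
 "\<exists>A C. 0 <= C \<and> (\<forall>t. 0 <= t \<longrightarrow> t <= T \<longrightarrow> A t \<in> bm (\<F> t T) \<and>
   (AE w in M. A t w = matrix_inv (DX t w) ** \<sigma> (X x t w)) \<and> moment_le M (\<lambda>w. norm (A t w) ^ 4) C) \<and>
  (\<forall>s t. 0 <= s \<longrightarrow> s <= t \<longrightarrow> t <= T \<longrightarrow> moment_le M (\<lambda>w. norm (A t w - A s w) ^ 4) (C * (t - s)^2))"
proof -
 obtain U where U: "inverse_flow U" using inverse_flow_exists by blast
 note UM = inverse_flow_measurable[OF U]
 obtain C1 where C1: "0 <= C1" "\<And>s t. 0 <= s \<Longrightarrow> s <= t \<Longrightarrow> t <= T \<Longrightarrow> moment_le M (\<lambda>w. norm (U t w) ^ 4) C1 \<and>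
   moment_le M (\<lambda>w. norm (U t w - U s w) ^ 4) (C1 * (t - s)^2)"
  using flow_moments[OF U, of 2] by auto
 obtain C2 where C2: "0 <= C2" "\<And>s t. 0 <= s \<Longrightarrow> s <= t \<Longrightarrow> t <= T \<Longrightarrow> moment_le M (\<lambda>w. norm (U t w) ^ 8) C2 \<and>
   moment_le M (\<lambda>w. norm (X x t w - X x s w) ^ 8) (C2 * (t - s) ^ 4)"
  using flow_moments[OF U, of 4] by auto
 define A where "A t w = U t w ** \<sigma> (X x t w)" for t w
 have sX: "(\<lambda>w. \<sigma> (X x t w)) \<in> bm N" if "X x t \<in> bm N" for N t
  by (rule measurable_compose[OF that borel_measurable_continuous_onI[OF s_cont]])
 define C where "C = K ^ 4 * C1 + 2 ^ 4 * (K ^ 4 * (C1 + C2))"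
 have K4: "0 <= K ^ 4" using K by simp
 have Am: "A t \<in> bm (\<F> t T)" "A t \<in> bm M" if t: "0 <= t" "t <= T" for t
  unfolding A_def[abs_def]
  by (intro measurable_matrix_mult sX sde_measurable[OF X t] UM t; use U t in \<open>simp add: inverse_flow_def\<close>)+
 have a: "moment_le M (\<lambda>w. norm (A t w) ^ 4) C" if t: "0 <= t" "t <= T" for t
 proof -
  have le: "norm (A t w) ^ 4 <= K ^ 4 * norm (U t w) ^ 4" for w
  proof -
   have "norm (A t w) <= norm (U t w) * K"
    unfolding A_def by (rule order_trans[OF norm_matrix_mult mult_left_mono[OF s_bound norm_ge_zero]])
   from power_mono[OF this, of 4] show ?thesis by (simp add: power_mult_distrib mult.commute)
  qed
  from C1(2)[OF order_refl t] have "moment_le M (\<lambda>w. norm (U t w) ^ 4) C1" by simp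
  from moment_le_mono[OF moment_le_cmult[OF this K4] _ _ le] have "moment_le M (\<lambda>w. norm (A t w) ^ 4) (K ^ 4 * C1)"
   using Am(2)[OF t] by simp
  then show ?thesis by (rule moment_le_weaken) (use C1 C2 K4 in \<open>auto simp: C_def\<close>)
 qed
 have d: "moment_le M (\<lambda>w. norm (A t w - A s w) ^ 4) (C * (t - s)^2)" if st: "0 <= s" "s <= t" "t <= T" for s t
 proof (cases "s = t")
  case True then show ?thesis by (simp add: moment_le_def)
 next
  case False
  have t: "0 <= t" "s <= T" using st by auto
  \<comment> \<open>Young's inequality splits the product of the fourth powers of \<open>U s\<close>
    and of the increment of \<open>X\<close>. This weight balances the eighth moment of
    \<open>U s\<close>, of order 1, against that of the increment, of order
    \<open>(t - s)^4\<close>.\<close>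
  define h where "h = (t - s)^2"
  have h: "0 < h" "h^2 = (t - s) ^ 4" using False st by (simp_all add: h_def)
  have 1: "moment_le M (\<lambda>w. norm (U t w - U s w) ^ 4) (C1 * h)" using C1(2)[OF st] by (simp add: h_def)
  have 2: "moment_le M (\<lambda>w. (norm (U s w) ^ 4)^2) C2" using C2(2)[OF order_refl st(1) t(2)] by (simp add: power_mult[symmetric])
  have 3: "moment_le M (\<lambda>w. (norm (X x t w - X x s w) ^ 4)^2) (C2 * h^2)"
   using C2(2)[OF st] by (simp only: h(2)) (simp add: power_mult[symmetric])
  let ?b = "\<lambda>w. 2 ^ 4 * (K ^ 4 * (norm (U t w - U s w) ^ 4 + (h / 2 * (norm (U s w) ^ 4)^2 + 1 / (2 * h) * (norm (X x t w - X x s w) ^ 4)^2)))"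
  have "moment_le M ?b (2 ^ 4 * (K ^ 4 * (C1 * h + (h / 2 * C2 + 1 / (2 * h) * (C2 * h^2)))))"
   by (intro moment_le_cmult moment_le_add 1 2 3) (use h K4 in auto)
  moreover have "h / 2 * C2 + 1 / (2 * h) * (C2 * h^2) = C2 * h" using h(1) by (simp add: field_simps power2_eq_square)
  ultimately have b: "moment_le M ?b (2 ^ 4 * (K ^ 4 * (C1 * h + C2 * h)))" by simp
  have le: "norm (A t w - A s w) ^ 4 <= ?b w" for w
  proof -
   let ?u = "norm (U t w - U s w)" and ?v = "norm (U s w)" and ?y = "norm (X x t w - X x s w)"
   have "A t w - A s w = (U t w - U s w) ** \<sigma> (X x t w) + U s w ** (\<sigma> (X x t w) - \<sigma> (X x s w))"
    by (simp add: A_def bounded_bilinear.diff_left[OF bounded_bilinear_matrix_mult] bounded_bilinear.diff_right[OF bounded_bilinear_matrix_mult])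
   also have "norm ... <= ?u * K + ?v * (K * ?y)"
    by (intro order_trans[OF norm_triangle_ineq] add_mono order_trans[OF norm_matrix_mult] mult_left_mono s_bound s_lip) auto
   finally have "norm (A t w - A s w) ^ 4 <= (?u * K + ?v * (K * ?y)) ^ 4" by (intro power_mono) auto
   also have "... <= 2 ^ 4 * ((?u * K) ^ 4 + (?v * (K * ?y)) ^ 4)" by (rule power_add_le) (use K in auto)
   also have "... = 2 ^ 4 * (K ^ 4 * (?u ^ 4 + ?v ^ 4 * ?y ^ 4))" by (simp add: power_mult_distrib algebra_simps)
   also have "... <= ?b w" by (intro mult_left_mono add_left_mono young_half h K4) auto
   finally show ?thesis .
  qed
  have "moment_le M (\<lambda>w. norm (A t w - A s w) ^ 4) (2 ^ 4 * (K ^ 4 * (C1 * h + C2 * h)))"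
   by (rule moment_le_mono[OF b _ _ le]) (use Am(2)[OF t(1) st(3)] Am(2)[OF st(1) t(2)] in auto)
  moreover have "2 ^ 4 * (K ^ 4 * (C1 * h + C2 * h)) <= C * h" using K4 C1 h by (simp add: C_def algebra_simps)
  ultimately show ?thesis unfolding h_def by (rule moment_le_weaken)
 qed
 have "AE w in M. A t w = matrix_inv (DX t w) ** \<sigma> (X x t w)" if "0 <= t" "t <= T" for t
  using U that by (auto simp: A_def inverse_flow_def elim: eventually_mono)
 moreover have "0 <= C" using K4 C1 C2 by (simp add: C_def)
 ultimately show ?thesis using a d Am(1) by (intro exI[of _ A] exI[of _ C]) auto
qed

end

section \<open>Linear backward doubly stochastic equations\<close>

lemma set_integral_half_open:
 fixes f :: "real => real"
 assumes f: "set_integrable lborel {s..t} f"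
 shows "(LINT r:{s..t}|lborel. f r) = (LINT r:{s<..t}|lborel. f r)"
proof -
 have g: "set_integrable lborel {s<..t} f" by (rule set_integrable_subset[OF f]) auto
 show ?thesis unfolding set_lebesgue_integral_def
 proof (rule integral_cong_AE)
  show "AE r in lborel. indicator {s..t} r *\<^sub>R f r = indicator {s<..t} r *\<^sub>R f r"
   using AE_lborel_singleton[of s] by eventually_elim (auto simp: indicator_def)
 qed (use f g in \<open>auto simp: set_integrable_def\<close>)
qed

text \<open>The equation of one component of the gradient with its linearity forgotten:
  \<open>F\<close> and \<open>G\<close> only have to be dominated by \<open>u\<close>,
  \<open>y\<close> and \<open>z\<close>, with a factor \<open>\<alpha> < 1\<close> on
  \<open>z\<close> in \<open>G\<close>. The process \<open>u\<close> stands for a column of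
  \<open>DX\<close> and is the source in all estimates.\<close>

locale linear_bdsde = two_brownian_motions M T W B
 for M :: "'w measure" and T :: real and W :: "real => 'w => real^'d" and B :: "real => 'w => real" +
 fixes u :: "real => 'w => real^'d" and \<zeta> :: "'w => real" and F G y :: "real => 'w => real"
  and z :: "real => 'w => real^'d" and c\<^sub>0 c\<^sub>F c\<^sub>G \<alpha> :: real
 assumes u_process: "process M T u"
  and u_L2: "(\<integral>\<^sup>+p. ennreal (indicator {0..T} (fst p) * (norm (u (fst p) (snd p)))^2) \<partial>(lborel \<Otimes>\<^sub>M M)) < \<infinity>"
   "(\<integral>\<^sup>+w. ennreal ((norm (u T w))^2) \<partial>M) < \<infinity>"
  and sol: "bdsde_solution M W B T \<zeta> F G y z"
  and zeta_bound: "\<And>w. w \<in> space M \<Longrightarrow> (\<zeta> w)^2 <= c\<^sub>0 * (norm (u T w))^2"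
  and F_bound: "\<And>r w. w \<in> space M \<Longrightarrow> 0 <= r \<Longrightarrow> r <= T \<Longrightarrow>
   (F r w)^2 <= c\<^sub>F * ((norm (u r w))^2 + (y r w)^2 + (norm (z r w))^2)"
  and G_bound: "\<And>r w. w \<in> space M \<Longrightarrow> 0 <= r \<Longrightarrow> r <= T \<Longrightarrow>
   (G r w)^2 <= c\<^sub>G * ((norm (u r w))^2 + (y r w)^2) + \<alpha> * (norm (z r w))^2"
  and c_nonneg: "0 <= c\<^sub>0" "0 <= c\<^sub>F" "0 <= c\<^sub>G" "0 <= \<alpha>" "\<alpha> < 1"
begin

abbreviation PM :: "(real \<times> 'w) measure" where "PM \<equiv> lborel \<Otimes>\<^sub>M M"

lemma u_T_measurable: "u T \<in> bm M" using process_section[OF u_process] T_pos by simp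

lemma y_measurable:
 assumes "0 <= t" "t <= T"
 shows "y t \<in> bm (\<F> t t)" "y t \<in> bm M"
proof -
 show "y t \<in> bm (\<F> t t)" using sol assms by (auto simp: bdsde_solution_def)
 from measurable_info_events[OF this] show "y t \<in> bm M" using assms by simp
qed

text \<open>The forward integral \<open>L\<close> is placed next to \<open>y s\<close> and the
  backward integral \<open>J\<close> next to \<open>y t\<close>. In this arrangement
  \<open>y s\<close> is orthogonal to \<open>L\<close> and \<open>y t\<close> to \<open>J\<close>,
  so squaring either sum produces no cross term; this replaces the Ito formula.\<close>

lemma increment:
 assumes st: "0 <= s" "s <= t" "t <= T"
 obtains J L where "bwd.ito s t (\<lambda>p. indicator {s<..t} (fst p) *\<^sub>R G (fst p) (snd p)) J"
  "fwd.ito s t (\<lambda>p. indicator {s<..t} (fst p) *\<^sub>R z (fst p) (snd p)) L"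
  "AE w in M. set_integrable lborel {s<..t} (\<lambda>r. F r w) \<and> y s w + L w = y t w + J w + (LINT r:{s<..t}|lborel. F r w)"
proof -
 have *: "\<exists>J L. has_bwd_integral M W B T v T G J \<and> has_fwd_integral M W B T v T z L \<and>
    (AE w in M. set_integrable lborel {v..T} (\<lambda>r. F r w) \<and>
      y v w = \<zeta> w + (LINT r:{v..T}|lborel. F r w) + J w - L w)" if "0 <= v" "v <= T" for v
  using sol that unfolding bdsde_solution_def by auto
 obtain J L where J: "has_bwd_integral M W B T s T G J" and L: "has_fwd_integral M W B T s T z L"
  and eq: "AE w in M. set_integrable lborel {s..T} (\<lambda>r. F r w) \<and> y s w = \<zeta> w + (LINT r:{s..T}|lborel. F r w) + J w - L w"
  using *[of s] st by auto
 obtain J' L' where J': "has_bwd_integral M W B T t T G J'" and L': "has_fwd_integral M W B T t T z L'"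
  and eq': "AE w in M. set_integrable lborel {t..T} (\<lambda>r. F r w) \<and> y t w = \<zeta> w + (LINT r:{t..T}|lborel. F r w) + J' w - L' w"
  using *[of t] st by auto
 show thesis
 proof (rule that[of "\<lambda>w. J w - J' w" "\<lambda>w. L w - L' w"])
  show "bwd.ito s t (\<lambda>p. indicator {s<..t} (fst p) *\<^sub>R G (fst p) (snd p)) (\<lambda>w. J w - J' w)"
  proof (rule bwd.ito_increment)
   show "bwd.ito s T (\<lambda>p. indicator {s<..T} (fst p) *\<^sub>R G (fst p) (snd p)) J"
    using J st unfolding has_bwd_integral_def by (intro bwd.ito_of_has_ito_integral) auto
   show "bwd.ito t T (\<lambda>p. indicator {t<..T} (fst p) *\<^sub>R G (fst p) (snd p)) J'"
    using J' st unfolding has_bwd_integral_def by (intro bwd.ito_of_has_ito_integral) auto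
  qed (use st in auto)
  show "fwd.ito s t (\<lambda>p. indicator {s<..t} (fst p) *\<^sub>R z (fst p) (snd p)) (\<lambda>w. L w - L' w)"
  proof (rule fwd.ito_increment)
   show "fwd.ito s T (\<lambda>p. indicator {s<..T} (fst p) *\<^sub>R z (fst p) (snd p)) L"
    using L st unfolding has_fwd_integral_def by (intro fwd.ito_of_has_ito_integral) auto
   show "fwd.ito t T (\<lambda>p. indicator {t<..T} (fst p) *\<^sub>R z (fst p) (snd p)) L'"
    using L' st unfolding has_fwd_integral_def by (intro fwd.ito_of_has_ito_integral) auto
  qed (use st in auto)
  show "AE w in M. set_integrable lborel {s<..t} (\<lambda>r. F r w) \<and>
    y s w + (L w - L' w) = y t w + (J w - J' w) + (LINT r:{s<..t}|lborel. F r w)" using eq eq'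
  proof eventually_elim
   case (elim w)
   let ?f = "\<lambda>r. F r w"
   have i: "set_integrable lborel {s<..t} ?f" "set_integrable lborel {t<..T} ?f"
    using elim st by (auto intro: set_integrable_subset[where A="{s..T}"])
   have "{s<..T} = {s<..t} \<union> {t<..T}" using st by auto
   then have "(LINT r:{s<..T}|lborel. ?f r) = (LINT r:{s<..t}|lborel. ?f r) + (LINT r:{t<..T}|lborel. ?f r)"
    using set_integral_Un[OF _ i] by (simp add: Int_def)
   then show ?case using elim i by (simp add: set_integral_half_open)
  qed
 qed
qed

text \<open>As in \<open>sde_initial\<close>, the condition is read off the equation on a degenerate
  interval, here at \<open>T\<close>.\<close>

lemma terminal: "AE w in M. y T w = \<zeta> w"
proof -
 have "T \<in> {0..T}" using T_pos by auto
 then obtain J L where J: "has_bwd_integral M W B T T T G J" and L: "has_fwd_integral M W B T T T z L"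
  and eq: "AE w in M. set_integrable lborel {T..T} (\<lambda>r. F r w) \<and> y T w = \<zeta> w + (LINT r:{T..T}|lborel. F r w) + J w - L w"
  using sol unfolding bdsde_solution_def by blast
 have I: "bwd.ito T T (\<lambda>p. indicator {T<..T} (fst p) *\<^sub>R G (fst p) (snd p)) J"
   "fwd.ito T T (\<lambda>p. indicator {T<..T} (fst p) *\<^sub>R z (fst p) (snd p)) L"
  using J L T_pos unfolding has_fwd_integral_def has_bwd_integral_def
  by (intro bwd.ito_of_has_ito_integral fwd.ito_of_has_ito_integral; simp)+
 have [measurable]: "J \<in> bm M" "L \<in> bm M"
  using bwd.ito_measurable[OF I(1)] fwd.ito_measurable[OF I(2)] by auto
 have zero: "AE w in M. X w = 0" if X: "X \<in> bm M" "(\<E>\<^sup>+ w. ennreal ((X w)^2)) = 0" for X :: "'w => real"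
 proof -
  have "AE w in M. ennreal ((X w)^2) = 0" using X by (subst (asm) nn_integral_0_iff_AE) auto
  then show ?thesis by auto
 qed
 have "AE w in M. J w = 0" by (rule zero) (use bwd.ito_nn_isometry[OF I(1)] T_pos in simp_all)
 moreover have "AE w in M. L w = 0" by (rule zero) (use fwd.ito_nn_isometry[OF I(2)] T_pos in simp_all)
 moreover note eq
 ultimately show ?thesis
 proof eventually_elim
  case (elim w)
  then show ?case using set_integral_half_open[of T T "\<lambda>r. F r w"] by (simp add: set_lebesgue_integral_def)
 qed
qed

definition sq :: "(real => 'w => 'b::real_normed_vector) => real \<times> 'w => real" where
 "sq v p = indicator {0..T} (fst p) * (norm (v (fst p) (snd p)))^2"

lemma sq_nonneg [simp]: "0 <= sq v p" by (simp add: sq_def)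

lemma sq_measurable:
 fixes v :: "real => 'w => 'b::{real_normed_vector, second_countable_topology}"
 assumes "process M T v"
 shows "sq v \<in> bm PM"
proof -
 have "sq v = (\<lambda>p. (norm (indicator {0..T} (fst p) *\<^sub>R v (fst p) (snd p)))^2)"
  by (auto simp: sq_def fun_eq_iff indicator_def)
 then show ?thesis using measurable_compose[OF process_measurable[OF assms] borel_measurable_norm] by simp
qed

text \<open>An a priori bound of unknown size. Only its finiteness enters, so that suprema and
  integrals are finite before they are absorbed.\<close>

definition sup_const :: ennreal where "sup_const = (\<E>\<^sup>+ w. (SUP s\<in>{0..T}. ennreal (\<bar>y s w\<bar>^2)))"

lemma y_moment: "0 <= t \<Longrightarrow> t <= T \<Longrightarrow> (\<E>\<^sup>+ w. ennreal ((y t w)^2)) <= sup_const"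
 unfolding sup_const_def by (intro nn_integral_mono SUP_upper2[of t]) auto

lemma sup_const_finite: "sup_const < \<infinity>"
 using sol by (auto simp: sup_const_def bdsde_solution_def)

lemma y_square_integrable: "0 <= t \<Longrightarrow> t <= T \<Longrightarrow> integrable M (\<lambda>w. (y t w)^2)"
 using y_measurable(2)[of t] y_moment[of t] sup_const_finite by (intro integrableI_nonneg) (auto simp: le_less_trans)

lemma sq_integrable: "integrable PM (sq u)" "integrable PM (sq y)" "integrable PM (sq z)"
proof -
 have p: "process M T y" "process M T z" using sol by (auto simp: bdsde_solution_def)
 note [measurable] = sq_measurable[OF u_process] sq_measurable[OF p(1)] sq_measurable[OF p(2)]
 have "(\<integral>\<^sup>+p. ennreal (sq u p) \<partial>PM) < \<infinity>" using u_L2(1) by (simp add: sq_def)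
 then show "integrable PM (sq u)" by (intro integrableI_nonneg) auto
 have "(\<integral>\<^sup>+p. ennreal (sq y p) \<partial>PM) = (\<integral>\<^sup>+p. ennreal (sq y p) * indicator {0..T} (fst p) \<partial>PM)"
  by (intro nn_integral_cong) (auto simp: sq_def indicator_def)
 also have "... <= sup_const * emeasure lborel {0..T}"
  by (rule strip_integral_le) (simp_all add: sq_def[of _ "(_, _)"] y_moment)
 also have "... < \<infinity>" using sup_const_finite T_pos by (simp add: ennreal_mult_less_top)
 finally show "integrable PM (sq y)" by (intro integrableI_nonneg) auto
 have "(\<integral>\<^sup>+p. ennreal (sq z p) \<partial>PM) = (\<E>\<^sup>+ w. (\<integral>\<^sup>+r. ennreal (sq z (r, w)) \<partial>lborel))"
  by (rule fwd.pair.nn_integral_snd[symmetric]) simp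
 also have "... = (\<E>\<^sup>+ w. (\<integral>\<^sup>+r\<in>{0..T}. ennreal ((norm (z r w))^2) \<partial>lborel))"
  by (intro nn_integral_cong) (auto simp: sq_def indicator_def)
 also have "... < \<infinity>" using sol by (auto simp: bdsde_solution_def)
 finally show "integrable PM (sq z)" by (intro integrableI_nonneg) auto
qed

text \<open>Bounded, because \<open>y\<close> and the stochastic integrals have second moments only;
  unbounded weights are reached by truncation.\<close>

definition wt :: "('w => real) => real => bool" where
 "wt d R \<longleftrightarrow> d \<in> bm M \<and> (\<forall>w. 0 <= d w \<and> d w <= R)"

text \<open>A real number rather than an extended one, because the energy of \<open>z\<close> on the
  right has to be subtracted from that on the left.\<close>

definition energy :: "('w => real) => (real \<times> 'w => real) => real => real => real" where
 "energy d f s t = (\<integral>p. indicator {s<..t} (fst p) * (d (snd p) * f p) \<partial>PM)"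

lemma energy_integrable:
 assumes w: "wt d R" and f: "integrable PM f"
 shows "integrable PM (\<lambda>p. indicator {s<..t} (fst p) * (d (snd p) * f p))"
proof -
 have [measurable]: "d \<in> bm M" "f \<in> bm PM" using w f by (auto simp: wt_def)
 have "integrable PM (\<lambda>p. R * f p)" using f by simp
 then show ?thesis
 proof (rule Bochner_Integration.integrable_bound)
  show "AE p in PM. norm (indicator {s<..t} (fst p) * (d (snd p) * f p)) <= norm (R * f p)"
  proof (rule AE_I2)
   fix p :: "real \<times> 'w"
   have "0 <= d (snd p)" "d (snd p) <= R" using w by (auto simp: wt_def)
   then have "\<bar>d (snd p)\<bar> * \<bar>f p\<bar> <= \<bar>R\<bar> * \<bar>f p\<bar>" by (intro mult_right_mono) auto
   then show "norm (indicator {s<..t} (fst p) * (d (snd p) * f p)) <= norm (R * f p)"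
    by (auto simp: abs_mult indicator_def)
  qed
 qed simp
qed

lemma energy_nonneg:
 assumes "wt d R" "\<And>p. 0 <= f p"
 shows "0 <= energy d f s t" unfolding energy_def using assms(1)
 by (intro integral_nonneg_AE AE_I2 mult_nonneg_nonneg assms(2)) (auto simp: wt_def)

lemma energy_mono:
 assumes "wt d R" "wt d' R'" "integrable PM f" "\<And>p. 0 <= f p" "\<And>w. w \<in> space M \<Longrightarrow> d w <= d' w" "s' <= s" "t <= t'"
 shows "energy d f s t <= energy d' f s' t'" unfolding energy_def
proof (rule integral_mono[OF energy_integrable[OF assms(1,3)] energy_integrable[OF assms(2,3)]])
 fix p assume p: "p \<in> space PM"
 then have "d (snd p) * f p <= d' (snd p) * f p" "0 <= d (snd p) * f p"
  using assms(1) by (auto intro!: mult_right_mono assms(4,5) mult_nonneg_nonneg simp: space_pair_measure wt_def)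
 then show "indicator {s<..t} (fst p) * (d (snd p) * f p) <= indicator {s'<..t'} (fst p) * (d' (snd p) * f p)"
  using assms(6,7) by (auto simp: indicator_def)
qed

lemma energy_add:
 assumes "wt d R" "integrable PM f" "integrable PM g"
 shows "energy d (\<lambda>p. f p + g p) s t = energy d f s t + energy d g s t"
 unfolding energy_def distrib_left using assms by (intro Bochner_Integration.integral_add energy_integrable)

lemma energy_cmult: "energy d (\<lambda>p. c * f p) s t = c * energy d f s t"
 unfolding energy_def by (subst integral_mult_right_zero[symmetric]) (simp add: ac_simps)

lemma energy_join:
 assumes "wt d R" "integrable PM f" "s <= r" "r <= t"
 shows "energy d f s t = energy d f s r + energy d f r t"
proof -
 have "indicator {s<..t} q = indicator {s<..r} q + (indicator {r<..t} q :: real)" for q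
  using assms by (auto simp: indicator_def)
 then show ?thesis unfolding energy_def
  using Bochner_Integration.integral_add[OF energy_integrable[OF assms(1,2)] energy_integrable[OF assms(1,2)]]
  by (simp add: distrib_right)
qed

lemma nn_energy:
 assumes "wt d R" "integrable PM f" "\<And>p. 0 <= f p"
 shows "ennreal (energy d f s t) = (\<integral>\<^sup>+p. ennreal (indicator {s<..t} (fst p) * (d (snd p) * f p)) \<partial>PM)"
 unfolding energy_def
 by (rule nn_integral_eq_integral[symmetric, OF energy_integrable[OF assms(1,2)]]) (use assms in \<open>auto simp: wt_def\<close>)

end

section \<open>Weighted energy estimates over one step\<close>

context linear_bdsde
begin

lemma wt_integrable: "wt d R \<Longrightarrow> integrable M f \<Longrightarrow> integrable M (\<lambda>w. d w * f w)"
 by (rule integrable_bounded_times[of _ _ _ R]) (auto simp: wt_def)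

lemma energy_data_bound:
 assumes w: "wt d R" and st: "0 <= s" "s <= t" "t <= T"
 shows "(\<integral>p. d (snd p) * (norm (indicator {s<..t} (fst p) *\<^sub>R z (fst p) (snd p)))^2 \<partial>PM) = energy d (sq z) s t"
  and "(\<integral>p. d (snd p) * (norm (indicator {s<..t} (fst p) *\<^sub>R G (fst p) (snd p)))^2 \<partial>PM) \<le>
   c\<^sub>G * (energy d (sq u) s t + energy d (sq y) s t) + \<alpha> * energy d (sq z) s t"
proof -
 show "(\<integral>p. d (snd p) * (norm (indicator {s<..t} (fst p) *\<^sub>R z (fst p) (snd p)))^2 \<partial>PM) = energy d (sq z) s t"
  unfolding energy_def by (rule arg_cong[where f="lebesgue_integral PM"]) (use st in \<open>auto simp: sq_def indicator_def fun_eq_iff\<close>)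
 let ?f = "\<lambda>p. c\<^sub>G * (sq u p + sq y p) + \<alpha> * sq z p"
 have i: "integrable PM ?f" using sq_integrable by simp
 have "(\<integral>p. d (snd p) * (norm (indicator {s<..t} (fst p) *\<^sub>R G (fst p) (snd p)))^2 \<partial>PM) <= energy d ?f s t"
  unfolding energy_def
 proof (rule integral_mono')
  fix p :: "real \<times> 'w" assume p: "p \<in> space PM"
  have d: "0 <= d (snd p)" using w by (simp add: wt_def)
  show "d (snd p) * (norm (indicator {s<..t} (fst p) *\<^sub>R G (fst p) (snd p)))^2 <= indicator {s<..t} (fst p) * (d (snd p) * ?f p)"
  proof (cases "fst p \<in> {s<..t}")
   case True
   then have "(G (fst p) (snd p))^2 <= ?f p"
    using G_bound[of "snd p" "fst p"] p st by (auto simp: sq_def space_pair_measure)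
   then show ?thesis using True mult_left_mono[OF _ d] by simp
  qed simp
  show "0 <= indicator {s<..t} (fst p) * (d (snd p) * ?f p)" using d c_nonneg by auto
 qed (rule energy_integrable[OF w i])
 also have "... = c\<^sub>G * (energy d (sq u) s t + energy d (sq y) s t) + \<alpha> * energy d (sq z) s t"
  using sq_integrable by (simp add: energy_add[OF w] energy_cmult)
 finally show "(\<integral>p. d (snd p) * (norm (indicator {s<..t} (fst p) *\<^sub>R G (fst p) (snd p)))^2 \<partial>PM) \<le>
   c\<^sub>G * (energy d (sq u) s t + energy d (sq y) s t) + \<alpha> * energy d (sq z) s t" .
qed

lemma drift_bound:
 assumes w: "wt d R" and st: "0 <= s" "s <= t" "t <= T"
  and V: "V \<in> bm M"
   "AE w in M. set_integrable lborel {s<..t} (\<lambda>r. F r w) \<and> V w = (LINT r:{s<..t}|lborel. F r w)"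
 shows "(\<E>\<^sup>+ w. ennreal (d w * (V w)^2)) \<le>
  ennreal ((t - s) * c\<^sub>F * (energy d (sq u) s t + energy d (sq y) s t + energy d (sq z) s t))"
proof -
 define f where "f p = sq u p + sq y p + sq z p" for p
 have i: "integrable PM f" using sq_integrable by (simp add: f_def[abs_def])
 have f0: "0 <= f p" for p by (simp add: f_def)
 have d: "0 <= d w" for w using w by (simp add: wt_def)
 have [measurable]: "d \<in> bm M" "f \<in> bm PM" using w i by (auto simp: wt_def)
 have "AE w in M. ennreal (d w * (V w)^2) \<le>
   ennreal ((t - s) * c\<^sub>F) * (\<integral>\<^sup>+r. ennreal (indicator {s<..t} r * (d w * f (r, w))) \<partial>lborel)"
  using V(2) AE_space
 proof eventually_elim
  case (elim w)
  have m: "(\<lambda>r. f (r, w)) \<in> bm lborel"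
   by (rule measurable_compose[OF measurable_Pair2']) (use elim in auto)
  have "ennreal (d w * (V w)^2) = ennreal (d w) * ennreal ((V w)^2)" using d by (simp add: ennreal_mult)
  also have "... <= ennreal (d w) * (ennreal (t - s) * (\<integral>\<^sup>+r\<in>{s<..t}. ennreal ((F r w)^2) \<partial>lborel))"
   using elim set_integral_square_le[of s t "\<lambda>r. F r w"] st by (intro mult_left_mono) auto
  also have "(\<integral>\<^sup>+r\<in>{s<..t}. ennreal ((F r w)^2) \<partial>lborel) <= (\<integral>\<^sup>+r. ennreal c\<^sub>F * ennreal (indicator {s<..t} r * f (r, w)) \<partial>lborel)"
  proof (rule nn_integral_mono)
   fix r
   show "ennreal ((F r w)^2) * indicator {s<..t} r <= ennreal c\<^sub>F * ennreal (indicator {s<..t} r * f (r, w))"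
   proof (cases "r \<in> {s<..t}")
    case True
    then have "(F r w)^2 <= c\<^sub>F * f (r, w)" using F_bound[of w r] elim st by (simp add: f_def sq_def)
    then show ?thesis using True c_nonneg(2) f0[of "(r, w)"] by (simp add: ennreal_mult[symmetric] ennreal_leI)
   qed simp
  qed
  also have "ennreal (d w) * (ennreal (t - s) * (\<integral>\<^sup>+r. ennreal c\<^sub>F * ennreal (indicator {s<..t} r * f (r, w)) \<partial>lborel)) =
    ennreal ((t - s) * c\<^sub>F) * (ennreal (d w) * (\<integral>\<^sup>+r. ennreal (indicator {s<..t} r * f (r, w)) \<partial>lborel))"
   using m c_nonneg st by (subst nn_integral_cmult) (auto simp: ennreal_mult ac_simps)
  also have "ennreal (d w) * (\<integral>\<^sup>+r. ennreal (indicator {s<..t} r * f (r, w)) \<partial>lborel) =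
    (\<integral>\<^sup>+r. ennreal (d w) * ennreal (indicator {s<..t} r * f (r, w)) \<partial>lborel)"
   using m by (subst nn_integral_cmult) auto
  also have "... = (\<integral>\<^sup>+r. ennreal (indicator {s<..t} r * (d w * f (r, w))) \<partial>lborel)"
   using d f0 by (intro nn_integral_cong, subst ennreal_mult[symmetric]) (auto simp: ac_simps)
  finally show ?case by (simp add: mult_left_mono)
 qed
 then have "(\<E>\<^sup>+ w. ennreal (d w * (V w)^2)) \<le>
   (\<E>\<^sup>+ w. ennreal ((t - s) * c\<^sub>F) * (\<integral>\<^sup>+r. ennreal (indicator {s<..t} r * (d w * f (r, w))) \<partial>lborel))"
  by (rule nn_integral_mono_AE)
 also have "... = ennreal ((t - s) * c\<^sub>F) * (\<E>\<^sup>+ w. (\<integral>\<^sup>+r. ennreal (indicator {s<..t} r * (d w * f (r, w))) \<partial>lborel))"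
  by (rule nn_integral_cmult) measurable
 also have "(\<E>\<^sup>+ w. (\<integral>\<^sup>+r. ennreal (indicator {s<..t} r * (d w * f (r, w))) \<partial>lborel)) =
   (\<integral>\<^sup>+p. ennreal (indicator {s<..t} (fst p) * (d (snd p) * f p)) \<partial>PM)"
  by (subst fwd.pair.nn_integral_snd[symmetric]) simp_all
 also have "... = ennreal (energy d f s t)" by (rule nn_energy[OF w i f0, symmetric])
 also have "energy d f s t = energy d (sq u) s t + energy d (sq y) s t + energy d (sq z) s t"
  using sq_integrable unfolding f_def[abs_def] by (simp add: energy_add[OF w])
 also have "ennreal ((t - s) * c\<^sub>F) * ennreal (energy d (sq u) s t + energy d (sq y) s t + energy d (sq z) s t) =
   ennreal ((t - s) * c\<^sub>F * (energy d (sq u) s t + energy d (sq y) s t + energy d (sq z) s t))"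
  using st c_nonneg energy_nonneg[OF w] by (subst ennreal_mult[symmetric]) (auto intro!: mult_nonneg_nonneg add_nonneg_nonneg)
 finally show ?thesis .
qed

text \<open>A bounded variable known from \<open>W\<close> up to \<open>s\<close> is a
  \<open>weight\<close> on \<open>[s, t]\<close> in both directions. So \<open>d w * y s w\<close>
  may be paired with the forward integral and \<open>d w * y t w\<close> with the backward one, and
  both isometries hold under \<open>d\<close>. \<open>V\<close> is defined as the difference of the
  two sides, which makes the identity hold everywhere and not only almost surely.\<close>

lemma energy_terms:
 assumes w: "wt d R" "d \<in> bm (\<F> s T)" and st: "0 <= s" "s <= t" "t <= T"
 shows "\<exists>J L V. integrable M (\<lambda>w. (J w)^2) \<and> integrable M (\<lambda>w. (L w)^2) \<and> integrable M (\<lambda>w. (V w)^2) \<and>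
  J \<in> bm M \<and> L \<in> bm M \<and> V \<in> bm M \<and>
  (\<forall>w. y s w + L w = (y t w + J w) + V w) \<and>
  (\<E> w. d w * (L w)^2) = energy d (sq z) s t \<and>
  (\<E> w. d w * (J w)^2) <= c\<^sub>G * (energy d (sq u) s t + energy d (sq y) s t) + \<alpha> * energy d (sq z) s t \<and>
  (\<E> w. d w * (V w)^2) <= (t - s) * c\<^sub>F * (energy d (sq u) s t + energy d (sq y) s t + energy d (sq z) s t) \<and>
  (\<E> w. d w * (y s w + L w)^2) = (\<E> w. d w * (y s w)^2) + (\<E> w. d w * (L w)^2) \<and>
  (\<E> w. d w * (y t w + J w)^2) = (\<E> w. d w * (y t w)^2) + (\<E> w. d w * (J w)^2)"
proof -
 obtain J L where J: "bwd.ito s t (\<lambda>p. indicator {s<..t} (fst p) *\<^sub>R G (fst p) (snd p)) J"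
  and L: "fwd.ito s t (\<lambda>p. indicator {s<..t} (fst p) *\<^sub>R z (fst p) (snd p)) L"
  and eq: "AE w in M. set_integrable lborel {s<..t} (\<lambda>r. F r w) \<and> y s w + L w = y t w + J w + (LINT r:{s<..t}|lborel. F r w)"
  by (rule increment[OF st])
 have st': "0 <= t" "s <= T" using st by auto
 define V where "V w = y s w + L w - (y t w + J w)" for w
 note y = y_measurable(2)[OF st(1) st'(2)] y_measurable(2)[OF st'(1) st(3)]
  y_square_integrable[OF st(1) st'(2)] y_square_integrable[OF st'(1) st(3)]
 have Jm [measurable]: "J \<in> bm M" and Lm [measurable]: "L \<in> bm M"
  using bwd.ito_measurable[OF J] fwd.ito_measurable[OF L] by auto
 have [measurable]: "y s \<in> bm M" "y t \<in> bm M" "V \<in> bm M" "d \<in> bm M"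
  using y w unfolding V_def[abs_def] wt_def by auto
 have J2: "integrable M (\<lambda>w. (J w)^2)" by (rule bwd.ito_square_integrable[OF J st])
 have L2: "integrable M (\<lambda>w. (L w)^2)" by (rule fwd.ito_square_integrable[OF L st])
 have yL2: "integrable M (\<lambda>w. (y s w + L w)^2)" and yJ2: "integrable M (\<lambda>w. (y t w + J w)^2)"
  using square_integrable_add[of "y s" M L] square_integrable_add[of "y t" M J] y J2 L2 by auto
 have V2: "integrable M (\<lambda>w. (V w)^2)"
  unfolding V_def using square_integrable_diff[of "\<lambda>w. y s w + L w" M "\<lambda>w. y t w + J w"] yL2 yJ2 y by auto
 have wf: "fwd.weight s t d" "bwd.weight s t d"
  unfolding fwd.weight_def bwd.weight_def using st T_pos by (auto intro!: measurable_info_mono[OF w(2)])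
 have bd: "bounded (d ` space M)" using w(1) by (auto simp: wt_def bounded_iff intro!: exI[of _ R])
 have wyf: "fwd.weight s t (\<lambda>w. d w * y s w)" unfolding fwd.weight_def
 proof (intro allI impI)
  fix a c assume ac: "s <= a" "a <= c" "c <= t"
  have "d \<in> bm (\<F> a 0)" using wf(1) ac by (auto simp: fwd.weight_def)
  moreover have "y s \<in> bm (\<F> a 0)"
   using ac st by (intro measurable_info_mono[OF y_measurable(1)[OF st(1) st'(2)]]) auto
  ultimately show "(\<lambda>w. d w * y s w) \<in> bm (\<F> a 0)" by (rule borel_measurable_times)
 qed
 have wyb: "bwd.weight s t (\<lambda>w. d w * y t w)" unfolding bwd.weight_def
 proof (intro allI impI)
  fix a c assume ac: "s <= a" "a <= c" "c <= t"
  have "d \<in> bm (\<F> T c)" using wf(2) ac by (auto simp: bwd.weight_def)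
  moreover have "y t \<in> bm (\<F> T c)"
   using ac st by (intro measurable_info_mono[OF y_measurable(1)[OF st'(1) st(3)]]) auto
  ultimately show "(\<lambda>w. d w * y t w) \<in> bm (\<F> T c)" by (rule borel_measurable_times)
 qed
 have wy2: "integrable M (\<lambda>w. (d w * v w)^2)" if "integrable M (\<lambda>w. (v w)^2)" for v
  unfolding power_mult_distrib
  by (rule integrable_bounded_times[of _ _ _ "R^2", OF _ that]) (use w(1) in \<open>auto simp: wt_def intro!: power_mono\<close>)
 note orth = fwd.ito_orthogonal[OF L st wyf wy2[OF y(3)]] bwd.ito_orthogonal[OF J st wyb wy2[OF y(4)]]
 have exp: "(\<E> w. d w * (v w + X w)^2) = (\<E> w. d w * (v w)^2) + (\<E> w. d w * (X w)^2)"
  if "integrable M (\<lambda>w. (v w)^2)" "integrable M (\<lambda>w. (X w)^2)" "(\<E> w. d w * v w * X w) = 0"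
   "integrable M (\<lambda>w. d w * v w * X w)" for v X
 proof -
  have "d w * (v w + X w)^2 = d w * (v w)^2 + d w * (X w)^2 + 2 * (d w * v w * X w)" for w
   by (simp add: power2_sum algebra_simps)
  then show ?thesis using wt_integrable[OF w(1)] that by simp
 qed
 have "(\<E> w. d w * (L w)^2) = energy d (sq z) s t"
  using fwd.ito_isometry[OF L st wf(1) bd] energy_data_bound(1)[OF w(1) st] by simp
 moreover have "(\<E> w. d w * (J w)^2) <= c\<^sub>G * (energy d (sq u) s t + energy d (sq y) s t) + \<alpha> * energy d (sq z) s t"
  using bwd.ito_isometry[OF J st wf(2) bd] energy_data_bound(2)[OF w(1) st] by simp
 moreover have "(\<E> w. d w * (V w)^2) <= (t - s) * c\<^sub>F * (energy d (sq u) s t + energy d (sq y) s t + energy d (sq z) s t)"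
 proof -
  have "ennreal (\<E> w. d w * (V w)^2) = (\<E>\<^sup>+ w. ennreal (d w * (V w)^2))"
   by (rule nn_integral_eq_integral[symmetric, OF wt_integrable[OF w(1) V2]]) (use w(1) in \<open>auto simp: wt_def\<close>)
  also have "... <= ennreal ((t - s) * c\<^sub>F * (energy d (sq u) s t + energy d (sq y) s t + energy d (sq z) s t))"
   by (rule drift_bound[OF w(1) st]) (use eq in \<open>auto simp: V_def\<close>)
  finally show ?thesis
   by (subst (asm) ennreal_le_iff) (use st c_nonneg energy_nonneg[OF w(1)] in \<open>auto intro!: mult_nonneg_nonneg add_nonneg_nonneg\<close>)
 qed
 moreover have "(\<E> w. d w * (y s w + L w)^2) = (\<E> w. d w * (y s w)^2) + (\<E> w. d w * (L w)^2)"
  by (rule exp) (use y L2 orth in auto)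
 moreover have "(\<E> w. d w * (y t w + J w)^2) = (\<E> w. d w * (y t w)^2) + (\<E> w. d w * (J w)^2)"
  by (rule exp) (use y J2 orth in auto)
 moreover have "\<forall>w. y s w + L w = (y t w + J w) + V w" by (simp add: V_def)
 ultimately show ?thesis using J2 L2 V2 Jm Lm by (intro exI[of _ J] exI[of _ L] exI[of _ V]) simp
qed

text \<open>Chosen so that the contributions of \<open>z\<close> on the right side of the energy
  balance sum to at most \<open>1 - (1 - \<alpha>) / 2\<close>: \<open>rate\<close> makes
  \<open>c\<^sub>F / rate\<close> small, and \<open>max_step\<close> makes the products of
  \<open>rate\<close>, \<open>c\<^sub>F\<close> and \<open>growth\<close> with a step small.\<close>

definition rate :: real where "rate = 8 * c\<^sub>F / (1 - \<alpha>) + 1"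
definition growth :: real where "growth = 2 * c\<^sub>G + 1"
definition max_step :: real where "max_step = (1 - \<alpha>) / (8 * (rate + c\<^sub>F + growth))"

lemma rates: "1 <= rate" "1 <= growth" "0 < max_step" "rate * max_step <= (1 - \<alpha>) / 8" "c\<^sub>F * max_step <= (1 - \<alpha>) / 8"
 "growth * max_step <= 1 / 8" "c\<^sub>F / rate <= (1 - \<alpha>) / 8"
proof -
 show r: "1 <= rate" "1 <= growth" using c_nonneg by (auto simp: rate_def growth_def)
 then have D: "0 < rate + c\<^sub>F + growth" using c_nonneg by simp
 then show "0 < max_step" using c_nonneg by (simp add: max_step_def)
 have m: "v * max_step <= (1 - \<alpha>) / 8" if "0 <= v" "v <= rate + c\<^sub>F + growth" for v
 proof -
  have "v * max_step <= (rate + c\<^sub>F + growth) * max_step" using that \<open>0 < max_step\<close> by (intro mult_right_mono) auto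
  also have "(rate + c\<^sub>F + growth) * max_step = (1 - \<alpha>) / 8"
  proof -
   have "d * ((1 - \<alpha>) / (8 * d)) = (1 - \<alpha>) / 8" if "0 < d" for d using that by simp
   from this[OF D] show ?thesis by (simp only: max_step_def)
  qed
  finally show ?thesis .
 qed
 show "rate * max_step <= (1 - \<alpha>) / 8" "c\<^sub>F * max_step <= (1 - \<alpha>) / 8" using m[of rate] m[of "c\<^sub>F"] r c_nonneg by auto
 show "growth * max_step <= 1 / 8" using m[of growth] r c_nonneg by auto
 have "rate * (1 - \<alpha>) = 8 * c\<^sub>F + (1 - \<alpha>)" using c_nonneg by (simp add: rate_def distrib_right)
 then have "8 * c\<^sub>F <= rate * (1 - \<alpha>)" using c_nonneg by simp
 then show "c\<^sub>F / rate <= (1 - \<alpha>) / 8" using r by (simp add: field_simps)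
qed

text \<open>Squaring \<open>y s + L = (y t + J) + V\<close> under \<open>d\<close>, the left side
  contains the full energy of \<open>z\<close>. The backward integral returns the part
  \<open>(1 + \<delta>) \<alpha>\<close> of it, and the drift, split off with
  \<open>\<delta> = rate h\<close>, returns \<open>c\<^sub>F h + c\<^sub>F / rate\<close>. Half of
  the gap \<open>1 - \<alpha>\<close> is left over.\<close>

lemma energy_inequality:
 assumes w: "wt d R" "d \<in> bm (\<F> s T)" and st: "0 <= s" "s <= t" "t <= T" "t - s <= max_step"
 shows "(\<E> w. d w * (y s w)^2) + (1 - \<alpha>) / 2 * energy d (sq z) s t \<le>
  (1 + rate * (t - s)) * (\<E> w. d w * (y t w)^2) + growth * (energy d (sq u) s t + energy d (sq y) s t)"
proof (cases "s = t")
 case True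
 then show ?thesis by (simp add: energy_def)
next
 case False
 define h where "h = t - s"
 have h: "0 < h" "h <= max_step" using False st by (auto simp: h_def)
 obtain J L V where i: "integrable M (\<lambda>w. (J w)^2)" "integrable M (\<lambda>w. (L w)^2)" "integrable M (\<lambda>w. (V w)^2)"
  and m: "J \<in> bm M" "L \<in> bm M" "V \<in> bm M"
  and eq: "\<And>w. y s w + L w = (y t w + J w) + V w"
  and b: "(\<E> w. d w * (L w)^2) = energy d (sq z) s t"
   "(\<E> w. d w * (J w)^2) <= c\<^sub>G * (energy d (sq u) s t + energy d (sq y) s t) + \<alpha> * energy d (sq z) s t"
   "(\<E> w. d w * (V w)^2) <= h * c\<^sub>F * (energy d (sq u) s t + energy d (sq y) s t + energy d (sq z) s t)"
  and o: "(\<E> w. d w * (y s w + L w)^2) = (\<E> w. d w * (y s w)^2) + (\<E> w. d w * (L w)^2)"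
   "(\<E> w. d w * (y t w + J w)^2) = (\<E> w. d w * (y t w)^2) + (\<E> w. d w * (J w)^2)"
  using energy_terms[OF w st(1-3)] unfolding h_def by blast
 let ?E = "energy d (sq u) s t + energy d (sq y) s t" and ?Z = "energy d (sq z) s t"
 have E: "0 <= ?E" "0 <= ?Z" using energy_nonneg[OF w(1)] by auto
 define \<delta> where "\<delta> = rate * h"
 define q where "q = (1 + 1 / \<delta>) * (h * c\<^sub>F)"
 have \<delta>: "0 < \<delta>" using rates h by (simp add: \<delta>_def)
 have st': "0 <= t" "s <= T" using st by auto
 note y = y_measurable(2)[OF st(1) st'(2)] y_measurable(2)[OF st'(1) st(3)]
  y_square_integrable[OF st(1) st'(2)] y_square_integrable[OF st'(1) st(3)]
 have yJ2: "integrable M (\<lambda>w. (y t w + J w)^2)" using square_integrable_add[of "y t" M J] y i m by auto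
 have yL2: "integrable M (\<lambda>w. (y s w + L w)^2)" using square_integrable_add[of "y s" M L] y i m by auto
 have "(\<E> w. d w * (y s w + L w)^2) <= (\<E> w. (1 + \<delta>) * (d w * (y t w + J w)^2) + (1 + 1 / \<delta>) * (d w * (V w)^2))"
 proof (rule integral_mono)
  fix w
  have "0 <= d w" using w by (simp add: wt_def)
  from mult_left_mono[OF square_sum_weighted_le[OF \<delta>, of "y t w + J w" "V w"] this]
  show "d w * (y s w + L w)^2 <= (1 + \<delta>) * (d w * (y t w + J w)^2) + (1 + 1 / \<delta>) * (d w * (V w)^2)"
   unfolding eq by (simp add: algebra_simps)
 qed (use wt_integrable[OF w(1)] yJ2 yL2 i in auto)
 also have "... = (1 + \<delta>) * (\<E> w. d w * (y t w + J w)^2) + (1 + 1 / \<delta>) * (\<E> w. d w * (V w)^2)"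
  using wt_integrable[OF w(1)] yJ2 i by simp
 also have "... <= (1 + \<delta>) * ((\<E> w. d w * (y t w)^2) + (c\<^sub>G * ?E + \<alpha> * ?Z)) + (1 + 1 / \<delta>) * (h * c\<^sub>F * (?E + ?Z))"
  unfolding o using b \<delta> by (intro add_mono mult_left_mono) auto
 also have "(1 + 1 / \<delta>) * (h * c\<^sub>F * (?E + ?Z)) = q * (?E + ?Z)" by (simp add: q_def)
 finally have main: "(\<E> w. d w * (y s w)^2) + ?Z \<le>
   (1 + \<delta>) * (\<E> w. d w * (y t w)^2) + ((1 + \<delta>) * c\<^sub>G + q) * ?E + ((1 + \<delta>) * \<alpha> + q) * ?Z"
  unfolding o b by (simp add: algebra_simps)
 have \<delta>8: "\<delta> <= (1 - \<alpha>) / 8" 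
 proof -
  have "rate * h <= rate * max_step" using h rates(1) by (intro mult_left_mono) auto
  then show ?thesis using rates(4) by (simp only: \<delta>_def)
 qed
 have hF: "q <= (1 - \<alpha>) / 4"
 proof -
  have "q = c\<^sub>F * h + c\<^sub>F / rate" using h rates by (simp add: q_def \<delta>_def field_simps)
  also have "c\<^sub>F * h <= c\<^sub>F * max_step" using h c_nonneg by (intro mult_left_mono) auto
  finally show ?thesis using rates(5,7) by linarith
 qed
 have "\<delta> * c\<^sub>G <= 1 * c\<^sub>G" using \<delta>8 c_nonneg by (intro mult_right_mono) auto
 then have 1: "(1 + \<delta>) * c\<^sub>G + q <= growth" using hF c_nonneg by (simp add: growth_def algebra_simps)
 have "\<delta> * \<alpha> <= \<delta>" using mult_left_mono[of \<alpha> 1 \<delta>] \<delta> c_nonneg by simp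
 moreover have "(1 + \<delta>) * \<alpha> = \<alpha> + \<delta> * \<alpha>" by (simp add: distrib_right)
 moreover have "1 - (1 - \<alpha>) / 2 = \<alpha> + (1 - \<alpha>) / 2" by (simp add: field_simps)
 ultimately have 2: "(1 + \<delta>) * \<alpha> + q <= 1 - (1 - \<alpha>) / 2" using hF \<delta>8 c_nonneg(5) by argo
 have "(\<E> w. d w * (y s w)^2) + ?Z <= (1 + \<delta>) * (\<E> w. d w * (y t w)^2) + growth * ?E + (1 - (1 - \<alpha>) / 2) * ?Z"
  using main mult_right_mono[OF 1 E(1)] mult_right_mono[OF 2 E(2)] by linarith
 then show ?thesis by (simp add: \<delta>_def h_def algebra_simps)
qed

lemma increment_inequality:
 assumes w: "wt d R" "d \<in> bm (\<F> s T)" and st: "0 <= s" "s <= t" "t <= T"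
 shows "(\<E> w. d w * (y t w - y s w)^2) \<le>
  4 * (2 + c\<^sub>G + T * c\<^sub>F) * (energy d (sq u) s t + energy d (sq y) s t + energy d (sq z) s t)"
proof -
 obtain J L V where i: "integrable M (\<lambda>w. (J w)^2)" "integrable M (\<lambda>w. (L w)^2)" "integrable M (\<lambda>w. (V w)^2)"
  and m: "J \<in> bm M" "L \<in> bm M" "V \<in> bm M"
  and eq: "\<And>w. y s w + L w = (y t w + J w) + V w"
  and b: "(\<E> w. d w * (L w)^2) = energy d (sq z) s t"
   "(\<E> w. d w * (J w)^2) <= c\<^sub>G * (energy d (sq u) s t + energy d (sq y) s t) + \<alpha> * energy d (sq z) s t"
   "(\<E> w. d w * (V w)^2) <= (t - s) * c\<^sub>F * (energy d (sq u) s t + energy d (sq y) s t + energy d (sq z) s t)"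
  using energy_terms[OF w st] by blast
 let ?U = "energy d (sq u) s t" and ?Y = "energy d (sq y) s t" and ?Z = "energy d (sq z) s t"
 have E: "0 <= ?U" "0 <= ?Y" "0 <= ?Z" using energy_nonneg[OF w(1)] by auto
 have "(\<E> w. d w * (y t w - y s w)^2) <= (\<E> w. 4 * (d w * (L w)^2) + 4 * (d w * (J w)^2) + 4 * (d w * (V w)^2))"
 proof (rule integral_mono')
  fix w
  have d: "0 <= d w" using w by (simp add: wt_def)
  have "(y t w - y s w)^2 = (L w + ((- J w) + (- V w)))^2" using eq[of w] by (intro arg_cong[where f="\<lambda>a. a^2"]) simp
  also have "... <= 2 * (L w)^2 + 2 * (2 * (- J w)^2 + 2 * (- V w)^2)"
   by (intro order_trans[OF square_add_le] add_left_mono mult_left_mono square_add_le) auto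
  also have "... <= 4 * (L w)^2 + 4 * (J w)^2 + 4 * (V w)^2" by simp
  finally show "d w * (y t w - y s w)^2 <= 4 * (d w * (L w)^2) + 4 * (d w * (J w)^2) + 4 * (d w * (V w)^2)"
   using mult_left_mono[OF _ d] by (fastforce simp: algebra_simps)
  show "0 <= 4 * (d w * (L w)^2) + 4 * (d w * (J w)^2) + 4 * (d w * (V w)^2)" using d by simp
 qed (use wt_integrable[OF w(1)] i in auto)
 also have "... = 4 * (\<E> w. d w * (L w)^2) + 4 * (\<E> w. d w * (J w)^2) + 4 * (\<E> w. d w * (V w)^2)"
  using wt_integrable[OF w(1)] i by simp
 also have "... <= 4 * ?Z + 4 * (c\<^sub>G * (?U + ?Y + ?Z) + (?U + ?Y + ?Z)) + 4 * (T * c\<^sub>F * (?U + ?Y + ?Z))"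
 proof (intro add_mono mult_left_mono)
  have "\<alpha> * ?Z <= 1 * ?Z" using c_nonneg E by (intro mult_right_mono) auto
  then show "(\<E> w. d w * (J w)^2) <= c\<^sub>G * (?U + ?Y + ?Z) + (?U + ?Y + ?Z)"
   using b(2) E mult_nonneg_nonneg[OF c_nonneg(3) E(3)] by (simp add: distrib_left)
  show "(\<E> w. d w * (V w)^2) <= T * c\<^sub>F * (?U + ?Y + ?Z)"
   by (rule order_trans[OF b(3)], intro mult_right_mono) (use st c_nonneg E in auto)
 qed (use b in auto)
 also have "... <= 4 * (2 + c\<^sub>G + T * c\<^sub>F) * (?U + ?Y + ?Z)" using E by (simp add: algebra_simps)
 finally show ?thesis .
qed

end

lemma nn_integral_truncation:
 fixes d g :: "'a => real"
 assumes [measurable]: "d \<in> bm N" "g \<in> bm N" and nn: "\<And>x. 0 <= d x" "\<And>x. 0 <= g x"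
 shows "(\<lambda>k. \<integral>\<^sup>+x. ennreal (min (d x) (real k) * g x) \<partial>N) \<longlonglongrightarrow> (\<integral>\<^sup>+x. ennreal (d x * g x) \<partial>N)"
proof (rule nn_integral_LIMSEQ)
 show "incseq (\<lambda>k x. ennreal (min (d x) (real k) * g x))"
  by (intro incseq_SucI le_funI ennreal_leI mult_right_mono nn) auto
 fix x
 obtain m :: nat where "d x <= real m" using real_arch_simple by blast
 then have "\<forall>\<^sub>F k in sequentially. ennreal (min (d x) (real k) * g x) = ennreal (d x * g x)"
  by (intro eventually_sequentiallyI[of m]) (auto simp: min_def)
 then show "(\<lambda>k. ennreal (min (d x) (real k) * g x)) \<longlonglongrightarrow> ennreal (d x * g x)" by (rule tendsto_eventually)
qed measurable

section \<open>Bounds uniform in time and summed over a grid\<close>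

context linear_bdsde
begin

text \<open>The size of the data under the weight: by \<open>zeta_bound\<close> the terminal value,
  too, is controlled by \<open>u\<close>.\<close>

definition total :: "('w => real) => real" where
 "total d = (\<E> w. d w * (norm (u T w))^2) + energy d (sq u) 0 T"

lemma u_T_integrable: "integrable M (\<lambda>w. (norm (u T w))^2)"
 using u_T_measurable u_L2(2) by (subst square_integrable_iff) auto

lemma total_nonneg:
 assumes "wt d R"
 shows "0 <= (\<E> w. d w * (norm (u T w))^2)" "0 <= energy d (sq u) 0 T" "0 <= total d"
proof -
 show "0 <= (\<E> w. d w * (norm (u T w))^2)"
  using assms by (intro integral_nonneg_AE AE_I2 mult_nonneg_nonneg) (auto simp: wt_def)
 moreover show "0 <= energy d (sq u) 0 T" by (rule energy_nonneg[OF assms]) simp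
 ultimately show "0 <= total d" by (simp add: total_def)
qed

lemma wt_moment_mono:
 assumes "wt d R" "wt d' R'" "integrable M f" "\<And>w. 0 <= f w" "\<And>w. w \<in> space M \<Longrightarrow> d w <= d' w"
 shows "(\<E> w. d w * f w) <= (\<E> w. d' w * f w)"
 by (intro integral_mono wt_integrable[OF assms(1,3)] wt_integrable[OF assms(2,3)] mult_right_mono assms(4,5))

lemma total_mono: "wt d R \<Longrightarrow> wt d' R' \<Longrightarrow> (\<And>w. w \<in> space M \<Longrightarrow> d w <= d' w) \<Longrightarrow> total d <= total d'"
 unfolding total_def
 by (intro add_mono wt_moment_mono[OF _ _ u_T_integrable] energy_mono[OF _ _ sq_integrable(1)]) auto

lemma energy_y_le:
 assumes w: "wt d R" and st: "0 <= s" "s <= t" "t <= T" and m: "\<And>q. s <= q \<Longrightarrow> q <= t \<Longrightarrow> (\<E> w. d w * (y q w)^2) <= m" "0 <= m"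
 shows "energy d (sq y) s t <= m * (t - s)"
proof -
 have "ennreal (energy d (sq y) s t) = (\<integral>\<^sup>+p. ennreal (indicator {s<..t} (fst p) * (d (snd p) * sq y p)) \<partial>PM)"
  by (rule nn_energy[OF w sq_integrable(2)]) simp
 also have "... = (\<integral>\<^sup>+p. ennreal (d (snd p) * sq y p) * indicator {s<..t} (fst p) \<partial>PM)"
  by (intro nn_integral_cong) (simp add: indicator_def)
 also have "... <= ennreal m * emeasure lborel {s<..t}"
 proof (rule strip_integral_le)
  show "(\<lambda>p. ennreal (d (snd p) * sq y p)) \<in> bm PM"
   using w borel_measurable_integrable[OF sq_integrable(2)] by (auto simp: wt_def)
  fix q assume "q \<in> {s<..t}"
  then have q: "0 <= q" "q <= T" "s <= q" "q <= t" using st by auto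
  have "(\<E>\<^sup>+ w. ennreal (d w * sq y (q, w))) = ennreal (\<E> w. d w * (y q w)^2)"
   using nn_integral_eq_integral[OF wt_integrable[OF w y_square_integrable[OF q(1,2)]]] w q by (simp add: sq_def wt_def)
  also have "... <= ennreal m" by (intro ennreal_leI m q)
  finally show "(\<E>\<^sup>+ w. ennreal (d (snd (q, w)) * sq y (q, w))) <= ennreal m" by simp
 qed simp
 also have "... = ennreal (m * (t - s))" using st m(2) by (simp add: ennreal_mult)
 finally show ?thesis using st m(2) by (subst (asm) ennreal_le_iff) auto
qed

text \<open>Over a short interval the time integral of \<open>y^2\<close> is at most its supremum
  \<open>m\<close> times the length. Since \<open>growth\<close> times the length is below 1/8,
  \<open>m\<close> returns on the right with the factor 1/8 and is absorbed; it is finite because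
  \<open>sup_const\<close> is.\<close>

lemma sup_bound_step:
 assumes w: "wt d R" "d \<in> bm (\<F> s T)" and ab: "0 <= s" "s <= a" "a <= c" "c <= T" "c - a <= max_step"
 shows "(\<E> w. d w * (y a w)^2) <= 2 * (\<E> w. d w * (y c w)^2) + 2 * growth * energy d (sq u) 0 T"
proof -
 let ?Y = "\<lambda>q. \<E> w. d w * (y q w)^2" and ?E = "energy d (sq u) 0 T"
 define m where "m = (SUP q\<in>{a..c}. ?Y q)"
 have Y0: "0 <= ?Y q" for q using w(1) by (intro integral_nonneg_AE AE_I2 mult_nonneg_nonneg) (auto simp: wt_def)
 have R: "0 <= R" using w(1) order_trans[of 0 "d undefined" R] by (auto simp: wt_def)
 have Y2: "?Y q <= R * enn2real sup_const" if q: "0 <= q" "q <= T" for q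
 proof -
  have "?Y q <= (\<E> w. R * (y q w)^2)"
   by (intro integral_mono wt_integrable[OF w(1)] integrable_mult_right y_square_integrable q mult_right_mono) (use w(1) in \<open>auto simp: wt_def\<close>)
  also have "... = R * (\<E> w. (y q w)^2)" by simp
  also have "(\<E> w. (y q w)^2) <= enn2real sup_const"
  proof -
   have "ennreal (\<E> w. (y q w)^2) <= sup_const"
    using y_moment[OF q] y_square_integrable[OF q] by (subst nn_integral_eq_integral[symmetric]) auto
   moreover have "sup_const = ennreal (enn2real sup_const)" using sup_const_finite by simp
   ultimately show ?thesis using ennreal_le_iff[OF enn2real_nonneg] by metis
  qed
  finally show ?thesis using R by (simp add: mult_left_mono)
 qed
 have bdd: "bdd_above (?Y ` {a..c})" using Y2 ab by (intro bdd_aboveI2[of _ _ "R * enn2real sup_const"]) auto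
 have Ym: "?Y q <= m" if "a <= q" "q <= c" for q unfolding m_def using that bdd by (intro cSUP_upper) auto
 have m0: "0 <= m" using Y0[of a] Ym[of a] ab by simp
 have "?Y q <= 9/8 * ?Y c + growth * ?E + m / 8" if q: "a <= q" "q <= c" for q
 proof -
  have d: "d \<in> bm (\<F> q T)" using q ab by (intro measurable_info_mono[OF w(2)]) auto
  have q': "0 <= q" "c - q <= max_step" using q ab by auto
  have "(1 - \<alpha>) / 2 * energy d (sq z) q c \<ge> 0" using c_nonneg energy_nonneg[OF w(1)] by simp
  then have "?Y q <= (1 + rate * (c - q)) * ?Y c + growth * (energy d (sq u) q c + energy d (sq y) q c)"
   using energy_inequality[OF w(1) d q'(1) q(2) ab(4) q'(2)] by linarith
  also have "... <= (1 + 1/8) * ?Y c + growth * (?E + m * (c - q))"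
  proof (intro add_mono mult_right_mono mult_left_mono Y0)
   have "rate * (c - q) <= rate * max_step" using q'(2) rates(1) by (intro mult_left_mono) auto
   also have "... <= (1 - \<alpha>) / 8" by (rule rates(4))
   also have "... <= 1 / 8" using c_nonneg by simp
   finally show "rate * (c - q) <= 1 / 8" .
   show "energy d (sq u) q c <= ?E" by (rule energy_mono[OF w(1) w(1) sq_integrable(1)]) (use q ab in auto)
   show "energy d (sq y) q c <= m * (c - q)" by (rule energy_y_le[OF w(1)]) (use q ab m0 Ym in auto)
  qed (use rates in auto)
  also have "growth * (?E + m * (c - q)) = growth * ?E + m * (growth * (c - q))" by (simp add: algebra_simps)
  also have "m * (growth * (c - q)) <= m * (1 / 8)"
  proof (intro mult_left_mono m0)
   have "growth * (c - q) <= growth * max_step" using q'(2) rates(2) by (intro mult_left_mono) auto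
   then show "growth * (c - q) <= 1 / 8" using rates(6) by linarith
  qed
  finally show ?thesis by simp
 qed
 then have "(SUP q\<in>{a..c}. ?Y q) <= 9/8 * ?Y c + growth * ?E + m / 8" using ab by (intro cSUP_least) auto
 then have "m <= 9/8 * ?Y c + growth * ?E + m / 8" by (simp only: m_def[symmetric])
 moreover have "0 <= growth * ?E" using rates total_nonneg(2)[OF w(1)] by simp
 ultimately show ?thesis using Ym[of a] ab Y0[of c] by simp
qed

text \<open>Each backward step of length \<open>max_step\<close> doubles the bound and adds the size
  of the data, altogether at most a factor 3.\<close>

definition sup_bound_const :: real where
 "sup_bound_const = 3 ^ nat \<lceil>T / max_step\<rceil> * (c\<^sub>0 + 2 * growth)"

lemma sup_bound_const_nonneg: "0 <= sup_bound_const"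
 using rates c_nonneg by (simp add: sup_bound_const_def)

lemma sup_bound:
 assumes w: "wt d R" "d \<in> bm (\<F> s T)" and r: "0 <= s" "s <= r" "r <= T"
 shows "(\<E> w. d w * (y r w)^2) <= sup_bound_const * total d"
proof -
 let ?Y = "\<lambda>q. \<E> w. d w * (y q w)^2" and ?E = "energy d (sq u) 0 T"
 note nn = total_nonneg[OF w(1)]
 define Q where "Q = (c\<^sub>0 + 2 * growth) * total d"
 have Q0: "0 <= Q" using nn rates c_nonneg by (simp add: Q_def)
 have QE: "2 * growth * ?E <= Q" unfolding Q_def
  by (rule mult_mono) (use nn rates c_nonneg in \<open>auto simp: total_def\<close>)
 have YT: "?Y T <= Q"
 proof -
  have "?Y T <= (\<E> w. c\<^sub>0 * (d w * (norm (u T w))^2))"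
  proof (rule integral_mono_AE)
   show "AE w in M. d w * (y T w)^2 <= c\<^sub>0 * (d w * (norm (u T w))^2)"
    using terminal AE_space
   proof eventually_elim
    case (elim w)
    then show ?case using mult_left_mono[OF zeta_bound[of w], of "d w"] w(1) by (simp add: wt_def mult.left_commute)
   qed
  qed (use wt_integrable[OF w(1)] y_square_integrable[of T] u_T_integrable T_pos in auto)
  also have "... = c\<^sub>0 * (\<E> w. d w * (norm (u T w))^2)" by simp
  also have "... <= Q" unfolding Q_def by (rule mult_mono) (use nn rates c_nonneg in \<open>auto simp: total_def\<close>)
  finally show ?thesis .
 qed
 have it: "?Y q <= 3 ^ k * Q" if "s <= q" "q <= T" "T - real k * max_step <= q" for k q
  using that
 proof (induction k arbitrary: q)
  case 0
  then have "q = T" by simp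
  then show ?case using YT by simp
 next
  case (Suc k)
  \<comment> \<open>The step that reaches \<open>T\<close> may be shorter than
    \<open>max_step\<close>.\<close>
  define c where "c = min T (q + max_step)"
  have c: "q <= c" "c <= T" "c - q <= max_step" using Suc.prems rates by (auto simp: c_def)
  have "T - real k * max_step <= c" using Suc.prems rates by (auto simp: c_def algebra_simps)
  then have "?Y c <= 3 ^ k * Q" using Suc.prems c by (intro Suc.IH) auto
  moreover have "?Y q <= 2 * ?Y c + 2 * growth * ?E" by (rule sup_bound_step[OF w r(1) Suc.prems(1) c])
  moreover have "1 * Q <= 3 ^ k * Q" using Q0 by (intro mult_right_mono) auto
  ultimately show ?case using QE by simp
 qed
 let ?N = "nat \<lceil>T / max_step\<rceil>"
 have "T / max_step <= real ?N" by linarith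
 then have "T - real ?N * max_step <= 0" using rates by (simp add: field_simps)
 then have "?Y r <= 3 ^ ?N * Q" using r by (intro it) auto
 then show ?thesis by (simp add: Q_def sup_bound_const_def)
qed

text \<open>The first bracket bounds the energies of \<open>u\<close> and \<open>y\<close>; the
  second summand bounds that of \<open>z\<close>, after division by
  \<open>(1 - \<alpha>) / 2\<close>.\<close>

definition grid_const :: real where
 "grid_const = (1 + sup_bound_const * T) +
  2 / (1 - \<alpha>) * (sup_bound_const + rate * sup_bound_const * T + growth * (1 + sup_bound_const * T))"

lemma grid_const_nonneg: "0 <= grid_const"
 using sup_bound_const_nonneg T_pos rates c_nonneg by (simp add: grid_const_def)

text \<open>The weights increase along the grid, so that the terms \<open>d\<^sub>i y^2\<close> telescope.\<close>

lemma grid_energy_bound: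
 assumes p: "grid p n" "\<And>i. i < n \<Longrightarrow> p (Suc i) - p i <= max_step"
  and w: "\<And>i. i <= n \<Longrightarrow> wt (d i) R" "\<And>i. i <= n \<Longrightarrow> d i \<in> bm (\<F> (p i) T)"
  and mono: "\<And>i w. i < n \<Longrightarrow> d i w <= d (Suc i) w"
 shows "(\<Sum>i<n. energy (d i) (sq u) (p i) (p (Suc i)) + energy (d i) (sq y) (p i) (p (Suc i)) + energy (d i) (sq z) (p i) (p (Suc i)))
  <= grid_const * total (d n)"
proof -
 let ?A = "sup_bound_const" and ?t = "total (d n)" and ?Y = "\<lambda>i. \<E> w. d i w * (y (p i) w)^2"
 let ?E = "\<lambda>i. energy (d i) (sq u) (p i) (p (Suc i)) + energy (d i) (sq y) (p i) (p (Suc i))"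
 let ?Z = "\<lambda>i. energy (d i) (sq z) (p i) (p (Suc i))"
 have step: "0 <= p k \<and> p k <= p (Suc k) \<and> p (Suc k) <= T" if "k < n" for k
  using that p(1) grid_bounds[OF p(1), of k] grid_bounds[OF p(1), of "Suc k"] by (auto simp: grid_def)
 note wn = w(1)[OF order_refl]
 note t0 = total_nonneg[OF wn]
 have dn: "d i w <= d n w" if "i <= n" for i w
  using that by (rule inc_induct) (auto intro: order_trans mono)
 have tot: "total (d i) <= ?t" if "i <= n" for i by (rule total_mono[OF w(1)[OF that] wn dn[OF that]])
 have Y: "(\<E> w. d i w * (y q w)^2) <= ?A * ?t" if "i <= n" "p i <= q" "q <= T" for i q
  using sup_bound[OF w[OF that(1)] _ that(2,3)] grid_bounds[OF p(1) that(1)] mult_left_mono[OF tot[OF that(1)] sup_bound_const_nonneg]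
  by simp
 have A0: "0 <= ?A * ?t" using sup_bound_const_nonneg t0 by simp
 have sumE: "(\<Sum>i<k. ?E i) <= energy (d n) (sq u) (p 0) (p k) + ?A * ?t * (p k - p 0)" if "k <= n" for k
  using that
 proof (induction k)
  case 0
  then show ?case using energy_nonneg[OF wn] by simp
 next
  case (Suc k)
  note b = step[of k]
  have "energy (d k) (sq u) (p k) (p (Suc k)) <= energy (d n) (sq u) (p k) (p (Suc k))"
   by (rule energy_mono[OF w(1) wn sq_integrable(1)]) (use Suc.prems dn in auto)
  moreover have "energy (d k) (sq y) (p k) (p (Suc k)) <= ?A * ?t * (p (Suc k) - p k)"
   by (rule energy_y_le[OF w(1)]) (use Suc.prems b Y A0 in auto)
  moreover have "energy (d n) (sq u) (p 0) (p (Suc k)) = energy (d n) (sq u) (p 0) (p k) + energy (d n) (sq u) (p k) (p (Suc k))"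
   by (rule energy_join[OF wn sq_integrable(1)]) (use Suc.prems b grid_mono[OF p(1), of 0 k] in auto)
  ultimately show ?case using Suc by (simp add: algebra_simps)
 qed
 have sumZ: "?Y 0 + (1 - \<alpha>) / 2 * (\<Sum>i<k. ?Z i) <= ?Y k + rate * (?A * ?t) * (p k - p 0) + growth * (\<Sum>i<k. ?E i)" if "k <= n" for k
  using that
 proof (induction k)
  case (Suc k)
  note b = step[of k]
  have k: "k <= n" "Suc k <= n" using Suc.prems by auto
  have st: "0 <= p k" "p k <= p (Suc k)" "p (Suc k) <= T" "p (Suc k) - p k <= max_step" using Suc.prems b p(2)[of k] by auto
  let ?y = "\<E> w. d k w * (y (p (Suc k)) w)^2"
  have "?Y k + (1 - \<alpha>) / 2 * ?Z k <= (1 + rate * (p (Suc k) - p k)) * ?y + growth * ?E k"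
   by (rule energy_inequality[OF w[OF k(1)] st])
  moreover have "?y <= ?Y (Suc k)"
   by (rule wt_moment_mono[OF w(1)[OF k(1)] w(1)[OF k(2)] y_square_integrable]) (use st Suc.prems mono[of k] in auto)
  \<comment> \<open>The factor \<open>1 + rate dt\<close> is not iterated as in Gronwall's lemma:
    its surplus is bounded by \<open>sup_bound\<close> and summed over the grid.\<close>
  moreover have "rate * (p (Suc k) - p k) * ?y <= rate * (p (Suc k) - p k) * (?A * ?t)"
   using st rates by (intro mult_left_mono Y[OF k(1)]) auto
  ultimately show ?case using Suc by (simp add: algebra_simps)
 qed simp
 have n: "0 <= p 0" "p 0 <= p n" "p n <= T" using grid_bounds[OF p(1)] grid_mono[OF p(1), of 0 n] by auto
 have "energy (d n) (sq u) (p 0) (p n) <= ?t"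
  using energy_mono[OF wn wn sq_integrable(1), of 0 "p 0" "p n" T] n t0 by (simp add: total_def)
 moreover have len: "?A * ?t * (p n - p 0) <= ?A * ?t * T" using A0 n by (intro mult_left_mono) auto
 ultimately have E: "(\<Sum>i<n. ?E i) <= (1 + ?A * T) * ?t" using sumE[OF order_refl] by (simp add: algebra_simps)
 have r0: "0 <= rate" "0 <= growth" using rates by auto
 have "0 <= ?Y 0" using w(1)[of 0] by (intro integral_nonneg_AE AE_I2 mult_nonneg_nonneg) (auto simp: wt_def)
 then have "(1 - \<alpha>) / 2 * (\<Sum>i<n. ?Z i) <= ?A * ?t + rate * (?A * ?t * T) + growth * ((1 + ?A * T) * ?t)"
  using sumZ[OF order_refl] Y[OF order_refl order_refl n(3)] mult_left_mono[OF len r0(1)] mult_left_mono[OF E r0(2)]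
  by (simp only: mult.assoc)
 also have "... = (?A + rate * ?A * T + growth * (1 + ?A * T)) * ?t" by (simp add: algebra_simps)
 finally have "2 / (1 - \<alpha>) * ((1 - \<alpha>) / 2 * (\<Sum>i<n. ?Z i)) <= 2 / (1 - \<alpha>) * ((?A + rate * ?A * T + growth * (1 + ?A * T)) * ?t)"
  using c_nonneg by (intro mult_left_mono) auto
 moreover have "2 / (1 - \<alpha>) * ((1 - \<alpha>) / 2 * (\<Sum>i<n. ?Z i)) = (\<Sum>i<n. ?Z i)" using c_nonneg by simp
 ultimately have "(\<Sum>i<n. ?Z i) <= 2 / (1 - \<alpha>) * (?A + rate * ?A * T + growth * (1 + ?A * T)) * ?t"
  by (simp only: mult.assoc)
 with E show ?thesis by (simp add: sum.distrib grid_const_def distrib_right)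
qed

end

section \<open>Passage to unbounded weights\<close>

context linear_bdsde
begin

definition nn_total :: "('w => real) => ennreal" where
 "nn_total d = (\<E>\<^sup>+ w. ennreal (d w * (norm (u T w))^2)) + (\<integral>\<^sup>+p. ennreal (d (snd p) * sq u p) \<partial>PM)"

definition nn_energy_sum :: "('w => real) => real => real => ennreal" where
 "nn_energy_sum d s t = (\<integral>\<^sup>+p. ennreal (d (snd p) * (indicator {s<..t} (fst p) * (sq u p + sq y p + sq z p))) \<partial>PM)"

text \<open>Truncating with \<open>min\<close> preserves measurability and the order between
  weights, which \<open>grid_energy_bound\<close> requires; the convergence is monotone.\<close>

definition trunc :: "('w => real) => nat => 'w => real" where
 "trunc d k w = min (d w) (real k)"

lemma wt_trunc: "d \<in> bm M \<Longrightarrow> (\<And>w. 0 <= d w) \<Longrightarrow> wt (trunc d k) (real k)"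
 unfolding wt_def trunc_def[abs_def] by auto

lemma trunc_measurable: "d \<in> bm N \<Longrightarrow> trunc d k \<in> bm N"
 unfolding trunc_def[abs_def] by measurable

lemma total_trunc_le:
 assumes d: "d \<in> bm M" "\<And>w. 0 <= d w"
 shows "ennreal (total (trunc d k)) <= nn_total d"
proof -
 note w = wt_trunc[OF d, of k]
 have "ennreal (total (trunc d k)) = ennreal (\<E> w. trunc d k w * (norm (u T w))^2) + ennreal (energy (trunc d k) (sq u) 0 T)"
  unfolding total_def by (rule ennreal_plus[OF total_nonneg(1,2)[OF w]])
 also have "ennreal (\<E> w. trunc d k w * (norm (u T w))^2) = (\<E>\<^sup>+ w. ennreal (trunc d k w * (norm (u T w))^2))"
  by (rule nn_integral_eq_integral[symmetric, OF wt_integrable[OF w u_T_integrable]]) (use w in \<open>auto simp: wt_def\<close>)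
 also have "ennreal (energy (trunc d k) (sq u) 0 T) = (\<integral>\<^sup>+p. ennreal (indicator {0<..T} (fst p) * (trunc d k (snd p) * sq u p)) \<partial>PM)"
  by (rule nn_energy[OF w sq_integrable(1)]) simp
 finally show ?thesis unfolding nn_total_def by (rule ord_eq_le_trans)
    (intro add_mono nn_integral_mono ennreal_leI, auto simp: trunc_def indicator_def d intro!: mult_right_mono mult_nonneg_nonneg)
qed

lemma energy_sum_trunc:
 assumes d: "d \<in> bm M" "\<And>w. 0 <= d w"
 shows "(\<lambda>k. ennreal (energy (trunc d k) (sq u) s t + energy (trunc d k) (sq y) s t + energy (trunc d k) (sq z) s t)) \<longlonglongrightarrow> nn_energy_sum d s t"
proof -
 have i: "integrable PM (\<lambda>p. sq u p + sq y p + sq z p)" using sq_integrable by simp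
 note [measurable] = d(1) borel_measurable_integrable[OF sq_integrable(1)] borel_measurable_integrable[OF sq_integrable(2)]
  borel_measurable_integrable[OF sq_integrable(3)]
 have "ennreal (energy (trunc d k) (sq u) s t + energy (trunc d k) (sq y) s t + energy (trunc d k) (sq z) s t) =
   (\<integral>\<^sup>+p. ennreal (min (d (snd p)) (real k) * (indicator {s<..t} (fst p) * (sq u p + sq y p + sq z p))) \<partial>PM)" for k
 proof -
  have 1: "energy (trunc d k) (sq u) s t + energy (trunc d k) (sq y) s t + energy (trunc d k) (sq z) s t =
    energy (trunc d k) (\<lambda>p. sq u p + sq y p + sq z p) s t"
   using sq_integrable by (simp add: energy_add[OF wt_trunc[OF d]])
  have 2: "ennreal (energy (trunc d k) (\<lambda>p. sq u p + sq y p + sq z p) s t) =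
    (\<integral>\<^sup>+p. ennreal (indicator {s<..t} (fst p) * (trunc d k (snd p) * (sq u p + sq y p + sq z p))) \<partial>PM)"
   by (rule nn_energy[OF wt_trunc[OF d] i]) simp
  show ?thesis unfolding 1 2 by (simp only: trunc_def mult.left_commute)
 qed
 moreover have "(\<lambda>k. \<integral>\<^sup>+p. ennreal (min (d (snd p)) (real k) * (indicator {s<..t} (fst p) * (sq u p + sq y p + sq z p))) \<partial>PM)
   \<longlonglongrightarrow> (\<integral>\<^sup>+p. ennreal (d (snd p) * (indicator {s<..t} (fst p) * (sq u p + sq y p + sq z p))) \<partial>PM)"
  by (rule nn_integral_truncation) (auto simp: d)
 ultimately show ?thesis by (simp add: nn_energy_sum_def)
qed

lemma sup_bound_nn:
 assumes d: "d \<in> bm M" "\<And>w. 0 <= d w" "d \<in> bm (\<F> s T)" and r: "0 <= s" "s <= r" "r <= T"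
 shows "(\<E>\<^sup>+ w. ennreal (d w * (y r w)^2)) <= ennreal sup_bound_const * nn_total d"
proof (rule LIMSEQ_le_const2)
 have r': "0 <= r" using r by simp
 note [measurable] = d(1) y_measurable(2)[OF r' r(3)]
 show "(\<lambda>k. \<E>\<^sup>+ w. ennreal (min (d w) (real k) * (y r w)^2)) \<longlonglongrightarrow> (\<E>\<^sup>+ w. ennreal (d w * (y r w)^2))"
  by (rule nn_integral_truncation) (auto simp: d)
 have "(\<E>\<^sup>+ w. ennreal (min (d w) (real k) * (y r w)^2)) <= ennreal sup_bound_const * nn_total d" for k
 proof -
  note w = wt_trunc[OF d(1,2), of k]
  have "(\<E>\<^sup>+ w. ennreal (trunc d k w * (y r w)^2)) = ennreal (\<E> w. trunc d k w * (y r w)^2)"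
   by (rule nn_integral_eq_integral[OF wt_integrable[OF w y_square_integrable[OF r' r(3)]]]) (use w in \<open>auto simp: wt_def\<close>)
  also have "... <= ennreal (sup_bound_const * total (trunc d k))"
   by (intro ennreal_leI sup_bound[OF w trunc_measurable[OF d(3)] r])
  also have "... = ennreal sup_bound_const * ennreal (total (trunc d k))"
   by (rule ennreal_mult[OF sup_bound_const_nonneg total_nonneg(3)[OF w]])
  also have "... <= ennreal sup_bound_const * nn_total d" by (intro mult_left_mono total_trunc_le d) auto
  finally show ?thesis by (simp add: trunc_def)
 qed
 then show "\<exists>N. \<forall>k\<ge>N. (\<E>\<^sup>+ w. ennreal (min (d w) (real k) * (y r w)^2)) <= ennreal sup_bound_const * nn_total d" by blast
qed

lemma increment_bound_nn:
 assumes d: "d \<in> bm M" "\<And>w. 0 <= d w" "d \<in> bm (\<F> s T)" and st: "0 <= s" "s <= t" "t <= T"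
 shows "(\<E>\<^sup>+ w. ennreal (d w * (y t w - y s w)^2)) <= ennreal (4 * (2 + c\<^sub>G + T * c\<^sub>F)) * nn_energy_sum d s t"
proof (rule tendsto_le[OF trivial_limit_sequentially])
 have st': "0 <= t" "s <= T" using st by auto
 note [measurable] = d(1) y_measurable(2)[OF st(1) st'(2)] y_measurable(2)[OF st'(1) st(3)]
 let ?E = "\<lambda>k. energy (trunc d k) (sq u) s t + energy (trunc d k) (sq y) s t + energy (trunc d k) (sq z) s t"
 show "(\<lambda>k. \<E>\<^sup>+ w. ennreal (min (d w) (real k) * (y t w - y s w)^2)) \<longlonglongrightarrow> (\<E>\<^sup>+ w. ennreal (d w * (y t w - y s w)^2))"
  by (rule nn_integral_truncation) (auto simp: d)
 show "(\<lambda>k. ennreal (4 * (2 + c\<^sub>G + T * c\<^sub>F)) * ennreal (?E k)) \<longlonglongrightarrow> ennreal (4 * (2 + c\<^sub>G + T * c\<^sub>F)) * nn_energy_sum d s t"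
  by (intro ennreal_tendsto_cmult energy_sum_trunc d) simp
 have yy: "integrable M (\<lambda>w. (y t w - y s w)^2)"
  using square_integrable_diff[of "y t" M "y s"] y_square_integrable[OF st(1) st'(2)] y_square_integrable[OF st'(1) st(3)] by auto
 have "(\<E>\<^sup>+ w. ennreal (min (d w) (real k) * (y t w - y s w)^2)) <= ennreal (4 * (2 + c\<^sub>G + T * c\<^sub>F)) * ennreal (?E k)" for k
 proof -
  note w = wt_trunc[OF d(1,2), of k]
  have "(\<E>\<^sup>+ w. ennreal (trunc d k w * (y t w - y s w)^2)) = ennreal (\<E> w. trunc d k w * (y t w - y s w)^2)"
   by (rule nn_integral_eq_integral[OF wt_integrable[OF w yy]]) (use w in \<open>auto simp: wt_def\<close>)
  also have "... <= ennreal (4 * (2 + c\<^sub>G + T * c\<^sub>F) * ?E k)"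
   by (intro ennreal_leI increment_inequality[OF w trunc_measurable[OF d(3)] st])
  also have "... = ennreal (4 * (2 + c\<^sub>G + T * c\<^sub>F)) * ennreal (?E k)"
   using c_nonneg T_pos energy_nonneg[OF w] by (intro ennreal_mult add_nonneg_nonneg) auto
  finally show ?thesis by (simp add: trunc_def)
 qed
 then show "\<forall>\<^sub>F k in sequentially. (\<E>\<^sup>+ w. ennreal (min (d w) (real k) * (y t w - y s w)^2)) \<le>
   ennreal (4 * (2 + c\<^sub>G + T * c\<^sub>F)) * ennreal (?E k)" by simp
qed

lemma grid_energy_bound_nn:
 assumes p: "grid p n" "\<And>i. i < n \<Longrightarrow> p (Suc i) - p i <= max_step"
  and d: "\<And>i. i <= n \<Longrightarrow> d i \<in> bm M" "\<And>i w. 0 <= d i w"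
   "\<And>i. i <= n \<Longrightarrow> d i \<in> bm (\<F> (p i) T)"
  and mono: "\<And>i w. i < n \<Longrightarrow> d i w <= d (Suc i) w"
 shows "(\<Sum>i<n. nn_energy_sum (d i) (p i) (p (Suc i))) <= ennreal grid_const * nn_total (d n)"
proof (rule LIMSEQ_le_const2)
 let ?E = "\<lambda>k i. energy (trunc (d i) k) (sq u) (p i) (p (Suc i)) + energy (trunc (d i) k) (sq y) (p i) (p (Suc i)) +
  energy (trunc (d i) k) (sq z) (p i) (p (Suc i))"
 show "(\<lambda>k. \<Sum>i<n. ennreal (?E k i)) \<longlonglongrightarrow> (\<Sum>i<n. nn_energy_sum (d i) (p i) (p (Suc i)))"
  by (intro tendsto_sum energy_sum_trunc d) auto
 have "(\<Sum>i<n. ennreal (?E k i)) <= ennreal grid_const * nn_total (d n)" for k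
 proof -
  have w: "wt (trunc (d i) k) (real k)" if "i <= n" for i by (rule wt_trunc[OF d(1)[OF that] d(2)])
  have mono': "trunc (d i) k w <= trunc (d (Suc i)) k w" if "i < n" for i w
   unfolding trunc_def by (rule min.mono[OF mono[OF that] order_refl])
  have "(\<Sum>i<n. ennreal (?E k i)) = ennreal (\<Sum>i<n. ?E k i)"
   by (intro sum_ennreal add_nonneg_nonneg energy_nonneg[OF w]) auto
  also have "... <= ennreal (grid_const * total (trunc (d n) k))"
   by (intro ennreal_leI grid_energy_bound[OF p w trunc_measurable[OF d(3)] mono'])
  also have "... = ennreal grid_const * ennreal (total (trunc (d n) k))"
   by (rule ennreal_mult[OF grid_const_nonneg total_nonneg(3)[OF w]]) simp
  also have "... <= ennreal grid_const * nn_total (d n)" by (intro mult_left_mono total_trunc_le d) auto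
  finally show ?thesis .
 qed
 then show "\<exists>N. \<forall>k\<ge>N. (\<Sum>i<n. ennreal (?E k i)) <= ennreal grid_const * nn_total (d n)" by blast
qed

text \<open>Young's inequality separates the weight from the source, each entering with a moment
  that is known. The parameter \<open>l\<close> matters for small weights: if \<open>d\<close> is of
  size \<open>t - s\<close>, the choice \<open>l = 1 / (t - s)\<close> makes the bound proportional
  to \<open>t - s\<close>.\<close>

lemma nn_total_le:
 assumes d: "d \<in> bm M" "\<And>w. 0 <= d w" and a: "moment_le M (\<lambda>w. (d w)^2) a" and l: "0 < l"
  and c: "\<And>r. 0 <= r \<Longrightarrow> r <= T \<Longrightarrow> moment_le M (\<lambda>w. norm (u r w) ^ 4) c"
 shows "nn_total d <= ennreal ((1 + T) * (l / 2 * a + 1 / (2 * l) * c))"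
proof -
 let ?b = "l / 2 * a + 1 / (2 * l) * c"
 have b: "(\<E>\<^sup>+ w. ennreal (d w * (norm (u r w))^2)) <= ennreal ?b" if r: "0 <= r" "r <= T" for r
 proof -
  have "moment_le M (\<lambda>w. l / 2 * (d w)^2 + 1 / (2 * l) * norm (u r w) ^ 4) ?b"
   by (intro moment_le_add moment_le_cmult a c r) (use l in auto)
  then have "moment_le M (\<lambda>w. d w * (norm (u r w))^2) ?b"
  proof (rule moment_le_mono)
   show "(\<lambda>w. d w * (norm (u r w))^2) \<in> bm M"
    using d(1) process_section[OF u_process r] by measurable
   show "d w * (norm (u r w))^2 <= l / 2 * (d w)^2 + 1 / (2 * l) * norm (u r w) ^ 4" for w
    using young_half[OF l, of "d w" "(norm (u r w))^2"] by (simp add: power_mult[symmetric])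
  qed (use d in auto)
  then show ?thesis by (simp add: moment_le_def)
 qed
 have b0: "0 <= ?b" using a c[of 0] T_pos l by (auto simp: moment_le_def)
 have m: "(\<lambda>p. ennreal (d (snd p) * sq u p)) \<in> bm PM"
  using d(1) sq_measurable[OF u_process] by measurable
 have "(\<integral>\<^sup>+p. ennreal (d (snd p) * sq u p) \<partial>PM) = (\<integral>\<^sup>+p. ennreal (d (snd p) * sq u p) * indicator {0..T} (fst p) \<partial>PM)"
  by (intro nn_integral_cong) (auto simp: sq_def indicator_def)
 also have "... <= ennreal ?b * emeasure lborel {0..T}"
  by (rule strip_integral_le[OF m]) (use b in \<open>auto simp: sq_def\<close>)
 also have "... = ennreal (T * ?b)" using T_pos b0 by (simp only: emeasure_lborel_Icc less_imp_le diff_zero) (simp add: ennreal_mult mult.commute)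
 finally have "nn_total d <= ennreal ?b + ennreal (T * ?b)" unfolding nn_total_def using T_pos by (intro add_mono b) auto
 also have "... = ennreal ((1 + T) * ?b)" using b0 T_pos by (subst ennreal_plus[symmetric]) (auto simp: distrib_right)
 finally show ?thesis .
qed

end

section \<open>Bounds for the linearized coefficients\<close>

lemma grad_inner:
 fixes h :: "'a::euclidean_space => real"
 assumes "h differentiable (at x)"
 shows "grad h x \<bullet> v = frechet_derivative h (at x) v"
proof -
 have lin: "linear (frechet_derivative h (at x))" using assms by (rule linear_frechet_derivative)
 have "frechet_derivative h (at x) v = frechet_derivative h (at x) (\<Sum>e\<in>Basis. (v \<bullet> e) *\<^sub>R e)"
  by (simp add: euclidean_representation)
 also have "... = (\<Sum>e\<in>Basis. (v \<bullet> e) * frechet_derivative h (at x) e)"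
  using lin by (simp add: linear_sum linear_cmul)
 finally show ?thesis by (simp add: grad_def inner_sum_left inner_commute[of v] mult.commute)
qed

text \<open>\<open>linearized\<close> is assembled from separate partial derivatives. Joint
  differentiability identifies it with the total derivative, which can be estimated along a single
  line.\<close>

lemma linearized_frechet:
 fixes h :: "real^'d => real => real^'d => real"
 assumes h: "(\<lambda>(x, y, z). h x y z) differentiable (at (x, y, z))"
 shows "linearized h x y z u v w = frechet_derivative (\<lambda>(x, y, z). h x y z) (at (x, y, z)) (u, v, w)"
proof -
 let ?H = "\<lambda>(x, y, z). h x y z"
 define D where "D = frechet_derivative ?H (at (x, y, z))"
 have D: "(?H has_derivative D) (at (x, y, z))" unfolding D_def using h by (simp add: frechet_derivative_works)
 interpret D: bounded_linear D using D by (rule has_derivative_bounded_linear)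
 have "(?H \<circ> (\<lambda>x'. (x', y, z)) has_derivative D \<circ> (\<lambda>v. (v, 0, 0))) (at x)"
  by (intro diff_chain_at D has_derivative_Pair has_derivative_ident has_derivative_const)
 then have 1: "((\<lambda>x'. h x' y z) has_derivative (\<lambda>v. D (v, 0, 0))) (at x)" by (simp add: comp_def)
 have "(?H \<circ> (\<lambda>y'. (x, y', z)) has_derivative D \<circ> (\<lambda>v. (0, v, 0))) (at y)"
  by (intro diff_chain_at D has_derivative_Pair has_derivative_ident has_derivative_const)
 then have 2: "((\<lambda>y'. h x y' z) has_derivative (\<lambda>v. D (0, v, 0))) (at y)" by (simp add: comp_def)
 have "(?H \<circ> (\<lambda>z'. (x, y, z')) has_derivative D \<circ> (\<lambda>v. (0, 0, v))) (at z)"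
  by (intro diff_chain_at D has_derivative_Pair has_derivative_ident has_derivative_const)
 then have 3: "((\<lambda>z'. h x y z') has_derivative (\<lambda>v. D (0, 0, v))) (at z)" by (simp add: comp_def)
 have "grad (\<lambda>x'. h x' y z) x \<bullet> u = D (u, 0, 0)"
  by (subst grad_inner) (auto simp: frechet_derivative_at[OF 1, symmetric] intro: differentiableI[OF 1])
 moreover have "grad (\<lambda>z'. h x y z') z \<bullet> w = D (0, 0, w)"
  by (subst grad_inner) (auto simp: frechet_derivative_at[OF 3, symmetric] intro: differentiableI[OF 3])
 moreover have "deriv (\<lambda>y'. h x y' z) y * v = D (0, v, 0)"
 proof -
  have s: "D (0, r, 0) = D (0, 1, 0) * r" for r using D.scaleR[of r "(0, 1, 0)"] by (simp add: mult.commute)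
  have "((\<lambda>y'. h x y' z) has_field_derivative D (0, 1, 0)) (at y)"
  proof -
   have "(\<lambda>v. D (0, v, 0)) = (*) (D (0, 1, 0))" by (rule ext) (rule s)
   with 2 show ?thesis unfolding has_field_derivative_def by (simp only:)
  qed
  from DERIV_imp_deriv[OF this] show ?thesis by (simp only: s[of v])
 qed
 moreover have "D (u, v, w) = D (u, 0, 0) + D (0, v, 0) + D (0, 0, w)"
  by (simp add: D.add[symmetric])
 ultimately show ?thesis unfolding linearized_def D_def by simp
qed

lemma directional_derivative_bound:
 fixes H :: "'a::real_normed_vector => real"
 assumes D: "(H has_derivative D) (at p)" and b: "\<And>t. (H (p + t *\<^sub>R q) - H p)^2 <= S * t^2"
 shows "(D q)^2 <= S"
proof -
 interpret D: bounded_linear D using D by (rule has_derivative_bounded_linear)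
 have "(H \<circ> (\<lambda>t. p + t *\<^sub>R q) has_derivative D \<circ> (\<lambda>t. t *\<^sub>R q)) (at 0)"
  by (rule diff_chain_at) (auto intro!: derivative_eq_intros D)
 then have "((\<lambda>t. H (p + t *\<^sub>R q)) has_field_derivative D q) (at 0)"
  unfolding has_field_derivative_def by (simp add: comp_def D.scaleR mult_commute_abs)
 then have "((\<lambda>t. (H (p + t *\<^sub>R q) - H p) / t) \<longlongrightarrow> D q) (at 0)" unfolding DERIV_def by simp
 then have "((\<lambda>t. ((H (p + t *\<^sub>R q) - H p) / t)^2) \<longlongrightarrow> (D q)^2) (at 0)" by (rule tendsto_power)
 then show ?thesis
 proof (rule tendsto_upperbound)
  have "((H (p + t *\<^sub>R q) - H p) / t)^2 <= S" if "t \<noteq> 0" for t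
   using b[of t] that by (simp add: power_divide divide_le_eq)
  then show "\<forall>\<^sub>F t in at 0. ((H (p + t *\<^sub>R q) - H p) / t)^2 <= S" by (auto simp: eventually_at_filter)
 qed simp
qed

text \<open>Difference quotients along a line inherit the quadratic Lipschitz bound, so the
  derivative obeys it with the same constants. Applied to \<open>g\<close>, the factor
  \<open>\<alpha> < 1\<close> survives the linearization.\<close>

lemma linearized_bound:
 fixes h :: "real^'d => real => real^'d => real"
 assumes C: "class_C 3 (\<lambda>(x, y, z). h x y z)"
  and b: "\<And>x x' y y' z z'. (h x y z - h x' y' z')^2 <= a * ((norm (x - x'))^2 + (y - y')^2) + c * (norm (z - z'))^2"
 shows "(linearized h x y z u v w)^2 <= a * ((norm u)^2 + v^2) + c * (norm w)^2"
proof -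
 let ?H = "\<lambda>(x, y, z). h x y z"
 have H: "?H differentiable (at (x, y, z))"
  using C unfolding class_C_def by (auto dest!: spec[of _ "[]"])
 have "(frechet_derivative ?H (at (x, y, z)) (u, v, w))^2 <= a * ((norm u)^2 + v^2) + c * (norm w)^2"
 proof (rule directional_derivative_bound[where H="?H" and p="(x, y, z)" and q="(u, v, w)"])
  show "(?H has_derivative frechet_derivative ?H (at (x, y, z))) (at (x, y, z))"
   using H by (simp add: frechet_derivative_works)
  fix t :: real
  show "(?H ((x, y, z) + t *\<^sub>R (u, v, w)) - ?H (x, y, z))^2 <= (a * ((norm u)^2 + v^2) + c * (norm w)^2) * t^2"
   using b[of "x + t *\<^sub>R u" "y + t * v" "z + t *\<^sub>R w" x y z] by (simp add: power_mult_distrib algebra_simps)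
 qed
 then show ?thesis by (simp add: linearized_frechet[OF H])
qed

lemma class_Cb_2_grad_bound:
 fixes \<phi> :: "'a::euclidean_space => real"
 assumes "class_Cb 2 \<phi>"
 shows "\<exists>K\<ge>0. \<forall>x v. (grad \<phi> x \<bullet> v)^2 <= K * (norm v)^2"
proof -
 have diff: "\<phi> differentiable (at x)" for x
  using assms unfolding class_Cb_def class_C_def by (auto dest!: spec[of _ "[]"])
 have "\<exists>K. \<forall>x. norm (partials [e] \<phi> x) <= K" if "e \<in> Basis" for e
 proof -
  have "bounded (range (partials [e] \<phi>))" 
   using assms that unfolding class_Cb_def by (auto dest!: spec[of _ "[e]"])
  then show ?thesis by (auto simp: bounded_iff)
 qed
 then obtain k where k: "\<And>e x. e \<in> Basis \<Longrightarrow> norm (partials [e] \<phi> x) <= k e" by metis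
 define c where "c = (\<Sum>e\<in>(Basis::'a set). \<bar>k e\<bar>)"
 have c: "norm (partials [e] \<phi> x) <= c" if "e \<in> Basis" for e x
 proof -
  have "k e <= \<bar>k e\<bar>" by simp
  also have "... <= c" unfolding c_def using that by (intro member_le_sum) auto
  finally show ?thesis using k[OF that, of x] by linarith
 qed
 have "(grad \<phi> x \<bullet> v)^2 <= (real DIM('a) * c)^2 * (norm v)^2" for x v
 proof -
  have "\<bar>grad \<phi> x \<bullet> v\<bar> <= real DIM('a) * c * norm v"
   using norm_frechet_derivative_le[OF diff c, of x v] by (simp add: grad_inner[OF diff])
  from power_mono[OF this, of 2] show ?thesis by (simp add: power_mult_distrib)
 qed
 then show ?thesis by (intro exI[of _ "(real DIM('a) * c)^2"]) simp
qed

lemma norm_column_le: "norm (column j (A::real^'n^'m)) <= norm A"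
proof -
 have "(norm (column j A))^2 <= (norm A)^2"
  unfolding norm_square_sum_columns by (rule member_le_sum) auto
 then show ?thesis by (rule power2_le_imp_le) simp
qed

section \<open>Path regularity\<close>

lemma (in two_brownian_motions) interval_integral_le:
 fixes Z :: "real => 'w => real^'d"
 assumes Z: "process M T Z" and st: "0 <= s" "s <= t" "t <= T"
  and b: "\<And>r. s <= r \<Longrightarrow> r <= t \<Longrightarrow> (\<E>\<^sup>+ w. ennreal ((norm (Z r w - Z s w))^2 + (norm (Z r w - Z t w))^2)) <= c"
 shows "(\<E>\<^sup>+ w. (\<integral>\<^sup>+r\<in>{s..t}. ennreal ((norm (Z r w - Z s w))^2 + (norm (Z r w - Z t w))^2) \<partial>lborel)) <= c * ennreal (t - s)"
proof -
 let ?Z = "\<lambda>p. indicator {0..T} (fst p) *\<^sub>R Z (fst p) (snd p)"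
 define f where "f p = ennreal ((norm (?Z p - Z s (snd p)))^2 + (norm (?Z p - Z t (snd p)))^2)" for p
 have st': "0 <= t" "s <= T" using st by auto
 note [measurable] = process_measurable[OF Z] process_section[OF Z st(1) st'(2)] process_section[OF Z st'(1) st(3)]
 have [measurable]: "f \<in> bm (lborel \<Otimes>\<^sub>M M)" unfolding f_def by measurable
 have eq: "ennreal ((norm (Z r w - Z s w))^2 + (norm (Z r w - Z t w))^2) * indicator {s..t} r = f (r, w) * indicator {s..t} r" for r w
  using st by (auto simp: f_def indicator_def)
 have "(\<E>\<^sup>+ w. (\<integral>\<^sup>+r\<in>{s..t}. ennreal ((norm (Z r w - Z s w))^2 + (norm (Z r w - Z t w))^2) \<partial>lborel)) =
   (\<integral>\<^sup>+p. f p * indicator {s..t} (fst p) \<partial>(lborel \<Otimes>\<^sub>M M))"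
  unfolding eq by (subst fwd.pair.nn_integral_snd[symmetric]) simp_all
 also have "... <= c * emeasure lborel {s..t}"
  by (rule strip_integral_le) (use b st in \<open>auto simp: f_def\<close>)
 also have "... = c * ennreal (t - s)" using st by simp
 finally show ?thesis .
qed

lemma (in linear_bdsde) nn_energy_sum_mono: "0 <= t \<Longrightarrow> r <= t \<Longrightarrow> (\<And>w. 0 <= d w) \<Longrightarrow> nn_energy_sum d s r <= nn_energy_sum d s t"
 unfolding nn_energy_sum_def by (intro nn_integral_mono ennreal_leI mult_left_mono mult_right_mono) (auto simp: indicator_def)

context differentiable_flow
begin

text \<open>Products with a matrix are taken apart into scalar problems: component \<open>j\<close>
  of \<open>DY\<close> solves an equation whose source is column \<open>j\<close> of
  \<open>DX\<close>. The constants are common to all \<open>j\<close>, so that one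
  \<open>max_step\<close> and one bound serve every component.\<close>

lemma path_regularity:
 fixes DY Z :: "real => 'w => real^'d"
 assumes lin: "\<And>j. linear_bdsde M T W B (\<lambda>r w. column j (DX r w)) (\<zeta> j) (F j) (G j) (\<lambda>t w. DY t w $ j) (DZ j) c\<^sub>0 c\<^sub>F c\<^sub>G \<alpha>"
  and Z: "process M T Z"
  and ZA: "\<And>t. 0 <= t \<Longrightarrow> t <= T \<Longrightarrow> AE w in M. Z t w = (DY t w v* matrix_inv (DX t w)) v* \<sigma> (X x t w)"
 shows "\<exists>C\<ge>0. \<forall>(n::nat) (t :: nat => real). n \<ge> 1 \<and> t 0 = 0 \<and> t n = T \<and> (\<forall>i\<in>{1..n}. t (i - 1) < t i) \<longrightarrow>
  (\<Sum>i\<in>{1..n}. \<E>\<^sup>+ w. (\<integral>\<^sup>+r\<in>{t (i - 1)..t i}.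
    ennreal ((norm (Z r w - Z (t (i - 1)) w))^2 + (norm (Z r w - Z (t i) w))^2) \<partial>lborel))
   <= ennreal (C * Max ((\<lambda>i. t i - t (i - 1)) ` {1..n}))"
proof -
 interpret L: linear_bdsde M T W B "\<lambda>r w. column j (DX r w)" "\<zeta> j" "F j" "G j" "\<lambda>t w. DY t w $ j" "DZ j" "c\<^sub>0" "c\<^sub>F" "c\<^sub>G" \<alpha> for j
  by (rule lin)
 obtain A C where C: "0 <= C"
  and A': "\<forall>t. 0 <= t \<longrightarrow> t <= T \<longrightarrow> A t \<in> bm (\<F> t T) \<and>
   (AE w in M. A t w = matrix_inv (DX t w) ** \<sigma> (X x t w)) \<and> moment_le M (\<lambda>w. norm (A t w) ^ 4) C"
  and dA': "\<forall>s t. 0 <= s \<longrightarrow> s <= t \<longrightarrow> t <= T \<longrightarrow> moment_le M (\<lambda>w. norm (A t w - A s w) ^ 4) (C * (t - s)^2)"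
  using factor_exists by blast
 have Ai: "A t \<in> bm (\<F> t T)" and AX: "AE w in M. A t w = matrix_inv (DX t w) ** \<sigma> (X x t w)"
  and A4: "moment_le M (\<lambda>w. norm (A t w) ^ 4) C" if "0 <= t" "t <= T" for t
  using A' that by auto
 have dA: "moment_le M (\<lambda>w. norm (A t w - A s w) ^ 4) (C * (t - s)^2)" if "0 <= s" "s <= t" "t <= T" for s t
  using dA' that by blast
 have AM [measurable]: "A t \<in> bm M" if "0 <= t" "t <= T" for t
  using measurable_info_events[OF Ai[OF that] that(2)] T_pos by simp
 obtain c where c: "0 <= c" and c4: "\<And>j r. 0 <= r \<Longrightarrow> r <= T \<Longrightarrow> moment_le M (\<lambda>w. norm (column j (DX r w)) ^ 4) c"
 proof -
  obtain U where "inverse_flow U" using inverse_flow_exists by blast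
  from flow_moments[OF this, of 2] obtain c where c: "0 <= c" and m: "\<And>t. 0 <= t \<Longrightarrow> t <= T \<Longrightarrow> moment_le M (\<lambda>w. norm (DX t w) ^ 4) c"
   by auto
  show thesis
  proof (rule that[OF c])
   fix j r assume r: "0 <= r" "r <= T"
   show "moment_le M (\<lambda>w. norm (column j (DX r w)) ^ 4) c"
    by (rule moment_le_mono[OF m[OF r]]) (use process_section[OF L.u_process r, of j] in \<open>auto intro!: power_mono norm_column_le\<close>)
  qed
 qed
 let ?d = "real CARD('d)"
 let ?CA = L.sup_bound_const and ?CD = "4 * (2 + c\<^sub>G + T * c\<^sub>F)" and ?gc = L.grid_const
 note CA = L.sup_bound_const_nonneg and gc = L.grid_const_nonneg
 have twice: "2 * ennreal v = ennreal (2 * v)" for v by (simp add: ennreal_mult')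
 have sum_const: "(\<Sum>j\<in>(UNIV::'d set). ennreal v) = ennreal (?d * v)" for v
  by (simp add: ennreal_mult' ennreal_of_nat_eq_real_of_nat)
 have five: "3 * v + 2 * v = 5 * v" for v :: ennreal by (simp add: distrib_right[symmetric])
 have CD: "0 <= ?CD" using L.c_nonneg T_pos by simp
 have DYm: "(\<lambda>w. DY t w $ j) \<in> bm M" if "0 <= t" "t <= T" for t j by (rule L.y_measurable(2)[OF that])
 have ZDY: "AE w in M. Z t w = DY t w v* A t w" if t: "0 <= t" "t <= T" for t
  using ZA[OF t] AX[OF t] by eventually_elim (simp add: vector_matrix_mul_assoc)
 \<comment> \<open>The weight may be anything known from \<open>W\<close> up to the very time
   \<open>r\<close>, because \<open>sup_bound_nn\<close> is applied to the interval that begins at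
   \<open>r\<close>.\<close>
 have sup: "(\<E>\<^sup>+ w. ennreal (d w * (DY r w $ j)^2)) <= ennreal (?CA * ((1 + T) * (l / 2 * a + 1 / (2 * l) * c)))"
  if "\<And>w. 0 <= d w" "d \<in> bm (\<F> r T)" "0 <= r" "r <= T" "moment_le M (\<lambda>w. (d w)^2) a" "0 < l" for d r j a l
 proof -
  have d: "d \<in> bm M" using measurable_info_events[OF that(2,4)] T_pos by simp
  have "(\<E>\<^sup>+ w. ennreal (d w * (DY r w $ j)^2)) <= ennreal ?CA * L.nn_total j d"
   by (rule L.sup_bound_nn[OF d that(1,2,3) order_refl that(4)])
  also have "... <= ennreal ?CA * ennreal ((1 + T) * (l / 2 * a + 1 / (2 * l) * c))"
   by (intro mult_left_mono L.nn_total_le d that c4) auto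
  finally show ?thesis by (simp add: ennreal_mult' CA)
 qed
 define Q where "Q = ?d * (2 * (?CA * ((1 + T) * ((C + c) / 2))))"
 have Q0: "0 <= Q" using CA C c T_pos by (simp add: Q_def)
 \<comment> \<open>Any majorant \<open>d\<close> of \<open>|A s|^2\<close> known at \<open>s\<close>
   will do, which leaves room for the running maximum. The energies extend up to \<open>t\<close>
   and thus bound all \<open>r\<close> of the interval at once.\<close>
 have key: "(\<E>\<^sup>+ w. ennreal ((norm (Z r w - Z s w))^2)) \<le>
   (\<Sum>j\<in>UNIV. ennreal (2 * ?CD) * L.nn_energy_sum j d s t) + ennreal (Q * (t - s))"
  if st: "0 <= s" "s < t" "t <= T" and r: "s <= r" "r <= t"
   and d: "\<And>w. (norm (A s w))^2 <= d w" "d \<in> bm (\<F> s T)" for s t r d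
 proof -
  have r': "0 <= r" "r <= T" "s <= T" "0 <= t" using st r by auto
  have d0: "0 <= d w" for w using d(1)[of w] by (rule order_trans[rotated]) simp
  have dM: "d \<in> bm M" using measurable_info_events[OF d(2) r'(3)] T_pos by simp
  note [measurable] = dM DYm[OF r'(1,2)] DYm[OF st(1) r'(3)] AM[OF r'(1,2)] AM[OF st(1) r'(3)]
  let ?a = "\<lambda>j w. 2 * (d w * (DY r w $ j - DY s w $ j)^2)" and ?b = "\<lambda>j w. 2 * ((norm (A r w - A s w))^2 * (DY r w $ j)^2)"
  have "AE w in M. ennreal ((norm (Z r w - Z s w))^2) <= (\<Sum>j\<in>UNIV. ennreal (?a j w) + ennreal (?b j w))"
   using ZDY[OF r'(1,2)] ZDY[OF st(1) r'(3)]
  proof eventually_elim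
   case (elim w)
   have "Z r w - Z s w = (DY r w - DY s w) v* A s w + DY r w v* (A r w - A s w)"
    unfolding elim by (simp add: algebra_simps)
   then have "(norm (Z r w - Z s w))^2 <= 2 * (norm ((DY r w - DY s w) v* A s w))^2 + 2 * (norm (DY r w v* (A r w - A s w)))^2"
    by (simp only: norm_square_add_le)
   also have "... <= 2 * (norm (DY r w - DY s w) * norm (A s w))^2 + 2 * (norm (DY r w) * norm (A r w - A s w))^2"
    by (intro add_mono mult_left_mono power_mono norm_vector_matrix_mult) auto
   also have "... = 2 * ((norm (A s w))^2 * (norm (DY r w - DY s w))^2) + 2 * ((norm (A r w - A s w))^2 * (norm (DY r w))^2)"
    by (simp add: power_mult_distrib mult.commute)
   also have "... <= 2 * (d w * (norm (DY r w - DY s w))^2) + 2 * ((norm (A r w - A s w))^2 * (norm (DY r w))^2)"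
    by (intro add_right_mono mult_left_mono mult_right_mono d) auto
   also have "... = (\<Sum>j\<in>UNIV. ?a j w + ?b j w)"
    unfolding norm_vec_square by (simp add: sum_distrib_left sum.distrib)
   finally have "ennreal ((norm (Z r w - Z s w))^2) <= ennreal (\<Sum>j\<in>UNIV. ?a j w + ?b j w)" by (rule ennreal_leI)
   also have "... = (\<Sum>j\<in>UNIV. ennreal (?a j w) + ennreal (?b j w))"
    using d0 by (subst sum_ennreal[symmetric]) auto
   finally show ?case .
  qed
  then have "(\<E>\<^sup>+ w. ennreal ((norm (Z r w - Z s w))^2)) <= (\<E>\<^sup>+ w. (\<Sum>j\<in>UNIV. ennreal (?a j w) + ennreal (?b j w)))"
   by (rule nn_integral_mono_AE)
  also have "... = (\<Sum>j\<in>UNIV. (\<E>\<^sup>+ w. ennreal (?a j w)) + (\<E>\<^sup>+ w. ennreal (?b j w)))"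
   by (subst nn_integral_sum) (auto simp: nn_integral_add)
  also have "... <= (\<Sum>j\<in>(UNIV::'d set). ennreal (2 * ?CD) * L.nn_energy_sum j d s t + ennreal (2 * (?CA * ((1 + T) * ((C + c) / 2))) * (t - s)))"
  proof (intro sum_mono add_mono)
   fix j
   have "(\<E>\<^sup>+ w. ennreal (?a j w)) = 2 * (\<E>\<^sup>+ w. ennreal (d w * (DY r w $ j - DY s w $ j)^2))"
    using d0 by (simp add: ennreal_mult nn_integral_cmult)
   also have "... <= 2 * (ennreal ?CD * L.nn_energy_sum j d s r)"
    by (intro mult_left_mono L.increment_bound_nn[OF dM d0 d(2) st(1) r(1) r'(2)]) auto
   also have "... <= 2 * (ennreal ?CD * L.nn_energy_sum j d s t)"
    by (intro mult_left_mono L.nn_energy_sum_mono r' r d0) auto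
   also have "... = ennreal (2 * ?CD) * L.nn_energy_sum j d s t" using CD by (subst ennreal_mult) (auto simp: mult.assoc)
   finally show "(\<E>\<^sup>+ w. ennreal (?a j w)) <= ennreal (2 * ?CD) * L.nn_energy_sum j d s t" .
   \<comment> \<open>Balances the fourth moment of \<open>A r - A s\<close>, of order
     \<open>(t - s)^2\<close>, against the moment of the column, of order 1; the outcome is of order
     \<open>t - s\<close>.\<close>
   let ?l = "1 / (t - s)"
   have sq: "moment_le M (\<lambda>w. ((norm (A r w - A s w))^2)^2) (C * (t - s)^2)"
   proof -
    have "C * (r - s)^2 <= C * (t - s)^2" using C r by (intro mult_left_mono power_mono) auto
    from moment_le_weaken[OF dA[OF st(1) r(1) r'(2)] this] show ?thesis by (simp add: power_mult[symmetric])
   qed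
   have im: "(\<lambda>w. (norm (A r w - A s w))^2) \<in> bm (\<F> r T)"
    using Ai[OF r'(1,2)] measurable_info_mono[OF Ai[OF st(1) r'(3)] r(1) order_refl] by measurable
   have "(\<E>\<^sup>+ w. ennreal (?b j w)) = 2 * (\<E>\<^sup>+ w. ennreal ((norm (A r w - A s w))^2 * (DY r w $ j)^2))"
    by (simp add: ennreal_mult nn_integral_cmult)
   also have "... <= 2 * ennreal (?CA * ((1 + T) * (?l / 2 * (C * (t - s)^2) + 1 / (2 * ?l) * c)))"
    by (intro mult_left_mono sup[OF _ im r'(1,2) sq]) (use st in auto)
   also have "?l / 2 * (C * (t - s)^2) + 1 / (2 * ?l) * c = (C + c) / 2 * (t - s)"
    using st by (simp add: power2_eq_square field_simps)
   also have "2 * ennreal (?CA * ((1 + T) * ((C + c) / 2 * (t - s)))) = ennreal (2 * (?CA * ((1 + T) * ((C + c) / 2))) * (t - s))"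
    by (simp only: twice mult.assoc)
   finally show "(\<E>\<^sup>+ w. ennreal (?b j w)) <= ennreal (2 * (?CA * ((1 + T) * ((C + c) / 2))) * (t - s))" .
  qed
  also have "... = (\<Sum>j\<in>UNIV. ennreal (2 * ?CD) * L.nn_energy_sum j d s t) + ennreal (Q * (t - s))"
   by (simp only: sum.distrib sum_const Q_def mult.assoc)
  finally show ?thesis .
 qed
 define Q1 where "Q1 = ?d * (?CA * ((1 + T) * (1 / 2 * C + 1 / (2 * 1) * c)))"
 have Q10: "0 <= Q1" using CA C c T_pos by (simp add: Q1_def)
 have Zm [measurable]: "Z r \<in> bm M" if "0 <= r" "r <= T" for r by (rule process_section[OF Z that])
 have crude: "(\<E>\<^sup>+ w. ennreal ((norm (Z r w))^2)) <= ennreal Q1" if r: "0 <= r" "r <= T" for r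
 proof -
  note [measurable] = DYm[OF r] AM[OF r]
  have "(\<E>\<^sup>+ w. ennreal ((norm (Z r w))^2)) <= (\<E>\<^sup>+ w. (\<Sum>j\<in>UNIV. ennreal ((norm (A r w))^2 * (DY r w $ j)^2)))"
  proof (rule nn_integral_mono_AE)
   show "AE w in M. ennreal ((norm (Z r w))^2) <= (\<Sum>j\<in>UNIV. ennreal ((norm (A r w))^2 * (DY r w $ j)^2))"
    using ZDY[OF r]
   proof eventually_elim
    case (elim w)
    have "(norm (Z r w))^2 <= (norm (DY r w) * norm (A r w))^2"
     unfolding elim by (intro power_mono norm_vector_matrix_mult) auto
    also have "... = (\<Sum>j\<in>UNIV. (norm (A r w))^2 * (DY r w $ j)^2)"
     by (simp only: power_mult_distrib norm_vec_square[of "DY r w"] sum_distrib_left mult.commute)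
    finally show ?case by (subst sum_ennreal) (auto intro: ennreal_leI)
   qed
  qed
  also have "... = (\<Sum>j\<in>UNIV. \<E>\<^sup>+ w. ennreal ((norm (A r w))^2 * (DY r w $ j)^2))"
   by (rule nn_integral_sum) measurable
  also have "... <= (\<Sum>j\<in>(UNIV::'d set). ennreal (?CA * ((1 + T) * (1 / 2 * C + 1 / (2 * 1) * c))))"
  proof (intro sum_mono sup r)
   show "moment_le M (\<lambda>w. ((norm (A r w))^2)^2) C" using A4[OF r] by (simp add: power_mult[symmetric])
   show "(\<lambda>w. (norm (A r w))^2) \<in> bm (\<F> r T)" using Ai[OF r] by measurable
  qed auto
  also have "... = ennreal Q1" by (simp only: Q1_def sum_const)
  finally show ?thesis .
 qed
 define H where "H = 81 * (C + 1000 * (C * T^2) + C)"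
 have H0: "0 <= H" using C by (simp add: H_def)
 define P where "P = 2 * ?CD * (?d * (?gc * ((1 + T) * (1 / 2 * H + 1 / (2 * 1) * c))))"
 have P0: "0 <= P" unfolding P_def using L.c_nonneg gc H0 c T_pos by (intro mult_nonneg_nonneg add_nonneg_nonneg) auto
 \<comment> \<open>One summand for fine and one for coarse subdivisions.\<close>
 define Cf where "Cf = 5 * (P + Q * T) + 8 * Q1 * T / L.max_step"
 have Cf: "5 * (P + Q * T) <= Cf" "8 * Q1 * T / L.max_step <= Cf" "0 <= Cf"
  using P0 Q0 Q10 T_pos L.rates(3) by (auto simp: Cf_def intro!: divide_nonneg_pos mult_nonneg_nonneg add_nonneg_nonneg)
 have fin: "(\<Sum>i<n. \<E>\<^sup>+ w. (\<integral>\<^sup>+r\<in>{t i..t (Suc i)}. ennreal ((norm (Z r w - Z (t i) w))^2 + (norm (Z r w - Z (t (Suc i)) w))^2) \<partial>lborel))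
   <= ennreal (Cf * D)"
  if t: "t 0 = 0" "t n = T" "\<And>i. i < n \<Longrightarrow> t i < t (Suc i)" and D: "\<And>i. i < n \<Longrightarrow> t (Suc i) - t i <= D" "0 <= D" for n :: nat and t D
 proof -
  let ?I = "\<lambda>i. \<E>\<^sup>+ w. (\<integral>\<^sup>+r\<in>{t i..t (Suc i)}. ennreal ((norm (Z r w - Z (t i) w))^2 + (norm (Z r w - Z (t (Suc i)) w))^2) \<partial>lborel)"
  have gr: "grid t n" using t T_pos by (auto simp: grid_def less_imp_le)
  have b: "0 <= t i" "t i < t (Suc i)" "t (Suc i) <= T" if "i < n" for i
   using that t(3) grid_bounds[OF gr, of i] grid_bounds[OF gr, of "Suc i"] by auto
  have len: "(\<Sum>i<n. t (Suc i) - t i) = T" using sum_lessThan_telescope[of t n] t by simp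
  show ?thesis
  proof (cases "D <= L.max_step")
   \<comment> \<open>The sum is at most \<open>8 * Q1 * T\<close> for any subdivision, and since
     \<open>D\<close> exceeds \<open>max_step\<close> this constant is a multiple of
     \<open>D\<close>.\<close>
   case False
   have "?I i <= ennreal (8 * Q1) * ennreal (t (Suc i) - t i)" if i: "i < n" for i
   proof (rule interval_integral_le[OF Z b(1)[OF i] less_imp_le[OF b(2)[OF i]] b(3)[OF i]])
    fix r assume r: "t i <= r" "r <= t (Suc i)"
    have rr: "0 <= r" "r <= T" "t i <= T" "0 <= t (Suc i)" using r b[OF i] by auto
    note [measurable] = Zm[OF rr(1,2)] Zm[OF b(1)[OF i] rr(3)] Zm[OF rr(4) b(3)[OF i]]
    have "ennreal ((norm (Z r w - Z (t i) w))^2 + (norm (Z r w - Z (t (Suc i)) w))^2) \<le>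
      4 * ennreal ((norm (Z r w))^2) + (2 * ennreal ((norm (Z (t i) w))^2) + 2 * ennreal ((norm (Z (t (Suc i)) w))^2))" for w
    proof -
     have "(norm (Z r w - Z (t i) w))^2 + (norm (Z r w - Z (t (Suc i)) w))^2 \<le>
       4 * (norm (Z r w))^2 + (2 * (norm (Z (t i) w))^2 + 2 * (norm (Z (t (Suc i)) w))^2)"
      using norm_square_diff_le[of "Z r w" "Z (t i) w"] norm_square_diff_le[of "Z r w" "Z (t (Suc i)) w"] by linarith
     from ennreal_leI[OF this] show ?thesis by (simp add: ennreal_mult')
    qed
    then have "(\<E>\<^sup>+ w. ennreal ((norm (Z r w - Z (t i) w))^2 + (norm (Z r w - Z (t (Suc i)) w))^2)) \<le>
     (\<E>\<^sup>+ w. 4 * ennreal ((norm (Z r w))^2) + (2 * ennreal ((norm (Z (t i) w))^2) + 2 * ennreal ((norm (Z (t (Suc i)) w))^2)))"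
     by (rule nn_integral_mono)
    also have "... = 4 * (\<E>\<^sup>+ w. ennreal ((norm (Z r w))^2)) + (2 * (\<E>\<^sup>+ w. ennreal ((norm (Z (t i) w))^2)) +
      2 * (\<E>\<^sup>+ w. ennreal ((norm (Z (t (Suc i)) w))^2)))"
     by (simp add: nn_integral_add nn_integral_cmult)
    also have "... <= 4 * ennreal Q1 + (2 * ennreal Q1 + 2 * ennreal Q1)"
     by (intro add_mono mult_left_mono crude rr b[OF i]) auto
    also have "... = ennreal (8 * Q1)" using Q10 by (simp add: ennreal_mult distrib_right[symmetric])
    finally show "(\<E>\<^sup>+ w. ennreal ((norm (Z r w - Z (t i) w))^2 + (norm (Z r w - Z (t (Suc i)) w))^2)) <= ennreal (8 * Q1)" .
   qed
   then have "(\<Sum>i<n. ?I i) <= (\<Sum>i<n. ennreal (8 * Q1) * ennreal (t (Suc i) - t i))" by (intro sum_mono) auto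
   also have "... = ennreal (8 * Q1) * ennreal (\<Sum>i<n. t (Suc i) - t i)"
    unfolding sum_distrib_left[symmetric] by (subst sum_ennreal) (auto simp: less_imp_le b)
   also have "... = ennreal (8 * Q1 * T)" unfolding len using Q10 T_pos by (simp add: ennreal_mult)
   also have "... <= ennreal (Cf * D)"
   proof (rule ennreal_leI)
    have "8 * Q1 * T = 8 * Q1 * T / L.max_step * L.max_step" using L.rates(3) by simp
    also have "... <= Cf * D" using False Cf L.rates(3) by (intro mult_mono) auto
    finally show "8 * Q1 * T <= Cf * D" .
   qed
   finally show ?thesis .
  next
   case True
   \<comment> \<open>The maximum runs over the grid points up to \<open>i\<close> only. It is
     therefore known from \<open>W\<close> up to \<open>t i\<close>, increases with \<open>i\<close>
     and majorizes the square of \<open>A (t i)\<close>.\<close>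
   define d where "d i w = Max ((\<lambda>j. (norm (A (t j) w))^2) ` {..i})" for i w
   have dmax: "(norm (A (t j) w))^2 <= d i w" if "j <= i" for i j w unfolding d_def using that by (intro Max_ge) auto
   have d0: "0 <= d i w" for i w using dmax[of i i w] by (rule order_trans[rotated]) simp_all
   have dmono: "d i w <= d (Suc i) w" for i w unfolding d_def by (intro Max_mono) auto
   have di: "d i \<in> bm (\<F> (t i) T)" if i: "i <= n" for i
    unfolding d_def[abs_def]
   proof (rule borel_measurable_Max)
    fix j assume "j \<in> {..i}"
    then have j: "j <= i" "j <= n" using i by auto
    have "A (t j) \<in> bm (\<F> (t i) T)"
     using grid_bounds[OF gr j(2)] grid_mono[OF gr j(1) i] by (intro measurable_info_mono[OF Ai]) auto
    then show "(\<lambda>w. (norm (A (t j) w))^2) \<in> bm (\<F> (t i) T)" by measurable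
   qed auto
   have dM: "d i \<in> bm M" if i: "i <= n" for i
    using measurable_info_events[OF di[OF i]] grid_bounds[OF gr i] T_pos by simp
   \<comment> \<open>The bound of \<open>chaining\<close> does not depend on the number of points,
     so the last weight has a second moment uniform in the subdivision. \<open>X\<close> is a
     majorant here and shadows the diffusion.\<close>
   obtain X where X: "moment_le M X H" "\<And>w s. s \<in> t ` {..n} \<Longrightarrow> norm (A s w) ^ 4 <= X w"
   proof -
    have z: "0 <= (0::real)" "0 <= T" using T_pos by auto
    have "\<exists>X. moment_le M X (81 * (C + 1000 * (C * T^2) + C)) \<and> (\<forall>w. \<forall>s\<in>t ` {..n}. norm (A s w) ^ 4 <= X w)"
    proof (rule chaining)
     show "t ` {..n} \<subseteq> {0..T}" using grid_bounds[OF gr] by auto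
     show "(\<E>\<^sup>+ w. ennreal (norm (A 0 w) ^ 4)) <= ennreal C" using A4[OF z] by (simp add: moment_le_def)
    qed (use AM T_pos C dA in \<open>auto simp: moment_le_def\<close>)
    then show thesis using that unfolding H_def by blast
   qed
   have d2: "moment_le M (\<lambda>w. (d n w)^2) H"
   proof (rule moment_le_mono[OF X(1)])
    show "(\<lambda>w. (d n w)^2) \<in> bm M" using dM[OF order_refl] by measurable
    fix w
    have "d n w \<in> (\<lambda>j. (norm (A (t j) w))^2) ` {..n}" unfolding d_def by (intro Max_in) auto
    then obtain j where "j <= n" "d n w = (norm (A (t j) w))^2" by auto
    then show "(d n w)^2 <= X w" using X(2)[of "t j" w] by (simp add: power_mult[symmetric])
   qed simp
   let ?E = "\<lambda>i. (\<Sum>j\<in>UNIV. ennreal (2 * ?CD) * L.nn_energy_sum j (d i) (t i) (t (Suc i)))"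
   have I: "?I i <= 5 * (?E i + ennreal (Q * (t (Suc i) - t i))) * ennreal (t (Suc i) - t i)" if i: "i < n" for i
   proof (rule interval_integral_le[OF Z b(1)[OF i] less_imp_le[OF b(2)[OF i]] b(3)[OF i]])
    fix r assume r: "t i <= r" "r <= t (Suc i)"
    have rr: "0 <= r" "r <= T" "t i <= T" "0 <= t (Suc i)" using r b[OF i] by auto
    note [measurable] = Zm[OF rr(1,2)] Zm[OF b(1)[OF i] rr(3)] Zm[OF rr(4) b(3)[OF i]]
    let ?K = "?E i + ennreal (Q * (t (Suc i) - t i))"
    have k: "(\<E>\<^sup>+ w. ennreal ((norm (Z q w - Z (t i) w))^2)) <= ?K" if "t i <= q" "q <= t (Suc i)" for q
     by (rule key[OF b(1)[OF i] b(2)[OF i] b(3)[OF i] that dmax[OF order_refl] di]) (use i in simp)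
    \<comment> \<open>With \<open>a = Z r - Z (t i)\<close> and
      \<open>b = Z (t (Suc i)) - Z (t i)\<close>, the bound
      \<open>|a|^2 + |a - b|^2 <= 3 |a|^2 + 2 |b|^2\<close> reduces the right end point to
      increments from the left one, to which \<open>key\<close> applies.\<close>
    have "ennreal ((norm (Z r w - Z (t i) w))^2 + (norm (Z r w - Z (t (Suc i)) w))^2) \<le>
      3 * ennreal ((norm (Z r w - Z (t i) w))^2) + 2 * ennreal ((norm (Z (t (Suc i)) w - Z (t i) w))^2)" for w
    proof -
     have "(norm (Z r w - Z (t i) w))^2 + (norm (Z r w - Z (t (Suc i)) w))^2 \<le>
       3 * (norm (Z r w - Z (t i) w))^2 + 2 * (norm (Z (t (Suc i)) w - Z (t i) w))^2"
      using norm_square_diff_le[of "Z r w - Z (t i) w" "Z (t (Suc i)) w - Z (t i) w"] by simp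
     from ennreal_leI[OF this] show ?thesis by (simp add: ennreal_mult')
    qed
    then have "(\<E>\<^sup>+ w. ennreal ((norm (Z r w - Z (t i) w))^2 + (norm (Z r w - Z (t (Suc i)) w))^2)) \<le>
     (\<E>\<^sup>+ w. 3 * ennreal ((norm (Z r w - Z (t i) w))^2) + 2 * ennreal ((norm (Z (t (Suc i)) w - Z (t i) w))^2))"
     by (rule nn_integral_mono)
    also have "... = 3 * (\<E>\<^sup>+ w. ennreal ((norm (Z r w - Z (t i) w))^2)) + 2 * (\<E>\<^sup>+ w. ennreal ((norm (Z (t (Suc i)) w - Z (t i) w))^2))"
     by (simp add: nn_integral_add nn_integral_cmult)
    also have "... <= 3 * ?K + 2 * ?K" using b[OF i] by (intro add_mono mult_left_mono k r) auto
    also have "... = 5 * ?K" by (rule five)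
    finally show "(\<E>\<^sup>+ w. ennreal ((norm (Z r w - Z (t i) w))^2 + (norm (Z r w - Z (t (Suc i)) w))^2)) <= 5 * ?K" .
   qed
   \<comment> \<open>The integration over time contributes one more length, which is replaced by
     \<open>D\<close>; the remaining factors sum to a constant.\<close>
   have "(\<Sum>i<n. ?I i) <= (\<Sum>i<n. 5 * (?E i + ennreal (Q * (t (Suc i) - t i))) * ennreal D)"
    by (intro sum_mono order_trans[OF I] mult_left_mono ennreal_leI D) auto
   also have "... = 5 * ((\<Sum>i<n. ?E i) + (\<Sum>i<n. ennreal (Q * (t (Suc i) - t i)))) * ennreal D"
    by (simp only: sum_distrib_right[symmetric] sum_distrib_left[symmetric] sum.distrib)
   also have "(\<Sum>i<n. ennreal (Q * (t (Suc i) - t i))) = ennreal (Q * T)"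
    unfolding len[symmetric] sum_distrib_left using Q0 by (intro sum_ennreal) (auto simp: less_imp_le b)
   also have "(\<Sum>i<n. ?E i) <= ennreal P"
   proof -
    have "(\<Sum>i<n. ?E i) = ennreal (2 * ?CD) * (\<Sum>j\<in>UNIV. \<Sum>i<n. L.nn_energy_sum j (d i) (t i) (t (Suc i)))"
     by (subst sum.swap) (simp only: sum_distrib_left)
    also have "... <= ennreal (2 * ?CD) * (\<Sum>j\<in>(UNIV::'d set). ennreal (?gc * ((1 + T) * (1 / 2 * H + 1 / (2 * 1) * c))))"
    proof (intro mult_left_mono sum_mono)
     fix j
     have "(\<Sum>i<n. L.nn_energy_sum j (d i) (t i) (t (Suc i))) <= ennreal ?gc * L.nn_total j (d n)"
      by (rule L.grid_energy_bound_nn[OF gr]) (use True D(1) dM d0 di dmono in \<open>auto intro: order_trans\<close>)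
     also have "... <= ennreal ?gc * ennreal ((1 + T) * (1 / 2 * H + 1 / (2 * 1) * c))"
      by (intro mult_left_mono L.nn_total_le[OF dM[OF order_refl] d0 d2 _ c4]) auto
     finally show "(\<Sum>i<n. L.nn_energy_sum j (d i) (t i) (t (Suc i))) <= ennreal (?gc * ((1 + T) * (1 / 2 * H + 1 / (2 * 1) * c)))"
      using gc by (simp only: ennreal_mult')
    qed simp
    also have "... = ennreal P"
     unfolding P_def sum_const by (rule ennreal_mult'[symmetric]) (use CD in simp)
    finally show ?thesis .
   qed
   also have "5 * (ennreal P + ennreal (Q * T)) * ennreal D = ennreal (5 * (P + Q * T) * D)"
   proof -
    have QT: "0 <= Q * T" using Q0 T_pos by simp
    have "5 * ennreal v = ennreal (5 * v)" for v by (simp add: ennreal_mult')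
    then show ?thesis using P0 QT by (simp only: ennreal_plus[OF P0 QT, symmetric]) (rule ennreal_mult'[symmetric], simp)
   qed
   also have "... <= ennreal (Cf * D)" using Cf D(2) by (intro ennreal_leI mult_right_mono) auto
   finally show ?thesis by (simp add: mult_left_mono mult_right_mono add_right_mono)
  qed
 qed
 show ?thesis
 proof (intro exI[of _ Cf] conjI allI impI)
  fix n :: nat and t :: "nat => real"
  assume "n \<ge> 1 \<and> t 0 = 0 \<and> t n = T \<and> (\<forall>i\<in>{1..n}. t (i - 1) < t i)"
  then have t: "1 <= n" "t 0 = 0" "t n = T" "\<And>i. i \<in> {1..n} \<Longrightarrow> t (i - 1) < t i" by auto
  let ?D = "Max ((\<lambda>i. t i - t (i - 1)) ` {1..n})"
  have D: "t (Suc i) - t i <= ?D" if "i < n" for i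
  proof -
   have "t (Suc i) - t (Suc i - 1) \<in> (\<lambda>i. t i - t (i - 1)) ` {1..n}" using that by (intro imageI) auto
   then show ?thesis by (intro Max_ge) auto
  qed
  have inc: "t i < t (Suc i)" if "i < n" for i using t(4)[of "Suc i"] that by simp
  have "0 <= ?D" using D[of 0] inc[of 0] t(1) by linarith
  moreover have "(\<Sum>i\<in>{1..n}. v i) = (\<Sum>i<n. v (Suc i))" for v :: "nat => ennreal"
   by (simp add: sum.atLeast1_atMost_eq)
  ultimately show "(\<Sum>i\<in>{1..n}. \<E>\<^sup>+ w. (\<integral>\<^sup>+r\<in>{t (i - 1)..t i}.
    ennreal ((norm (Z r w - Z (t (i - 1)) w))^2 + (norm (Z r w - Z (t i) w))^2) \<partial>lborel)) <= ennreal (Cf * ?D)"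
   using fin[OF t(2,3) inc D] by (simp only: diff_Suc_1)
 qed (rule Cf(3))
qed

end

section \<open>Reduction of the given equations to the abstract estimates\<close>

theorem theorem2p3:
  fixes M :: "'w measure" and T :: real
    and W :: "real \<Rightarrow> 'w \<Rightarrow> real^'d" and B :: "real \<Rightarrow> 'w \<Rightarrow> real"
    and b :: "real^'d \<Rightarrow> real^'d" and \<sigma> :: "real^'d \<Rightarrow> real^'d^'d"
    and f g :: "'w \<Rightarrow> real \<Rightarrow> real^'d \<Rightarrow> real \<Rightarrow> real^'d \<Rightarrow> real"
    and \<phi> :: "real^'d \<Rightarrow> real"
    and L\<^sub>f L\<^sub>g \<alpha> :: real
    and X :: "real^'d \<Rightarrow> real \<Rightarrow> 'w \<Rightarrow> real^'d"
    and Y :: "real^'d \<Rightarrow> real \<Rightarrow> 'w \<Rightarrow> real"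
    and Z :: "real^'d \<Rightarrow> real \<Rightarrow> 'w \<Rightarrow> real^'d"
    and x :: "real^'d"
    and DX :: "real \<Rightarrow> 'w \<Rightarrow> real^'d^'d"
    and DY :: "real \<Rightarrow> 'w \<Rightarrow> real^'d"
    and DZ :: "'d \<Rightarrow> real \<Rightarrow> 'w \<Rightarrow> real^'d"
  assumes "prob_space M" and "T > 0"
    and "std_brownian_motion M T W" and "std_brownian_motion M T B"
    and "independent_processes M T W B"
    \<comment> \<open>coefficients of the forward equation\<close>
    and "class_Cb 3 b" and "class_Cb 3 \<sigma>"
    \<comment> \<open>coefficients of the backward equation\<close>
    and "\<And>h. h \<in> {f, g} \<Longrightarrow>
           (\<lambda>(\<omega>, t, x, y, z). h \<omega> t x y z) \<in>
             borel_measurable (M \<Otimes>\<^sub>M restrict_space borel {0..T} \<Otimes>\<^sub>M borel \<Otimes>\<^sub>M borel \<Otimes>\<^sub>M borel)"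
    and "\<And>h x y z. h \<in> {f, g} \<Longrightarrow> M2 M W B T (\<lambda>t \<omega>. h \<omega> t x y z)"
    and "L\<^sub>f \<ge> 0" and "L\<^sub>g \<ge> 0" and "0 \<le> \<alpha>" and "\<alpha> < 1"
    and "\<And>\<omega> t t' x x' y y' z z'. \<omega> \<in> space M \<Longrightarrow> t \<in> {0..T} \<Longrightarrow> t' \<in> {0..T} \<Longrightarrow>
           \<bar>f \<omega> t x y z - f \<omega> t' x' y' z'\<bar>\<^sup>2
             \<le> L\<^sub>f * (\<bar>t - t'\<bar> + (norm (x - x'))\<^sup>2 + \<bar>y - y'\<bar>\<^sup>2 + (norm (z - z'))\<^sup>2)"
    and "\<And>\<omega> t t' x x' y y' z z'. \<omega> \<in> space M \<Longrightarrow> t \<in> {0..T} \<Longrightarrow> t' \<in> {0..T} \<Longrightarrow>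
           \<bar>g \<omega> t x y z - g \<omega> t' x' y' z'\<bar>\<^sup>2
             \<le> L\<^sub>g * (\<bar>t - t'\<bar> + (norm (x - x'))\<^sup>2 + \<bar>y - y'\<bar>\<^sup>2) + \<alpha> * (norm (z - z'))\<^sup>2"
    and "\<And>h \<omega> s. h \<in> {f, g} \<Longrightarrow> \<omega> \<in> space M \<Longrightarrow> s \<in> {0..T} \<Longrightarrow>
           class_C 3 (\<lambda>(x, y, z). h \<omega> s x y z)"
    and "\<And>h \<omega>. h \<in> {f, g} \<Longrightarrow> \<omega> \<in> space M \<Longrightarrow>
           \<exists>K. \<forall>s\<in>{0..T}. \<forall>es. set es \<subseteq> Basis \<and> length es \<in> {1..3} \<longrightarrow>
             (\<forall>p. \<bar>partials es (\<lambda>(x, y, z). h \<omega> s x y z) p\<bar> \<le> K)"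
    and "\<And>h \<omega>. h \<in> {f, g} \<Longrightarrow> \<omega> \<in> space M \<Longrightarrow> bdd_above ((\<lambda>r. \<bar>h \<omega> r 0 0 0\<bar>) ` {0..T})"
    and "\<And>\<omega>. \<omega> \<in> space M \<Longrightarrow>
           (SUP (t, x, y, z) \<in> {0..T} \<times> UNIV. ereal (norm (grad (\<lambda>z'. g \<omega> t x y z') z))) < 1"
    and "class_Cb 2 \<phi>"
    \<comment> \<open>the forward and the backward equation, for every initial condition\<close>
    and "\<And>x. sde_solution M W B T b \<sigma> x (X x)"
    and "\<And>x. bdsde_solution M W B T (\<lambda>\<omega>. \<phi> (X x T \<omega>))
           (\<lambda>r \<omega>. f \<omega> r (X x r \<omega>) (Y x r \<omega>) (Z x r \<omega>))
           (\<lambda>r \<omega>. g \<omega> r (X x r \<omega>) (Y x r \<omega>) (Z x r \<omega>))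
           (Y x) (Z x)"
    \<comment> \<open>gradients with respect to the initial condition, at \<open>x\<close>\<close>
    and "process M T DX"
    and "\<And>t. t \<in> {0..T} \<Longrightarrow>
           AE \<omega> in M. ((\<lambda>x'. X x' t \<omega>) has_derivative (\<lambda>h. DX t \<omega> *v h)) (at x)"
    and "\<And>t. t \<in> {0..T} \<Longrightarrow>
           AE \<omega> in M. ((\<lambda>x'. Y x' t \<omega>) has_derivative (\<lambda>h. DY t \<omega> \<bullet> h)) (at x)"
    and "AE \<omega> in M. continuous_on {0..T} (\<lambda>t. DY t \<omega>)"
    and "\<And>j. bdsde_solution M W B T (\<lambda>\<omega>. grad \<phi> (X x T \<omega>) \<bullet> column j (DX T \<omega>))
           (\<lambda>r \<omega>. linearized (f \<omega> r) (X x r \<omega>) (Y x r \<omega>) (Z x r \<omega>)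
                     (column j (DX r \<omega>)) (DY r \<omega> $ j) (DZ j r \<omega>))
           (\<lambda>r \<omega>. linearized (g \<omega> r) (X x r \<omega>) (Y x r \<omega>) (Z x r \<omega>)
                     (column j (DX r \<omega>)) (DY r \<omega> $ j) (DZ j r \<omega>))
           (\<lambda>t \<omega>. DY t \<omega> $ j) (DZ j)"
    \<comment> \<open>the pointwise version of \<open>Z\<close>\<close>
    and "\<And>t. t \<in> {0..T} \<Longrightarrow>
           AE \<omega> in M. Z x t \<omega> = (DY t \<omega> v* matrix_inv (DX t \<omega>)) v* \<sigma> (X x t \<omega>)"
  shows "\<exists>C\<ge>0. \<forall>(n::nat) (t :: nat \<Rightarrow> real).
           n \<ge> 1 \<and> t 0 = 0 \<and> t n = T \<and> (\<forall>i\<in>{1..n}. t (i - 1) < t i) \<longrightarrow>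
           (\<Sum>i\<in>{1..n}. \<integral>\<^sup>+\<omega>. (\<integral>\<^sup>+r\<in>{t (i - 1)..t i}.
               ennreal ((norm (Z x r \<omega> - Z x (t (i - 1)) \<omega>))\<^sup>2 + (norm (Z x r \<omega> - Z x (t i) \<omega>))\<^sup>2)
               \<partial>lborel) \<partial>M)
             \<le> ennreal (C * Max ((\<lambda>i. t i - t (i - 1)) ` {1..n}))"
proof -
 interpret two_brownian_motions M T W B
  by (intro two_brownian_motions.intro two_brownian_motions_axioms.intro assms)
 obtain K\<^sub>b where b: "K\<^sub>b \<ge> 0" "\<And>x. norm (b x) <= K\<^sub>b"
  "\<And>x h. norm (frechet_derivative b (at x) h) <= K\<^sub>b * norm h"
  "\<And>x y. norm (b x - b y) <= K\<^sub>b * norm (x - y)"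
  "\<And>x y. norm (b y - b x - frechet_derivative b (at x) (y - x)) <= K\<^sub>b * (norm (y - x))^2"
  "\<And>x. linear (frechet_derivative b (at x))"
  "\<And>h. continuous_on UNIV (\<lambda>x. frechet_derivative b (at x) h)" "continuous_on UNIV b"
  by (rule class_Cb_3_bounds[OF \<open>class_Cb 3 b\<close>]) (rule that)
 obtain K\<^sub>s where s: "K\<^sub>s \<ge> 0" "\<And>x. norm (\<sigma> x) <= K\<^sub>s"
  "\<And>x h. norm (frechet_derivative \<sigma> (at x) h) <= K\<^sub>s * norm h"
  "\<And>x y. norm (\<sigma> x - \<sigma> y) <= K\<^sub>s * norm (x - y)"
  "\<And>x y. norm (\<sigma> y - \<sigma> x - frechet_derivative \<sigma> (at x) (y - x)) <= K\<^sub>s * (norm (y - x))^2"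
  "\<And>x. linear (frechet_derivative \<sigma> (at x))"
  "\<And>h. continuous_on UNIV (\<lambda>x. frechet_derivative \<sigma> (at x) h)" "continuous_on UNIV \<sigma>"
  by (rule class_Cb_3_bounds[OF \<open>class_Cb 3 \<sigma>\<close>]) (rule that)
 define K where "K = max K\<^sub>b K\<^sub>s"
 have K: "K\<^sub>b * v <= K * v" "K\<^sub>s * v <= K * v" if "0 <= v" for v
  using that by (auto simp: K_def intro!: mult_right_mono)
 interpret diffusion M T W B b \<sigma> "\<lambda>x. frechet_derivative b (at x)" "\<lambda>x. frechet_derivative \<sigma> (at x)" K
 proof (intro diffusion.intro diffusion_axioms.intro two_brownian_motions_axioms)
  show "0 <= K" "norm (b x) <= K" "norm (\<sigma> x) <= K" for x
   using b(1) b(2)[of x] s(2)[of x] by (auto simp: K_def)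
  show "norm (frechet_derivative b (at x) h) <= K * norm h" "norm (frechet_derivative \<sigma> (at x) h) <= K * norm h" for x h
   by (rule order_trans[OF b(3) K(1)] order_trans[OF s(3) K(2)]; simp)+
  show "norm (b x - b y) <= K * norm (x - y)" "norm (\<sigma> x - \<sigma> y) <= K * norm (x - y)" for x y
   by (rule order_trans[OF b(4) K(1)] order_trans[OF s(4) K(2)]; simp)+
  show "norm (b y - b x - frechet_derivative b (at x) (y - x)) <= K * (norm (y - x))^2"
    "norm (\<sigma> y - \<sigma> x - frechet_derivative \<sigma> (at x) (y - x)) <= K * (norm (y - x))^2" for x y
   by (rule order_trans[OF b(5) K(1)] order_trans[OF s(5) K(2)]; simp)+
 qed (rule b s)+
 interpret differentiable_flow M T W B b \<sigma> "\<lambda>x. frechet_derivative b (at x)" "\<lambda>x. frechet_derivative \<sigma> (at x)" K X x DX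
  by unfold_locales (use assms(21,23,24) in auto)
 obtain c\<^sub>0 where c0: "0 <= c\<^sub>0" "\<And>x v. (grad \<phi> x \<bullet> v)^2 <= c\<^sub>0 * (norm v)^2"
  using class_Cb_2_grad_bound[OF \<open>class_Cb 2 \<phi>\<close>] by blast
 obtain U where "inverse_flow U" using inverse_flow_exists by blast
 \<comment> \<open>Square integrability of the columns of \<open>DX\<close>, which
   \<open>linear_bdsde\<close> demands of its source, is itself a result of the flow
   estimates.\<close>
 from flow_moments[OF this, of 1] obtain C where "\<And>t. 0 <= t \<Longrightarrow> t <= T \<Longrightarrow> moment_le M (\<lambda>w. (norm (DX t w))^2) C"
  by auto
 then have C: "(\<integral>\<^sup>+w. ennreal ((norm (DX t w))^2) \<partial>M) <= ennreal C" if "0 <= t" "t <= T" for t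
  using that by (simp add: moment_le_def)
 have col: "(\<integral>\<^sup>+w. ennreal ((norm (column j (DX t w)))^2) \<partial>M) <= ennreal C" if "0 <= t" "t <= T" for j t
  using that by (intro order_trans[OF nn_integral_mono C] ennreal_leI power_mono) (auto simp: norm_column_le)
 have proc: "process M T (\<lambda>r w. column j (DX r w))" for j
 proof -
  have "(\<lambda>A. column j A) \<in> borel_measurable (borel :: (real^'d^'d) measure)"
   unfolding column_def by (intro borel_measurable_continuous_onI continuous_intros)
  from measurable_compose[OF DX_process[unfolded process_def] this] show ?thesis
   by (simp add: process_def case_prod_unfold)
 qed
 show ?thesis
 proof (rule path_regularity)
  fix j
  show "linear_bdsde M T W B (\<lambda>r w. column j (DX r w)) (\<lambda>w. grad \<phi> (X x T w) \<bullet> column j (DX T w))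
    (\<lambda>r w. linearized (f w r) (X x r w) (Y x r w) (Z x r w) (column j (DX r w)) (DY r w $ j) (DZ j r w))
    (\<lambda>r w. linearized (g w r) (X x r w) (Y x r w) (Z x r w) (column j (DX r w)) (DY r w $ j) (DZ j r w))
    (\<lambda>t w. DY t w $ j) (DZ j) c\<^sub>0 L\<^sub>f L\<^sub>g \<alpha>"
  proof
   show "process M T (\<lambda>r w. column j (DX r w))" by (rule proc)
   have "(\<lambda>p. (norm (indicator {0..T} (fst p) *\<^sub>R column j (DX (fst p) (snd p))))^2) \<in> borel_measurable PM"
    using process_measurable[OF proc[of j]] by measurable
   moreover have "(norm (indicator {0..T} (fst p) *\<^sub>R column j (DX (fst p) (snd p))))^2 =
     indicator {0..T} (fst p) * (norm (column j (DX (fst p) (snd p))))^2" for p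
    by (simp add: indicator_def)
   ultimately have "(\<integral>\<^sup>+p. ennreal (indicator {0..T} (fst p) * (norm (column j (DX (fst p) (snd p))))^2) \<partial>PM) =
     (\<integral>\<^sup>+r. (\<integral>\<^sup>+w. ennreal (indicator {0..T} r * (norm (column j (DX r w)))^2) \<partial>M) \<partial>lborel)"
    by (subst nn_integral_PM_fst) simp_all
   also have "... <= (\<integral>\<^sup>+r. ennreal C * indicator {0..T} r \<partial>lborel)"
    by (intro nn_integral_mono) (auto simp: indicator_def col)
   also have "... < \<infinity>" using T_pos by (simp add: nn_integral_cmult ennreal_mult_less_top)
   finally show "(\<integral>\<^sup>+p. ennreal (indicator {0..T} (fst p) * (norm (column j (DX (fst p) (snd p))))^2) \<partial>PM) < \<infinity>" .
   show "(\<integral>\<^sup>+w. ennreal ((norm (column j (DX T w)))^2) \<partial>M) < \<infinity>"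
    using col[of T j] T_pos by (auto intro: le_less_trans)
   show "bdsde_solution M W B T (\<lambda>w. grad \<phi> (X x T w) \<bullet> column j (DX T w))
    (\<lambda>r w. linearized (f w r) (X x r w) (Y x r w) (Z x r w) (column j (DX r w)) (DY r w $ j) (DZ j r w))
    (\<lambda>r w. linearized (g w r) (X x r w) (Y x r w) (Z x r w) (column j (DX r w)) (DY r w $ j) (DZ j r w))
    (\<lambda>t w. DY t w $ j) (DZ j)" by (rule assms(27))
   show "(grad \<phi> (X x T w) \<bullet> column j (DX T w))^2 <= c\<^sub>0 * (norm (column j (DX T w)))^2" for w by (rule c0(2))
   show "(linearized (f w r) (X x r w) (Y x r w) (Z x r w) (column j (DX r w)) (DY r w $ j) (DZ j r w))^2 \<le>
     L\<^sub>f * ((norm (column j (DX r w)))^2 + (DY r w $ j)^2 + (norm (DZ j r w))^2)"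
    if "w \<in> space M" "0 <= r" "r <= T" for r w
   proof -
    \<comment> \<open>Equal times in the Lipschitz condition make the term in
      \<open>\<bar>t - t'\<bar>\<close> vanish, so the linearized coefficient is bounded with
      \<open>L\<^sub>f\<close> itself as the constant.\<close>
    have r: "r \<in> {0..T}" using that by simp
    have "class_C 3 (\<lambda>(x, y, z). f w r x y z)" using that by (intro assms(16)) auto
    then have "(linearized (f w r) (X x r w) (Y x r w) (Z x r w) (column j (DX r w)) (DY r w $ j) (DZ j r w))^2 \<le>
     L\<^sub>f * ((norm (column j (DX r w)))^2 + (DY r w $ j)^2) + L\<^sub>f * (norm (DZ j r w))^2"
     by (rule linearized_bound) (use assms(14)[OF that(1) r r] in \<open>simp add: distrib_left\<close>)
    then show ?thesis by (simp add: distrib_left)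
   qed
   show "(linearized (g w r) (X x r w) (Y x r w) (Z x r w) (column j (DX r w)) (DY r w $ j) (DZ j r w))^2 \<le>
     L\<^sub>g * ((norm (column j (DX r w)))^2 + (DY r w $ j)^2) + \<alpha> * (norm (DZ j r w))^2"
    if "w \<in> space M" "0 <= r" "r <= T" for r w
   proof -
    have r: "r \<in> {0..T}" using that by simp
    have "class_C 3 (\<lambda>(x, y, z). g w r x y z)" using that by (intro assms(16)) auto
    then show ?thesis by (rule linearized_bound) (use assms(15)[OF that(1) r r] in simp)
   qed
  qed (use c0(1) assms(10-13) in auto)
 next
  show "process M T (Z x)" using assms(22)[of x] by (simp add: bdsde_solution_def)
  show "AE w in M. Z x t w = (DY t w v* matrix_inv (DX t w)) v* \<sigma> (X x t w)" if "0 <= t" "t <= T" for t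
   by (rule assms(28)) (use that in simp)
 qed
qed

end
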